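(* Let $S$ be a truncation set. The big de Rham-Witt complex of $\mathbb{Z}$ is given as follows: $$\mathbb{W}_S\Omega_{\mathbb{Z}}^0=\prod_{n\in S}\mathbb{Z}\cdot V_n\eta_{S/n}([1]_{S/n}),\qquad \mathbb{W}_S\Omega_{\mathbb{Z}}^1=\prod_{n\in S}\mathbb{Z}/n\mathbb{Z}\cdot dV_n\eta_{S/n}([1]_{S/n}),$$ and the groups $\mathbb{W}_S\Omega^q_{\mathbb{Z}}$ are zero for $q\geq2$. The multiplication is given, for $m,n\in\mathbb{N}$, by $$V_m\eta_{S/m}([1]_{S/m})\cdot V_n\eta_{S/n}([1]_{S/n})=(m,n)\cdot V_{[m,n]}\eta_{S/[m,n]}([1]_{S/[m,n]}),$$ $$V_m\eta_{S/m}([1]_{S/m})\cdot dV_n\eta_{S/n}([1]_{S/n})=(m,n]\cdot dV_{[m,n]}\eta_{S/[m,n]}([1]_{S/[m,n]})+\{m,n\}\sum_{r\geq1}2^{r-1}[m,n]\cdot dV_{2^r[m,n]}\eta_{S/2^r[m,n]}([1]_{S/2^r[m,n]}),$$ and the $m$th Frobenius and Verschiebung maps are given by $$F_mV_n\eta_{S/n}([1]_{S/n})=(m,n)\cdot V_{[m,n]/m}\eta_{S/[m,n]}([1]_{S/[m,n]}),$$ $$F_mdV_n\eta_{S/n}([1]_{S/n})=((m,n]/m)\cdot dV_{[m,n]/m}\eta_{S/[m,n]}([1]_{S/[m,n]})+\{m,n\}\sum_{r\geq1}(2^{r-1}[m,n]/m)\cdot dV_{2^r[m,n]/m}\eta_{S/2^r[m,n]}([1]_{S/2^r[m,n]}),$$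 $$V_m(V_n\eta_{S/mn}([1]_{S/mn}))=V_{mn}\eta_{S/mn}([1]_{S/mn}),$$ $$V_m(dV_n\eta_{S/mn}([1]_{S/mn}))=m\cdot dV_{mn}\eta_{S/mn}([1]_{S/mn}).$$
   Context: Notation for integers: for positive integers $m,n$, $(m,n)$ and $[m,n]$ are the greatest common divisor and least common multiple; $(m,n]$ is the unique integer modulo $[m,n]$ with $(m,n]\equiv0$ modulo $m$ and $(m,n]\equiv(m,n)$ modulo $n$ (so $(m,n]/m$ is well defined modulo $[m,n]/m$); $\{m,n\}$ is the integer modulo $2$ that is non-zero if and only if both $m$ and $n$ are even. The product description means that every element is uniquely a (convergent, in the inverse limit over finite sub-truncation sets of $S$) sum $\sum_{n\in S}c_nV_n\eta_{S/n}([1]_{S/n})$, $c_n\in\mathbb{Z}$, resp. $\sum_{n\in S}c_n\,dV_n\eta_{S/n}([1]_{S/n})$, $c_n\in\mathbb{Z}/n\mathbb{Z}$. (Terms indexed by integers not in the relevant truncation set are zero.) Rings are commutative and unital; $\mathbb{N}$ is the set of positive integers. A truncation set is a subset $S\subset\mathbb{N}$ (possibly empty) containing all divisors of its elements; $S/n=\{e\in\mathbb{N}\mid ne\in S\}$. Witt vectors. $\mathbb{W}_S(A)$ is the set $A^S$ with the unique ring structure, functorial in $A$, such that the ghost maps $w_n(a)=\sum_{e\mid n}ea_e^{n/e}$, $n\in S$, are natural ring homomorphisms to $A$. $R^S_T\colon\mathbb{W}_S(A)\to\mathbb{W}_T(A)$ ($T\subset S$) forgets components. $F_n\colon\mathbb{W}_S(A)\to\mathbb{W}_{S/n}(A)$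 is the unique natural ring homomorphism with $w_e\circ F_n=w_{ne}$. $V_n\colon\mathbb{W}_{S/n}(A)\to\mathbb{W}_S(A)$ is the additive map with $V_n(a)_{ne}=a_e$ and other components $0$. $[a]_S$ has first component $a$ and other components $0$. Witt complexes. A Witt complex over $A$ is a contravariant functor $S\mapsto E_S^{\cdot}$ from the poset of truncation sets under inclusion (with structure maps called restrictions $R^S_T$) to anticommutative graded rings ($xy=(-1)^{|x||y|}yx$), such that for each $S$ and $q$, $E_S^q$ is via restriction the limit of the $E_T^q$ over finite truncation sets $T\subset S$, together with a ring homomorphism $\eta_S\colon\mathbb{W}_S(A)\to E_S^0$ natural in $S$ and additive maps $d\colon E_S^q\to E_S^{q+1}$, $F_n\colon E_S^q\to E_{S/n}^q$, $V_n\colon E_{S/n}^q\to E_S^q$ ($n\in\mathbb{N}$) natural in $S$ such that: (i) $d(xx')=d(x)x'+(-1)^q x\,d(x')$ for $x\in E_S^q$, $x'\in E_S^{q'}$, and $d(d(x))=d\log\eta_S([-1]_S)\cdot d(x)$, where $d\log\eta_S([-1]_S)=\eta_S([-1]_S)^{-1}d\eta_S([-1]_S)$; (ii) $F_1=V_1=\mathrm{id}$, $F_mF_n=F_{mn}$, $V_nV_m=V_{mn}$, $F_nV_n=n\cdot\mathrm{id}$, $F_mV_n=V_nF_m$ if $(m,n)=1$, $F_n\eta_S=\eta_{S/n}F_n$, $\eta_SV_n=V_n\eta_{S/n}$; (iii) $F_n$ is a ring homomorphism and $x\cdot V_n(y)=V_n(F_n(x)y)$; (iv) $F_ndV_n(y)=d(y)+(n-1)d\log\eta_{S/n}([-1]_{S/n})\cdot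 y$ for $y\in E_{S/n}^q$; (v) $F_nd\eta_S([a]_S)=\eta_{S/n}([a]_{S/n}^{n-1})d\eta_{S/n}([a]_{S/n})$ for $a\in A$. A map of Witt complexes is a family of graded ring homomorphisms natural in $S$ commuting with $\eta,d,F_n,V_n$. The big de Rham-Witt complex $\mathbb{W}_S\Omega_A^{\cdot}$ of $A$ is the initial Witt complex over $A$ (it exists). *)

theory Defs
  imports "HOL-Algebra.Product_Groups" "HOL-Algebra.RingHom" "HOL-Number_Theory.Cong"
begin

section \<open>Truncation sets\<close>

definition truncation_set :: "nat set \<Rightarrow> bool" where
  "truncation_set S \<longleftrightarrow> 0 \<notin> S \<and> (\<forall>n\<in>S. \<forall>e. e dvd n \<longrightarrow> e \<in> S)"

definition trunc_quot :: "nat set \<Rightarrow> nat \<Rightarrow> nat set"  (infixl \<open>\<div>\<close> 70) where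
  "S \<div> n = {e. 0 < e \<and> n * e \<in> S}"

lemma trunc_quot_quot: "0 < m \<Longrightarrow> 0 < n \<Longrightarrow> (S \<div> m) \<div> n = S \<div> (m * n)"
  by (auto simp: trunc_quot_def mult.assoc)

lemma truncation_set_quot: "truncation_set S \<Longrightarrow> truncation_set (S \<div> n)"
  unfolding truncation_set_def trunc_quot_def
  by (auto intro!: Nat.gr0I)

section \<open>Witt vectors over the integers\<close>

text \<open>
  The elements of the ring of Witt vectors of \<open>\<int>\<close> indexed by \<open>S\<close> are the families in
  \<open>\<int>\<^sup>S\<close>, represented as extensional functions. As \<open>\<int>\<close> is torsion free, a Witt vector is
  determined by its ghost components. Hence the ring structure is the only one for which all
  ghost maps are ring homomorphisms, and the Frobenius is the only map with the prescribed effect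
  on ghost components; functoriality in the coefficient ring is not needed to single them out.
\<close>

definition ghost :: "nat \<Rightarrow> (nat \<Rightarrow> int) \<Rightarrow> int" where
  "ghost n a = (\<Sum>e | e dvd n. int e * a e ^ (n div e))"

definition of_ghost :: "nat set \<Rightarrow> (nat \<Rightarrow> int) \<Rightarrow> nat \<Rightarrow> int" where
  "of_ghost S g = (THE a. a \<in> S \<rightarrow>\<^sub>E UNIV \<and> (\<forall>n\<in>S. ghost n a = g n))"

definition witt :: "nat set \<Rightarrow> (nat \<Rightarrow> int) ring" where
  "witt S = \<lparr>carrier = S \<rightarrow>\<^sub>E UNIV,
     monoid.mult = (\<lambda>a b. of_ghost S (\<lambda>n. ghost n a * ghost n b)),
     one = of_ghost S (\<lambda>n. 1),
     ring.zero = of_ghost S (\<lambda>n. 0),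
     ring.add = (\<lambda>a b. of_ghost S (\<lambda>n. ghost n a + ghost n b))\<rparr>"

definition witt_frob :: "nat \<Rightarrow> nat set \<Rightarrow> (nat \<Rightarrow> int) \<Rightarrow> nat \<Rightarrow> int" where
  "witt_frob n S a = of_ghost (S \<div> n) (\<lambda>e. ghost (n * e) a)"

definition witt_ver :: "nat \<Rightarrow> nat set \<Rightarrow> (nat \<Rightarrow> int) \<Rightarrow> nat \<Rightarrow> int" where
  "witt_ver n S a = (\<lambda>k\<in>S. if n dvd k then a (k div n) else 0)"

definition teich :: "nat set \<Rightarrow> int \<Rightarrow> nat \<Rightarrow> int" where
  "teich S a = (\<lambda>n\<in>S. if n = 1 then a else 0)"

section \<open>Witt complexes over the integers\<close>

text \<open>
  A graded ring is a ring \<open>R\<close> that is the internal direct sum of additive subgroups \<open>G q\<close>.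
  Anticommutativity is meant as \<open>xy = (-1)\<^sup>p\<^sup>q yx\<close> only; squares of elements of odd degree
  need not vanish.
\<close>

locale anticomm_graded_ring = ring R for R :: "'u ring" (structure) +
  fixes G :: "nat \<Rightarrow> 'u set"
  assumes degree_subgroup: "subgroup (G q) (add_monoid R)"
    and one_degree: "\<one> \<in> G 0"
    and mult_degree: "x \<in> G p \<Longrightarrow> y \<in> G q \<Longrightarrow> x \<otimes> y \<in> G (p + q)"
    and direct_sum: "x \<in> carrier R \<Longrightarrow>
      \<exists>!c. (\<forall>q. c q \<in> G q) \<and> finite {q. c q \<noteq> \<zero>} \<and> x = (\<Oplus>q\<in>{q. c q \<noteq> \<zero>}. c q)"
    and anticomm: "x \<in> G p \<Longrightarrow> y \<in> G q \<Longrightarrow> x \<otimes> y = [((- 1 :: int) ^ (p * q))] \<cdot> (y \<otimes> x)"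

text \<open>
  All components are indexed by the truncation set of their source, except that \<open>ver E n S\<close>
  is the Verschiebung from \<open>S \<div> n\<close> to \<open>S\<close>, and \<open>res E S T\<close> is the restriction from \<open>S\<close> to
  \<open>T \<subseteq> S\<close>. Values at other arguments are irrelevant.
\<close>

record 'u witt_data =
  obj :: "nat set \<Rightarrow> 'u ring"
  deg :: "nat set \<Rightarrow> nat \<Rightarrow> 'u set"
  res :: "nat set \<Rightarrow> nat set \<Rightarrow> 'u \<Rightarrow> 'u"
  eta :: "nat set \<Rightarrow> (nat \<Rightarrow> int) \<Rightarrow> 'u"
  diff :: "nat set \<Rightarrow> 'u \<Rightarrow> 'u"
  frob :: "nat \<Rightarrow> nat set \<Rightarrow> 'u \<Rightarrow> 'u"
  ver :: "nat \<Rightarrow> nat set \<Rightarrow> 'u \<Rightarrow> 'u"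

definition dlog_minus_one :: "'u witt_data \<Rightarrow> nat set \<Rightarrow> 'u" where
  "dlog_minus_one E S =
     inv\<^bsub>obj E S\<^esub> (eta E S (teich S (- 1))) \<otimes>\<^bsub>obj E S\<^esub> diff E S (eta E S (teich S (- 1)))"

locale witt_complex =
  fixes E :: "'u witt_data"
  assumes graded: "truncation_set S \<Longrightarrow> anticomm_graded_ring (obj E S) (deg E S)"
    \<comment> \<open>the functor of truncation sets\<close>
    and res_hom: "truncation_set S \<Longrightarrow> truncation_set T \<Longrightarrow> T \<subseteq> S \<Longrightarrow>
      res E S T \<in> ring_hom (obj E S) (obj E T)"
    and res_deg: "truncation_set S \<Longrightarrow> truncation_set T \<Longrightarrow> T \<subseteq> S \<Longrightarrow> x \<in> deg E S q \<Longrightarrow>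
      res E S T x \<in> deg E T q"
    and res_id: "truncation_set S \<Longrightarrow> x \<in> carrier (obj E S) \<Longrightarrow> res E S S x = x"
    and res_res: "truncation_set S \<Longrightarrow> truncation_set T \<Longrightarrow> truncation_set U \<Longrightarrow>
      T \<subseteq> S \<Longrightarrow> U \<subseteq> T \<Longrightarrow> x \<in> carrier (obj E S) \<Longrightarrow> res E T U (res E S T x) = res E S U x"
    and limit: "truncation_set S \<Longrightarrow>
      (\<And>T. truncation_set T \<Longrightarrow> finite T \<Longrightarrow> T \<subseteq> S \<Longrightarrow> t T \<in> deg E T q) \<Longrightarrow>
      (\<And>T U. truncation_set T \<Longrightarrow> finite T \<Longrightarrow> T \<subseteq> S \<Longrightarrow> truncation_set U \<Longrightarrow> U \<subseteq> T \<Longrightarrow>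
        res E T U (t T) = t U) \<Longrightarrow>
      \<exists>!y. y \<in> deg E S q \<and>
        (\<forall>T. truncation_set T \<and> finite T \<and> T \<subseteq> S \<longrightarrow> res E S T y = t T)"
    \<comment> \<open>types and naturality of the structure maps\<close>
    and eta_hom: "truncation_set S \<Longrightarrow> eta E S \<in> ring_hom (witt S) (obj E S)"
    and eta_deg: "truncation_set S \<Longrightarrow> a \<in> carrier (witt S) \<Longrightarrow> eta E S a \<in> deg E S 0"
    and eta_res: "truncation_set S \<Longrightarrow> truncation_set T \<Longrightarrow> T \<subseteq> S \<Longrightarrow> a \<in> carrier (witt S) \<Longrightarrow>
      res E S T (eta E S a) = eta E T (restrict a T)"
    and diff_hom: "truncation_set S \<Longrightarrow>
      diff E S \<in> hom (add_monoid (obj E S)) (add_monoid (obj E S))"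
    and diff_deg: "truncation_set S \<Longrightarrow> x \<in> deg E S q \<Longrightarrow> diff E S x \<in> deg E S (q + 1)"
    and diff_res: "truncation_set S \<Longrightarrow> truncation_set T \<Longrightarrow> T \<subseteq> S \<Longrightarrow> x \<in> carrier (obj E S) \<Longrightarrow>
      res E S T (diff E S x) = diff E T (res E S T x)"
    and frob_hom: "truncation_set S \<Longrightarrow> 0 < n \<Longrightarrow>
      frob E n S \<in> ring_hom (obj E S) (obj E (S \<div> n))"
    and frob_deg: "truncation_set S \<Longrightarrow> 0 < n \<Longrightarrow> x \<in> deg E S q \<Longrightarrow>
      frob E n S x \<in> deg E (S \<div> n) q"
    and frob_res: "truncation_set S \<Longrightarrow> truncation_set T \<Longrightarrow> T \<subseteq> S \<Longrightarrow> 0 < n \<Longrightarrow>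
      x \<in> carrier (obj E S) \<Longrightarrow>
      res E (S \<div> n) (T \<div> n) (frob E n S x) = frob E n T (res E S T x)"
    and ver_hom: "truncation_set S \<Longrightarrow> 0 < n \<Longrightarrow>
      ver E n S \<in> hom (add_monoid (obj E (S \<div> n))) (add_monoid (obj E S))"
    and ver_deg: "truncation_set S \<Longrightarrow> 0 < n \<Longrightarrow> x \<in> deg E (S \<div> n) q \<Longrightarrow>
      ver E n S x \<in> deg E S q"
    and ver_res: "truncation_set S \<Longrightarrow> truncation_set T \<Longrightarrow> T \<subseteq> S \<Longrightarrow> 0 < n \<Longrightarrow>
      x \<in> carrier (obj E (S \<div> n)) \<Longrightarrow>
      res E S T (ver E n S x) = ver E n T (res E (S \<div> n) (T \<div> n) x)"
    \<comment> \<open>(i)\<close>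
    and leibniz: "truncation_set S \<Longrightarrow> x \<in> deg E S q \<Longrightarrow> x' \<in> deg E S q' \<Longrightarrow>
      diff E S (x \<otimes>\<^bsub>obj E S\<^esub> x') =
        diff E S x \<otimes>\<^bsub>obj E S\<^esub> x' \<oplus>\<^bsub>obj E S\<^esub>
        [((- 1 :: int) ^ q)] \<cdot>\<^bsub>obj E S\<^esub> (x \<otimes>\<^bsub>obj E S\<^esub> diff E S x')"
    and diff_diff: "truncation_set S \<Longrightarrow> x \<in> carrier (obj E S) \<Longrightarrow>
      diff E S (diff E S x) = dlog_minus_one E S \<otimes>\<^bsub>obj E S\<^esub> diff E S x"
    \<comment> \<open>(ii)\<close>
    and frob_1: "truncation_set S \<Longrightarrow> x \<in> carrier (obj E S) \<Longrightarrow> frob E 1 S x = x"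
    and ver_1: "truncation_set S \<Longrightarrow> x \<in> carrier (obj E S) \<Longrightarrow> ver E 1 S x = x"
    and frob_frob: "truncation_set S \<Longrightarrow> 0 < m \<Longrightarrow> 0 < n \<Longrightarrow> x \<in> carrier (obj E S) \<Longrightarrow>
      frob E m (S \<div> n) (frob E n S x) = frob E (m * n) S x"
    and ver_ver: "truncation_set S \<Longrightarrow> 0 < m \<Longrightarrow> 0 < n \<Longrightarrow> x \<in> carrier (obj E (S \<div> (m * n))) \<Longrightarrow>
      ver E n S (ver E m (S \<div> n) x) = ver E (m * n) S x"
    and frob_ver: "truncation_set S \<Longrightarrow> 0 < n \<Longrightarrow> x \<in> carrier (obj E (S \<div> n)) \<Longrightarrow>
      frob E n S (ver E n S x) = [n] \<cdot>\<^bsub>obj E (S \<div> n)\<^esub> x"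
    and frob_ver_coprime: "truncation_set S \<Longrightarrow> 0 < m \<Longrightarrow> 0 < n \<Longrightarrow> coprime m n \<Longrightarrow>
      x \<in> carrier (obj E (S \<div> n)) \<Longrightarrow>
      frob E m S (ver E n S x) = ver E n (S \<div> m) (frob E m (S \<div> n) x)"
    and frob_eta: "truncation_set S \<Longrightarrow> 0 < n \<Longrightarrow> a \<in> carrier (witt S) \<Longrightarrow>
      frob E n S (eta E S a) = eta E (S \<div> n) (witt_frob n S a)"
    and eta_ver: "truncation_set S \<Longrightarrow> 0 < n \<Longrightarrow> a \<in> carrier (witt (S \<div> n)) \<Longrightarrow>
      eta E S (witt_ver n S a) = ver E n S (eta E (S \<div> n) a)"
    \<comment> \<open>(iii), where multiplicativity of the Frobenius is \<open>frob_hom\<close>\<close>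
    and projection_formula: "truncation_set S \<Longrightarrow> 0 < n \<Longrightarrow>
      x \<in> carrier (obj E S) \<Longrightarrow> y \<in> carrier (obj E (S \<div> n)) \<Longrightarrow>
      x \<otimes>\<^bsub>obj E S\<^esub> ver E n S y = ver E n S (frob E n S x \<otimes>\<^bsub>obj E (S \<div> n)\<^esub> y)"
    \<comment> \<open>(iv)\<close>
    and frob_diff_ver: "truncation_set S \<Longrightarrow> 0 < n \<Longrightarrow> y \<in> carrier (obj E (S \<div> n)) \<Longrightarrow>
      frob E n S (diff E S (ver E n S y)) =
        diff E (S \<div> n) y \<oplus>\<^bsub>obj E (S \<div> n)\<^esub>
        [(n - 1)] \<cdot>\<^bsub>obj E (S \<div> n)\<^esub> (dlog_minus_one E (S \<div> n) \<otimes>\<^bsub>obj E (S \<div> n)\<^esub> y)"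
    \<comment> \<open>(v)\<close>
    and frob_diff_teich: "truncation_set S \<Longrightarrow> 0 < n \<Longrightarrow>
      frob E n S (diff E S (eta E S (teich S k))) =
        eta E (S \<div> n) (teich (S \<div> n) k [^]\<^bsub>witt (S \<div> n)\<^esub> (n - 1)) \<otimes>\<^bsub>obj E (S \<div> n)\<^esub>
        diff E (S \<div> n) (eta E (S \<div> n) (teich (S \<div> n) k))"

locale witt_complex_map =
  fixes E E' :: "'u witt_data" and f :: "nat set \<Rightarrow> 'u \<Rightarrow> 'u"
  assumes map_hom: "truncation_set S \<Longrightarrow> f S \<in> ring_hom (obj E S) (obj E' S)"
    and map_deg: "truncation_set S \<Longrightarrow> x \<in> deg E S q \<Longrightarrow> f S x \<in> deg E' S q"
    and map_res: "truncation_set S \<Longrightarrow> truncation_set T \<Longrightarrow> T \<subseteq> S \<Longrightarrow> x \<in> carrier (obj E S) \<Longrightarrow>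
      f T (res E S T x) = res E' S T (f S x)"
    and map_eta: "truncation_set S \<Longrightarrow> a \<in> carrier (witt S) \<Longrightarrow> f S (eta E S a) = eta E' S a"
    and map_diff: "truncation_set S \<Longrightarrow> x \<in> carrier (obj E S) \<Longrightarrow>
      f S (diff E S x) = diff E' S (f S x)"
    and map_frob: "truncation_set S \<Longrightarrow> 0 < n \<Longrightarrow> x \<in> carrier (obj E S) \<Longrightarrow>
      f (S \<div> n) (frob E n S x) = frob E' n S (f S x)"
    and map_ver: "truncation_set S \<Longrightarrow> 0 < n \<Longrightarrow> x \<in> carrier (obj E (S \<div> n)) \<Longrightarrow>
      f S (ver E n S x) = ver E' n S (f (S \<div> n) x)"

text \<open>
  The big de Rham-Witt complex of \<open>\<int>\<close> is the initial Witt complex. The type \<open>'u\<close> plays the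
  role of a universe: initiality is tested against all Witt complexes with elements in \<open>'u\<close>. This
  is the intended notion once \<open>'u\<close> has at least the cardinality of the continuum (the cardinality
  of the Witt vectors of \<open>\<int>\<close> indexed by an infinite set), whence the second condition below.
\<close>

definition initial_witt_complex :: "'u witt_data \<Rightarrow> bool" where
  "initial_witt_complex E \<longleftrightarrow> witt_complex E \<and>
     (\<forall>E' :: 'u witt_data. witt_complex E' \<longrightarrow>
       (\<exists>f. witt_complex_map E E' f \<and>
         (\<forall>g. witt_complex_map E E' g \<longrightarrow>
           (\<forall>S. truncation_set S \<longrightarrow> (\<forall>x\<in>carrier (obj E S). g S x = f S x)))))"

definition big_de_Rham_Witt :: "'u witt_data \<Rightarrow> bool" where
  "big_de_Rham_Witt E \<longleftrightarrow>
     initial_witt_complex E \<and> (\<exists>\<iota> :: (nat \<Rightarrow> int) \<Rightarrow> 'u. inj \<iota>)"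

section \<open>Infinite sums, generators and coefficients\<close>

definition deg_group :: "'u witt_data \<Rightarrow> nat set \<Rightarrow> nat \<Rightarrow> 'u monoid" where
  "deg_group E S q = (add_monoid (obj E S))\<lparr>carrier := deg E S q\<rparr>"

text \<open>
  \<open>x\<close> is the sum of the family \<open>t\<close> in the degree \<open>q\<close> part, with respect to the topology of the
  inverse limit of the discrete groups indexed by the finite truncation sets \<open>T \<subseteq> S\<close>.
\<close>

definition has_limit_sum ::
    "'u witt_data \<Rightarrow> nat set \<Rightarrow> nat \<Rightarrow> 'i set \<Rightarrow> ('i \<Rightarrow> 'u) \<Rightarrow> 'u \<Rightarrow> bool" where
  "has_limit_sum E S q I t x \<longleftrightarrow> x \<in> deg E S q \<and> t \<in> I \<rightarrow> deg E S q \<and>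
     (\<forall>T. truncation_set T \<and> finite T \<and> T \<subseteq> S \<longrightarrow>
       (let J = {i\<in>I. res E S T (t i) \<noteq> \<zero>\<^bsub>obj E T\<^esub>} in
        finite J \<and> res E S T x = (\<Oplus>\<^bsub>obj E T\<^esub>i\<in>J. res E S T (t i))))"

definition limit_sum :: "'u witt_data \<Rightarrow> nat set \<Rightarrow> nat \<Rightarrow> 'i set \<Rightarrow> ('i \<Rightarrow> 'u) \<Rightarrow> 'u" where
  "limit_sum E S q I t = (THE x. has_limit_sum E S q I t x)"

text \<open>
  The element \<open>V\<^sub>n \<eta> ([1])\<close> over \<open>S\<close>. Since \<open>(S \<div> m) \<div> k = S \<div> (m * k)\<close>, the elements
  written with \<open>\<eta>\<close> indexed by \<open>S \<div> (m * k)\<close> and living over \<open>S \<div> m\<close> are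
  \<open>ver_one E (S \<div> m) k\<close>.
\<close>

definition ver_one :: "'u witt_data \<Rightarrow> nat set \<Rightarrow> nat \<Rightarrow> 'u" where
  "ver_one E S n = ver E n S (eta E (S \<div> n) (teich (S \<div> n) 1))"

text \<open>
  The integer \<open>(m,n]\<close> modulo \<open>[m,n]\<close>, and the integer \<open>{m,n}\<close> modulo 2, both represented by
  their least non-negative residues.
\<close>

definition gcd_lift :: "nat \<Rightarrow> nat \<Rightarrow> int" where
  "gcd_lift m n = (THE c. 0 \<le> c \<and> c < int (lcm m n) \<and>
     [c = 0] (mod int m) \<and> [c = int (gcd m n)] (mod int n))"

definition both_even :: "nat \<Rightarrow> nat \<Rightarrow> int" where
  "both_even m n = (if even m \<and> even n then 1 else 0)"

end

theory Submission
  imports Defs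
begin

text \<open>
  Lower bound: a family \<open>g\<close> of integers indexed by \<open>S\<close> consists of the ghost coordinates of a Witt
  vector if and only if it satisfies Dwork's congruences \<open>g(k) \<equiv> g(k/p)\<close> modulo the \<open>p\<close>-part of
  \<open>k\<close>. Pairs of such a family and of a family \<open>w(k) \<in> \<int>/k\<close> form an explicit Witt complex: the
  coordinate of \<open>dg\<close> at \<open>k\<close> is \<open>(g(k) - g(k/p))/k\<close> at every prime \<open>p\<close> dividing \<open>k\<close>, and \<open>g\<close> acts
  on \<open>w\<close> by \<open>g(k)w(k)\<close>, corrected by \<open>k/2\<close> for even \<open>k\<close> if certain parities are odd. The
  coordinate of \<open>dV\<^sub>n(1)\<close> at \<open>k\<close> is 1 for \<open>k = n\<close> and vanishes unless \<open>n\<close> divides \<open>k\<close>, which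
  yields the independence of these elements by triangularity.

  Upper bound: in every Witt complex, the class \<open>\<epsilon> = dlog [-1]\<close> satisfies \<open>2\<epsilon> = 0\<close> and
  \<open>\<epsilon> = dV\<^sub>2(1) + V\<^sub>2(\<epsilon>)\<close>, and \<open>F\<^sub>m dV\<^sub>n(1)\<close> is a combination of \<open>dV\<^sub>l(1)\<close> and \<open>V\<^sub>l(\<epsilon>)\<close> for
  \<open>l = [m,n]/m\<close>. Iterating the second relation writes \<open>V\<^sub>l(\<epsilon>)\<close> as a convergent sum of multiples of
  \<open>dV\<^sub>j(1)\<close>, so that the Witt vectors and the \<open>dV\<^sub>n(1)\<close> generate a subcomplex, which is
  everything by initiality.
\<close>

section \<open>Dwork sequences\<close>

text \<open>The corrections by k/2 are dictated by axiom (iv). Coordinatewise operations would give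
  F_n d V_n = d, whereas (iv) adds (n - 1) dlog[-1], and dlog[-1] turns out to have the coordinate
  k/2 at every even k. For even n the Frobenius must recover this term from the coordinates of
  dV_n(h); the parity that achieves it adds up the coordinates at n k/2, n k/4, ... as long as these
  indices are even, and the projection formula then fixes the correction of the product. In the
  upper bound the obstacle is that V_l(\<epsilon>) is in general only a convergent sum of
  generators. Membership in the subcomplex is therefore tested over finite truncation sets, where
  the chain l, 2l, 4l, ... leaves the set and downward induction along it is possible. The same
  induction gives \<epsilon> dV_n(1) = 0, hence d(dV_n(1)) = 0 and the vanishing of all degrees
  above 1. The explicit complex is not shown to be initial directly: it only has to separate the
  generators.\<close>

lemma cong_all_prime_powers:
  fixes a b :: int
  assumes "0 < k" "\<And>p. prime p \<Longrightarrow> p dvd k \<Longrightarrow> [a = b] (mod int (p ^ multiplicity p k))"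
  shows "[a = b] (mod int k)"
proof -
  have "k dvd nat \<bar>a - b\<bar>"
  proof (cases "a = b")
    case False
    show ?thesis
    proof (rule multiplicity_le_imp_dvd)
      show "k \<noteq> 0" using assms by simp
      fix p :: nat assume p: "prime p"
      show "multiplicity p k \<le> multiplicity p (nat \<bar>a - b\<bar>)"
      proof (cases "p dvd k")
        case True
        then have "int (p ^ multiplicity p k) dvd a - b"
          using assms(2)[OF p] by (simp add: cong_iff_dvd_diff)
        then have "p ^ multiplicity p k dvd nat \<bar>a - b\<bar>"
          by (metis dvd_abs_iff int_dvd_int_iff nat_0_le abs_ge_zero)
        then show ?thesis
          using False p by (intro multiplicity_geI) (auto simp: prime_gt_1_nat)
      qed (simp add: not_dvd_imp_multiplicity_0)
    qed
  qed simp
  then have "int k dvd \<bar>a - b\<bar>" by (metis int_dvd_int_iff nat_0_le abs_ge_zero)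
  then show ?thesis by (simp add: cong_iff_dvd_diff)
qed

definition dwork :: "nat set \<Rightarrow> (nat \<Rightarrow> int) \<Rightarrow> bool" where
  "dwork S g \<longleftrightarrow>
     (\<forall>k\<in>S. \<forall>p. prime p \<longrightarrow> p dvd k \<longrightarrow> [g k = g (k div p)] (mod int (p ^ multiplicity p k)))"

lemma dworkD: "dwork S g \<Longrightarrow> k \<in> S \<Longrightarrow> prime p \<Longrightarrow> p dvd k \<Longrightarrow>
    [g k = g (k div p)] (mod int (p ^ multiplicity p k))"
  by (auto simp: dwork_def)

lemma truncation_set_pos: "truncation_set S \<Longrightarrow> k \<in> S \<Longrightarrow> 0 < k"
  by (auto simp: truncation_set_def intro: Nat.gr0I)

lemma truncation_set_dvd: "truncation_set S \<Longrightarrow> k \<in> S \<Longrightarrow> e dvd k \<Longrightarrow> e \<in> S"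
  by (auto simp: truncation_set_def)

lemma truncation_set_div: "truncation_set S \<Longrightarrow> k \<in> S \<Longrightarrow> p dvd k \<Longrightarrow> k div p \<in> S"
  by (metis dvd_mult_div_cancel dvd_triv_right truncation_set_dvd)

lemma dwork_cong:
  assumes "truncation_set S" "\<And>k. k \<in> S \<Longrightarrow> g k = h k"
  shows "dwork S g \<longleftrightarrow> dwork S h"
  using assms truncation_set_div[OF assms(1)] by (auto simp: dwork_def)

lemma dwork_add: "dwork S g \<Longrightarrow> dwork S h \<Longrightarrow> dwork S (\<lambda>k. g k + h k)"
  and dwork_mult: "dwork S g \<Longrightarrow> dwork S h \<Longrightarrow> dwork S (\<lambda>k. g k * h k)"
  and dwork_uminus: "dwork S g \<Longrightarrow> dwork S (\<lambda>k. - g k)"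
  and dwork_const: "dwork S (\<lambda>k. c)"
  unfolding dwork_def
  by (auto intro: cong_add cong_mult simp: cong_minus_minus_iff)

text \<open>Factor a^p - b^p as a - b times a sum of p products. Modulo p each of these products is
  b^(p-1), so the sum contributes one more factor p. This uses a \<equiv> b modulo p, which is where
  \<open>0 < v\<close> enters.\<close>

lemma cong_power_prime_power:
  fixes a b :: int
  assumes p: "prime p" and ab: "[a = b] (mod int p ^ v)" and v: "0 < v"
  shows "[a ^ p = b ^ p] (mod int p ^ Suc v)"
proof -
  have "[a = b] (mod int p)" using ab v
    by (meson cong_dvd_modulus dvd_power)
  then have "[(\<Sum>i<p. b ^ (p - Suc i) * a ^ i) = (\<Sum>i<p. b ^ (p - Suc i) * b ^ i)] (mod int p)"
    by (intro cong_sum cong_mult cong_pow) auto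
  also have "(\<Sum>i<p. b ^ (p - Suc i) * b ^ i) = (\<Sum>i<p. b ^ (p - 1))"
    by (intro sum.cong refl) (simp flip: power_add)
  also have "[\<dots> = 0] (mod int p)" by (simp add: cong_0_iff)
  finally have "int p dvd (\<Sum>i<p. b ^ (p - Suc i) * a ^ i)" by (simp add: cong_0_iff)
  moreover have "int p ^ v dvd a - b" using ab by (simp add: cong_iff_dvd_diff)
  ultimately have "int p ^ v * int p dvd (a - b) * (\<Sum>i<p. b ^ (p - Suc i) * a ^ i)"
    by (rule mult_dvd_mono[rotated])
  also have "(a - b) * (\<Sum>i<p. b ^ (p - Suc i) * a ^ i) = a ^ p - b ^ p"
    by (simp only: power_diff_sumr2)
  finally show ?thesis by (simp add: cong_iff_dvd_diff mult.commute)
qed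

text \<open>Fermat's little theorem, by induction on a natural representative of \<open>a\<close>:
  the inner binomial coefficients in the expansion of (n + 1)^p are divisible by p.\<close>

lemma cong_power_self_prime:
  fixes a :: int
  assumes p: "prime p"
  shows "[a ^ p = a] (mod int p)"
proof -
  have p0: "0 < p" using p by (rule prime_gt_0_nat)
  have "[int n ^ p = int n] (mod int p)" for n
  proof (induction n)
    case 0
    then show ?case using p0 by (simp add: power_0_left)
  next
    case (Suc n)
    have "int (Suc n) ^ p = (\<Sum>i\<le>p. int (p choose i) * int n ^ i)"
      using binomial_ring[of "int n" 1 p] by (simp add: add.commute)
    also have "{..p} = insert 0 (insert p {0<..<p})" using p0 by auto
    also have "(\<Sum>i\<in>insert 0 (insert p {0<..<p}). int (p choose i) * int n ^ i) =
        1 + int n ^ p + (\<Sum>i\<in>{0<..<p}. int (p choose i) * int n ^ i)"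
      using p0 by simp
    also have "[1 + int n ^ p + (\<Sum>i\<in>{0<..<p}. int (p choose i) * int n ^ i) = 1 + int n + 0] (mod int p)"
    proof (intro cong_add Suc cong_refl)
      have "int p dvd (\<Sum>i\<in>{0<..<p}. int (p choose i) * int n ^ i)"
        using p by (intro dvd_sum dvd_mult2) (simp add: dvd_choose_prime)
      then show "[(\<Sum>i\<in>{0<..<p}. int (p choose i) * int n ^ i) = 0] (mod int p)"
        by (simp add: cong_0_iff)
    qed
    finally show ?case by (simp add: add.commute)
  qed
  moreover have "0 \<le> a mod int p" using p0 by simp
  then have n: "[a = int (nat (a mod int p))] (mod int p)" by simp
  ultimately show ?thesis by (meson cong_pow cong_sym cong_trans)
qed

text \<open>These are the ghost components of the Teichmueller element [x]. Fermat's theorem treats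
  the first factor p of k, and each further factor p gains one power of p by
  \<open>cong_power_prime_power\<close>.\<close>

lemma dwork_power: "dwork {0<..} (\<lambda>k. x ^ k)"
  unfolding dwork_def
proof (intro ballI allI impI)
  fix k p :: nat assume k: "k \<in> {0<..}" and p: "prime p" "p dvd k"
  have gen: "[x ^ (p ^ Suc v * j) = x ^ (p ^ v * j)] (mod int p ^ Suc v)" for v j
  proof (induction v)
    case 0
    show ?case using cong_power_self_prime[OF p(1), of "x ^ j"]
      by (simp flip: power_mult add: mult.commute)
  next
    case (Suc v)
    from cong_power_prime_power[OF p(1) Suc] show ?case
      by (simp flip: power_mult add: mult_ac)
  qed
  define v where "v = multiplicity p k - 1"
  have mp: "0 < multiplicity p k" using k p
    by (metis greaterThan_iff multiplicity_gt_zero_iff neq0_conv not_prime_unit)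
  then have v: "multiplicity p k = Suc v" by (simp add: v_def)
  obtain j where j: "k = p ^ Suc v * j"
    by (metis v multiplicity_dvd dvdE)
  then have "k div p = p ^ v * j" using prime_gt_0_nat[OF p(1)] by (simp add: mult.assoc)
  then show "[x ^ k = x ^ (k div p)] (mod int (p ^ multiplicity p k))"
    using gen[of v j] j v by simp
qed

lemma prime_power_multiplicity_dvd_mult:
  fixes a b :: int
  assumes "prime p" "0 < e" "0 < j" "[a = b] (mod int (p ^ multiplicity p j))"
  shows "[int e * a = int e * b] (mod int (p ^ multiplicity p (e * j)))"
proof -
  have "multiplicity p (e * j) = multiplicity p e + multiplicity p j"
    using assms by (intro prime_elem_multiplicity_mult_distrib) auto
  moreover have "int (p ^ multiplicity p e) dvd int e"
    by (simp only: int_dvd_int_iff multiplicity_dvd)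
  ultimately have "int (p ^ multiplicity p (e * j)) dvd int e * (a - b)"
    using assms(4) by (simp add: power_add cong_iff_dvd_diff mult_dvd_mono)
  then show ?thesis by (simp add: cong_iff_dvd_diff right_diff_distrib)
qed

text \<open>The divisors e of k fall into two classes. If p divides k/e, then e also occurs for k/p,
  and Dwork's congruence for \<open>t e\<close> at k/e, multiplied by e, holds modulo the p-part of
  k. If p does not divide k/e, then e carries the whole p-part of k, so its term vanishes modulo
  that part, and e does not divide k/p.\<close>

lemma sum_dwork_cong:
  fixes t :: "nat \<Rightarrow> nat \<Rightarrow> int"
  assumes t: "\<And>e. dwork {0<..} (t e)" and k: "0 < k" and p: "prime p" "p dvd k"
  shows "[(\<Sum>e | e dvd k. int e * t e (k div e)) =
    (\<Sum>e | e dvd k div p. int e * t e (k div p div e))] (mod int (p ^ multiplicity p k))"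
proof -
  have p0: "0 < p" using p(1) by (rule prime_gt_0_nat)
  have kp: "k div p dvd k" using p(2) by (metis dvd_mult_div_cancel dvd_triv_right)
  have kp0: "0 < k div p" using k p p0 by (simp add: dvd_imp_le div_greater_zero_iff)
  have "[(\<Sum>e | e dvd k. int e * t e (k div e)) =
    (\<Sum>e | e dvd k. if e dvd k div p then int e * t e (k div p div e) else 0)]
      (mod int (p ^ multiplicity p k))"
  proof (rule cong_sum)
    fix e assume "e \<in> {e. e dvd k}"
    then obtain j where j: "k = e * j" by auto
    then have e0: "0 < e" and j0: "0 < j" using k by auto
    show "[int e * t e (k div e) = (if e dvd k div p then int e * t e (k div p div e) else 0)]
      (mod int (p ^ multiplicity p k))"
    proof (cases "p dvd j")
      case True
      then obtain i where i: "j = p * i" by auto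
      have "[t e j = t e (j div p)] (mod int (p ^ multiplicity p j))"
        using dworkD[OF t] j0 p True by auto
      from prime_power_multiplicity_dvd_mult[OF p(1) e0 j0 this] show ?thesis
        using e0 p0 by (simp add: j i mult.left_commute)
    next
      case False
      have ne: "\<not> e dvd k div p"
      proof
        assume "e dvd k div p"
        then obtain i where "k div p = e * i" by auto
        then have "e * j = e * (p * i)" using p(2) j by (metis dvd_mult_div_cancel mult.left_commute)
        then show False using False e0 by simp
      qed
      have "multiplicity p k = multiplicity p e"
        unfolding j using p e0 j0 False
        by (subst prime_elem_multiplicity_mult_distrib) (auto simp: not_dvd_imp_multiplicity_0)
      then have "int (p ^ multiplicity p k) dvd int e"
        by (simp only: int_dvd_int_iff multiplicity_dvd)
      then show ?thesis using ne by (simp add: cong_0_iff)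
    qed
  qed
  also have "(\<Sum>e | e dvd k. if e dvd k div p then int e * t e (k div p div e) else 0) =
     (\<Sum>e | e dvd k div p. int e * t e (k div p div e))"
    using kp k by (intro sum.mono_neutral_cong_right) (auto dest: dvd_trans)
  finally show ?thesis .
qed

text \<open>Solves the triangular system g n = \<Sum> e * t (c e) (n/e), summed over the divisors e
  of n, for the coefficients c: if \<open>t x 1 = x\<close>, the summand with e = n is n * c n. That
  the division by n is exact is a consequence of Dwork's congruences and is proved in
  \<open>dwork_expansion\<close>.\<close>

function dwork_coeff :: "(int \<Rightarrow> nat \<Rightarrow> int) \<Rightarrow> (nat \<Rightarrow> int) \<Rightarrow> nat \<Rightarrow> int" where
  "dwork_coeff t g n =
     (g n - (\<Sum>e | e dvd n \<and> e < n. int e * t (dwork_coeff t g e) (n div e))) div int n"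
  by auto
termination by (relation "measure (\<lambda>(t, g, n). n)") auto

declare dwork_coeff.simps [simp del]

lemma sum_divisors_split:
  fixes f :: "nat \<Rightarrow> int"
  assumes "0 < k"
  shows "(\<Sum>e | e dvd k. f e) = f k + (\<Sum>e | e dvd k \<and> e < k. f e)"
proof -
  have "{e. e dvd k} = insert k {e. e dvd k \<and> e < k}"
    using assms by (auto dest: dvd_imp_le simp: le_less)
  then show ?thesis by simp
qed

text \<open>
  Applied to powers this is the surjectivity of the ghost map, and applied to constants the
  expansion of a Witt vector in the elements \<open>V\<^sub>n [1]\<close>.
\<close>

lemma dwork_expansion:
  assumes S: "truncation_set S" and g: "dwork S g"
    and t: "\<And>x. dwork {0<..} (t x)" and t1: "\<And>x. t x 1 = x"
    and k: "k \<in> S"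
  shows "(\<Sum>e | e dvd k. int e * t (dwork_coeff t g e) (k div e)) = g k"
  using k
proof (induction k rule: less_induct)
  case (less k)
  let ?c = "dwork_coeff t g"
  let ?r = "\<Sum>e | e dvd k \<and> e < k. int e * t (?c e) (k div e)"
  have k0: "0 < k" using less.prems S by (rule truncation_set_pos[rotated])
  \<comment> \<open>This is the exactness of the division in \<open>dwork_coeff\<close>. At a prime
    p both sides are compared with the expansion at k/p, known by induction; the summand for e = k
    is a multiple of k and may be added freely.\<close>
  have "[g k = ?r] (mod int k)"
  proof (rule cong_all_prime_powers[OF k0])
    fix p assume p: "prime p" "p dvd k"
    have d: "int (p ^ multiplicity p k) dvd int k" by (simp only: int_dvd_int_iff multiplicity_dvd)
    have "k div p \<in> S" "k div p < k"
      using S less.prems p k0 prime_gt_1_nat[OF p(1)] by (auto simp: truncation_set_div)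
    then have "g (k div p) = (\<Sum>e | e dvd k div p. int e * t (?c e) (k div p div e))"
      using less.IH by simp
    then have "[g k = (\<Sum>e | e dvd k div p. int e * t (?c e) (k div p div e))]
        (mod int (p ^ multiplicity p k))"
      using dworkD[OF g less.prems p] by simp
    also have "[(\<Sum>e | e dvd k div p. int e * t (?c e) (k div p div e)) =
        (\<Sum>e | e dvd k. int e * t (?c e) (k div e))] (mod int (p ^ multiplicity p k))"
      using sum_dwork_cong[OF t k0 p, of ?c] by (rule cong_sym)
    also have "(\<Sum>e | e dvd k. int e * t (?c e) (k div e)) = int k * ?c k + ?r"
      using k0 t1 by (subst sum_divisors_split) simp_all
    also have "[int k * ?c k + ?r = 0 + ?r] (mod int (p ^ multiplicity p k))"
      using d by (intro cong_add cong_refl) (auto simp: cong_0_iff)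
    finally show "[g k = ?r] (mod int (p ^ multiplicity p k))" by simp
  qed
  then have "int k dvd g k - ?r" by (simp add: cong_iff_dvd_diff)
  then have "int k * ?c k = g k - ?r" by (subst dwork_coeff.simps) simp
  then show ?case using k0 t1 by (subst sum_divisors_split) simp_all
qed

section \<open>The ring of Witt vectors\<close>

lemma ghost_eq: "ghost n a = (\<Sum>e | e dvd n. int e * (\<lambda>x k. x ^ k) (a e) (n div e))"
  by (simp add: ghost_def)

lemma dwork_ghost:
  assumes S: "truncation_set S"
  shows "dwork S (\<lambda>n. ghost n a)"
proof (unfold dwork_def, intro ballI allI impI)
  fix k p assume k: "k \<in> S" and p: "prime p" "p dvd k"
  show "[ghost k a = ghost (k div p) a] (mod int (p ^ multiplicity p k))"
    unfolding ghost_eq by (rule sum_dwork_cong[OF dwork_power truncation_set_pos[OF S k] p])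
qed

text \<open>The ghost component at n is n times the coordinate at n plus terms in the coordinates at
  smaller divisors, and n can be cancelled in the integers.\<close>

lemma ghost_inj:
  assumes S: "truncation_set S" and ab: "a \<in> S \<rightarrow>\<^sub>E UNIV" "b \<in> S \<rightarrow>\<^sub>E UNIV"
    and eq: "\<And>n. n \<in> S \<Longrightarrow> ghost n a = ghost n b"
  shows "a = b"
proof
  have "a n = b n" if "n \<in> S" for n
    using that
  proof (induction n rule: less_induct)
    case (less n)
    have n0: "0 < n" using S less.prems by (rule truncation_set_pos)
    have "(\<Sum>e | e dvd n \<and> e < n. int e * a e ^ (n div e)) =
      (\<Sum>e | e dvd n \<and> e < n. int e * b e ^ (n div e))"
      using less.IH truncation_set_dvd[OF S less.prems] by (intro sum.cong) auto
    moreover have "ghost n a = ghost n b" using eq less.prems .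
    ultimately show ?case using n0 by (simp add: ghost_def sum_divisors_split)
  qed
  then show "a n = b n" for n using ab by (cases "n \<in> S") (auto simp: PiE_def extensional_def)
qed

lemma ghost_restrict:
  assumes S: "truncation_set S" and n: "n \<in> S"
  shows "ghost n (restrict a S) = ghost n a"
  unfolding ghost_def using truncation_set_dvd[OF S n] by (intro sum.cong) auto

text \<open>Dwork's congruences are what makes a ghost family come from a Witt vector, so from here
  on an operation on Witt vectors is under control as soon as its ghost family is shown to satisfy
  them.\<close>

lemma of_ghost:
  assumes S: "truncation_set S" and g: "dwork S g"
  shows of_ghost_closed: "of_ghost S g \<in> S \<rightarrow>\<^sub>E UNIV"
    and ghost_of_ghost: "\<And>n. n \<in> S \<Longrightarrow> ghost n (of_ghost S g) = g n"
proof -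
  let ?a = "restrict (dwork_coeff (\<lambda>x k. x ^ k) g) S"
  have "\<forall>n\<in>S. ghost n ?a = g n"
  proof
    fix n assume n: "n \<in> S"
    show "ghost n ?a = g n"
      using dwork_expansion[OF S g, of "\<lambda>x k. x ^ k", OF dwork_power power_one_right n]
      by (subst ghost_restrict[OF S n]) (simp add: ghost_def)
  qed
  then have "\<exists>!a. a \<in> S \<rightarrow>\<^sub>E UNIV \<and> (\<forall>n\<in>S. ghost n a = g n)"
    by (intro ex1I[of _ ?a] conjI) (auto intro: ghost_inj[OF S])
  from theI'[OF this] show "of_ghost S g \<in> S \<rightarrow>\<^sub>E UNIV"
    "\<And>n. n \<in> S \<Longrightarrow> ghost n (of_ghost S g) = g n"
    by (simp_all add: of_ghost_def)
qed

lemma carrier_witt [simp]: "carrier (witt S) = S \<rightarrow>\<^sub>E UNIV"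
  by (simp add: witt_def)

lemma witt_closed [simp]:
  assumes "truncation_set S"
  shows "a \<otimes>\<^bsub>witt S\<^esub> b \<in> S \<rightarrow>\<^sub>E UNIV" "a \<oplus>\<^bsub>witt S\<^esub> b \<in> S \<rightarrow>\<^sub>E UNIV"
    "\<one>\<^bsub>witt S\<^esub> \<in> S \<rightarrow>\<^sub>E UNIV" "\<zero>\<^bsub>witt S\<^esub> \<in> S \<rightarrow>\<^sub>E UNIV"
  using assms
  by (auto simp only: witt_def ring.simps monoid.simps partial_object.simps
      intro!: of_ghost_closed dwork_mult dwork_add dwork_ghost dwork_const)

lemma ghost_witt [simp]:
  assumes "truncation_set S" "n \<in> S"
  shows "ghost n (a \<otimes>\<^bsub>witt S\<^esub> b) = ghost n a * ghost n b"
    "ghost n (a \<oplus>\<^bsub>witt S\<^esub> b) = ghost n a + ghost n b"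
    "ghost n \<one>\<^bsub>witt S\<^esub> = 1" "ghost n \<zero>\<^bsub>witt S\<^esub> = 0"
  using assms
  by (simp_all add: witt_def ghost_of_ghost dwork_mult dwork_add dwork_ghost dwork_const)

text \<open>Every axiom holds for ghost components, and these determine the Witt vector.\<close>

lemma ring_witt:
  assumes S: "truncation_set S"
  shows "cring (witt S)"
proof (rule cringI)
  show "abelian_group (witt S)"
  proof (rule abelian_groupI)
    fix a assume a: "a \<in> carrier (witt S)"
    show "\<exists>b\<in>carrier (witt S). b \<oplus>\<^bsub>witt S\<^esub> a = \<zero>\<^bsub>witt S\<^esub>"
    proof
      let ?b = "of_ghost S (\<lambda>n. - ghost n a)"
      show b: "?b \<in> carrier (witt S)"
        using S by (auto intro!: of_ghost_closed dwork_uminus dwork_ghost)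
      show "?b \<oplus>\<^bsub>witt S\<^esub> a = \<zero>\<^bsub>witt S\<^esub>"
        using S by (intro ghost_inj[OF S]) (auto simp: ghost_of_ghost dwork_uminus dwork_ghost)
    qed
  qed (use S in \<open>auto intro!: ghost_inj[OF S] del: PiE_I\<close>)
  show "comm_monoid (witt S)"
    by (rule comm_monoidI) (use S in \<open>auto intro!: ghost_inj[OF S] del: PiE_I\<close>)
qed (use S in \<open>auto intro!: ghost_inj[OF S] del: PiE_I simp: algebra_simps\<close>)

lemma ghost_a_inv [simp]:
  assumes S: "truncation_set S" and a: "a \<in> S \<rightarrow>\<^sub>E UNIV" and n: "n \<in> S"
  shows "ghost n (\<ominus>\<^bsub>witt S\<^esub> a) = - ghost n a"
proof -
  interpret cring "witt S" using S by (rule ring_witt)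
  have "ghost n (a \<oplus>\<^bsub>witt S\<^esub> \<ominus>\<^bsub>witt S\<^esub> a) = 0"
    using a S n by (simp add: r_neg)
  then show ?thesis using S n by simp
qed

lemma ghost_nat_pow [simp]:
  assumes S: "truncation_set S" and n: "n \<in> S"
  shows "ghost n (a [^]\<^bsub>witt S\<^esub> (m :: nat)) = ghost n a ^ m"
  by (induction m) (use assms in auto)

lemma teich_closed [simp]: "teich S a \<in> S \<rightarrow>\<^sub>E UNIV"
  by (auto simp: teich_def)

lemma ghost_teich [simp]:
  assumes S: "truncation_set S" and n: "n \<in> S"
  shows "ghost n (teich S a) = a ^ n"
proof -
  have n0: "0 < n" using S n by (rule truncation_set_pos)
  have "ghost n (teich S a) = (\<Sum>e | e dvd n. if e = 1 then a ^ n else 0)"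
    unfolding ghost_def
  proof (intro sum.cong refl)
    fix e assume "e \<in> {e. e dvd n}"
    then have "e \<in> S" "0 < n div e" using truncation_set_dvd[OF S n] n0
      by (auto elim!: dvdE)
    then show "int e * teich S a e ^ (n div e) = (if e = 1 then a ^ n else 0)"
      by (auto simp: teich_def)
  qed
  also have "\<dots> = a ^ n" using n0 by simp
  finally show ?thesis .
qed

lemma witt_one_eq: "truncation_set S \<Longrightarrow> \<one>\<^bsub>witt S\<^esub> = teich S 1"
  by (rule ghost_inj) (auto del: PiE_I)

lemma trunc_quotI: "truncation_set S \<Longrightarrow> n * e \<in> S \<Longrightarrow> e \<in> S \<div> n"
  by (auto simp: trunc_quot_def dest: truncation_set_pos)

lemma trunc_quotD: "e \<in> S \<div> n \<Longrightarrow> n * e \<in> S"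
  by (auto simp: trunc_quot_def)

text \<open>The congruence at k follows from the one at n k, because the p-part of k divides that of
  n k.\<close>

lemma dwork_frob:
  assumes g: "dwork S g" and n: "0 < n" and S: "truncation_set S"
  shows "dwork (S \<div> n) (\<lambda>e. g (n * e))"
  unfolding dwork_def
proof (intro ballI allI impI)
  fix k p assume k: "k \<in> S \<div> n" and p: "prime p" "p dvd k"
  have k': "n * k \<in> S" using k by (rule trunc_quotD)
  have "int p ^ multiplicity p k dvd int p ^ multiplicity p (n * k)"
  proof (rule le_imp_power_dvd)
    show "multiplicity p k \<le> multiplicity p (n * k)"
      using k' n p S by (intro dvd_imp_multiplicity_le) (auto dest: truncation_set_pos)
  qed
  with dworkD[OF g k' p(1)] p show "[g (n * k) = g (n * (k div p))] (mod int (p ^ multiplicity p k))"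
    by (auto simp: div_mult_swap intro: cong_dvd_modulus)
qed

lemma witt_frob_closed: "truncation_set S \<Longrightarrow> 0 < n \<Longrightarrow> witt_frob n S a \<in> S \<div> n \<rightarrow>\<^sub>E UNIV"
  and ghost_witt_frob: "truncation_set S \<Longrightarrow> 0 < n \<Longrightarrow> k \<in> S \<div> n \<Longrightarrow>
    ghost k (witt_frob n S a) = ghost (n * k) a"
  unfolding witt_frob_def
  by (intro of_ghost_closed ghost_of_ghost truncation_set_quot dwork_frob dwork_ghost; assumption)+

lemma witt_ver_closed: "witt_ver n S a \<in> S \<rightarrow>\<^sub>E UNIV"
  by (auto simp: witt_ver_def)

lemma ghost_witt_ver:
  assumes S: "truncation_set S" and n: "0 < n" and k: "k \<in> S"
  shows "ghost k (witt_ver n S a) = (if n dvd k then int n * ghost (k div n) a else 0)"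
proof -
  have k0: "0 < k" using S k by (rule truncation_set_pos)
  have "ghost k (witt_ver n S a) =
      (\<Sum>e | e dvd k. if n dvd e then int e * a (e div n) ^ (k div e) else 0)"
    unfolding ghost_def
  proof (intro sum.cong refl)
    fix e assume "e \<in> {e. e dvd k}"
    then have "e \<in> S" "0 < k div e" using truncation_set_dvd[OF S k] k0
      by (auto elim!: dvdE)
    then show "int e * witt_ver n S a e ^ (k div e) = (if n dvd e then int e * a (e div n) ^ (k div e) else 0)"
      by (auto simp: witt_ver_def)
  qed
  also have "\<dots> = (\<Sum>e | n dvd e \<and> e dvd k. int e * a (e div n) ^ (k div e))"
    using k0 by (intro sum.mono_neutral_cong_right) auto
  also have "\<dots> = (if n dvd k then int n * ghost (k div n) a else 0)"
  proof (cases "n dvd k")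
    case True
    then obtain j where j: "k = n * j" by auto
    have "(\<Sum>e | n dvd e \<and> e dvd k. int e * a (e div n) ^ (k div e)) =
      (\<Sum>e | e dvd j. int (n * e) * a e ^ (j div e))"
      by (rule sum.reindex_bij_witness[of _ "\<lambda>e. n * e" "\<lambda>e. e div n"]) (use n j in auto)
    then show ?thesis using n by (simp add: j ghost_def sum_distrib_left mult.assoc)
  next
    case False
    then have *: "{e. n dvd e \<and> e dvd k} = {}" by (auto dest: dvd_trans)
    show ?thesis using False by (simp only: *) simp
  qed
  finally show ?thesis .
qed

section \<open>Difference quotients and parities\<close>

lemma multiplicity_split:
  fixes k p :: nat
  assumes "prime p" "0 < k"
  obtains v j where "multiplicity p k = v" "k = p ^ v * j" "\<not> p dvd j"
proof (rule multiplicity_decompose'[of k p])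
  show "k \<noteq> 0" "\<not> is_unit p" using assms by auto
qed (use that in blast)

text \<open>Cancelling k costs exactly the p-part of k in the modulus, since the cofactor of this
  part is prime to p.\<close>

lemma cong_cancel_multiplicity:
  fixes a b :: int
  assumes p: "prime p" and k: "0 < k"
    and ab: "[int k * a = int k * b] (mod int (p ^ (multiplicity p k + t)))"
  shows "[a = b] (mod int (p ^ t))"
proof -
  obtain v j where v: "multiplicity p k = v" and j: "k = p ^ v * j" and nj: "\<not> p dvd j"
    using multiplicity_split[OF p k] by metis
  have "int p ^ v * int p ^ t dvd int p ^ v * (int j * (a - b))"
    using ab[unfolded v] unfolding j by (simp add: cong_iff_dvd_diff power_add algebra_simps)
  then have "int p ^ t dvd int j * (a - b)"
    using prime_gt_0_nat[OF p] by simp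
  moreover have "coprime (int p ^ t) (int j)"
    using p nj by (simp add: prime_imp_coprime)
  ultimately show ?thesis by (simp add: coprime_dvd_mult_right_iff cong_iff_dvd_diff)
qed

text \<open>
  \<open>dquot g k\<close> modulo \<open>k\<close> is the coordinate of \<open>dg\<close> at \<open>k\<close>, for a Dwork sequence \<open>g\<close>. At a prime
  \<open>p\<close> dividing \<open>k\<close> it is \<open>(g k - g (k / p)) / k\<close>; the numerator being divisible by the \<open>p\<close>-part
  \<open>p\<^sup>v\<close> of \<open>k\<close>, this is well-defined modulo \<open>p\<^sup>v\<close> once the numerator is known modulo \<open>p\<^sup>2\<^sup>v\<close>.
\<close>

definition is_dquot :: "(nat \<Rightarrow> int) \<Rightarrow> nat \<Rightarrow> int \<Rightarrow> bool" where
  "is_dquot g k x \<longleftrightarrow> (\<forall>p. prime p \<longrightarrow> p dvd k \<longrightarrow>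
     [int k * x = g k - g (k div p)] (mod int (p ^ (multiplicity p k + multiplicity p k))))"

definition dquot :: "(nat \<Rightarrow> int) \<Rightarrow> nat \<Rightarrow> int" where
  "dquot g k = (SOME x. 0 \<le> x \<and> x < int k \<and> is_dquot g k x)"

lemma is_dquotD: "is_dquot g k x \<Longrightarrow> prime p \<Longrightarrow> p dvd k \<Longrightarrow>
     [int k * x = g k - g (k div p)] (mod int (p ^ (multiplicity p k + multiplicity p k)))"
  by (auto simp: is_dquot_def)

lemma dquot_eqI:
  assumes "0 < k" "is_dquot g k x" "is_dquot g k y"
  shows "[x = y] (mod int k)"
proof (rule cong_all_prime_powers)
  fix p assume p: "prime p" "p dvd k"
  show "[x = y] (mod int (p ^ multiplicity p k))"
    by (rule cong_cancel_multiplicity[OF p(1) assms(1)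
          cong_trans[OF is_dquotD[OF assms(2) p] cong_sym[OF is_dquotD[OF assms(3) p]]]])
qed fact

lemma cong_mult_multiplicity:
  assumes "[x = y] (mod int (p ^ multiplicity p k))"
  shows "[int k * x = int k * y] (mod int (p ^ (multiplicity p k + multiplicity p k)))"
proof -
  have "int (p ^ multiplicity p k) dvd int k" by (simp only: int_dvd_int_iff multiplicity_dvd)
  then show ?thesis
    using mult_dvd_mono[of "int (p ^ multiplicity p k)" "int k" "int (p ^ multiplicity p k)" "x - y"] assms
    by (simp add: cong_iff_dvd_diff power_add right_diff_distrib)
qed

lemma is_dquot_cong:
  assumes "is_dquot g k x" "[x = y] (mod int k)"
  shows "is_dquot g k y"
  unfolding is_dquot_def
proof (intro allI impI)
  fix p assume p: "prime p" "p dvd k"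
  have "int (p ^ multiplicity p k) dvd int k" by (simp only: int_dvd_int_iff multiplicity_dvd)
  then have "[y = x] (mod int (p ^ multiplicity p k))"
    using assms(2) by (metis cong_dvd_modulus cong_sym)
  from cong_trans[OF cong_mult_multiplicity[OF this] is_dquotD[OF assms(1) p]]
  show "[int k * y = g k - g (k div p)] (mod int (p ^ (multiplicity p k + multiplicity p k)))" .
qed

text \<open>A quotient is found at each prime separately, and the results are glued by the Chinese
  remainder theorem. At p the numerator is p^v t by Dwork's congruence; with k = p^v j it remains to
  divide t by j, which is a unit modulo p^v.\<close>

lemma dquot_exists:
  assumes S: "truncation_set S" and g: "dwork S g" and k: "k \<in> S"
  shows "\<exists>x. 0 \<le> x \<and> x < int k \<and> is_dquot g k x"
proof -
  have k0: "0 < k" using S k by (rule truncation_set_pos)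
  have "\<exists>y :: nat. [int k * int y = g k - g (k div p)] (mod int (p ^ (multiplicity p k + multiplicity p k)))"
    if p: "p \<in> prime_factors k" for p
  proof -
    have p': "prime p" "p dvd k" using p by auto
    obtain v j where v: "multiplicity p k = v" and j: "k = p ^ v * j" and nj: "\<not> p dvd j"
      using multiplicity_split[OF p'(1) k0] by metis
    obtain t where t: "g k - g (k div p) = int (p ^ v) * t"
      using dworkD[OF g k p'] unfolding v by (auto simp: cong_iff_dvd_diff)
    have "coprime (int j) (int (p ^ v))"
      using p' nj by (metis coprime_commute coprime_int_iff coprime_power_right_iff prime_imp_coprime)
    then obtain z where z: "[int j * z = 1] (mod int (p ^ v))"
      using cong_solve_coprime_int by blast
    let ?y = "(t * z) mod int (p ^ v)"
    have "[int j * ?y = int j * (t * z)] (mod int (p ^ v))"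
      by (intro cong_scalar_left) simp
    also have "int j * (t * z) = t * (int j * z)" by simp
    also have "[t * (int j * z) = t * 1] (mod int (p ^ v))"
      using z by (rule cong_scalar_left)
    finally have "int (p ^ v) dvd int j * ?y - t" by (simp add: cong_iff_dvd_diff)
    then have "int (p ^ v) * int (p ^ v) dvd int (p ^ v) * (int j * ?y - t)"
      by (intro mult_dvd_mono) simp
    also have "int (p ^ v) * (int j * ?y - t) = int k * ?y - int (p ^ v) * t"
      by (simp only: j of_nat_mult right_diff_distrib mult.assoc)
    finally have "[int k * ?y = g k - g (k div p)] (mod int (p ^ (v + v)))"
      unfolding t by (simp add: cong_iff_dvd_diff power_add)
    moreover have "0 \<le> ?y" using prime_gt_0_nat[OF p'(1)] by simp
    then have "int (nat ?y) = ?y" by simp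
    ultimately show ?thesis unfolding v by metis
  qed
  then obtain u :: "nat \<Rightarrow> nat" where u: "\<And>p. p \<in> prime_factors k \<Longrightarrow>
     [int k * int (u p) = g k - g (k div p)] (mod int (p ^ (multiplicity p k + multiplicity p k)))"
    by metis
  have "\<exists>x. \<forall>p\<in>prime_factors k. [x = u p] (mod p ^ multiplicity p k)"
    by (rule chinese_remainder_nat)
      (auto intro!: primes_coprime simp: in_prime_factors_iff)
  then obtain x where x: "\<And>p. p \<in> prime_factors k \<Longrightarrow> [x = u p] (mod p ^ multiplicity p k)"
    by blast
  have "is_dquot g k (int x)"
    unfolding is_dquot_def
  proof (intro allI impI)
    fix p assume p: "prime p" "p dvd k"
    then have p': "p \<in> prime_factors k" using k0 by (simp add: in_prime_factors_iff)
    have "[int x = int (u p)] (mod int (p ^ multiplicity p k))"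
      using x[OF p'] by (simp only: cong_int_iff)
    from cong_trans[OF cong_mult_multiplicity[OF this] u[OF p']]
    show "[int k * int x = g k - g (k div p)] (mod int (p ^ (multiplicity p k + multiplicity p k)))" .
  qed
  then have "is_dquot g k (int x mod int k)"
    by (rule is_dquot_cong) simp
  moreover have "0 \<le> int x mod int k" "int x mod int k < int k" using k0 by simp_all
  ultimately show ?thesis by blast
qed

lemma dquot:
  assumes "truncation_set S" "dwork S g" "k \<in> S"
  shows dquot_nonneg: "0 \<le> dquot g k" and dquot_less: "dquot g k < int k"
    and is_dquot: "is_dquot g k (dquot g k)"
proof -
  have "0 \<le> dquot g k \<and> dquot g k < int k \<and> is_dquot g k (dquot g k)"
    unfolding dquot_def by (rule someI_ex[OF dquot_exists[OF assms]])
  then show "0 \<le> dquot g k" "dquot g k < int k" "is_dquot g k (dquot g k)" by simp_all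
qed

lemma dquot_cong:
  assumes "truncation_set S" "dwork S g" "k \<in> S" "is_dquot g k x"
  shows "[dquot g k = x] (mod int k)"
  using truncation_set_pos[OF assms(1,3)] is_dquot[OF assms(1-3)] assms(4) by (rule dquot_eqI)

lemma dquot_local:
  assumes "truncation_set S" "k \<in> S" "\<And>j. j \<in> S \<Longrightarrow> g j = h j"
  shows "dquot g k = dquot h k"
proof -
  have "is_dquot g k = is_dquot h k"
    using assms truncation_set_div[OF assms(1,2)] by (auto simp: is_dquot_def fun_eq_iff)
  then show ?thesis by (simp add: dquot_def)
qed

lemma is_dquot_add: "is_dquot g k x \<Longrightarrow> is_dquot h k y \<Longrightarrow> is_dquot (\<lambda>k. g k + h k) k (x + y)"
  unfolding is_dquot_def
proof (intro allI impI)
  fix p assume p: "prime p" "p dvd k"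
    and "\<forall>p. prime p \<longrightarrow> p dvd k \<longrightarrow> [int k * x = g k - g (k div p)] (mod int (p ^ (multiplicity p k + multiplicity p k)))"
    "\<forall>p. prime p \<longrightarrow> p dvd k \<longrightarrow> [int k * y = h k - h (k div p)] (mod int (p ^ (multiplicity p k + multiplicity p k)))"
  then have "[int k * x + int k * y = (g k - g (k div p)) + (h k - h (k div p))]
     (mod int (p ^ (multiplicity p k + multiplicity p k)))"
    by (intro cong_add) auto
  then show "[int k * (x + y) = g k + h k - (g (k div p) + h (k div p))]
     (mod int (p ^ (multiplicity p k + multiplicity p k)))"
    by (simp add: algebra_simps)
qed

text \<open>The numerator of the product differs from the one predicted by the product rule by (g(k)
  - g(k/p)) (h(k) - h(k/p)). Both factors are divisible by p^v, so the difference vanishes modulo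
  p^(2v), precisely the modulus in \<open>is_dquot\<close>.\<close>

lemma is_dquot_mult:
  assumes "dwork S g" "dwork S h" "k \<in> S" "is_dquot g k x" "is_dquot h k y"
  shows "is_dquot (\<lambda>k. g k * h k) k (g k * y + h k * x)"
  unfolding is_dquot_def
proof (intro allI impI)
  fix p assume p: "prime p" "p dvd k"
  let ?m = "int (p ^ (multiplicity p k + multiplicity p k))"
  let ?g = "g (k div p)" and ?h = "h (k div p)"
  have "int (p ^ multiplicity p k) * int (p ^ multiplicity p k) dvd (g k - ?g) * (h k - ?h)"
    using dworkD[OF assms(1,3) p] dworkD[OF assms(2,3) p]
    by (intro mult_dvd_mono) (simp_all add: cong_iff_dvd_diff)
  then have 1: "?m dvd (g k - ?g) * (h k - ?h)"
    by (simp add: power_add)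
  have 2: "[g k * (int k * y) + h k * (int k * x) = g k * (h k - ?h) + h k * (g k - ?g)] (mod ?m)"
    using is_dquotD[OF assms(4) p] is_dquotD[OF assms(5) p]
    by (intro cong_add cong_scalar_left)
  have "?m dvd (g k * (int k * y) + h k * (int k * x)) - (g k * (h k - ?h) + h k * (g k - ?g))
      + (g k - ?g) * (h k - ?h)"
    by (intro dvd_add 1) (use 2 in \<open>simp add: cong_iff_dvd_diff\<close>)
  then show "[int k * (g k * y + h k * x) = g k * h k - ?g * ?h] (mod ?m)"
    by (simp add: cong_iff_dvd_diff algebra_simps)
qed

text \<open>The numerator stays that of g at n k, while the denominator drops from n k to k; hence
  the factor n. This is the coordinate form of d F_n = n F_n d.\<close>

lemma is_dquot_frob:
  assumes "0 < n" "0 < k" "is_dquot g (n * k) x"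
  shows "is_dquot (\<lambda>k. g (n * k)) k (int n * x)"
  unfolding is_dquot_def
proof (intro allI impI)
  fix p assume p: "prime p" "p dvd k"
  have "int (p ^ (multiplicity p k + multiplicity p k)) dvd
      int (p ^ (multiplicity p (n * k) + multiplicity p (n * k)))"
    using assms by (simp only: int_dvd_int_iff) (intro le_imp_power_dvd add_mono dvd_imp_multiplicity_le; simp)
  then show "[int k * (int n * x) = g (n * k) - g (n * (k div p))]
     (mod int (p ^ (multiplicity p k + multiplicity p k)))"
    using is_dquotD[OF assms(3) p(1)] p by (auto simp: div_mult_swap mult_ac intro: cong_dvd_modulus)
qed

text \<open>The same formula serves twice: on ghost components it is the Verschiebung of Witt
  vectors, and on coordinates of differentials it is the Verschiebung of the explicit
  complex.\<close>

definition dver :: "nat \<Rightarrow> (nat \<Rightarrow> int) \<Rightarrow> nat \<Rightarrow> int" where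
  "dver n w k = (if n dvd k then int n * w (k div n) else 0)"

text \<open>Numerator and denominator at n k both contain the factor n of the values of V_n(h), and
  cancelling it still leaves a sufficient modulus. This is the coordinate form of F_n d V_n = d,
  before the term with dlog[-1] is taken into account.\<close>

lemma is_dquot_ver:
  assumes n: "0 < n" and k: "0 < k" and x: "is_dquot (dver n h) (n * k) x"
  shows "is_dquot h k x"
  unfolding is_dquot_def
proof (intro allI impI)
  fix p assume p: "prime p" "p dvd k"
  have "n * k div p = n * (k div p)" using p by (simp add: div_mult_swap)
  then have "[int n * (int k * x) = int n * (h k - h (k div p))]
     (mod int (p ^ (multiplicity p (n * k) + multiplicity p (n * k))))"
    using is_dquotD[OF x p(1)] p n by (simp add: dver_def right_diff_distrib mult.assoc)
  moreover have "multiplicity p (n * k) + multiplicity p (n * k) =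
     multiplicity p n + (multiplicity p n + (multiplicity p k + multiplicity p k))"
    using n k p by (subst (1 2) prime_elem_multiplicity_mult_distrib) auto
  ultimately have "[int k * x = h k - h (k div p)]
     (mod int (p ^ (multiplicity p n + (multiplicity p k + multiplicity p k))))"
    using n p by (metis cong_cancel_multiplicity)
  then show "[int k * x = h k - h (k div p)] (mod int (p ^ (multiplicity p k + multiplicity p k)))"
    by (rule cong_dvd_modulus) (simp add: power_add)
qed

lemma is_dquot_ver_not_dvd:
  assumes "\<not> n dvd k"
  shows "is_dquot (dver n h) k 0"
  unfolding is_dquot_def
proof (intro allI impI)
  fix p assume p: "prime p" "p dvd k"
  have "\<not> n dvd k div p" using assms p by (metis dvd_mult_div_cancel dvd_mult)
  then show "[int k * 0 = dver n h k - dver n h (k div p)] (mod int (p ^ (multiplicity p k + multiplicity p k)))"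
    using assms by (simp add: dver_def)
qed

text \<open>For even n and odd i, halving n i destroys divisibility by n. Hence the numerator at the
  prime 2 is n h(i) alone, and dividing it by n i leaves h(i) modulo 2. This boundary value is the
  source of dlog[-1] in \<open>dfrob_dquot_dver\<close>.\<close>

lemma is_dquot_ver_odd:
  assumes n: "even n" "0 < n" and i: "odd i" and x: "is_dquot (dver n h) (n * i) x"
  shows "[x = h i] (mod 2)"
proof -
  have "\<not> n dvd n * i div 2"
  proof
    assume "n dvd n * i div 2"
    then have "n * 2 dvd n * i" using n by (metis dvd_mult2 dvd_mult_div_cancel mult.commute mult_dvd_mono dvd_refl)
    then show False using n i by simp
  qed
  then have "[int n * (int i * x) = int n * h i] (mod int (2 ^ (multiplicity 2 (n * i) + multiplicity 2 (n * i))))"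
    using is_dquotD[OF x, of 2] n by (simp add: dver_def mult.assoc)
  moreover have "multiplicity 2 (n * i) = multiplicity 2 n"
    using n i by (subst prime_elem_multiplicity_mult_distrib) (auto simp: not_dvd_imp_multiplicity_0 elim: oddE)
  ultimately have "[int i * x = h i] (mod int (2 ^ multiplicity 2 n))"
    using n by (metis cong_cancel_multiplicity two_is_prime_nat)
  moreover have "(2::int) dvd int (2 ^ multiplicity 2 n)"
    using n by (simp add: multiplicity_gt_zero_iff dvd_power)
  ultimately have "[int i * x = h i] (mod 2)" by (rule cong_dvd_modulus)
  moreover have "[x = int i * x] (mod 2)"
    using i by (simp add: cong_iff_dvd_diff)
  ultimately show ?thesis by (metis cong_trans)
qed

text \<open>
  The parities behind the sums over \<open>r\<close> in the formulas for products and the Frobenius.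
\<close>

function par :: "(nat \<Rightarrow> int) \<Rightarrow> nat \<Rightarrow> int" where
  "par w k = (if 0 < k \<and> 4 dvd k then w (k div 2) + par w (k div 2) else 0)"
  by auto
termination by (relation "measure snd") auto

declare par.simps [simp del]

lemma par_eq_0: "\<not> 4 dvd k \<Longrightarrow> par w k = 0"
  by (subst par.simps) simp

lemma par_0 [simp]: "par w 0 = 0"
  by (subst par.simps) simp

lemma par_rec: "0 < k \<Longrightarrow> 4 dvd k \<Longrightarrow> par w k = w (k div 2) + par w (k div 2)"
  by (subst par.simps) simp

lemma dvd_4_half: "4 dvd (k :: nat) \<Longrightarrow> even k \<and> even (k div 2) \<and> k div 2 dvd k \<and> 2 * (k div 2) = k"
  by (auto elim!: dvdE)

text \<open>Unrolled, \<open>par w k\<close> is the sum of w(k/2^r) over all r \<ge> 1 for which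
  k/2^r is still an even integer. Every index j in this sum is even, and 2j divides k.\<close>

lemma par_cong:
  assumes "\<And>j. even j \<Longrightarrow> 2 * j dvd k \<Longrightarrow> [f j = g j] (mod 2)"
  shows "[par f k = par g k] (mod 2)"
  using assms
proof (induction k rule: less_induct)
  case (less k)
  show ?case
  proof (cases "0 < k \<and> 4 dvd k")
    case True
    then have "k div 2 < k" and d: "even (k div 2)" "2 * (k div 2) = k"
      using dvd_4_half[of k] by auto
    then have "[par f (k div 2) = par g (k div 2)] (mod 2)"
      using less.prems by (intro less.IH) (metis dvd_mult_right dvd_trans dvd_triv_right d(2))+
    moreover have "[f (k div 2) = g (k div 2)] (mod 2)"
      using less.prems d by simp
    ultimately show ?thesis using True by (simp add: par_rec cong_add)
  qed (cases "k = 0"; simp add: par_eq_0)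
qed

lemma par_add: "par (\<lambda>k. f k + g k) k = par f k + par g k"
proof (induction k rule: less_induct)
  case (less k)
  then show ?case
    by (cases "k = 0"; cases "4 dvd k") (simp_all add: par_rec par_eq_0)
qed

lemma par_zero [simp]: "par (\<lambda>k. 0) k = 0"
proof (induction k rule: less_induct)
  case (less k)
  then show ?case
    by (cases "k = 0"; cases "4 dvd k") (simp_all add: par_rec par_eq_0)
qed

lemma dwork_parity: "dwork S g \<Longrightarrow> k \<in> S \<Longrightarrow> even k \<Longrightarrow> 0 < k \<Longrightarrow> [g k = g (k div 2)] (mod 2)"
  using dworkD[of S g k 2] cong_dvd_modulus[of "g k" "g (k div 2)" "int (2 ^ multiplicity 2 k)" 2]
  by (simp add: multiplicity_gt_zero_iff dvd_power)

text \<open>By Dwork's congruence at the prime 2, the parity of g is constant along k, k/2, k/4,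
  ..., so g factors out of the sum that defines \<open>par\<close>.\<close>

lemma par_scale:
  assumes S: "truncation_set S" and g: "dwork S g" and k: "k \<in> S"
  shows "[par (\<lambda>j. g j * w j) k = g k * par w k] (mod 2)"
  using k
proof (induction k rule: less_induct)
  case (less k)
  have k0: "0 < k" using S less.prems by (rule truncation_set_pos)
  show ?case
  proof (cases "4 dvd k")
    case True
    then have "k div 2 < k" "k div 2 \<in> S" "even k"
      using k0 less.prems truncation_set_div[OF S, of k 2] dvd_4_half[of k] by auto
    then have 1: "[par (\<lambda>j. g j * w j) (k div 2) = g (k div 2) * par w (k div 2)] (mod 2)"
      and 2: "[g (k div 2) = g k] (mod 2)"
      using less dwork_parity[OF g less.prems _ k0] by (auto simp: cong_sym)
    have "[g (k div 2) * w (k div 2) + par (\<lambda>j. g j * w j) (k div 2) =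
       g k * w (k div 2) + g k * par w (k div 2)] (mod 2)"
      by (intro cong_add cong_trans[OF 1] cong_scalar_right 2)
    then show ?thesis using k0 True by (simp add: par_rec distrib_left)
  qed (simp add: par_eq_0)
qed

lemma par_dvd_cong:
  assumes "\<And>j. 0 < j \<Longrightarrow> j dvd k \<Longrightarrow> [f j = g j] (mod int j)" and "0 < k"
  shows "[par f k = par g k] (mod 2)"
proof (rule par_cong)
  fix j assume j: "even j" "2 * j dvd k"
  then have "[f j = g j] (mod int j)"
    using assms by (auto intro!: assms(1) Nat.gr0I dest: dvd_mult_right)
  then show "[f j = g j] (mod 2)"
    by (rule cong_dvd_modulus) (use j(1) in simp)
qed

lemma par_odd: "odd n \<Longrightarrow> par (\<lambda>k. w (n * k)) k = par w (n * k)"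
proof (induction k rule: less_induct)
  case (less k)
  have 4: "4 dvd n * k \<longleftrightarrow> 4 dvd k"
  proof -
    have "coprime (2 ^ 2) n"
      unfolding coprime_power_left_iff using less.prems by auto
    then have "2 ^ 2 dvd n * k \<longleftrightarrow> 2 ^ 2 dvd k" by (rule coprime_dvd_mult_right_iff)
    then show ?thesis by simp
  qed
  have n0: "0 < n" using less.prems by (auto intro: Nat.gr0I)
  show ?case
  proof (cases "0 < k \<and> 4 dvd k")
    case True
    then have "n * k div 2 = n * (k div 2)" using dvd_4_half[of k] by (simp add: div_mult_swap)
    then show ?thesis using True less n0 4 by (simp add: par_rec)
  next
    case False
    then show ?thesis using 4 by (cases "k = 0") (simp_all add: par_eq_0)
  qed
qed

text \<open>The multiples of k/2, the element of order two in the integers modulo k; for odd k there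
  is no such element. Modulo k only the parity of c matters, and all corrections in the explicit
  complex have this form.\<close>

definition tw :: "nat \<Rightarrow> int \<Rightarrow> int" where
  "tw k c = (if even k then int (k div 2) * c else 0)"

lemma tw_cong:
  assumes "[a = b] (mod 2)"
  shows "[tw k a = tw k b] (mod int k)"
proof (cases "even k")
  case True
  then obtain m where m: "k = 2 * m" by blast
  have "2 * int m dvd (a - b) * int m"
    using assms by (intro mult_dvd_mono) (auto simp: cong_iff_dvd_diff)
  also have "(a - b) * int m = tw k a - tw k b" by (simp add: m tw_def algebra_simps)
  finally show ?thesis by (simp add: m cong_iff_dvd_diff)
qed (simp add: tw_def)

lemma tw_0 [simp]: "tw k 0 = 0"
  by (simp add: tw_def)

lemma tw_add: "tw k (a + b) = tw k a + tw k b"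
  and tw_mult: "c * tw k a = tw k (c * a)"
  by (auto simp: tw_def algebra_simps)

lemma tw_even: "even c \<Longrightarrow> [tw k c = 0] (mod int k)"
  using tw_cong[of c 0 k] by (simp add: cong_0_iff)

lemma tw_mult_odd: "odd n \<Longrightarrow> int n * tw k c = tw (n * k) c"
  by (cases "even k") (auto simp: tw_def div_mult_swap)

lemma tw_mult_even: "even k \<Longrightarrow> int n * tw k c = tw (n * k) c"
  by (auto simp: tw_def div_mult_swap)

lemma tw_mult_odd_cong: "odd n \<Longrightarrow> [tw (n * k) c = tw k c] (mod int k)"
  using tw_cong[of "int n * c" c k]
  by (simp add: tw_mult_odd[symmetric] tw_mult cong_iff_dvd_diff)

lemma tw_mult_even_cong:
  assumes "even n"
  shows "[tw (n * k) c = 0] (mod int k)"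
proof -
  obtain m where "n = 2 * m" using assms by blast
  then show ?thesis by (simp add: tw_def cong_0_iff mult.assoc)
qed

section \<open>Action, Frobenius and Verschiebung on differentials\<close>

text \<open>The projection formula forces the correction: for even n, V_n(h) w must equal V_n(h
  F_n(w)), and at an index n j with j even the correction of the Frobenius contributes n h(j) (j/2)
  times a parity of w. Expressed as the product of the parities of dg and of w, the correction is
  additive in both arguments modulo k, and it cancels in g dh + h dg.\<close>

definition dact :: "(nat \<Rightarrow> int) \<Rightarrow> (nat \<Rightarrow> int) \<Rightarrow> nat \<Rightarrow> int" where
  "dact g w k = g k * w k + tw k (par (dquot g) k * par w k)"

text \<open>For even n the correction produces the term with dlog[-1] that axiom (iv) demands of F_n
  d V_n, as \<open>dfrob_dquot_dver\<close> shows. For odd n that term is an even multiple of a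
  class of order two.\<close>

definition dfrob :: "nat \<Rightarrow> (nat \<Rightarrow> int) \<Rightarrow> nat \<Rightarrow> int" where
  "dfrob n w k = w (n * k) + (if even n then tw k (par w (n * k)) else 0)"

lemma dact_add_right: "dact g (\<lambda>k. v k + w k) k = dact g v k + dact g w k"
  by (simp add: dact_def par_add distrib_left tw_add)

lemma dfrob_add: "dfrob n (\<lambda>k. v k + w k) k = dfrob n v k + dfrob n w k"
  by (simp add: dfrob_def par_add tw_add)

lemma dver_add: "dver n (\<lambda>k. v k + w k) k = dver n v k + dver n w k"
  by (simp add: dver_def distrib_left)

lemma dver_dver: "0 < m \<Longrightarrow> 0 < n \<Longrightarrow> dver n (dver m w) k = dver (m * n) w k"
proof (cases "n dvd k")
  case True
  assume "0 < m" "0 < n"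
  with True show ?thesis by (auto simp: dver_def mult.commute[of m n] elim!: dvdE)
next
  case False
  then have "\<not> m * n dvd k" by (meson dvd_mult_right)
  then show ?thesis using False by (simp add: dver_def)
qed

lemma dact_cong:
  assumes "\<And>j. 0 < j \<Longrightarrow> j dvd k \<Longrightarrow> [v j = w j] (mod int j)" and k: "0 < k"
  shows "[dact g v k = dact g w k] (mod int k)"
  unfolding dact_def
  using assms(1)[of k] par_dvd_cong[OF assms(1) k] k
  by (intro cong_add cong_scalar_left tw_cong) auto

lemma dfrob_cong:
  assumes "\<And>j. 0 < j \<Longrightarrow> j dvd n * k \<Longrightarrow> [v j = w j] (mod int j)" and k: "0 < k" and n: "0 < n"
  shows "[dfrob n v k = dfrob n w k] (mod int k)"
proof -
  have "[v (n * k) = w (n * k)] (mod int (n * k))" using k n by (intro assms(1)) simp_all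
  then have "[v (n * k) = w (n * k)] (mod int k)" by (rule cong_dvd_modulus) simp
  moreover have "[par v (n * k) = par w (n * k)] (mod 2)" using assms by (intro par_dvd_cong) auto
  ultimately show ?thesis by (auto simp: dfrob_def intro!: cong_add tw_cong)
qed

lemma dver_cong:
  assumes "n dvd k \<Longrightarrow> [v (k div n) = w (k div n)] (mod int (k div n))"
  shows "[dver n v k = dver n w k] (mod int k)"
proof (cases "n dvd k")
  case True
  then have "int n * int (k div n) dvd int n * (v (k div n) - w (k div n))"
    using assms by (intro mult_dvd_mono) (auto simp: cong_iff_dvd_diff)
  then show ?thesis using True
    by (simp add: dver_def cong_iff_dvd_diff right_diff_distrib flip: of_nat_mult)
qed (simp add: dver_def)

lemma cong_2_if_even: "even k \<Longrightarrow> [a = b] (mod int k) \<Longrightarrow> [a = b] (mod 2)"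
  by (erule cong_dvd_modulus) simp

text \<open>Either 4 divides j, and then j/2 is even, or the chain of even indices below j is empty
  and the parity is 0. Hence the correction in \<open>dact\<close> is invisible to
  \<open>par\<close>.\<close>

lemma tw_par_even:
  assumes "even j"
  shows "even (tw j (a * par w j))"
proof (cases "4 dvd j")
  case True
  then show ?thesis using dvd_4_half[of j] by (simp add: tw_def)
qed (simp add: par_eq_0)

lemma par_dact:
  assumes "truncation_set S" "dwork S g" "k \<in> S"
  shows "[par (dact g w) k = g k * par w k] (mod 2)"
proof (rule cong_trans[OF par_cong par_scale[OF assms]])
  fix j :: nat assume "even j"
  then show "[dact g w j = g j * w j] (mod 2)"
    using tw_par_even[of j] by (simp add: dact_def cong_iff_dvd_diff)
qed

lemma dwork_subset: "dwork S g \<Longrightarrow> T \<subseteq> S \<Longrightarrow> dwork T g"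
  by (auto simp: dwork_def)

lemma dquot_add:
  assumes S: "truncation_set S" and g: "dwork S g" and h: "dwork S h" and k: "k \<in> S"
  shows "[dquot (\<lambda>k. g k + h k) k = dquot g k + dquot h k] (mod int k)"
  by (rule dquot_cong[OF S dwork_add[OF g h] k is_dquot_add[OF is_dquot[OF S g k] is_dquot[OF S h k]]])

lemma dquot_mult:
  assumes S: "truncation_set S" and g: "dwork S g" and h: "dwork S h" and k: "k \<in> S"
  shows "[dquot (\<lambda>k. g k * h k) k = g k * dquot h k + h k * dquot g k] (mod int k)"
  by (rule dquot_cong[OF S dwork_mult[OF g h] k is_dquot_mult[OF g h k is_dquot[OF S g k] is_dquot[OF S h k]]])

lemma par_dquot_mult:
  assumes S: "truncation_set S" and g: "dwork S g" and h: "dwork S h" and k: "k \<in> S"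
  shows "[par (dquot (\<lambda>k. g k * h k)) k = g k * par (dquot h) k + h k * par (dquot g) k] (mod 2)"
proof -
  have "[par (dquot (\<lambda>k. g k * h k)) k = par (\<lambda>k. g k * dquot h k + h k * dquot g k) k] (mod 2)"
    using truncation_set_pos[OF S k] truncation_set_dvd[OF S k] assms
    by (intro par_dvd_cong dquot_mult[OF S])
  also have "par (\<lambda>k. g k * dquot h k + h k * dquot g k) k =
      par (\<lambda>k. g k * dquot h k) k + par (\<lambda>k. h k * dquot g k) k"
    by (rule par_add)
  also have "[par (\<lambda>k. g k * dquot h k) k + par (\<lambda>k. h k * dquot g k) k =
      g k * par (dquot h) k + h k * par (dquot g) k] (mod 2)"
    using assms by (intro cong_add par_scale)
  finally show ?thesis .
qed

lemma dact_add_left: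
  assumes S: "truncation_set S" and g: "dwork S g" and h: "dwork S h" and k: "k \<in> S"
  shows "[dact (\<lambda>k. g k + h k) w k = dact g w k + dact h w k] (mod int k)"
proof -
  have "[par (dquot (\<lambda>k. g k + h k)) k = par (\<lambda>k. dquot g k + dquot h k) k] (mod 2)"
    using truncation_set_pos[OF S k] truncation_set_dvd[OF S k] assms
    by (intro par_dvd_cong dquot_add[OF S])
  then have "[par (dquot (\<lambda>k. g k + h k)) k = par (dquot g) k + par (dquot h) k] (mod 2)"
    by (simp add: par_add)
  then have "[(g k + h k) * w k + tw k (par (dquot (\<lambda>k. g k + h k)) k * par w k) =
      (g k + h k) * w k + tw k ((par (dquot g) k + par (dquot h) k) * par w k)] (mod int k)"
    by (intro cong_add tw_cong cong_scalar_right cong_refl)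
  then show ?thesis by (simp add: dact_def tw_add distrib_right algebra_simps)
qed

text \<open>On both sides the correction is governed by (g par(dh) + h par(dg)) par(w). On the left
  this comes from the product rule for d(gh); on the right the two actions contribute one summand
  each.\<close>

lemma dact_mult:
  assumes S: "truncation_set S" and g: "dwork S g" and h: "dwork S h" and k: "k \<in> S"
  shows "[dact (\<lambda>k. g k * h k) w k = dact g (dact h w) k] (mod int k)"
proof -
  let ?p = "par w k" and ?g = "par (dquot g) k" and ?h = "par (dquot h) k"
  have "[par (dquot (\<lambda>k. g k * h k)) k * ?p = (g k * ?h + h k * ?g) * ?p] (mod 2)"
    using par_dquot_mult[OF assms] by (rule cong_scalar_right)
  then have "[par (dquot (\<lambda>k. g k * h k)) k * ?p = g k * (?h * ?p) + ?g * (h k * ?p)] (mod 2)"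
    by (simp add: algebra_simps)
  also have "[g k * (?h * ?p) + ?g * (h k * ?p) =
      g k * (?h * ?p) + ?g * par (dact h w) k] (mod 2)"
    by (intro cong_add cong_scalar_left cong_refl cong_sym[OF par_dact[OF S h k]])
  finally have "[g k * h k * w k + tw k (par (dquot (\<lambda>k. g k * h k)) k * ?p) =
      g k * h k * w k + tw k (g k * (?h * ?p) + ?g * par (dact h w) k)] (mod int k)"
    by (intro cong_add cong_refl tw_cong)
  moreover have "dact g (dact h w) k =
     g k * h k * w k + tw k (g k * (?h * ?p) + ?g * par (dact h w) k)"
    unfolding dact_def[of g] by (subst dact_def) (simp add: tw_add distrib_left tw_mult)
  ultimately show ?thesis by (simp add: dact_def)
qed

lemma dquot_const:
  assumes S: "truncation_set S" and k: "k \<in> S"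
  shows "[dquot (\<lambda>k. c) k = 0] (mod int k)"
  by (rule dquot_cong[OF S dwork_const k]) (simp add: is_dquot_def)

lemma dact_one:
  assumes S: "truncation_set S" and k: "k \<in> S"
  shows "[dact (\<lambda>k. 1) w k = w k] (mod int k)"
proof -
  have "[par (dquot (\<lambda>k. 1)) k = par (\<lambda>k. 0) k] (mod 2)"
    using truncation_set_pos[OF S k] truncation_set_dvd[OF S k] assms
    by (intro par_dvd_cong dquot_const[OF S])
  then have "even (par (dquot (\<lambda>k. 1)) k * par w k)"
    by (simp add: cong_0_iff)
  from tw_even[OF this] have "[1 * w k + tw k (par (dquot (\<lambda>k. 1)) k * par w k) = 1 * w k + 0] (mod int k)"
    by (intro cong_add cong_refl)
  then show ?thesis by (simp add: dact_def)
qed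

text \<open>The corrections of the two summands coincide, both being given by par(dg) par(dh).
  Together they are an even multiple of k/2, so the product rule for difference quotients is also
  the Leibniz rule for the corrected action.\<close>

lemma dquot_mult_dact:
  assumes S: "truncation_set S" and g: "dwork S g" and h: "dwork S h" and k: "k \<in> S"
  shows "[dquot (\<lambda>k. g k * h k) k = dact g (dquot h) k + dact h (dquot g) k] (mod int k)"
proof -
  let ?c = "par (dquot g) k * par (dquot h) k"
  have "[dquot (\<lambda>k. g k * h k) k + 0 = g k * dquot h k + h k * dquot g k + tw k (?c + ?c)] (mod int k)"
    by (intro cong_add dquot_mult[OF assms] cong_sym[OF tw_even]) simp
  moreover have "g k * dquot h k + h k * dquot g k + tw k (?c + ?c) =
      dact g (dquot h) k + dact h (dquot g) k"
    by (simp only: tw_add) (simp add: dact_def mult.commute[of "par (dquot h) k"])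
  ultimately show ?thesis by simp
qed

text \<open>For even n the chain of even indices below n k is longer than n times the chain below k,
  since k/2^r may be odd while n k/2^r is not. The missing tail is supplied by the correction of the
  Frobenius at the last even index k/2^r, whose half is odd; at the earlier indices the correction
  is even. The condition that 4 divides k guarantees that a last even index with r \<ge> 1
  exists.\<close>

lemma par_dfrob:
  assumes n: "0 < n" and k: "0 < k" and e: "even n \<Longrightarrow> 4 dvd k"
  shows "[par (dfrob n w) k = par w (n * k)] (mod 2)"
proof (cases "even n")
  case True
  with e have "4 dvd k" by simp
  with k show ?thesis
  proof (induction k rule: less_induct)
    case (less k)
    let ?j = "k div 2"
    have j: "?j < k" "0 < ?j" "even ?j" "4 dvd n * k" "n * k div 2 = n * ?j" "4 dvd n * ?j"
      using less.prems True dvd_4_half[of k] mult_dvd_mono[of 2 n 2 ?j]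
      by (auto simp: div_mult_swap)
    have r: "par w (n * k) = w (n * ?j) + par w (n * ?j)"
      using less.prems n j by (simp add: par_rec)
    have "[dfrob n w ?j + par (dfrob n w) ?j = w (n * ?j) + par w (n * ?j)] (mod 2)"
    proof (cases "4 dvd ?j")
      case True
      have "[dfrob n w ?j = w (n * ?j)] (mod 2)"
        using True dvd_4_half[of ?j] by (simp add: dfrob_def tw_def cong_iff_dvd_diff)
      with less.IH[OF j(1,2) True] show ?thesis by (intro cong_add)
    next
      case False
      then have "odd (?j div 2)"
        by (metis dvd_mult_div_cancel j(3) mult_dvd_mono dvd_refl numeral_Bit0 mult_2 numeral_times_numeral semiring_norm(13) semiring_norm(12))
      then have "[dfrob n w ?j = w (n * ?j) + par w (n * ?j)] (mod 2)"
        using j True by (simp add: dfrob_def tw_def cong_iff_dvd_diff algebra_simps)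
      then show ?thesis using False by (simp add: par_eq_0)
    qed
    then show ?case using less.prems r by (simp add: par_rec)
  qed
next
  case False
  then have "dfrob n w = (\<lambda>k. w (n * k))" by (auto simp: dfrob_def)
  with False show ?thesis by (simp add: par_odd)
qed

lemma par_dver_even: "even n \<Longrightarrow> even (par (dver n w) k)"
  using par_cong[of k "dver n w" "\<lambda>k. 0"] by (simp add: dver_def cong_iff_dvd_diff)

lemma par_dver_odd_dvd:
  assumes "odd n"
  shows "[par (dver n w) (n * k) = par w k] (mod 2)"
proof -
  have "par (\<lambda>k. dver n w (n * k)) k = par (dver n w) (n * k)"
    using assms by (rule par_odd)
  moreover have "0 < n" using assms by (auto intro: Nat.gr0I)
  then have "(\<lambda>k. dver n w (n * k)) = (\<lambda>k. int n * w k)" by (auto simp: dver_def)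
  moreover have "[par (\<lambda>k. int n * w k) k = par w k] (mod 2)"
    using assms by (intro par_cong) (simp add: cong_iff_dvd_diff)
  ultimately show ?thesis by simp
qed

lemma par_dver_odd_not_dvd:
  assumes "\<not> n dvd k"
  shows "even (par (dver n w) k)"
proof -
  have "[par (dver n w) k = par (\<lambda>k. 0) k] (mod 2)"
  proof (rule par_cong)
    fix j assume "2 * j dvd k"
    then have "\<not> n dvd j" using assms by (metis dvd_mult dvd_trans)
    then show "[dver n w j = 0] (mod 2)" by (simp add: dver_def)
  qed
  then show ?thesis by (simp add: cong_0_iff)
qed

lemma dquot_frob:
  assumes S: "truncation_set S" and g: "dwork S g" and n: "0 < n" and k: "n * k \<in> S"
  shows "[dquot (\<lambda>k. g (n * k)) k = int n * dquot g (n * k)] (mod int k)"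
proof (rule dquot_cong)
  show "truncation_set (S \<div> n)" using S by (rule truncation_set_quot)
  show "dwork (S \<div> n) (\<lambda>k. g (n * k))" using g n S by (rule dwork_frob)
  show "k \<in> S \<div> n" using S k by (rule trunc_quotI)
  have "0 < k" using truncation_set_pos[OF S k] by simp
  then show "is_dquot (\<lambda>k. g (n * k)) k (int n * dquot g (n * k))"
    by (intro is_dquot_frob n is_dquot[OF S g k])
qed

lemma par_dquot_frob:
  assumes S: "truncation_set S" and g: "dwork S g" and n: "0 < n" and k: "n * k \<in> S"
  shows "[par (dquot (\<lambda>k. g (n * k))) k = int n * par (dquot g) (n * k)] (mod 2)"
proof -
  have k0: "0 < k" using truncation_set_pos[OF S k] by simp
  have 1: "[par (dquot (\<lambda>k. g (n * k))) k = par (\<lambda>k. int n * dquot g (n * k)) k] (mod 2)"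
    using k0 truncation_set_dvd[OF S k] assms
    by (intro par_dvd_cong dquot_frob[OF S]) auto
  show ?thesis
  proof (cases "even n")
    case True
    have "[par (\<lambda>k. int n * dquot g (n * k)) k = par (\<lambda>k. 0) k] (mod 2)"
      using True by (intro par_cong) (simp add: cong_0_iff)
    then show ?thesis using cong_trans[OF 1] True by (simp add: cong_0_iff cong_def)
  next
    case False
    have "[par (\<lambda>k. int n * dquot g (n * k)) k = par (\<lambda>k. dquot g (n * k)) k] (mod 2)"
      using False by (intro par_cong) (simp add: cong_iff_dvd_diff)
    also have "par (\<lambda>k. dquot g (n * k)) k = par (dquot g) (n * k)"
      using False by (rule par_odd)
    also have "[par (dquot g) (n * k) = int n * par (dquot g) (n * k)] (mod 2)"
      using False by (simp add: cong_iff_dvd_diff)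
    finally show ?thesis using cong_trans[OF 1] by blast
  qed
qed

text \<open>For even n the corrections of both actions vanish: on the left because n k/2 is a
  multiple of k, on the right because d(F_n g) = n F_n(dg) has even parity. What remains is the
  correction of the Frobenius, from which g factors out. For odd n the corrections of the two
  actions agree modulo k.\<close>

lemma dfrob_dact:
  assumes S: "truncation_set S" and g: "dwork S g" and n: "0 < n" and k: "n * k \<in> S"
  shows "[dfrob n (dact g w) k = dact (\<lambda>k. g (n * k)) (dfrob n w) k] (mod int k)"
proof -
  have k0: "0 < k" using truncation_set_pos[OF S k] by simp
  let ?g = "g (n * k)" and ?p = "par w (n * k)" and ?d = "par (dquot g) (n * k)"
  have pg: "[par (dquot (\<lambda>k. g (n * k))) k = int n * ?d] (mod 2)"
    using assms by (rule par_dquot_frob)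
  show ?thesis
  proof (cases "even n")
    case True
    have "[dact g w (n * k) + tw k (par (dact g w) (n * k)) = ?g * w (n * k) + 0 + tw k (?g * ?p)] (mod int k)"
      unfolding dact_def[of g w "n * k"]
      using True by (intro cong_add cong_refl tw_mult_even_cong tw_cong par_dact[OF S g k])
    then have "[dfrob n (dact g w) k = ?g * w (n * k) + 0 + tw k (?g * ?p)] (mod int k)"
      using True by (simp add: dfrob_def)
    also have "?g * w (n * k) + 0 + tw k (?g * ?p) = ?g * dfrob n w k + 0"
      using True by (simp add: dfrob_def distrib_left tw_mult)
    also
    have ev: "even (int n * ?d)" using True by simp
    then have "even (par (dquot (\<lambda>k. g (n * k))) k)" using pg by (metis cong_dvd_iff)
    then have "[?g * dfrob n w k + 0 = ?g * dfrob n w k +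
        tw k (par (dquot (\<lambda>k. g (n * k))) k * par (dfrob n w) k)] (mod int k)"
      by (intro cong_add cong_refl cong_sym[OF tw_even]) simp
    finally show ?thesis by (simp add: dact_def[of "\<lambda>k. g (n * k)"])
  next
    case False
    then have f: "dfrob n v = (\<lambda>k. v (n * k))" for v by (simp add: fun_eq_iff dfrob_def)
    have "[?g * w (n * k) + tw (n * k) (?d * ?p) = ?g * w (n * k) + tw k (?d * ?p)] (mod int k)"
      using False by (intro cong_add cong_refl tw_mult_odd_cong)
    also have "[?g * w (n * k) + tw k (?d * ?p) =
       ?g * w (n * k) + tw k (par (dquot (\<lambda>k. g (n * k))) k * ?p)] (mod int k)"
    proof (intro cong_add cong_refl tw_cong cong_scalar_right)
      have "[?d = int n * ?d] (mod 2)" using False by (simp add: cong_iff_dvd_diff)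
      then show "[?d = par (dquot (\<lambda>k. g (n * k))) k] (mod 2)"
        using pg by (metis cong_sym cong_trans)
    qed
    finally show ?thesis using False par_odd[OF False, of w k]
      by (simp only: dact_def f)
  qed
qed

text \<open>For even m the inner correction sits at the index m k and is a multiple of k, so only
  the outer one survives. If k is even as well, 4 divides m k and \<open>par_dfrob\<close> compares
  the parities; for odd k the outer correction is 0. For odd m the inner correction at m k restricts
  to the one at k.\<close>

lemma dfrob_dfrob:
  assumes m: "0 < m" and n: "0 < n" and k: "0 < k"
  shows "[dfrob m (dfrob n w) k = dfrob (m * n) w k] (mod int k)"
proof (cases "even m")
  case False
  have "[tw (m * k) (par w (n * (m * k))) = tw k (par w (n * (m * k)))] (mod int k)"
    using False by (rule tw_mult_odd_cong)
  then show ?thesis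
    using False by (auto simp: dfrob_def mult.left_commute[of n m] mult.assoc intro!: cong_add)
next
  case True
  have "[dfrob n w (m * k) = w (n * (m * k)) + 0] (mod int k)"
    unfolding dfrob_def using True by (intro cong_add cong_refl) (simp add: tw_mult_even_cong)
  moreover have "[tw k (par (dfrob n w) (m * k)) = tw k (par w (n * (m * k)))] (mod int k)"
  proof (cases "even k")
    case e: True
    show ?thesis
      using True e k m n mult_dvd_mono[of 2 m 2 k] by (intro tw_cong par_dfrob) auto
  qed (simp add: tw_def)
  ultimately have "[dfrob n w (m * k) + tw k (par (dfrob n w) (m * k)) =
     w (n * (m * k)) + 0 + tw k (par w (n * (m * k)))] (mod int k)"
    by (rule cong_add)
  then show ?thesis using True by (simp add: dfrob_def[of m] dfrob_def[of "m * n"] mult_ac)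
qed

lemma dfrob_dver:
  assumes n: "0 < n"
  shows "[dfrob n (dver n w) k = int n * w k] (mod int k)"
proof -
  have "[int n * w k + (if even n then tw k (par (dver n w) (n * k)) else 0) = int n * w k + 0] (mod int k)"
    by (intro cong_add cong_refl) (simp add: tw_even par_dver_even)
  then show ?thesis using n by (simp add: dfrob_def dver_def)
qed

lemma dfrob_dver_coprime:
  assumes n: "0 < n" and m: "0 < m" and c: "coprime m n" and k: "0 < k"
  shows "[dfrob m (dver n w) k = dver n (dfrob m w) k] (mod int k)"
proof -
  have d: "n dvd m * k \<longleftrightarrow> n dvd k"
    using c by (simp add: coprime_commute coprime_dvd_mult_right_iff)
  show ?thesis
  proof (cases "n dvd k")
    case True
    then obtain j where j: "k = n * j" by blast
    show ?thesis
    proof (cases "even m")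
      case e: True
      then have o: "odd n" using coprime_common_divisor[OF c, of 2] by auto
      have "[tw k (par (dver n w) (m * k)) = tw k (par w (m * j))] (mod int k)"
        using par_dver_odd_dvd[OF o, of w "m * j"] by (intro tw_cong) (simp add: j mult_ac)
      then have "[int n * w (m * j) + tw k (par (dver n w) (m * k)) =
          int n * w (m * j) + int n * tw j (par w (m * j))] (mod int k)"
        unfolding tw_mult_odd[OF o] j by (intro cong_add cong_refl)
      then show ?thesis using e n by (simp add: dfrob_def dver_def j distrib_left mult.left_commute[of m])
    next
      case False
      then show ?thesis using n by (simp add: dfrob_def dver_def j mult.left_commute[of m])
    qed
  next
    case False
    have "[tw k (par (dver n w) (m * k)) = 0] (mod int k)"
      using False d by (intro tw_even par_dver_odd_not_dvd) simp
    then show ?thesis using False d by (simp add: dfrob_def dver_def)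
  qed
qed

text \<open>For even n both corrections vanish, because V_n(w) has even coordinates and d(F_n g) has
  even parity. For odd n they correspond to each other under multiplication by n.\<close>

lemma dact_dver:
  assumes S: "truncation_set S" and g: "dwork S g" and n: "0 < n" and k: "k \<in> S"
  shows "[dact g (dver n w) k = dver n (dact (\<lambda>k. g (n * k)) w) k] (mod int k)"
proof (cases "n dvd k")
  case True
  then obtain j where j: "k = n * j" by blast
  have pg: "[par (dquot (\<lambda>k. g (n * k))) j = int n * par (dquot g) k] (mod 2)"
    unfolding j by (rule par_dquot_frob[OF S g n]) (use k j in simp)
  let ?r = "int n * (g k * w j)"
  have "[tw k (par (dquot g) k * par (dver n w) k) =
     int n * tw j (par (dquot (\<lambda>k. g (n * k))) j * par w j)] (mod int k)"
  proof (cases "even n")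
    case True
    have "even (int n * par (dquot g) k)" using True by simp
    then have "even (par (dquot (\<lambda>k. g (n * k))) j)" using pg by (metis cong_dvd_iff)
    then have "int n * int j dvd int n * tw j (par (dquot (\<lambda>k. g (n * k))) j * par w j)"
      using tw_even[of "par (dquot (\<lambda>k. g (n * k))) j * par w j" j]
      by (intro mult_dvd_mono) (simp_all add: cong_0_iff)
    then have "[int n * tw j (par (dquot (\<lambda>k. g (n * k))) j * par w j) = 0] (mod int k)"
      by (simp add: cong_0_iff j)
    moreover have "[tw k (par (dquot g) k * par (dver n w) k) = 0] (mod int k)"
      using True by (intro tw_even) (simp add: par_dver_even)
    ultimately show ?thesis by (metis cong_sym cong_trans)
  next
    case False
    have "[par (dquot g) k = int n * par (dquot g) k] (mod 2)"
      using False by (simp add: cong_iff_dvd_diff)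
    then have "[par (dquot g) k = par (dquot (\<lambda>k. g (n * k))) j] (mod 2)"
      using pg by (metis cong_sym cong_trans)
    moreover have "[par (dver n w) k = par w j] (mod 2)"
      unfolding j using False by (rule par_dver_odd_dvd)
    ultimately show ?thesis unfolding tw_mult_odd[OF False]
      by (subst j[symmetric]) (intro tw_cong cong_mult)
  qed
  then have "[?r + tw k (par (dquot g) k * par (dver n w) k) =
     ?r + int n * tw j (par (dquot (\<lambda>k. g (n * k))) j * par w j)] (mod int k)"
    by (intro cong_add cong_refl)
  moreover have "dver n w k = int n * w j" using n by (simp add: dver_def j)
  ultimately show ?thesis using n
    by (simp add: dact_def dver_def[of n "dact _ _"] j distrib_left mult_ac)
next
  case False
  have "[tw k (par (dquot g) k * par (dver n w) k) = 0] (mod int k)"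
    using False by (intro tw_even) (simp add: par_dver_odd_not_dvd)
  then show ?thesis using False by (simp add: dact_def dver_def)
qed

section \<open>Difference quotients of Verschiebungen, and axiom (iv)\<close>

lemma dwork_dver:
  assumes S: "truncation_set S" and h: "dwork (S \<div> n) h" and n: "0 < n"
  shows "dwork S (dver n h)"
  unfolding dwork_def
proof (intro ballI allI impI)
  fix k p assume k: "k \<in> S" and p: "prime p" "p dvd k"
  have k0: "0 < k" using S k by (rule truncation_set_pos)
  show "[dver n h k = dver n h (k div p)] (mod int (p ^ multiplicity p k))"
  proof (cases "n dvd k")
    case True
    then obtain j where j: "k = n * j" by blast
    have j0: "0 < j" using k0 j by simp
    have jS: "j \<in> S \<div> n" using S k j by (auto intro: trunc_quotI)
    show ?thesis
    proof (cases "p dvd j")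
      case True
      have "k div p = n * (j div p)" using True j by (simp add: div_mult_swap)
      then show ?thesis
        using prime_power_multiplicity_dvd_mult[OF p(1) n j0 dworkD[OF h jS p(1) True]] n
        by (simp add: dver_def j)
    next
      case False
      have "\<not> n dvd k div p"
      proof
        assume "n dvd k div p"
        then obtain i where "k div p = n * i" by blast
        then have "n * j = n * (p * i)" using p(2) j by (metis dvd_mult_div_cancel mult.left_commute)
        then show False using False n by simp
      qed
      moreover have "multiplicity p k = multiplicity p n"
        unfolding j using p n j0 False
        by (subst prime_elem_multiplicity_mult_distrib) (auto simp: not_dvd_imp_multiplicity_0)
      then have "int (p ^ multiplicity p k) dvd int n"
        by (simp only: int_dvd_int_iff multiplicity_dvd)
      ultimately show ?thesis using True by (simp add: dver_def cong_0_iff)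
    qed
  next
    case False
    then have "\<not> n dvd k div p" using p by (metis dvd_mult_div_cancel dvd_mult)
    then show ?thesis using False by (simp add: dver_def)
  qed
qed

lemma dquot_dver:
  assumes S: "truncation_set S" and h: "dwork (S \<div> n) h" and n: "0 < n" and k: "n * k \<in> S"
  shows "[dquot (dver n h) (n * k) = dquot h k] (mod int k)"
proof -
  have k0: "0 < k" using truncation_set_pos[OF S k] by simp
  show ?thesis
    by (rule dquot_eqI[OF k0 is_dquot_ver[OF n k0 is_dquot[OF S dwork_dver[OF S h n] k]]
        is_dquot[OF truncation_set_quot[OF S] h trunc_quotI[OF S k]]])
qed

lemma dquot_dver_not_dvd:
  assumes S: "truncation_set S" and h: "dwork (S \<div> n) h" and n: "0 < n" and k: "k \<in> S" and d: "\<not> n dvd k"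
  shows "[dquot (dver n h) k = 0] (mod int k)"
  by (rule dquot_cong[OF S dwork_dver[OF S h n] k is_dquot_ver_not_dvd[OF d]])

lemma par_dquot_dver_not_dvd:
  assumes S: "truncation_set S" and h: "dwork (S \<div> n) h" and n: "0 < n" and k: "k \<in> S"
    and d: "\<And>j. 2 * j dvd k \<Longrightarrow> \<not> n dvd j"
  shows "even (par (dquot (dver n h)) k)"
proof -
  have "[par (dquot (dver n h)) k = par (\<lambda>k. 0) k] (mod 2)"
  proof (rule par_cong)
    fix j assume j: "even j" "2 * j dvd k"
    then have "[dquot (dver n h) j = 0] (mod int j)"
      using d j k by (intro dquot_dver_not_dvd[OF S h n]) (auto intro: truncation_set_dvd[OF S k] dvd_mult_right)
    with j show "[dquot (dver n h) j = 0] (mod 2)" by (intro cong_2_if_even)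
  qed
  then show ?thesis by (simp add: cong_0_iff)
qed

lemma par_dquot_dver_odd:
  assumes S: "truncation_set S" and h: "dwork (S \<div> n) h" and n: "0 < n" "odd n" and k: "n * k \<in> S"
  shows "[par (dquot (dver n h)) (n * k) = par (dquot h) k] (mod 2)"
proof -
  have "0 < k" using truncation_set_pos[OF S k] by simp
  then have "[par (\<lambda>k. dquot (dver n h) (n * k)) k = par (dquot h) k] (mod 2)"
    using truncation_set_dvd[OF S k] n by (intro par_dvd_cong dquot_dver[OF S h]) auto
  then show ?thesis using n by (simp add: par_odd)
qed

lemma par_dquot_dver_odd_index:
  assumes S: "truncation_set S" and h: "dwork (S \<div> n) h" and n: "0 < n" and k: "n * k \<in> S" "odd k"
  shows "even (par (dquot (dver n h)) (n * k))"
proof (rule par_dquot_dver_not_dvd[OF S h n k(1)])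
  fix j assume "2 * j dvd n * k"
  show "\<not> n dvd j"
  proof
    assume "n dvd j"
    then have "n * 2 dvd n * k" using \<open>2 * j dvd n * k\<close> by (metis dvd_trans mult.commute mult_dvd_mono dvd_refl)
    then show False using n k by simp
  qed
qed

text \<open>Follow the indices n k/2^r. As long as k/2^r is even, the coordinate of dV_n(h) there is
  that of dh at k/2^r, and these add up to the parity of dh. At the first odd k/2^r the coordinate
  is h(k/2^r), which has the parity of h(k). Afterwards n no longer divides the index.\<close>

lemma par_dquot_dver_even:
  assumes S: "truncation_set S" and h: "dwork (S \<div> n) h" and n: "0 < n" "even n" and k: "n * k \<in> S" "even k"
  shows "[par (dquot (dver n h)) (n * k) = h k + par (dquot h) k] (mod 2)"
  using k
proof (induction k rule: less_induct)
  case (less k)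
  have k0: "0 < k" using truncation_set_pos[OF S less.prems(1)] by simp
  let ?j = "k div 2"
  have j: "?j < k" "0 < ?j" "n * k div 2 = n * ?j" "4 dvd n * k" "2 * ?j = k"
    using k0 less.prems n mult_dvd_mono[of 2 n 2 k] by (auto simp: div_mult_swap)
  have jS: "n * ?j \<in> S" using truncation_set_div[OF S less.prems(1), of 2] j n by simp
  have hk: "[h k = h ?j] (mod 2)"
    using less.prems k0 by (intro dwork_parity[OF h] trunc_quotI[OF S])
  have r: "par (dquot (dver n h)) (n * k) = dquot (dver n h) (n * ?j) + par (dquot (dver n h)) (n * ?j)"
    using j k0 n by (simp add: par_rec)
  show ?case
  proof (cases "4 dvd k")
    case True
    then have e: "even ?j" using dvd_4_half by blast
    have "[dquot (dver n h) (n * ?j) + par (dquot (dver n h)) (n * ?j) = dquot h ?j + (h ?j + par (dquot h) ?j)] (mod 2)"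
      by (intro cong_add cong_2_if_even[OF e] dquot_dver[OF S h n(1) jS] less.IH j jS e)
    also have "dquot h ?j + (h ?j + par (dquot h) ?j) = h ?j + par (dquot h) k"
      using True k0 by (simp add: par_rec)
    also have "[h ?j + par (dquot h) k = h k + par (dquot h) k] (mod 2)"
      using hk by (intro cong_add cong_refl) (rule cong_sym)
    finally show ?thesis using r by simp
  next
    case False
    then have o: "odd ?j" using j by (metis dvd_mult_div_cancel mult_dvd_mono dvd_refl numeral_Bit0 mult_2 less.prems(2) numeral_times_numeral semiring_norm(12,13))
    have "[dquot (dver n h) (n * ?j) + par (dquot (dver n h)) (n * ?j) = h ?j + 0] (mod 2)"
      using par_dquot_dver_odd_index[OF S h n(1) jS o]
      by (intro cong_add is_dquot_ver_odd[OF n(2,1) o is_dquot[OF S dwork_dver[OF S h n(1)] jS]])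
        (simp add: cong_0_iff)
    also have "[h ?j + 0 = h k + par (dquot h) k] (mod 2)"
      using hk False by (simp add: par_eq_0 cong_sym)
    finally show ?thesis using r by simp
  qed
qed

text \<open>This is what the correction in \<open>dact\<close> is made for. At k = n j with n and j
  even, the parity of dV_n(h) is h(j) plus the parity of dh at j: the first summand matches the
  correction of F_n(w) under V_n, the second the correction of the action of h on F_n(w).\<close>

lemma dact_of_dver:
  assumes S: "truncation_set S" and h: "dwork (S \<div> n) h" and n: "0 < n" and k: "k \<in> S"
  shows "[dact (dver n h) w k = dver n (dact h (dfrob n w)) k] (mod int k)"
proof (cases "n dvd k")
  case False
  have "even (par (dquot (dver n h)) k)"
    using False by (intro par_dquot_dver_not_dvd[OF S h n k]) (metis dvd_mult dvd_trans)
  then have "[tw k (par (dquot (dver n h)) k * par w k) = 0] (mod int k)"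
    by (intro tw_even) simp
  then show ?thesis using False by (simp add: dact_def dver_def)
next
  case True
  then obtain j where j: "k = n * j" by blast
  have k0: "0 < k" using S k by (rule truncation_set_pos)
  have j0: "0 < j" using k0 j by simp
  have k': "n * j \<in> S" using k j by simp
  let ?q = "par (dquot (dver n h)) k" and ?d = "par (dquot h) j" and ?p = "par w k"
  have "[tw k (?q * ?p) = int n * (h j * (if even n then tw j ?p else 0)) +
     int n * tw j (?d * par (dfrob n w) j)] (mod int k)"
  proof (cases "even n")
    case False
    have "[?q * ?p = ?d * par (dfrob n w) j] (mod 2)"
      unfolding j using False n j0
      by (intro cong_mult par_dquot_dver_odd[OF S h n False k'] cong_sym[OF par_dfrob]) auto
    then have "[tw k (?q * ?p) = tw (n * j) (?d * par (dfrob n w) j)] (mod int k)"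
      unfolding j by (rule tw_cong)
    then show ?thesis using False by (simp add: tw_mult_odd)
  next
    case en: True
    show ?thesis
    proof (cases "even j")
      case True
      have "[?q * ?p = (h j + ?d) * ?p] (mod 2)"
        unfolding j using par_dquot_dver_even[OF S h n en k' True] by (rule cong_scalar_right)
      then have "[?q * ?p = h j * ?p + ?d * ?p] (mod 2)" by (simp add: distrib_right)
      also have "[h j * ?p + ?d * ?p = h j * ?p + ?d * par (dfrob n w) j] (mod 2)"
      proof (intro cong_add cong_refl)
        show "[?d * ?p = ?d * par (dfrob n w) j] (mod 2)"
          using par_dfrob[OF n j0, of w] by (cases "4 dvd j") (simp_all add: j par_eq_0 cong_scalar_left cong_sym)
      qed
      finally have "[tw k (?q * ?p) = tw (n * j) (h j * ?p + ?d * par (dfrob n w) j)] (mod int k)"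
        unfolding j by (rule tw_cong)
      then show ?thesis using en True
        by (simp only: tw_mult tw_mult_even[symmetric] tw_add if_True distrib_left)
    next
      case False
      then have "[tw k (?q * ?p) = 0] (mod int k)"
        unfolding j by (intro tw_even) (simp add: par_dquot_dver_odd_index[OF S h n k'])
      then show ?thesis using False by (simp add: tw_def[of j])
    qed
  qed
  then have "[int n * h j * w k + tw k (?q * ?p) = int n * h j * w k +
     (int n * (h j * (if even n then tw j ?p else 0)) + int n * tw j (?d * par (dfrob n w) j))] (mod int k)"
    by (intro cong_add cong_refl)
  moreover have "dver n (dact h (dfrob n w)) k = int n * h j * w k +
     (int n * (h j * (if even n then tw j ?p else 0)) + int n * tw j (?d * par (dfrob n w) j))"
    using n by (simp add: dver_def dact_def[of h] dfrob_def[of n w j] j algebra_simps)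
  moreover have "dver n h k = int n * h j" using n by (simp add: dver_def j)
  ultimately show ?thesis by (simp add: dact_def[of "dver n h"])
qed

text \<open>The coordinates of \<open>dlog [-1]\<close>.\<close>

definition dlog_coord :: "nat \<Rightarrow> int" where
  "dlog_coord k = tw k 1"

lemma odd_half: "even k \<Longrightarrow> \<not> 4 dvd (k :: nat) \<Longrightarrow> odd (k div 2)"
  by (metis dvd_mult_div_cancel mult_2 mult_dvd_mono dvd_refl numeral_Bit0 numeral_times_numeral semiring_norm(12,13))

text \<open>Among the even indices k/2, k/4, ... only the last has an odd half, so exactly one
  coordinate in the sum is odd.\<close>

lemma par_dlog_coord: "0 < k \<Longrightarrow> 4 dvd k \<Longrightarrow> [par dlog_coord k = 1] (mod 2)"
proof (induction k rule: less_induct)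
  case (less k)
  let ?j = "k div 2"
  have j: "?j < k" "0 < ?j" "even ?j" using less.prems dvd_4_half[of k] by auto
  show ?case
  proof (cases "4 dvd ?j")
    case True
    then have "[dlog_coord ?j + par dlog_coord ?j = 0 + 1] (mod 2)"
      using dvd_4_half[OF True] j
      by (intro cong_add less.IH) (auto simp: dlog_coord_def tw_def cong_0_iff)
    then show ?thesis using less.prems by (simp add: par_rec)
  next
    case False
    then have "odd (?j div 2)" using j odd_half by blast
    then have "[dlog_coord ?j + par dlog_coord ?j = 1 + 0] (mod 2)"
      using j False by (intro cong_add) (auto simp: dlog_coord_def tw_def par_eq_0 cong_iff_dvd_diff)
    then show ?thesis using less.prems by (simp add: par_rec)
  qed
qed

text \<open>For odd n the even factor n - 1 kills the term with dlog[-1]. For even n and k the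
  correction of the Frobenius is given by h(k) + par(dh). So is the product of h with dlog[-1]: the
  parity of dlog[-1] is odd if 4 divides k, and otherwise the parity of dh is 0.\<close>

lemma dfrob_dquot_dver:
  assumes S: "truncation_set S" and h: "dwork (S \<div> n) h" and n: "0 < n" and k: "n * k \<in> S"
  shows "[dfrob n (dquot (dver n h)) k = dquot h k + int (n - 1) * dact h dlog_coord k] (mod int k)"
proof (cases "even n")
  case False
  then have e: "even (int (n - 1))" using n by simp
  have "int (n - 1) * dact h dlog_coord k = tw k (int (n - 1) * (h k + par (dquot h) k * par dlog_coord k))"
    by (simp only: tw_mult[symmetric] tw_add) (simp add: dact_def dlog_coord_def tw_mult)
  also have "[tw k (int (n - 1) * (h k + par (dquot h) k * par dlog_coord k)) = 0] (mod int k)"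
    using e by (intro tw_even) simp
  finally have "[dquot h k + int (n - 1) * dact h dlog_coord k = dquot h k + 0] (mod int k)"
    by (intro cong_add cong_refl)
  with dquot_dver[OF S h n k] show ?thesis using False
    by (simp add: dfrob_def) (metis cong_sym cong_trans)
next
  case en: True
  have k0: "0 < k" using truncation_set_pos[OF S k] by simp
  have "[tw k (par (dquot (dver n h)) (n * k)) = int (n - 1) * dact h dlog_coord k] (mod int k)"
  proof (cases "even k")
    case True
    have "[par (dquot (dver n h)) (n * k) = h k + par (dquot h) k] (mod 2)"
      by (rule par_dquot_dver_even[OF S h n en k True])
    also have "[h k + par (dquot h) k = h k + par (dquot h) k * par dlog_coord k] (mod 2)"
    proof (intro cong_add cong_refl)
      show "[par (dquot h) k = par (dquot h) k * par dlog_coord k] (mod 2)"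
        using cong_scalar_left[OF par_dlog_coord[OF k0], of "par (dquot h) k"]
        by (cases "4 dvd k") (simp_all add: par_eq_0 cong_sym)
    qed
    also have "[h k + par (dquot h) k * par dlog_coord k =
        int (n - 1) * (h k + par (dquot h) k * par dlog_coord k)] (mod 2)"
      using en n by (simp add: cong_iff_dvd_diff)
    finally have "[tw k (par (dquot (dver n h)) (n * k)) =
       tw k (int (n - 1) * (h k + par (dquot h) k * par dlog_coord k))] (mod int k)"
      by (rule tw_cong)
    also have "tw k (int (n - 1) * (h k + par (dquot h) k * par dlog_coord k)) = int (n - 1) * dact h dlog_coord k"
      by (simp only: tw_mult[symmetric] tw_add) (simp add: dact_def dlog_coord_def tw_mult)
    finally show ?thesis .
  qed (simp add: tw_def dact_def dlog_coord_def)
  from cong_add[OF dquot_dver[OF S h n k] this] show ?thesis using en by (simp add: dfrob_def)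
qed

section \<open>Teichmueller families: the class dlog[-1] and axiom (v)\<close>

lemma truncation_set_all: "truncation_set {0<..}"
  by (auto simp: truncation_set_def intro: Nat.gr0I)

text \<open>An odd prime p does not change the sign between k and k/p. At 2 the sign changes only
  for k = 2j with j odd; there the numerator is 2, and k (k/2) = 2 j^2 is congruent to 2 modulo
  4.\<close>

lemma dquot_minus_one:
  assumes k: "0 < k"
  shows "[dquot (\<lambda>k. (-1) ^ k) k = (if 4 dvd k then 0 else tw k 1)] (mod int k)"
proof (rule dquot_cong[OF truncation_set_all dwork_power])
  show "k \<in> {0<..}" using k by simp
  show "is_dquot (\<lambda>k. (-1) ^ k) k (if 4 dvd k then 0 else tw k 1)"
    unfolding is_dquot_def
  proof (intro allI impI)
    fix p assume p: "prime p" "p dvd k"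
    let ?m = "int (p ^ (multiplicity p k + multiplicity p k))"
    show "[int k * (if 4 dvd k then 0 else tw k 1) = (-1) ^ k - (-1) ^ (k div p)] (mod ?m)"
    proof (cases "p = 2")
      case True
      show ?thesis
      proof (cases "4 dvd k")
        case True
        then show ?thesis using dvd_4_half[of k] \<open>p = 2\<close> by simp
      next
        case False
        then have o: "odd (k div 2)" using odd_half p True by blast
        obtain j where j: "k = 2 * j" using p True by blast
        have oj: "odd j" using o j by simp
        have "multiplicity 2 k = 1"
          unfolding j using oj k j
          by (subst prime_elem_multiplicity_mult_distrib) (auto simp: not_dvd_imp_multiplicity_0)
        moreover have "[2 * int j * int j = 2] (mod 4)"
        proof -
          obtain i where "j = 2 * i + 1" using oj by (rule oddE)
          then have "2 * int j * int j - 2 = 4 * (2 * int i * int i + 2 * int i)" by (simp add: algebra_simps)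
          then show ?thesis by (simp add: cong_iff_dvd_diff)
        qed
        ultimately show ?thesis using False o True oj by (simp add: j tw_def)
      qed
    next
      case False
      then have "odd p" using p prime_odd_nat prime_ge_2_nat[OF p(1)] by force
      then have "even k \<longleftrightarrow> even (k div p)" using p(2) by (metis dvd_mult_div_cancel even_mult_iff)
      then have r: "(-1 :: int) ^ k - (-1) ^ (k div p) = 0" by (simp add: minus_one_power_iff)
      have "?m dvd int k * (if 4 dvd k then 0 else tw k 1)"
      proof (cases "even k")
        case True
        have "multiplicity p k = multiplicity p (k div 2)"
        proof -
          have "k = 2 * (k div 2)" "0 < k div 2" using True k by auto
          then have "multiplicity p k = multiplicity p 2 + multiplicity p (k div 2)"
            using p(1) by (metis prime_elem_multiplicity_mult_distrib neq0_conv prime_imp_prime_elem zero_neq_numeral)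
          moreover have "\<not> p dvd 2" using p(1) False primes_dvd_imp_eq two_is_prime_nat by blast
          ultimately show ?thesis by (simp add: not_dvd_imp_multiplicity_0)
        qed
        then have "int (p ^ multiplicity p k) dvd int (k div 2)"
          by (metis int_dvd_int_iff multiplicity_dvd)
        moreover have "int (p ^ multiplicity p k) dvd int k"
          by (simp only: int_dvd_int_iff multiplicity_dvd)
        ultimately show ?thesis using True by (simp add: tw_def power_add mult_dvd_mono)
      qed (simp add: tw_def)
      then show ?thesis using r by (simp add: cong_0_iff)
    qed
  qed
qed

lemma par_dquot_minus_one: "0 < k \<Longrightarrow> 4 dvd k \<Longrightarrow> [par (dquot (\<lambda>k. (-1) ^ k)) k = 1] (mod 2)"
proof (induction k rule: less_induct)
  case (less k)
  let ?j = "k div 2" and ?f = "dquot (\<lambda>k. (-1) ^ k)"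
  have j: "?j < k" "0 < ?j" "even ?j" using less.prems dvd_4_half[of k] by auto
  have d: "[?f ?j = (if 4 dvd ?j then 0 else tw ?j 1)] (mod 2)"
    using dquot_minus_one[OF j(2)] j(3) by (intro cong_2_if_even)
  show ?case
  proof (cases "4 dvd ?j")
    case True
    then have "[?f ?j + par ?f ?j = 0 + 1] (mod 2)"
      using d j by (intro cong_add less.IH) simp_all
    then show ?thesis using less.prems by (simp add: par_rec)
  next
    case False
    then have "odd (?j div 2)" using j odd_half by blast
    then have "[tw ?j 1 = 1] (mod 2)" using j by (simp add: tw_def cong_iff_dvd_diff)
    then have "[?f ?j + par ?f ?j = 1 + 0] (mod 2)"
      using d False by (intro cong_add) (auto simp: par_eq_0 intro: cong_trans)
    then show ?thesis using less.prems by (simp add: par_rec)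
  qed
qed

text \<open>By itself d[-1] has the coordinate k/2 only for k \<equiv> 2 modulo 4. At the multiples
  of 4 the parity of d[-1] is odd, so the correction in the product [-1] d[-1] supplies the missing
  k/2.\<close>

lemma dact_minus_one:
  assumes k: "0 < k"
  shows "[dact (\<lambda>k. (-1) ^ k) (dquot (\<lambda>k. (-1) ^ k)) k = dlog_coord k] (mod int k)"
proof -
  let ?f = "dquot (\<lambda>k. (-1) ^ k)"
  have "[(-1) ^ k * ?f k + tw k (par ?f k * par ?f k) = (-1) ^ k * (if 4 dvd k then 0 else tw k 1) +
     (if 4 dvd k then tw k (1 * 1) else 0)] (mod int k)"
    using cong_mult[OF par_dquot_minus_one[OF k] par_dquot_minus_one[OF k]]
    by (intro cong_add cong_scalar_left dquot_minus_one k) (auto intro: tw_cong simp: par_eq_0)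
  moreover have "(-1) ^ k * (if 4 dvd k then 0 else tw k 1) + (if 4 dvd k then tw k (1 * 1) else 0) = dlog_coord k"
    by (simp add: dlog_coord_def tw_def)
  ultimately show ?thesis by (simp add: dact_def)
qed


text \<open>The terms of order 2 to q - 1 have a binomial coefficient divisible by q and contain
  z^2. The term z^q lacks such a coefficient, but v q \<ge> 3 v, and the excess v over 2 v is at
  least the multiplicity of p in q, which is at most 1. Here q \<ge> 3 is essential, and the prime 2
  is treated apart.\<close>

lemma dvd_binomial_remainder:
  fixes s z :: int
  assumes q: "prime q" "odd q" and p: "prime p" and v: "0 < v" and z: "int (p ^ v) dvd z"
  shows "int (p ^ (2 * v + multiplicity p q)) dvd (s + z) ^ q - s ^ q - int q * s ^ (q - 1) * z"
proof -
  have q2: "2 < q" using q by (metis even_numeral le_neq_implies_less prime_ge_2_nat)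
  have "(s + z) ^ q = (\<Sum>i\<le>q. int (q choose i) * z ^ i * s ^ (q - i))"
    using binomial_ring[of z s q] by (simp add: add.commute)
  also have "{..q} = insert 0 (insert 1 {2..q})" using q2 by auto
  also have "(\<Sum>i\<in>insert 0 (insert 1 {2..q}). int (q choose i) * z ^ i * s ^ (q - i)) =
    s ^ q + (int q * s ^ (q - 1) * z + (\<Sum>i=2..q. int (q choose i) * z ^ i * s ^ (q - i)))"
    by (simp add: mult_ac)
  finally have "(s + z) ^ q - s ^ q - int q * s ^ (q - 1) * z = (\<Sum>i=2..q. int (q choose i) * z ^ i * s ^ (q - i))"
    by simp
  also have "int (p ^ (2 * v + multiplicity p q)) dvd (\<Sum>i=2..q. int (q choose i) * z ^ i * s ^ (q - i))"
  proof (rule dvd_sum)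
    fix i assume i: "i \<in> {2..q}"
    have pz: "int p ^ (v * j) dvd z ^ j" for j
      using dvd_power_same[OF z, of j] by (simp add: power_mult)
    have "int p ^ (2 * v + multiplicity p q) dvd int (q choose i) * z ^ i"
    proof (cases "i = q")
      case True
      have "multiplicity p q \<le> 1" using p q by (cases "p = q") (simp_all add: prime_multiplicity_other multiplicity_prime)
      then have "2 * v + multiplicity p q \<le> v * 3" using v by simp
      also have "\<dots> \<le> v * q" using q2 by (intro mult_le_mono) auto
      finally show ?thesis using True pz[of q] by (simp add: dvd_trans[OF le_imp_power_dvd])
    next
      case False
      then have "q dvd q choose i" using i q q2 by (intro dvd_choose_prime) auto
      then have "p ^ multiplicity p q dvd q choose i" using multiplicity_dvd dvd_trans by blast
      then have "int (p ^ multiplicity p q) dvd int (q choose i)" by (simp only: int_dvd_int_iff)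
      moreover have "int p ^ (v * 2) dvd z ^ i"
        using i by (intro dvd_trans[OF le_imp_power_dvd pz]) auto
      ultimately have "int (p ^ multiplicity p q) * int p ^ (v * 2) dvd int (q choose i) * z ^ i"
        by (rule mult_dvd_mono)
      then show ?thesis by (simp add: power_add mult.commute)
    qed
    then show "int (p ^ (2 * v + multiplicity p q)) dvd int (q choose i) * z ^ i * s ^ (q - i)"
      by simp
  qed
  finally show ?thesis .
qed

lemma dwork_power_power: "dwork {0<..} (\<lambda>k. (a ^ k) ^ m)"
  using dwork_power[of "a ^ m"] by (simp add: mult.commute flip: power_mult)

lemma par_dquot_power_even:
  assumes "even m" "0 < k"
  shows "even (par (dquot (\<lambda>k. (a ^ k) ^ m)) k)"
proof -
  obtain i where m: "m = i + i" using assms by (metis evenE mult_2)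
  have "[par (dquot (\<lambda>k. (a ^ k) ^ i * (a ^ k) ^ i)) k =
    (a ^ k) ^ i * par (dquot (\<lambda>k. (a ^ k) ^ i)) k + (a ^ k) ^ i * par (dquot (\<lambda>k. (a ^ k) ^ i)) k] (mod 2)"
    using assms by (intro par_dquot_mult[OF truncation_set_all] dwork_power_power) auto
  then have "even (par (dquot (\<lambda>k. (a ^ k) ^ i * (a ^ k) ^ i)) k)"
    by (auto simp: cong_iff_dvd_diff)
  then show ?thesis by (simp add: m power_add)
qed

text \<open>With s = a^(k/p) and a^k = s + z, the numerator at q k is (s + z)^q - s^q, to first
  order q s^(q-1) z, while z is the numerator at k. Division by q k gives the claim with s^(q-1),
  and s is congruent to a^k modulo p^v.\<close>

lemma dquot_power_frob_prime:
  fixes a :: int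
  assumes q: "prime q" and p: "prime p" and pq: "odd q \<or> odd p" and k: "0 < k" "p dvd k"
  shows "[dquot (\<lambda>k. a ^ k) (q * k) = (a ^ k) ^ (q - 1) * dquot (\<lambda>k. a ^ k) k] (mod int (p ^ multiplicity p k))"
proof -
  let ?v = "multiplicity p k" and ?x = "dquot (\<lambda>k. a ^ k) (q * k)" and ?y = "dquot (\<lambda>k. a ^ k) k"
  define s where "s = a ^ (k div p)"
  define z where "z = s ^ p - s"
  have q0: "0 < q" using q by (rule prime_gt_0_nat)
  have ak: "a ^ k = s ^ p" using k by (simp add: s_def flip: power_mult)
  have v0: "0 < ?v" using k p by (metis multiplicity_gt_zero_iff neq0_conv not_prime_unit)
  have mqk: "multiplicity p (q * k) = multiplicity p q + ?v"
    using q0 k p by (intro prime_elem_multiplicity_mult_distrib) auto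
  have sz: "[s ^ p = s] (mod int (p ^ ?v))"
    using dworkD[OF dwork_power _ p k(2), of a] k ak by (simp add: s_def)
  then have z: "int (p ^ ?v) dvd z" by (simp add: z_def cong_iff_dvd_diff)
  have "a ^ (q * k) = (a ^ k) ^ q" by (simp add: mult.commute flip: power_mult)
  then have "a ^ (q * k) = (s + z) ^ q" by (simp add: ak z_def)
  moreover have "a ^ (q * k div p) = s ^ q"
    using k by (simp add: s_def div_mult_swap mult.commute flip: power_mult)
  ultimately have "[int (q * k) * ?x = (s + z) ^ q - s ^ q] (mod int (p ^ (multiplicity p (q * k) + multiplicity p (q * k))))"
    using is_dquotD[OF is_dquot[OF truncation_set_all dwork_power] p, of "q * k" a] q0 k by simp
  then have hx: "[int (q * k) * ?x = (s + z) ^ q - s ^ q] (mod int (p ^ (multiplicity p (q * k) + ?v)))"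
    by (rule cong_dvd_modulus) (simp add: mqk power_add)
  have hy: "[int k * ?y = z] (mod int (p ^ (?v + ?v)))"
    using is_dquotD[OF is_dquot[OF truncation_set_all dwork_power] p, of k a] k ak by (simp add: s_def z_def)
  have "int (p ^ (multiplicity p (q * k) + ?v)) dvd (s + z) ^ q - s ^ q - int q * s ^ (q - 1) * z"
  proof (cases "odd q")
    case True
    show ?thesis using dvd_binomial_remainder[OF q True p v0 z, of s] by (simp add: mqk mult_2 add_ac)
  next
    case False
    then have q2: "q = 2" using q prime_odd_nat prime_ge_2_nat[OF q] by force
    then have "multiplicity p q = 0" using pq p by (auto intro: prime_multiplicity_other)
    moreover have "(s + z) ^ q - s ^ q - int q * s ^ (q - 1) * z = z * z"
      by (simp add: q2 power2_eq_square algebra_simps)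
    ultimately show ?thesis using mult_dvd_mono[OF z z] by (simp add: mqk power_add)
  qed
  then have 1: "[(s + z) ^ q - s ^ q = int q * s ^ (q - 1) * z] (mod int (p ^ (multiplicity p (q * k) + ?v)))"
    by (simp add: cong_iff_dvd_diff)
  have "int (p ^ multiplicity p q) dvd int q" by (simp only: int_dvd_int_iff multiplicity_dvd)
  then have "int (p ^ multiplicity p q) * int (p ^ (?v + ?v)) dvd int q * (z - int k * ?y)"
    using hy by (intro mult_dvd_mono) (simp_all add: cong_iff_dvd_diff dvd_diff_commute)
  then have "[int q * z = int q * (int k * ?y)] (mod int (p ^ (multiplicity p (q * k) + ?v)))"
    unfolding mqk by (simp add: cong_iff_dvd_diff power_add right_diff_distrib mult_ac)
  from cong_trans[OF hx cong_trans[OF 1]] cong_scalar_left[OF this, of "s ^ (q - 1)"]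
  have "[int (q * k) * ?x = int (q * k) * (s ^ (q - 1) * ?y)] (mod int (p ^ (multiplicity p (q * k) + ?v)))"
    by (simp add: mult_ac)
  moreover have "0 < q * k" using q0 k by simp
  ultimately have "[?x = s ^ (q - 1) * ?y] (mod int (p ^ ?v))"
    using cong_cancel_multiplicity[OF p] by blast
  also have "[s ^ (q - 1) * ?y = (s ^ p) ^ (q - 1) * ?y] (mod int (p ^ ?v))"
    using sz by (intro cong_scalar_right cong_pow) (rule cong_sym)
  finally show ?thesis by (simp add: ak)
qed

text \<open>For p = q = 2 the remainder z^2 is divisible by 2^(2v), one factor 2 short of what
  division by 2k requires. Up to sufficiently divisible terms it is k^2 y^2, where y is the quotient
  at k. Since y (y + 1) is even, adding k^2 y = 2k (k/2) y repairs this, and after division by 2k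
  the added term is \<open>tw k y\<close>.\<close>

lemma dquot_power_frob_two:
  fixes a :: int
  assumes k: "0 < k"
  shows "[dquot (\<lambda>k. a ^ k) (2 * k) + tw k (dquot (\<lambda>k. a ^ k) k) = a ^ k * dquot (\<lambda>k. a ^ k) k] (mod int k)"
proof (rule cong_all_prime_powers[OF k])
  fix p assume p: "prime p" "p dvd k"
  let ?v = "multiplicity p k" and ?x = "dquot (\<lambda>k. a ^ k) (2 * k)" and ?y = "dquot (\<lambda>k. a ^ k) k"
  show "[?x + tw k ?y = a ^ k * ?y] (mod int (p ^ ?v))"
  proof (cases "p = 2")
    case False
    then have o: "odd p" using p prime_odd_nat prime_ge_2_nat[OF p(1)] by force
    have "multiplicity p 2 = 0" using p False by (intro prime_multiplicity_other) auto
    moreover have "2 * tw k ?y = (if even k then int k * ?y else 0)"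
      by (auto simp: tw_def elim!: evenE)
    moreover have "int (p ^ ?v) dvd int k" by (simp only: int_dvd_int_iff multiplicity_dvd)
    ultimately have "[int 2 * tw k ?y = int 2 * 0] (mod int (p ^ (multiplicity p 2 + ?v)))"
      by (auto simp: cong_0_iff)
    then have "[tw k ?y = 0] (mod int (p ^ ?v))"
      by (rule cong_cancel_multiplicity[OF p(1) zero_less_numeral])
    from cong_add[OF dquot_power_frob_prime[OF two_is_prime_nat p(1) disjI2[OF o] k p(2)] this]
    show ?thesis by simp
  next
    case True
    have e: "even k" using p True by simp
    define s where "s = a ^ (k div 2)"
    define z where "z = s ^ 2 - s"
    have ak: "a ^ k = s + z" "a ^ k = s ^ 2" using e by (simp_all add: s_def z_def flip: power_mult)
    have v0: "0 < ?v" using k p True by (simp add: multiplicity_gt_zero_iff)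
    have m2: "multiplicity p (2 * k) = Suc ?v"
      unfolding True using k by (subst prime_elem_multiplicity_mult_distrib) auto
    have "[a ^ k = s] (mod int (p ^ ?v))"
      using dworkD[OF dwork_power _ p, of a] k by (simp add: s_def True)
    then have z: "int (p ^ ?v) dvd z" by (simp add: ak(1) cong_iff_dvd_diff)
    have "2 * k div 2 = k" by simp
    have "a ^ (2 * k) = (s + z) ^ 2" unfolding ak(1)[symmetric] by (simp add: mult.commute flip: power_mult)
    then have "[int (2 * k) * ?x = (s + z) ^ 2 - (s ^ 2)] (mod int (p ^ (multiplicity p (2 * k) + multiplicity p (2 * k))))"
      using is_dquotD[OF is_dquot[OF truncation_set_all dwork_power] p(1), of "2 * k" a] True k ak(2) by simp
    then have hx: "[int (2 * k) * ?x = (s + z) ^ 2 - s ^ 2] (mod int (p ^ (Suc ?v + ?v)))"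
      by (rule cong_dvd_modulus) (simp add: m2 power_add)
    have hy: "[int k * ?y = z] (mod int (p ^ (?v + ?v)))"
      using is_dquotD[OF is_dquot[OF truncation_set_all dwork_power] p, of a] k ak True by (simp add: s_def)
    have "int (p ^ (?v + ?v)) dvd z - int k * ?y"
      using cong_sym[OF hy] by (simp only: cong_iff_dvd_diff)
    then obtain t where "z - int k * ?y = int (p ^ (?v + ?v)) * t" by (rule dvdE)
    then have t: "z = int k * ?y + 2 ^ (?v + ?v) * t" by (simp add: True)
    obtain i where i: "int k = 2 ^ ?v * i"
    proof -
      obtain i where "k = p ^ ?v * i" using multiplicity_dvd by (rule dvdE)
      then have "int k = int (p ^ ?v * i)" by simp
      then show ?thesis by (intro that[of "int i"]) (simp add: True)
    qed
    have "even (?y * (?y + 1))" by simp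
    then obtain j where j: "?y * (?y + 1) = 2 * j" by (rule evenE)
    obtain u where v: "?v = Suc u" using v0 by (cases ?v) auto
    have "(s + z) ^ 2 - s ^ 2 + int k * (int k * ?y) - int (2 * k) * (s * ?y) =
        2 * s * (z - int k * ?y) + (z - int k * ?y) * (z + int k * ?y) + int k * int k * (?y * (?y + 1))"
      by (simp add: power2_eq_square algebra_simps)
    also have "\<dots> = 2 * s * (2 ^ (?v + ?v) * t) + 2 ^ (?v + ?v) * t * (2 ^ (?v + ?v) * t + 2 * (2 ^ ?v * i * ?y))
       + (2 ^ ?v * i) * (2 ^ ?v * i) * (2 * j)"
      unfolding j by (simp add: t i algebra_simps)
    also have "\<dots> = 2 ^ (Suc ?v + ?v) * (s * t + t * (2 ^ (u + ?v) * t + 2 ^ ?v * i * ?y) + i * i * j)"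
      by (simp add: v power_add algebra_simps)
    finally have "[(s + z) ^ 2 - s ^ 2 + int k * (int k * ?y) = int (2 * k) * (s * ?y)] (mod int (p ^ (Suc ?v + ?v)))"
      by (simp add: True cong_iff_dvd_diff)
    then have "[int (2 * k) * ?x + int k * (int k * ?y) = int (2 * k) * (s * ?y)] (mod int (p ^ (Suc ?v + ?v)))"
      using cong_trans[OF cong_add[OF hx cong_refl]] by blast
    moreover have "int k * (int k * ?y) = int (2 * k) * tw k ?y"
      using e by (auto simp: tw_def elim!: evenE)
    ultimately have "[int (2 * k) * (?x + tw k ?y) = int (2 * k) * (s * ?y)] (mod int (p ^ (multiplicity p (2 * k) + ?v)))"
      by (simp add: m2 distrib_left)
    moreover have "0 < 2 * k" using k by simp
    ultimately have "[?x + tw k ?y = s * ?y] (mod int (p ^ ?v))"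
      using cong_cancel_multiplicity[OF p(1)] by blast
    also have "[s * ?y = a ^ k * ?y] (mod int (p ^ ?v))"
      using \<open>[a ^ k = s] (mod int (p ^ ?v))\<close> by (intro cong_scalar_right) (rule cong_sym)
    finally show ?thesis .
  qed
qed

text \<open>For q = 2 and even k, the parity of d[a] at 2k is the coordinate at k plus the parity at
  k. The first summand is the correction found in \<open>dquot_power_frob_two\<close>; the second is
  the correction of the action, because a parity is congruent to its own square.\<close>

lemma dfrob_dquot_power_prime:
  fixes a :: int
  assumes q: "prime q" and k: "0 < k"
  shows "[dfrob q (dquot (\<lambda>k. a ^ k)) k = dact (\<lambda>k. (a ^ k) ^ (q - 1)) (dquot (\<lambda>k. a ^ k)) k] (mod int k)"
proof (cases "q = 2")
  case False
  then have o: "odd q" using q prime_odd_nat prime_ge_2_nat[OF q] by force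
  let ?y = "dquot (\<lambda>k. a ^ k)"
  have "[?y (q * k) = (a ^ k) ^ (q - 1) * ?y k] (mod int k)"
    by (rule cong_all_prime_powers[OF k]) (intro dquot_power_frob_prime q disjI1 o k)
  moreover have "[0 = tw k (par (dquot (\<lambda>k. (a ^ k) ^ (q - 1))) k * par ?y k)] (mod int k)"
    using o k by (intro cong_sym[OF tw_even]) (simp add: par_dquot_power_even)
  ultimately have "[?y (q * k) + 0 = dact (\<lambda>k. (a ^ k) ^ (q - 1)) ?y k] (mod int k)"
    unfolding dact_def by (rule cong_add)
  then show ?thesis using o by (simp add: dfrob_def)
next
  case True
  let ?y = "dquot (\<lambda>k. a ^ k)"
  have "[?y (2 * k) + tw k (?y k) + tw k (par ?y k) = a ^ k * ?y k + tw k (par ?y k * par ?y k)] (mod int k)"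
    by (intro cong_add dquot_power_frob_two k tw_cong) (simp add: cong_iff_dvd_diff)
  moreover have "dfrob 2 ?y k = ?y (2 * k) + tw k (?y k) + tw k (par ?y k)"
  proof (cases "even k")
    case True
    then have "4 dvd 2 * k" using mult_dvd_mono[of 2 2 2 k] by simp
    then show ?thesis using k True by (simp add: dfrob_def par_rec tw_add)
  qed (simp add: dfrob_def tw_def)
  ultimately show ?thesis by (simp add: True dact_def)
qed

text \<open>Induction over the prime factors of n by F_(qm) = F_q F_m; the exponents combine as q (m
  - 1) + (q - 1) = q m - 1.\<close>

lemma dfrob_dquot_power:
  fixes a :: int
  assumes "0 < n" "0 < k"
  shows "[dfrob n (dquot (\<lambda>k. a ^ k)) k = dact (\<lambda>k. (a ^ k) ^ (n - 1)) (dquot (\<lambda>k. a ^ k)) k] (mod int k)"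
  using assms
proof (induction n arbitrary: k rule: prime_divisors_induct)
  case (unit n)
  then show ?case
    using dact_one[OF truncation_set_all, of k "dquot (\<lambda>k. a ^ k)"] by (simp add: dfrob_def cong_sym)
next
  case (factor q m)
  let ?y = "dquot (\<lambda>k. a ^ k)"
  have m0: "0 < m" and q0: "0 < q" using factor prime_gt_0_nat by auto
  have "[dfrob (q * m) ?y k = dfrob q (dfrob m ?y) k] (mod int k)"
    by (intro cong_sym[OF dfrob_dfrob] q0 m0 factor)
  also have "[dfrob q (dfrob m ?y) k = dfrob q (dact (\<lambda>k. (a ^ k) ^ (m - 1)) ?y) k] (mod int k)"
    using factor m0 q0 by (intro dfrob_cong) auto
  also have "[dfrob q (dact (\<lambda>k. (a ^ k) ^ (m - 1)) ?y) k =
      dact (\<lambda>k. (a ^ (q * k)) ^ (m - 1)) (dfrob q ?y) k] (mod int k)"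
    using factor q0 by (intro dfrob_dact[OF truncation_set_all] dwork_power_power) auto
  also have "[dact (\<lambda>k. (a ^ (q * k)) ^ (m - 1)) (dfrob q ?y) k =
      dact (\<lambda>k. (a ^ (q * k)) ^ (m - 1)) (dact (\<lambda>k. (a ^ k) ^ (q - 1)) ?y) k] (mod int k)"
    using factor by (intro dact_cong dfrob_dquot_power_prime) auto
  also have "[dact (\<lambda>k. (a ^ (q * k)) ^ (m - 1)) (dact (\<lambda>k. (a ^ k) ^ (q - 1)) ?y) k =
      dact (\<lambda>k. (a ^ (q * k)) ^ (m - 1) * (a ^ k) ^ (q - 1)) ?y k] (mod int k)"
    using factor dwork_power_power[of "a ^ q" "m - 1"]
    by (intro cong_sym[OF dact_mult[OF truncation_set_all]] dwork_power_power) (auto simp flip: power_mult)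
  also have "(\<lambda>k. (a ^ (q * k)) ^ (m - 1) * (a ^ k) ^ (q - 1)) = (\<lambda>k. (a ^ k) ^ (q * m - 1))"
  proof
    fix k
    have "q * k * (m - 1) + k * (q - 1) = k * (q * m - 1)"
      using m0 q0 by (cases m; cases q) (simp_all add: algebra_simps)
    then show "(a ^ (q * k)) ^ (m - 1) * (a ^ k) ^ (q - 1) = (a ^ k) ^ (q * m - 1)"
      by (simp flip: power_mult power_add)
  qed
  finally show ?case .
qed simp

section \<open>Graded rings concentrated in degrees 0 and 1\<close>

text \<open>Both the explicit complex and the subcomplex below live in degrees 0 and 1, and products
  of two elements of degree 1 are 0 in them. The graded ring axioms then reduce to commutativity
  with degree 0 and a direct sum of two subgroups.\<close>

lemma anticomm_graded_ring_two_step: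
  fixes R (structure)
  assumes R: "ring R"
    and sub: "subgroup (G 0) (add_monoid R)" "subgroup (G 1) (add_monoid R)"
    and G2: "\<And>q. 2 \<le> q \<Longrightarrow> G q = {\<zero>}"
    and decomp: "\<And>x. x \<in> carrier R \<Longrightarrow> \<exists>a\<in>G 0. \<exists>b\<in>G 1. x = a \<oplus> b"
    and disj: "G 0 \<inter> G 1 \<subseteq> {\<zero>}"
    and one: "\<one> \<in> G 0"
    and m00: "\<And>x y. x \<in> G 0 \<Longrightarrow> y \<in> G 0 \<Longrightarrow> x \<otimes> y \<in> G 0"
    and m01: "\<And>x y. x \<in> G 0 \<Longrightarrow> y \<in> G 1 \<Longrightarrow> x \<otimes> y \<in> G 1"
    and m11: "\<And>x y. x \<in> G 1 \<Longrightarrow> y \<in> G 1 \<Longrightarrow> x \<otimes> y = \<zero>"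
    and comm0: "\<And>x y. x \<in> G 0 \<Longrightarrow> y \<in> G 0 \<Longrightarrow> x \<otimes> y = y \<otimes> x"
    and comm1: "\<And>x y. x \<in> G 0 \<Longrightarrow> y \<in> G 1 \<Longrightarrow> x \<otimes> y = y \<otimes> x"
  shows "anticomm_graded_ring R G"
proof -
  interpret ring R by fact
  have G: "G q \<subseteq> carrier R" for q
  proof -
    consider "q = 0" | "q = 1" | "2 \<le> q" by linarith
    then show ?thesis using subgroup.subset[OF sub(1)] subgroup.subset[OF sub(2)] G2 by cases auto
  qed
  have zero: "\<zero> \<in> G 0" "\<zero> \<in> G 1"
    using subgroup.one_closed[OF sub(1)] subgroup.one_closed[OF sub(2)] by simp_all
  have q_cases: "(q = 0 \<Longrightarrow> P) \<Longrightarrow> (q = 1 \<Longrightarrow> P) \<Longrightarrow> (2 \<le> q \<Longrightarrow> P) \<Longrightarrow> P" for q :: nat and P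
    by linarith
  have sum2: "(\<Oplus>q\<in>{q. c q \<noteq> \<zero>}. c q) = c 0 \<oplus> c 1" if c: "\<forall>q. c q \<in> G q" for c
  proof -
    have c': "c q \<in> carrier R" for q using c G by blast
    have "c q = \<zero>" if "2 \<le> q" for q using c G2[OF that] by blast
    then have "{q. c q \<noteq> \<zero>} \<subseteq> {q. \<not> 2 \<le> q}" by blast
    also have "{q :: nat. \<not> 2 \<le> q} = {0, 1}" by auto
    finally have "{q. c q \<noteq> \<zero>} \<subseteq> {0, 1}" .
    then have "(\<Oplus>q\<in>{q. c q \<noteq> \<zero>}. c q) = (\<Oplus>q\<in>{0, 1}. c q)"
      using c' by (intro add.finprod_mono_neutral_cong_left) auto
    then show ?thesis using c' by simp
  qed
  have fin2: "finite {q. c q \<noteq> \<zero>}" if c: "\<forall>q. c q \<in> G q" for c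
  proof -
    have "c q = \<zero>" if "2 \<le> q" for q using c G2[OF that] by blast
    then have "{q. c q \<noteq> \<zero>} \<subseteq> {q. \<not> 2 \<le> q}" by blast
    also have "{q :: nat. \<not> 2 \<le> q} = {0, 1}" by auto
    finally have "{q. c q \<noteq> \<zero>} \<subseteq> {0, 1}" .
    then show ?thesis by (rule finite_subset) simp
  qed
  show ?thesis
  proof (intro anticomm_graded_ring.intro anticomm_graded_ring_axioms.intro R)
    show "subgroup (G q) (add_monoid R)" for q
    proof (rule q_cases[of q])
      assume "2 \<le> q"
      then show ?thesis using G2 add.triv_subgroup by simp
    qed (use sub in simp_all)
    show "\<one> \<in> G 0" by fact
    show "x \<otimes> y \<in> G (p + q)" if "x \<in> G p" "y \<in> G q" for x y p q
    proof -
      have x: "x \<in> carrier R" and y: "y \<in> carrier R" using that G by auto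
      consider "p = 0 \<and> q = 0" | "p = 0 \<and> q = 1" | "p = 1 \<and> q = 0" | "p = 1 \<and> q = 1" | "2 \<le> p" | "2 \<le> q"
        by linarith
      then show ?thesis
      proof cases
        case 3
        then have "x \<in> G 1" "y \<in> G 0" using that by simp_all
        then have "y \<otimes> x \<in> G 1" "y \<otimes> x = x \<otimes> y" by (rule m01[rotated], rule comm1[rotated])
        then show ?thesis using 3 by simp
      next
        case 4
        then show ?thesis using that m11[of x y] G2[of "p + q"] by simp
      next
        case 5
        then show ?thesis using that y G2[of p] G2[of "p + q"] by simp
      next
        case 6
        then show ?thesis using that x G2[of q] G2[of "p + q"] by simp
      qed (use that m00 m01 in simp_all)
    qed
    show "\<exists>!c. (\<forall>q. c q \<in> G q) \<and> finite {q. c q \<noteq> \<zero>} \<and> x = (\<Oplus>q\<in>{q. c q \<noteq> \<zero>}. c q)"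
      if xR: "x \<in> carrier R" for x
    proof -
      obtain a b where ab: "a \<in> G 0" "b \<in> G 1" "x = a \<oplus> b" using decomp[OF xR] by blast
      have abc: "a \<in> carrier R" "b \<in> carrier R" using ab G by auto
      define c where "c = (\<lambda>q :: nat. if q = 0 then a else if q = 1 then b else \<zero>)"
      have c01: "c 0 = a" "c 1 = b" and c2: "2 \<le> q \<Longrightarrow> c q = \<zero>" for q
        by (auto simp: c_def)
      have c: "\<forall>q. c q \<in> G q"
      proof
        show "c q \<in> G q" for q by (rule q_cases[of q]) (use ab G2[of q] c01 c2 in simp_all)
      qed
      show ?thesis
      proof (rule ex1I[of _ c])
        show "(\<forall>q. c q \<in> G q) \<and> finite {q. c q \<noteq> \<zero>} \<and> x = (\<Oplus>q\<in>{q. c q \<noteq> \<zero>}. c q)"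
          using c fin2[OF c] sum2[OF c] ab c01 by simp
      next
        fix c' assume c': "(\<forall>q. c' q \<in> G q) \<and> finite {q. c' q \<noteq> \<zero>} \<and> x = (\<Oplus>q\<in>{q. c' q \<noteq> \<zero>}. c' q)"
        then have x: "a \<oplus> b = c' 0 \<oplus> c' 1" using sum2[of c'] ab by simp
        have cc: "c' 0 \<in> carrier R" "c' 1 \<in> carrier R" "c' 0 \<in> G 0" "c' 1 \<in> G 1" using c' G by auto
        \<comment> \<open>Comparing two decompositions, the difference in degree 0 equals the
          difference in degree 1 up to sign, so both lie in the intersection of the two
          parts.\<close>
        have "a \<oplus> \<ominus> c' 0 = (a \<oplus> b) \<oplus> \<ominus> c' 0 \<oplus> \<ominus> b" using abc cc by algebra
        also have "\<dots> = (c' 0 \<oplus> c' 1) \<oplus> \<ominus> c' 0 \<oplus> \<ominus> b" by (simp only: x)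
        also have "\<dots> = c' 1 \<oplus> \<ominus> b" using abc cc by algebra
        finally have e: "a \<oplus> \<ominus> c' 0 = c' 1 \<oplus> \<ominus> b" .
        have "a \<oplus> \<ominus> c' 0 \<in> G 0" "c' 1 \<oplus> \<ominus> b \<in> G 1"
          using ab cc subgroup.m_closed[OF sub(1)] subgroup.m_closed[OF sub(2)]
            subgroup.m_inv_closed[OF sub(1)] subgroup.m_inv_closed[OF sub(2)]
          by (simp_all add: a_inv_def)
        then have z: "a \<oplus> \<ominus> c' 0 = \<zero>" "c' 1 \<oplus> \<ominus> b = \<zero>" using disj e by auto
        have "a = c' 0" "c' 1 = b"
          using minus_equality[OF z(1)] minus_equality[OF z(2)] abc cc by simp_all
        moreover have "c' q = \<zero>" if "2 \<le> q" for q using c' G2[OF that] by blast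
        ultimately have "c' q = c q" for q
          using c01 c2 by (rule_tac q_cases[of q]) simp_all
        then show "c' = c" by (rule ext)
      qed
    qed
    show "x \<otimes> y = [((- 1 :: int) ^ (p * q))] \<cdot> (y \<otimes> x)" if "x \<in> G p" "y \<in> G q" for x y p q
    proof -
      have x: "x \<in> carrier R" and y: "y \<in> carrier R" using that G by auto
      consider "p = 0 \<and> q = 0" | "p = 0 \<and> q = 1" | "p = 1 \<and> q = 0" | "p = 1 \<and> q = 1" | "2 \<le> p" | "2 \<le> q"
        by linarith
      then show ?thesis
      proof cases
        case 1
        then have "x \<otimes> y = y \<otimes> x" using that by (intro comm0) simp_all
        then show ?thesis using 1 x y by simp
      next
        case 2
        then have "x \<otimes> y = y \<otimes> x" using that by (intro comm1) simp_all
        then show ?thesis using 2 x y by simp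
      next
        case 3
        then have "y \<otimes> x = x \<otimes> y" using that by (intro comm1) simp_all
        then show ?thesis using 3 x y by simp
      next
        case 4
        then show ?thesis using that m11[of x y] m11[of y x] by (simp add: add.int_pow_one)
      next
        case 5
        then show ?thesis using that y G2[of p] by (simp add: add.int_pow_one)
      next
        case 6
        then show ?thesis using that x G2[of q] by (simp add: add.int_pow_one)
      qed
    qed
  qed
qed

section \<open>An explicit Witt complex\<close>

definition cutoff :: "nat set \<Rightarrow> (nat \<Rightarrow> int) \<Rightarrow> nat \<Rightarrow> int" where
  "cutoff S f k = (if k \<in> S then f k else 0)"

text \<open>Residue classes modulo k are stored as least nonnegative residues, and all functions are
  0 off S. In this normal form equality in the explicit complex is equality of functions, and
  identities modulo each k become identities of reductions by \<open>red_eq_iff\<close>.\<close>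

definition red :: "nat set \<Rightarrow> (nat \<Rightarrow> int) \<Rightarrow> nat \<Rightarrow> int" where
  "red S w k = (if k \<in> S then w k mod int k else 0)"

definition gvec :: "nat set \<Rightarrow> (nat \<Rightarrow> int) set" where
  "gvec S = {g. dwork S g \<and> (\<forall>k. k \<notin> S \<longrightarrow> g k = 0)}"

definition fvec :: "nat set \<Rightarrow> (nat \<Rightarrow> int) set" where
  "fvec S = {w. \<forall>k. if k \<in> S then 0 \<le> w k \<and> w k < int k else w k = 0}"

lemma red_eq_iff: "red S v = red S w \<longleftrightarrow> (\<forall>k\<in>S. [v k = w k] (mod int k))"
  by (auto simp: red_def fun_eq_iff cong_def)

lemma cong_red: "k \<in> S \<Longrightarrow> [red S w k = w k] (mod int k)"
  by (simp add: red_def cong_def)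

lemma red_fvec: "truncation_set S \<Longrightarrow> red S w \<in> fvec S"
  using truncation_set_pos[of S] by (auto simp: red_def fvec_def)

lemma red_id: "w \<in> fvec S \<Longrightarrow> red S w = w"
  by (auto simp: red_def fvec_def fun_eq_iff split: if_splits)

lemma cutoff_id: "g \<in> gvec S \<Longrightarrow> cutoff S g = g"
  by (auto simp: cutoff_def gvec_def fun_eq_iff)

lemma cutoff_gvec: "truncation_set S \<Longrightarrow> dwork S g \<Longrightarrow> cutoff S g \<in> gvec S"
  using dwork_cong[of S g "cutoff S g"] by (auto simp: cutoff_def gvec_def)

lemma gvec_dwork: "g \<in> gvec S \<Longrightarrow> dwork S g"
  by (simp add: gvec_def)

lemma zero_gvec [simp]: "(\<lambda>k. 0) \<in> gvec S"
  by (simp add: gvec_def dwork_def)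

lemma zero_fvec [simp]: "truncation_set S \<Longrightarrow> (\<lambda>k. 0) \<in> fvec S"
  using truncation_set_pos[of S] by (auto simp: fvec_def)

lemma red_zero [simp]: "red S (\<lambda>k. 0) = (\<lambda>k. 0)"
  by (auto simp: red_def fun_eq_iff)

lemma cutoff_zero [simp]: "cutoff S (\<lambda>k. 0) = (\<lambda>k. 0)"
  by (auto simp: cutoff_def fun_eq_iff)

lemma par_local: "(\<And>j. j dvd k \<Longrightarrow> f j = g j) \<Longrightarrow> par f k = par g k"
proof (induction k rule: less_induct)
  case (less k)
  show ?case
  proof (cases "0 < k \<and> 4 dvd k")
    case True
    then have j: "k div 2 < k" "k div 2 dvd k" using dvd_4_half[of k] by auto
    then have "par f (k div 2) = par g (k div 2)"
      using less.prems by (intro less.IH) (auto dest: dvd_trans)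
    then show ?thesis using True less.prems j by (simp add: par_rec)
  next
    case False
    then show ?thesis by (cases "k = 0") (simp_all add: par_eq_0)
  qed
qed

lemma dquot_cutoff: "truncation_set S \<Longrightarrow> k \<in> S \<Longrightarrow> dquot (cutoff S g) k = dquot g k"
  by (rule dquot_local) (auto simp: cutoff_def)

lemma dact_cutoff:
  assumes S: "truncation_set S" and k: "k \<in> S"
  shows "dact (cutoff S g) w k = dact g w k" "dact g (cutoff S w) k = dact g w k"
proof -
  have "par (dquot (cutoff S g)) k = par (dquot g) k"
    using dquot_cutoff[OF S] truncation_set_dvd[OF S k] by (intro par_local) auto
  moreover have "par (cutoff S w) k = par w k"
    using truncation_set_dvd[OF S k] by (intro par_local) (auto simp: cutoff_def)
  ultimately show "dact (cutoff S g) w k = dact g w k" "dact g (cutoff S w) k = dact g w k"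
    using k by (simp_all add: dact_def cutoff_def)
qed

lemma dact_red:
  assumes S: "truncation_set S" and k: "k \<in> S"
  shows "[dact g (red S w) k = dact g w k] (mod int k)"
  using truncation_set_pos[OF S k] truncation_set_dvd[OF S k]
  by (intro dact_cong cong_red) auto

lemma dfrob_cutoff:
  assumes S: "truncation_set S" and k: "n * k \<in> S"
  shows "dfrob n (cutoff S w) k = dfrob n w k"
proof -
  have "par (cutoff S w) (n * k) = par w (n * k)"
    using truncation_set_dvd[OF S k] by (intro par_local) (auto simp: cutoff_def)
  then show ?thesis using k by (simp add: dfrob_def cutoff_def)
qed

lemma dfrob_red:
  assumes S: "truncation_set S" and k: "n * k \<in> S"
  shows "[dfrob n (red S w) k = dfrob n w k] (mod int k)"
  using truncation_set_pos[OF S k] truncation_set_dvd[OF S k]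
  by (intro dfrob_cong cong_red) auto

lemma dver_cutoff:
  assumes S: "truncation_set S" and n: "0 < n" and k: "k \<in> S"
  shows "dver n (cutoff (S \<div> n) w) k = dver n w k"
  using trunc_quotI[OF S, of n "k div n"] k by (auto simp: dver_def cutoff_def)

lemma dver_red:
  assumes S: "truncation_set S" and n: "0 < n" and k: "k \<in> S"
  shows "[dver n (red (S \<div> n) w) k = dver n w k] (mod int k)"
  using trunc_quotI[OF S, of n "k div n"] k by (intro dver_cong cong_red) auto

lemma dquot_zero [simp]: "0 < k \<Longrightarrow> dquot (\<lambda>k. 0) k = 0"
  using dquot_const[OF truncation_set_all, of k 0] dquot_nonneg[OF truncation_set_all dwork_const, of k 0]
    dquot_less[OF truncation_set_all dwork_const, of k 0]
  by (simp add: cong_def)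

lemma dact_zero:
  assumes "0 < k"
  shows "dact (\<lambda>k. 0) w k = 0" "dact g (\<lambda>k. 0) k = 0"
proof -
  have "par (dquot (\<lambda>k. 0)) k = par (\<lambda>k. 0) k"
    using assms by (intro par_local) (auto intro: Nat.gr0I)
  then show "dact (\<lambda>k. 0) w k = 0" by (simp add: dact_def)
qed (simp add: dact_def)

text \<open>The square-zero extension of the ring of Dwork families by its module of differentials:
  first components multiply pointwise, each acts on the second component of the other factor, and
  the product of two second components is 0.\<close>

definition model_ring :: "nat set \<Rightarrow> ((nat \<Rightarrow> int) \<times> (nat \<Rightarrow> int)) ring" where
  "model_ring S = \<lparr>carrier = gvec S \<times> fvec S,
     monoid.mult = (\<lambda>x y. (\<lambda>k. fst x k * fst y k,
       red S (\<lambda>k. dact (fst x) (snd y) k + dact (fst y) (snd x) k))),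
     one = (cutoff S (\<lambda>k. 1), \<lambda>k. 0),
     ring.zero = (\<lambda>k. 0, \<lambda>k. 0),
     ring.add = (\<lambda>x y. (\<lambda>k. fst x k + fst y k, red S (\<lambda>k. snd x k + snd y k)))\<rparr>"

lemma model_ring_simps [simp]:
  "carrier (model_ring S) = gvec S \<times> fvec S"
  "x \<otimes>\<^bsub>model_ring S\<^esub> y = (\<lambda>k. fst x k * fst y k,
       red S (\<lambda>k. dact (fst x) (snd y) k + dact (fst y) (snd x) k))"
  "\<one>\<^bsub>model_ring S\<^esub> = (cutoff S (\<lambda>k. 1), \<lambda>k. 0)"
  "\<zero>\<^bsub>model_ring S\<^esub> = (\<lambda>k. 0, \<lambda>k. 0)"
  "x \<oplus>\<^bsub>model_ring S\<^esub> y = (\<lambda>k. fst x k + fst y k, red S (\<lambda>k. snd x k + snd y k))"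
  by (simp_all add: model_ring_def)

lemma gvec_add: "g \<in> gvec S \<Longrightarrow> h \<in> gvec S \<Longrightarrow> (\<lambda>k. g k + h k) \<in> gvec S"
  and gvec_mult: "g \<in> gvec S \<Longrightarrow> h \<in> gvec S \<Longrightarrow> (\<lambda>k. g k * h k) \<in> gvec S"
  and gvec_uminus: "g \<in> gvec S \<Longrightarrow> (\<lambda>k. - g k) \<in> gvec S"
  by (auto simp: gvec_def dwork_add dwork_mult dwork_uminus)

lemma cring_model_ring:
  assumes S: "truncation_set S"
  shows "cring (model_ring S)"
proof (rule cringI)
  note S' [simp] = red_fvec[OF S]
  show "abelian_group (model_ring S)"
  proof (rule abelian_groupI)
    fix x y z assume "x \<in> carrier (model_ring S)" "y \<in> carrier (model_ring S)" "z \<in> carrier (model_ring S)"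
    show "x \<oplus>\<^bsub>model_ring S\<^esub> y \<oplus>\<^bsub>model_ring S\<^esub> z = x \<oplus>\<^bsub>model_ring S\<^esub> (y \<oplus>\<^bsub>model_ring S\<^esub> z)"
      by (simp add: red_eq_iff)
        (simp add: red_def cong_def mod_simps add.assoc)
  next
    fix x assume "x \<in> carrier (model_ring S)"
    then show "\<exists>y\<in>carrier (model_ring S). y \<oplus>\<^bsub>model_ring S\<^esub> x = \<zero>\<^bsub>model_ring S\<^esub>"
      by (intro bexI[of _ "(\<lambda>k. - fst x k, red S (\<lambda>k. - snd x k))"])
        (auto simp: gvec_uminus red_def fun_eq_iff mod_simps)
  qed (use S in \<open>auto simp: gvec_add add.commute red_id\<close>)
  show "comm_monoid (model_ring S)"
  proof (rule comm_monoidI)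
    fix x y z assume xyz: "x \<in> carrier (model_ring S)" "y \<in> carrier (model_ring S)" "z \<in> carrier (model_ring S)"
    obtain g u h v i w where [simp]: "x = (g, u)" "y = (h, v)" "z = (i, w)"
      by (metis surj_pair)
    have d: "dwork S g" "dwork S h" "dwork S i" using xyz by (auto simp: gvec_dwork)
    have "red S (\<lambda>k. dact (\<lambda>k. g k * h k) w k + dact i (red S (\<lambda>k. dact g v k + dact h u k)) k) =
      red S (\<lambda>k. dact g (red S (\<lambda>k. dact h w k + dact i v k)) k + dact (\<lambda>k. h k * i k) u k)"
      unfolding red_eq_iff
    proof
      fix k assume k: "k \<in> S"
      have "[dact (\<lambda>k. g k * h k) w k + dact i (red S (\<lambda>k. dact g v k + dact h u k)) k =
          dact g (dact h w) k + (dact i (dact g v) k + dact i (dact h u) k)] (mod int k)"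
        unfolding dact_add_right[symmetric] by (intro cong_add dact_mult[OF S] d k dact_red S)
      \<comment> \<open>Actions of different families commute because both composites are the action
        of the product, which is commutative.\<close>
      also have "[dact i (dact g v) k = dact g (dact i v) k] (mod int k)"
        using cong_trans[OF cong_sym[OF dact_mult[OF S d(3,1) k, of v]], of "dact g (dact i v) k"]
          dact_mult[OF S d(1,3) k, of v]
        by (simp add: mult.commute)
      then have "[dact g (dact h w) k + (dact i (dact g v) k + dact i (dact h u) k) =
          dact g (dact h w) k + (dact g (dact i v) k + dact (\<lambda>k. h k * i k) u k)] (mod int k)"
        using dact_mult[OF S d(3,2) k, of u]
        by (intro cong_add cong_refl) (simp_all add: mult.commute cong_sym)
      also have "dact g (dact h w) k + (dact g (dact i v) k + dact (\<lambda>k. h k * i k) u k) =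
          dact g (\<lambda>k. dact h w k + dact i v k) k + dact (\<lambda>k. h k * i k) u k"
        by (simp add: dact_add_right)
      also have "[dact g (\<lambda>k. dact h w k + dact i v k) k + dact (\<lambda>k. h k * i k) u k =
        dact g (red S (\<lambda>k. dact h w k + dact i v k)) k + dact (\<lambda>k. h k * i k) u k] (mod int k)"
        by (intro cong_add cong_refl cong_sym[OF dact_red] S k)
      finally show "[dact (\<lambda>k. g k * h k) w k + dact i (red S (\<lambda>k. dact g v k + dact h u k)) k =
         dact g (red S (\<lambda>k. dact h w k + dact i v k)) k + dact (\<lambda>k. h k * i k) u k] (mod int k)" .
    qed
    then show "x \<otimes>\<^bsub>model_ring S\<^esub> y \<otimes>\<^bsub>model_ring S\<^esub> z = x \<otimes>\<^bsub>model_ring S\<^esub> (y \<otimes>\<^bsub>model_ring S\<^esub> z)"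
      by (simp add: mult.assoc)
  next
    fix x assume x: "x \<in> carrier (model_ring S)"
    have "red S (\<lambda>k. dact (cutoff S (\<lambda>k. 1)) (snd x) k + dact (fst x) (\<lambda>k. 0) k) = red S (snd x)"
      unfolding red_eq_iff
      using truncation_set_pos[OF S] by (simp add: dact_cutoff[OF S] dact_zero dact_one[OF S])
    then show "\<one>\<^bsub>model_ring S\<^esub> \<otimes>\<^bsub>model_ring S\<^esub> x = x"
      using x by (auto simp: red_id cutoff_def gvec_def fun_eq_iff)
  qed (use S in \<open>auto simp: gvec_mult add.commute mult.commute cutoff_gvec dwork_const\<close>)
  fix x y z assume xyz: "x \<in> carrier (model_ring S)" "y \<in> carrier (model_ring S)" "z \<in> carrier (model_ring S)"
  obtain g u h v i w where [simp]: "x = (g, u)" "y = (h, v)" "z = (i, w)"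
    by (metis surj_pair)
  have d: "dwork S g" "dwork S h" "dwork S i" using xyz by (auto simp: gvec_dwork)
  have "red S (\<lambda>k. dact (\<lambda>k. g k + h k) w k + dact i (red S (\<lambda>k. u k + v k)) k) =
    red S (\<lambda>k. red S (\<lambda>k. dact g w k + dact i u k) k + red S (\<lambda>k. dact h w k + dact i v k) k)"
    unfolding red_eq_iff
  proof
    fix k assume k: "k \<in> S"
    have "[dact (\<lambda>k. g k + h k) w k + dact i (red S (\<lambda>k. u k + v k)) k =
       (dact g w k + dact h w k) + dact i (\<lambda>k. u k + v k) k] (mod int k)"
      by (intro cong_add dact_add_left[OF S] d k dact_red S)
    also have "(dact g w k + dact h w k) + dact i (\<lambda>k. u k + v k) k =
        (dact g w k + dact i u k) + (dact h w k + dact i v k)"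
      by (simp add: dact_add_right)
    also have "[(dact g w k + dact i u k) + (dact h w k + dact i v k) =
       red S (\<lambda>k. dact g w k + dact i u k) k + red S (\<lambda>k. dact h w k + dact i v k) k] (mod int k)"
      using k by (intro cong_add) (rule cong_sym, rule cong_red, assumption)+
    finally show "[dact (\<lambda>k. g k + h k) w k + dact i (red S (\<lambda>k. u k + v k)) k =
       red S (\<lambda>k. dact g w k + dact i u k) k + red S (\<lambda>k. dact h w k + dact i v k) k] (mod int k)" .
  qed
  then show "(x \<oplus>\<^bsub>model_ring S\<^esub> y) \<otimes>\<^bsub>model_ring S\<^esub> z =
     x \<otimes>\<^bsub>model_ring S\<^esub> z \<oplus>\<^bsub>model_ring S\<^esub> y \<otimes>\<^bsub>model_ring S\<^esub> z"
    by (simp add: distrib_right)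
qed

text \<open>Since \<open>eta\<close> is the ghost map, Witt coordinates never have to be computed in
  the complex. The differential only has to be cut off, because \<open>dquot\<close> is chosen as a
  least residue on Dwork families.\<close>

definition model :: "((nat \<Rightarrow> int) \<times> (nat \<Rightarrow> int)) witt_data" where
  "model = \<lparr>obj = model_ring,
     deg = (\<lambda>S q. if q = 0 then gvec S \<times> {\<lambda>k. 0} else if q = 1 then {\<lambda>k. 0} \<times> fvec S
       else {(\<lambda>k. 0, \<lambda>k. 0)}),
     res = (\<lambda>S T x. (cutoff T (fst x), cutoff T (snd x))),
     eta = (\<lambda>S a. (cutoff S (\<lambda>k. ghost k a), \<lambda>k. 0)),
     diff = (\<lambda>S x. (\<lambda>k. 0, cutoff S (dquot (fst x)))),
     frob = (\<lambda>n S x. (cutoff (S \<div> n) (\<lambda>k. fst x (n * k)), red (S \<div> n) (dfrob n (snd x)))),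
     ver = (\<lambda>n S x. (cutoff S (dver n (fst x)), red S (dver n (snd x))))\<rparr>"

lemma model_simps [simp]:
  "obj model = model_ring"
  "deg model S q = (if q = 0 then gvec S \<times> {\<lambda>k. 0} else if q = 1 then {\<lambda>k. 0} \<times> fvec S
       else {(\<lambda>k. 0, \<lambda>k. 0)})"
  "res model S T x = (cutoff T (fst x), cutoff T (snd x))"
  "eta model S a = (cutoff S (\<lambda>k. ghost k a), \<lambda>k. 0)"
  "diff model S x = (\<lambda>k. 0, cutoff S (dquot (fst x)))"
  "frob model n S x = (cutoff (S \<div> n) (\<lambda>k. fst x (n * k)), red (S \<div> n) (dfrob n (snd x)))"
  "ver model n S x = (cutoff S (dver n (fst x)), red S (dver n (snd x)))"
  by (simp_all add: model_def)

lemma red_cong: "(\<And>k. k \<in> S \<Longrightarrow> [v k = w k] (mod int k)) \<Longrightarrow> red S v = red S w"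
  by (simp add: red_eq_iff)

lemma cutoff_cong: "(\<And>k. k \<in> S \<Longrightarrow> v k = w k) \<Longrightarrow> cutoff S v = cutoff S w"
  by (auto simp: cutoff_def fun_eq_iff)

lemma cutoff_eq_red: "w \<in> fvec S \<Longrightarrow> T \<subseteq> S \<Longrightarrow> cutoff T w = red T w"
  by (auto simp: cutoff_def fvec_def red_def fun_eq_iff split: if_splits)

lemma cutoff_fvec: "w \<in> fvec S \<Longrightarrow> T \<subseteq> S \<Longrightarrow> cutoff T w \<in> fvec T"
  by (auto simp: cutoff_def fvec_def split: if_splits)

lemma cutoff_cutoff: "T \<subseteq> S \<Longrightarrow> cutoff T (cutoff S w) = cutoff T w"
  by (auto simp: cutoff_def fun_eq_iff)

lemma cutoff_gvec_subset: "truncation_set T \<Longrightarrow> g \<in> gvec S \<Longrightarrow> T \<subseteq> S \<Longrightarrow> cutoff T g \<in> gvec T"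
  by (meson cutoff_gvec dwork_subset gvec_dwork)

lemma cutoff_dquot_fvec: "truncation_set S \<Longrightarrow> dwork S g \<Longrightarrow> cutoff S (dquot g) \<in> fvec S"
  by (auto simp: cutoff_def fvec_def dquot_nonneg dquot_less)

lemma cutoff_dquot_red: "truncation_set S \<Longrightarrow> dwork S g \<Longrightarrow> cutoff S (dquot g) = red S (dquot g)"
  using cutoff_eq_red[OF cutoff_dquot_fvec, of S g S] by (simp add: cutoff_cutoff cutoff_def red_def fun_eq_iff)

lemma dquot_zero_cutoff: "truncation_set S \<Longrightarrow> cutoff S (dquot (\<lambda>k. 0)) = (\<lambda>k. 0)"
  using truncation_set_pos[of S] by (auto simp: cutoff_def fun_eq_iff)

lemma red_dact_zero:
  assumes "truncation_set S"
  shows "red S (\<lambda>k. dact (\<lambda>k. 0) w k + c k) = red S c" "red S (\<lambda>k. c k + dact (\<lambda>k. 0) w k) = red S c"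
    "red S (\<lambda>k. dact g (\<lambda>k. 0) k + c k) = red S c" "red S (\<lambda>k. c k + dact g (\<lambda>k. 0) k) = red S c"
    "red S (dact (\<lambda>k. 0) w) = (\<lambda>k. 0)" "red S (dact g (\<lambda>k. 0)) = (\<lambda>k. 0)"
  using truncation_set_pos[OF assms] by (auto simp: red_def fun_eq_iff dact_zero)

section \<open>The axioms of a Witt complex for the explicit complex\<close>

lemma model_graded:
  assumes S: "truncation_set S"
  shows "anticomm_graded_ring (obj model S) (deg model S)"
proof -
  interpret cring "model_ring S" using S by (rule cring_model_ring)
  have inv: "\<ominus>\<^bsub>model_ring S\<^esub> x = (\<lambda>k. - fst x k, red S (\<lambda>k. - snd x k))" if "x \<in> gvec S \<times> fvec S" for x
    using that red_fvec[OF S]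
    by (intro minus_equality) (auto simp: gvec_uminus red_def[of S] fun_eq_iff mod_simps)
  have ne: "gvec S \<noteq> {}" "fvec S \<noteq> {}"
    using zero_gvec[of S] zero_fvec[OF S] by blast+
  show ?thesis
  proof (rule anticomm_graded_ring_two_step)
    show "ring (obj model S)" using ring_axioms by simp
    show "subgroup (deg model S 0) (add_monoid (obj model S))"
      unfolding model_simps by (intro add.subgroupI) (auto simp: S ne gvec_add inv gvec_uminus simp flip: a_inv_def)
    show "subgroup (deg model S 1) (add_monoid (obj model S))"
      unfolding model_simps by (intro add.subgroupI) (auto simp: S ne inv red_fvec simp flip: a_inv_def)
  qed (auto simp: S red_id mult.commute add.commute red_dact_zero red_fvec cutoff_gvec dwork_const gvec_mult)
qed

lemma model_res_hom:
  assumes S: "truncation_set S" and T: "truncation_set T" and TS: "T \<subseteq> S"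
  shows "res model S T \<in> ring_hom (obj model S) (obj model T)"
proof (rule ring_hom_memI; simp)
  show "cutoff T (fst x) \<in> gvec T \<and> cutoff T (snd x) \<in> fvec T" if "x \<in> gvec S \<times> fvec S" for x
    using that TS T cutoff_gvec_subset[of T] cutoff_fvec[of _ S T] by auto
  show "cutoff T (\<lambda>k. fst x k * fst y k) = (\<lambda>k. cutoff T (fst x) k * cutoff T (fst y) k) \<and>
      cutoff T (red S (\<lambda>k. dact (fst x) (snd y) k + dact (fst y) (snd x) k)) =
      red T (\<lambda>k. dact (cutoff T (fst x)) (cutoff T (snd y)) k + dact (cutoff T (fst y)) (cutoff T (snd x)) k)" for x y
    using TS by (auto simp: dact_cutoff[OF T] fun_eq_iff cutoff_def[of T] red_def)
  show "cutoff T (\<lambda>k. fst x k + fst y k) = (\<lambda>k. cutoff T (fst x) k + cutoff T (fst y) k) \<and>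
      cutoff T (red S (\<lambda>k. snd x k + snd y k)) = red T (\<lambda>k. cutoff T (snd x) k + cutoff T (snd y) k)" for x y
    using TS by (auto simp: fun_eq_iff cutoff_def red_def)
  show "cutoff T (cutoff S (\<lambda>k. 1)) = cutoff T (\<lambda>k. 1)"
    using TS by (rule cutoff_cutoff)
qed

lemma model_eta_hom:
  assumes S: "truncation_set S"
  shows "eta model S \<in> ring_hom (witt S) (obj model S)"
  by (rule ring_hom_memI)
    (auto simp: S cutoff_gvec dwork_ghost red_dact_zero, auto simp: S fun_eq_iff cutoff_def)

lemma model_diff_hom:
  assumes S: "truncation_set S"
  shows "diff model S \<in> hom (add_monoid (obj model S)) (add_monoid (obj model S))"
proof (rule homI)
  fix x y assume "x \<in> carrier (add_monoid (obj model S))" "y \<in> carrier (add_monoid (obj model S))"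
  then have d: "dwork S (fst x)" "dwork S (fst y)" by (auto simp: gvec_dwork)
  have "cutoff S (dquot (\<lambda>k. fst x k + fst y k)) = red S (\<lambda>k. cutoff S (dquot (fst x)) k + cutoff S (dquot (fst y)) k)"
    unfolding cutoff_dquot_red[OF S dwork_add[OF d]]
    by (rule red_cong) (simp add: cutoff_def dquot_add[OF S d])
  then show "diff model S (x \<otimes>\<^bsub>add_monoid (obj model S)\<^esub> y) =
      diff model S x \<otimes>\<^bsub>add_monoid (obj model S)\<^esub> diff model S y" by simp
qed (auto simp: S cutoff_dquot_fvec gvec_dwork)

lemma frob_carrier:
  assumes S: "truncation_set S" and n: "0 < n" and g: "dwork S g"
  shows "cutoff (S \<div> n) (\<lambda>k. g (n * k)) \<in> gvec (S \<div> n)"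
  using assms by (intro cutoff_gvec truncation_set_quot dwork_frob)

lemma model_frob_hom:
  assumes S: "truncation_set S" and n: "0 < n"
  shows "frob model n S \<in> ring_hom (obj model S) (obj model (S \<div> n))"
proof (rule ring_hom_memI)
  note Sn = truncation_set_quot[OF S, of n]
  fix x assume x: "x \<in> carrier (obj model S)"
  then have dx: "dwork S (fst x)" by (auto simp: gvec_dwork)
  show "frob model n S x \<in> carrier (obj model (S \<div> n))"
    using x by (auto simp: frob_carrier[OF S n dx] red_fvec[OF Sn])
  fix y assume y: "y \<in> carrier (obj model S)"
  then have dy: "dwork S (fst y)" by (auto simp: gvec_dwork)
  have "red (S \<div> n) (dfrob n (red S (\<lambda>k. dact (fst x) (snd y) k + dact (fst y) (snd x) k))) =
     red (S \<div> n) (\<lambda>k. dact (cutoff (S \<div> n) (\<lambda>k. fst x (n * k))) (red (S \<div> n) (dfrob n (snd y))) k +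
       dact (cutoff (S \<div> n) (\<lambda>k. fst y (n * k))) (red (S \<div> n) (dfrob n (snd x))) k)"
  proof (rule red_cong)
    fix k assume k: "k \<in> S \<div> n"
    have k': "n * k \<in> S" using k by (rule trunc_quotD)
    have "[dfrob n (red S (\<lambda>k. dact (fst x) (snd y) k + dact (fst y) (snd x) k)) k =
      dfrob n (dact (fst x) (snd y)) k + dfrob n (dact (fst y) (snd x)) k] (mod int k)"
      unfolding dfrob_add[symmetric] by (rule dfrob_red[OF S k'])
    also have "[dfrob n (dact (fst x) (snd y)) k + dfrob n (dact (fst y) (snd x)) k =
      dact (\<lambda>k. fst x (n * k)) (dfrob n (snd y)) k + dact (\<lambda>k. fst y (n * k)) (dfrob n (snd x)) k] (mod int k)"
      by (intro cong_add dfrob_dact[OF S _ n k'] dx dy)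
    also have "[dact (\<lambda>k. fst x (n * k)) (dfrob n (snd y)) k + dact (\<lambda>k. fst y (n * k)) (dfrob n (snd x)) k =
      dact (\<lambda>k. fst x (n * k)) (red (S \<div> n) (dfrob n (snd y))) k +
      dact (\<lambda>k. fst y (n * k)) (red (S \<div> n) (dfrob n (snd x))) k] (mod int k)"
      by (intro cong_add cong_sym[OF dact_red[OF Sn k]])
    finally show "[dfrob n (red S (\<lambda>k. dact (fst x) (snd y) k + dact (fst y) (snd x) k)) k =
      dact (cutoff (S \<div> n) (\<lambda>k. fst x (n * k))) (red (S \<div> n) (dfrob n (snd y))) k +
       dact (cutoff (S \<div> n) (\<lambda>k. fst y (n * k))) (red (S \<div> n) (dfrob n (snd x))) k] (mod int k)"
      by (simp only: dact_cutoff[OF Sn k])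
  qed
  then show "frob model n S (x \<otimes>\<^bsub>obj model S\<^esub> y) = frob model n S x \<otimes>\<^bsub>obj model (S \<div> n)\<^esub> frob model n S y"
    by (auto simp: cutoff_def fun_eq_iff)
  have "red (S \<div> n) (dfrob n (red S (\<lambda>k. snd x k + snd y k))) =
     red (S \<div> n) (\<lambda>k. red (S \<div> n) (dfrob n (snd x)) k + red (S \<div> n) (dfrob n (snd y)) k)"
  proof (rule red_cong)
    fix k assume k: "k \<in> S \<div> n"
    have k': "n * k \<in> S" using k by (rule trunc_quotD)
    have "[dfrob n (red S (\<lambda>k. snd x k + snd y k)) k = dfrob n (snd x) k + dfrob n (snd y) k] (mod int k)"
      unfolding dfrob_add[symmetric] by (rule dfrob_red[OF S k'])
    also have "[dfrob n (snd x) k + dfrob n (snd y) k =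
       red (S \<div> n) (dfrob n (snd x)) k + red (S \<div> n) (dfrob n (snd y)) k] (mod int k)"
      by (intro cong_add cong_sym[OF cong_red[OF k]])
    finally show "[dfrob n (red S (\<lambda>k. snd x k + snd y k)) k =
      red (S \<div> n) (dfrob n (snd x)) k + red (S \<div> n) (dfrob n (snd y)) k] (mod int k)" .
  qed
  then show "frob model n S (x \<oplus>\<^bsub>obj model S\<^esub> y) = frob model n S x \<oplus>\<^bsub>obj model (S \<div> n)\<^esub> frob model n S y"
    by (auto simp: cutoff_def fun_eq_iff)
next
  have "dfrob n (\<lambda>k. 0) = (\<lambda>k. 0)" by (auto simp: dfrob_def)
  then show "frob model n S \<one>\<^bsub>obj model S\<^esub> = \<one>\<^bsub>obj model (S \<div> n)\<^esub>"
    by (simp, auto simp: cutoff_def fun_eq_iff trunc_quotD)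
qed

lemma model_ver_hom:
  assumes S: "truncation_set S" and n: "0 < n"
  shows "ver model n S \<in> hom (add_monoid (obj model (S \<div> n))) (add_monoid (obj model S))"
proof (rule homI)
  fix x y :: "(nat \<Rightarrow> int) \<times> (nat \<Rightarrow> int)"
  have "red S (dver n (red (S \<div> n) (\<lambda>k. snd x k + snd y k))) =
    red S (\<lambda>k. red S (dver n (snd x)) k + red S (dver n (snd y)) k)"
  proof (rule red_cong)
    fix k assume k: "k \<in> S"
    have "[dver n (red (S \<div> n) (\<lambda>k. snd x k + snd y k)) k = dver n (snd x) k + dver n (snd y) k] (mod int k)"
      unfolding dver_add[symmetric] by (rule dver_red[OF S n k])
    also have "[dver n (snd x) k + dver n (snd y) k =
       red S (dver n (snd x)) k + red S (dver n (snd y)) k] (mod int k)"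
      by (intro cong_add cong_sym[OF cong_red[OF k]])
    finally show "[dver n (red (S \<div> n) (\<lambda>k. snd x k + snd y k)) k =
      red S (dver n (snd x)) k + red S (dver n (snd y)) k] (mod int k)" .
  qed
  then show "ver model n S (x \<otimes>\<^bsub>add_monoid (obj model (S \<div> n))\<^esub> y) =
    ver model n S x \<otimes>\<^bsub>add_monoid (obj model S)\<^esub> ver model n S y"
    by (auto simp: cutoff_def fun_eq_iff dver_add)
qed (auto simp: red_fvec[OF S] cutoff_gvec[OF S dwork_dver[OF S _ n]] gvec_dwork)

lemma model_nat_mult:
  assumes S: "truncation_set S" and x: "x \<in> gvec S \<times> fvec S"
  shows "[(n :: nat)] \<cdot>\<^bsub>model_ring S\<^esub> x = (\<lambda>k. int n * fst x k, red S (\<lambda>k. int n * snd x k))"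
proof -
  interpret cring "model_ring S" using S by (rule cring_model_ring)
  show ?thesis
  proof (induction n)
    case (Suc n)
    have "[Suc n] \<cdot>\<^bsub>model_ring S\<^esub> x = [n] \<cdot>\<^bsub>model_ring S\<^esub> x \<oplus>\<^bsub>model_ring S\<^esub> x"
      using x by simp
    also have "\<dots> = (\<lambda>k. int (Suc n) * fst x k, red S (\<lambda>k. int (Suc n) * snd x k))"
      by (auto simp: Suc fun_eq_iff red_def mod_simps algebra_simps)
    finally show ?case .
  qed simp
qed

lemma model_diff_deg:
  "truncation_set S \<Longrightarrow> x \<in> deg model S q \<Longrightarrow> diff model S x \<in> deg model S (q + 1)"
  by (auto simp: cutoff_dquot_fvec gvec_dwork dquot_zero_cutoff split: if_splits)

lemma model_frob_deg:
  assumes S: "truncation_set S" and n: "0 < n"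
  shows "x \<in> deg model S q \<Longrightarrow> frob model n S x \<in> deg model (S \<div> n) q"
proof -
  have "dfrob n (\<lambda>k. 0) = (\<lambda>k. 0)" by (auto simp: dfrob_def)
  then show "x \<in> deg model S q \<Longrightarrow> frob model n S x \<in> deg model (S \<div> n) q"
    using frob_carrier[OF S n] red_fvec[OF truncation_set_quot[OF S]]
    by (auto simp: gvec_dwork split: if_splits)
qed

lemma model_ver_deg:
  assumes S: "truncation_set S" and n: "0 < n"
  shows "x \<in> deg model (S \<div> n) q \<Longrightarrow> ver model n S x \<in> deg model S q"
proof -
  have "dver n (\<lambda>k. 0) = (\<lambda>k. 0)" by (auto simp: dver_def)
  then show "x \<in> deg model (S \<div> n) q \<Longrightarrow> ver model n S x \<in> deg model S q"
    using cutoff_gvec[OF S dwork_dver[OF S _ n]] red_fvec[OF S]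
    by (auto simp: gvec_dwork split: if_splits)
qed

lemma model_res_deg:
  assumes S: "truncation_set S" and T: "truncation_set T" and TS: "T \<subseteq> S"
  shows "x \<in> deg model S q \<Longrightarrow> res model S T x \<in> deg model T q"
  using cutoff_gvec_subset[OF T _ TS] cutoff_fvec[OF _ TS] by (auto split: if_splits)

lemma model_diff_res:
  assumes S: "truncation_set S" and T: "truncation_set T" and TS: "T \<subseteq> S"
  shows "res model S T (diff model S x) = diff model T (res model S T x)"
  using TS dquot_cutoff[OF T] by (auto simp: fun_eq_iff cutoff_def[of T] cutoff_def[of S])

lemma model_frob_res:
  assumes S: "truncation_set S" and T: "truncation_set T" and TS: "T \<subseteq> S" and n: "0 < n"
  shows "res model (S \<div> n) (T \<div> n) (frob model n S x) = frob model n T (res model S T x)"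
proof -
  have "T \<div> n \<subseteq> S \<div> n" using TS by (auto simp: trunc_quot_def)
  then show ?thesis
    by (auto simp: fun_eq_iff red_def cutoff_def[of "T \<div> n"] cutoff_def[of "S \<div> n"] trunc_quotD dfrob_cutoff[OF T])
     (auto simp: cutoff_def dest: trunc_quotD)
qed

lemma model_ver_res:
  assumes S: "truncation_set S" and T: "truncation_set T" and TS: "T \<subseteq> S" and n: "0 < n"
  shows "res model S T (ver model n S x) = ver model n T (res model (S \<div> n) (T \<div> n) x)"
  using TS dver_cutoff[OF T n] by (auto simp: fun_eq_iff red_def cutoff_def[of T] cutoff_def[of S])

text \<open>The coordinate at k of the limit is read off over the finite set \<open>D k\<close> of
  divisors of k. Dwork's congruence at k involves only k and k/p, which both belong to
  \<open>D k\<close>, so it passes to the limit.\<close>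

lemma model_limit:
  assumes S: "truncation_set S"
    and deg: "\<And>T. truncation_set T \<Longrightarrow> finite T \<Longrightarrow> T \<subseteq> S \<Longrightarrow> t T \<in> deg model T q"
    and comp: "\<And>T U. truncation_set T \<Longrightarrow> finite T \<Longrightarrow> T \<subseteq> S \<Longrightarrow> truncation_set U \<Longrightarrow> U \<subseteq> T \<Longrightarrow>
        res model T U (t T) = t U"
  shows "\<exists>!y. y \<in> deg model S q \<and>
        (\<forall>T. truncation_set T \<and> finite T \<and> T \<subseteq> S \<longrightarrow> res model S T y = t T)"
proof -
  define D where "D k = {d :: nat. d dvd k}" for k
  have D: "truncation_set (D k)" "finite (D k)" "D k \<subseteq> S" "k \<in> D k" if "k \<in> S" for k
    using truncation_set_pos[OF S that] truncation_set_dvd[OF S that]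
    by (auto simp: D_def truncation_set_def intro: dvd_trans)
  have eq: "fst (t T) k = fst (t (D k)) k \<and> snd (t T) k = snd (t (D k)) k"
    if "truncation_set T" "finite T" "T \<subseteq> S" "k \<in> T" for T k
  proof -
    have "D k \<subseteq> T" using truncation_set_dvd[OF that(1,4)] by (auto simp: D_def)
    then have "res model T (D k) (t T) = t (D k)"
      using D that by (intro comp) auto
    moreover have "k \<in> D k" by (simp add: D_def)
    ultimately show ?thesis by (metis cutoff_def fst_conv snd_conv model_simps(3))
  qed
  define y where "y = (cutoff S (\<lambda>k. fst (t (D k)) k), cutoff S (\<lambda>k. snd (t (D k)) k))"
  have tdeg: "t (D k) \<in> deg model (D k) q" if "k \<in> S" for k
    using D[OF that] by (intro deg)
  have tfst: "fst (t (D k)) \<in> gvec (D k)" "q \<noteq> 0 \<Longrightarrow> fst (t (D k)) = (\<lambda>k. 0)" if "k \<in> S" for k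
    using tdeg[OF that] by (auto split: if_splits)
  have tsnd: "snd (t (D k)) \<in> fvec (D k)" "q \<noteq> 1 \<Longrightarrow> snd (t (D k)) = (\<lambda>k. 0)" if "k \<in> S" for k
    using tdeg[OF that] D[OF that] by (auto split: if_splits)
  have "dwork S (\<lambda>k. fst (t (D k)) k)"
    unfolding dwork_def
  proof (intro ballI allI impI)
    fix k p assume k: "k \<in> S" and p: "prime p" "p dvd k"
    have kp: "k div p \<in> D k" using p(2) by (auto simp: D_def elim!: dvdE)
    have "fst (t (D k)) (k div p) = fst (t (D (k div p))) (k div p)"
      using eq[OF D(1-3)[OF k] kp] by simp
    then show "[fst (t (D k)) k = fst (t (D (k div p))) (k div p)] (mod int (p ^ multiplicity p k))"
      using dworkD[OF gvec_dwork[OF tfst(1)[OF k]] D(4)[OF k] p] by simp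
  qed
  then have y1: "fst y \<in> gvec S" using S by (simp add: y_def cutoff_gvec)
  have y2: "snd y \<in> fvec S"
    using tsnd(1) D(4) by (auto simp: y_def fvec_def cutoff_def)
  have y3: "fst y = (\<lambda>k. 0)" if "q \<noteq> 0"
    using tfst(2) that by (auto simp: y_def cutoff_def fun_eq_iff)
  have y4: "snd y = (\<lambda>k. 0)" if "q \<noteq> 1"
    using tsnd(2) that by (auto simp: y_def cutoff_def fun_eq_iff)
  show ?thesis
  proof (rule ex1I[of _ y])
    have "y \<in> deg model S q"
      using y1 y2 y3 y4 by (cases y) auto
    moreover have "res model S T y = t T" if T: "truncation_set T" "finite T" "T \<subseteq> S" for T
    proof -
      have "t T \<in> gvec T \<times> fvec T" using deg[OF T] T(1) by (auto split: if_splits)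
      then have "fst (t T) k = 0 \<and> snd (t T) k = 0" if "k \<notin> T" for k
        using that by (auto simp: gvec_def fvec_def)
      then show ?thesis
        using eq[OF T] T by (auto simp: y_def cutoff_def fun_eq_iff prod_eq_iff)
    qed
    ultimately show "y \<in> deg model S q \<and> (\<forall>T. truncation_set T \<and> finite T \<and> T \<subseteq> S \<longrightarrow> res model S T y = t T)"
      by blast
  next
    fix z assume z: "z \<in> deg model S q \<and> (\<forall>T. truncation_set T \<and> finite T \<and> T \<subseteq> S \<longrightarrow> res model S T z = t T)"
    then have zz: "z \<in> gvec S \<times> fvec S" using S by (auto split: if_splits)
    have "fst z k = fst y k \<and> snd z k = snd y k" for k
    proof (cases "k \<in> S")
      case True
      have "res model S (D k) z = t (D k)" using z D[OF True] by blast
      then have "fst z k = fst (t (D k)) k \<and> snd z k = snd (t (D k)) k"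
        using D(4)[OF True] by (metis cutoff_def fst_conv snd_conv model_simps(3))
      then show ?thesis using True by (simp add: y_def cutoff_def)
    next
      case False
      then show ?thesis using zz y1 y2 by (auto simp: gvec_def fvec_def)
    qed
    then show "z = y" by (simp add: prod_eq_iff fun_eq_iff)
  qed
qed

text \<open>In bidegree (0, 0) this is \<open>dquot_mult_dact\<close>. In all other cases one of the
  first components vanishes, and then each of the three terms is 0.\<close>

lemma model_leibniz:
  assumes S: "truncation_set S" and x: "x \<in> deg model S q" and y: "y \<in> deg model S q'"
  shows "diff model S (x \<otimes>\<^bsub>obj model S\<^esub> y) =
        diff model S x \<otimes>\<^bsub>obj model S\<^esub> y \<oplus>\<^bsub>obj model S\<^esub>
        [((- 1 :: int) ^ q)] \<cdot>\<^bsub>obj model S\<^esub> (x \<otimes>\<^bsub>obj model S\<^esub> diff model S y)"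
proof -
  interpret cring "model_ring S" using S by (rule cring_model_ring)
  have xc: "x \<in> carrier (model_ring S)" and yc: "y \<in> carrier (model_ring S)"
    using x y S by (auto split: if_splits)
  then have d: "dwork S (fst x)" "dwork S (fst y)" by (auto simp: gvec_dwork)
  show ?thesis
  proof (cases "q = 0 \<and> q' = 0")
    case True
    have dx: "x \<otimes>\<^bsub>model_ring S\<^esub> diff model S y \<in> carrier (model_ring S)"
      using xc d S by (intro m_closed) (simp_all add: cutoff_dquot_fvec)
    have "cutoff S (dquot (\<lambda>k. fst x k * fst y k)) =
       red S (\<lambda>k. red S (dact (fst y) (cutoff S (dquot (fst x)))) k + red S (dact (fst x) (cutoff S (dquot (fst y)))) k)"
      unfolding cutoff_dquot_red[OF S dwork_mult[OF d]]
    proof (rule red_cong)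
      fix k assume k: "k \<in> S"
      have "[dquot (\<lambda>k. fst x k * fst y k) k = dact (fst y) (dquot (fst x)) k + dact (fst x) (dquot (fst y)) k] (mod int k)"
        using dquot_mult_dact[OF S d k] by (simp add: add.commute)
      also have "[dact (fst y) (dquot (fst x)) k + dact (fst x) (dquot (fst y)) k =
        red S (dact (fst y) (cutoff S (dquot (fst x)))) k + red S (dact (fst x) (cutoff S (dquot (fst y)))) k] (mod int k)"
        using k by (intro cong_add cong_sym[OF cong_trans[OF cong_red]]) (simp_all add: dact_cutoff[OF S k])
      finally show "[dquot (\<lambda>k. fst x k * fst y k) k = red S (dact (fst y) (cutoff S (dquot (fst x)))) k +
        red S (dact (fst x) (cutoff S (dquot (fst y)))) k] (mod int k)" .
    qed
    then have "diff model S (x \<otimes>\<^bsub>model_ring S\<^esub> y) =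
        diff model S x \<otimes>\<^bsub>model_ring S\<^esub> y \<oplus>\<^bsub>model_ring S\<^esub> (x \<otimes>\<^bsub>model_ring S\<^esub> diff model S y)"
      by (simp add: red_dact_zero[OF S])
    then show ?thesis using True dx by simp
  next
    case False
    then have z: "fst x = (\<lambda>k. 0) \<or> fst y = (\<lambda>k. 0)" using x y by (auto split: if_splits)
    then have 1: "diff model S (x \<otimes>\<^bsub>model_ring S\<^esub> y) = \<zero>\<^bsub>model_ring S\<^esub>"
      using S by (auto simp: dquot_zero_cutoff)
    have 2: "diff model S x \<otimes>\<^bsub>model_ring S\<^esub> y = \<zero>\<^bsub>model_ring S\<^esub>"
      using z S by (auto simp: dquot_zero_cutoff red_dact_zero)
    have 3: "x \<otimes>\<^bsub>model_ring S\<^esub> diff model S y = \<zero>\<^bsub>model_ring S\<^esub>"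
      using z S by (auto simp: dquot_zero_cutoff red_dact_zero)
    show ?thesis unfolding model_simps(1) 1 2 3 by (simp only: add.int_pow_one r_zero zero_closed)
  qed
qed

lemma model_dlog:
  assumes S: "truncation_set S"
  shows "dlog_minus_one model S = (\<lambda>k. 0, red S dlog_coord)"
proof -
  interpret cring "model_ring S" using S by (rule cring_model_ring)
  let ?g = "cutoff S (\<lambda>k. (-1) ^ k)"
  have d: "dwork S (\<lambda>k. (-1) ^ k)"
    using dwork_subset[OF dwork_power[of "-1"]] truncation_set_pos[OF S] by auto
  have e: "cutoff S (\<lambda>k. ghost k (teich S (-1))) = ?g"
    using S by (auto intro: cutoff_cong)
  have g: "(?g, \<lambda>k. 0) \<in> carrier (model_ring S)"
    using S d by (simp add: cutoff_gvec)
  have gg: "(?g, \<lambda>k. 0) \<otimes>\<^bsub>model_ring S\<^esub> (?g, \<lambda>k. 0) = \<one>\<^bsub>model_ring S\<^esub>"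
    by (auto simp: cutoff_def fun_eq_iff dact_def simp flip: power_mult_distrib)
  then have i: "inv\<^bsub>model_ring S\<^esub> (?g, \<lambda>k. 0) = (?g, \<lambda>k. 0)"
    by (intro comm_inv_char) (use g in auto)
  have "red S (dact ?g (cutoff S (dquot ?g))) = red S dlog_coord"
  proof (rule red_cong)
    fix k assume k: "k \<in> S"
    have "cutoff S (dquot ?g) = cutoff S (dquot (\<lambda>k. (-1) ^ k))"
      by (rule cutoff_cong) (rule dquot_cutoff[OF S])
    then show "[dact ?g (cutoff S (dquot ?g)) k = dlog_coord k] (mod int k)"
      using dact_minus_one[of k] truncation_set_pos[OF S k] by (simp add: dact_cutoff[OF S k])
  qed
  then show ?thesis
    unfolding dlog_minus_one_def model_simps e i by (simp add: red_dact_zero[OF S])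
qed

lemma model_diff_diff:
  assumes S: "truncation_set S"
  shows "diff model S (diff model S x) = dlog_minus_one model S \<otimes>\<^bsub>obj model S\<^esub> diff model S x"
  using S by (simp add: model_dlog dquot_zero_cutoff red_dact_zero)

lemma trunc_quot_1: "truncation_set S \<Longrightarrow> S \<div> 1 = S"
  by (auto simp: trunc_quot_def dest: truncation_set_pos)

lemma model_frob_1:
  assumes S: "truncation_set S" and x: "x \<in> carrier (obj model S)"
  shows "frob model 1 S x = x"
proof -
  have "dfrob 1 w = w" for w by (auto simp: dfrob_def)
  then show ?thesis using x
    by (auto simp: trunc_quot_1[OF S, simplified] cutoff_id red_id)
qed

lemma model_ver_1:
  assumes S: "truncation_set S" and x: "x \<in> carrier (obj model S)"
  shows "ver model 1 S x = x"
proof -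
  have "dver 1 w = w" for w by (auto simp: dver_def)
  then show ?thesis using x by (auto simp: cutoff_id red_id)
qed

lemma model_frob_frob:
  assumes S: "truncation_set S" and m: "0 < m" and n: "0 < n"
  shows "frob model m (S \<div> n) (frob model n S x) = frob model (m * n) S x"
proof -
  have Q: "(S \<div> n) \<div> m = S \<div> (m * n)" using m n by (simp add: trunc_quot_quot mult.commute)
  have "cutoff (S \<div> (m * n)) (\<lambda>k. cutoff (S \<div> n) (\<lambda>k. fst x (n * k)) (m * k)) =
      cutoff (S \<div> (m * n)) (\<lambda>k. fst x (m * n * k))"
  proof (rule cutoff_cong)
    fix k assume "k \<in> S \<div> (m * n)"
    then have "m * k \<in> S \<div> n" unfolding Q[symmetric] by (rule trunc_quotD)
    then show "cutoff (S \<div> n) (\<lambda>k. fst x (n * k)) (m * k) = fst x (m * n * k)"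
      by (simp add: cutoff_def mult_ac)
  qed
  moreover have "red (S \<div> (m * n)) (dfrob m (red (S \<div> n) (dfrob n (snd x)))) =
     red (S \<div> (m * n)) (dfrob (m * n) (snd x))"
  proof (rule red_cong)
    fix k assume k: "k \<in> S \<div> (m * n)"
    then have "m * k \<in> S \<div> n" unfolding Q[symmetric] by (rule trunc_quotD)
    then show "[dfrob m (red (S \<div> n) (dfrob n (snd x))) k = dfrob (m * n) (snd x) k] (mod int k)"
      using cong_trans[OF dfrob_red[OF truncation_set_quot[OF S]] dfrob_dfrob[OF m n]]
        truncation_set_pos[OF truncation_set_quot[OF S] k] by blast
  qed
  ultimately show ?thesis by (simp add: Q)
qed

lemma model_ver_ver:
  assumes S: "truncation_set S" and m: "0 < m" and n: "0 < n"
  shows "ver model n S (ver model m (S \<div> n) x) = ver model (m * n) S x"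
proof -
  have "cutoff S (dver n (cutoff (S \<div> n) (dver m (fst x)))) = cutoff S (dver (m * n) (fst x))"
    by (rule cutoff_cong) (simp add: dver_cutoff[OF S n] dver_dver[OF m n])
  moreover have "red S (dver n (red (S \<div> n) (dver m (snd x)))) = red S (dver (m * n) (snd x))"
    by (rule red_cong) (use dver_red[OF S n, of _ "dver m (snd x)"] in \<open>simp add: dver_dver[OF m n]\<close>)
  ultimately show ?thesis by simp
qed

lemma model_frob_ver:
  assumes S: "truncation_set S" and n: "0 < n" and x: "x \<in> carrier (obj model (S \<div> n))"
  shows "frob model n S (ver model n S x) = [n] \<cdot>\<^bsub>obj model (S \<div> n)\<^esub> x"
proof -
  have "red (S \<div> n) (dfrob n (red S (dver n (snd x)))) = red (S \<div> n) (\<lambda>k. int n * snd x k)"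
    by (rule red_cong) (rule cong_trans[OF dfrob_red[OF S trunc_quotD] dfrob_dver[OF n]])
  moreover have "cutoff (S \<div> n) (\<lambda>k. cutoff S (dver n (fst x)) (n * k)) = (\<lambda>k. int n * fst x k)"
    using x n by (auto simp: cutoff_def dver_def fun_eq_iff gvec_def dest: trunc_quotD)
  ultimately show ?thesis
    using x model_nat_mult[OF truncation_set_quot[OF S], of x n n] by simp
qed

lemma model_frob_ver_coprime:
  assumes S: "truncation_set S" and m: "0 < m" and n: "0 < n" and c: "coprime m n"
  shows "frob model m S (ver model n S x) = ver model n (S \<div> m) (frob model m (S \<div> n) x)"
proof -
  note Sm = truncation_set_quot[OF S, of m]
  have d: "n dvd m * k \<longleftrightarrow> n dvd k" for k
    using c by (simp add: coprime_commute coprime_dvd_mult_right_iff)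
  have Q: "(S \<div> n) \<div> m = (S \<div> m) \<div> n" using m n by (simp add: trunc_quot_quot mult.commute)
  have k': "k div n \<in> (S \<div> n) \<div> m" if "k \<in> S \<div> m" "n dvd k" for k
    unfolding Q by (rule trunc_quotI[OF Sm]) (use that in simp)
  have "cutoff (S \<div> m) (\<lambda>k. cutoff S (dver n (fst x)) (m * k)) =
     cutoff (S \<div> m) (dver n (cutoff ((S \<div> n) \<div> m) (\<lambda>k. fst x (m * k))))"
    using d k' by (intro cutoff_cong) (auto simp: cutoff_def dver_def div_mult_swap dest: trunc_quotD)
  moreover have "red (S \<div> m) (dfrob m (red S (dver n (snd x)))) =
     red (S \<div> m) (dver n (red ((S \<div> n) \<div> m) (dfrob m (snd x))))"
  proof (rule red_cong)
    fix k assume k: "k \<in> S \<div> m"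
    show "[dfrob m (red S (dver n (snd x))) k = dver n (red ((S \<div> n) \<div> m) (dfrob m (snd x))) k] (mod int k)"
      unfolding Q
      by (rule cong_trans[OF dfrob_red[OF S trunc_quotD[OF k]]
        cong_trans[OF dfrob_dver_coprime[OF n m c truncation_set_pos[OF Sm k]] cong_sym[OF dver_red[OF Sm n k]]]])
  qed
  ultimately show ?thesis by simp
qed

lemma model_frob_eta:
  assumes S: "truncation_set S" and n: "0 < n"
  shows "frob model n S (eta model S a) = eta model (S \<div> n) (witt_frob n S a)"
proof -
  have "cutoff (S \<div> n) (\<lambda>k. cutoff S (\<lambda>k. ghost k a) (n * k)) = cutoff (S \<div> n) (\<lambda>k. ghost k (witt_frob n S a))"
    by (rule cutoff_cong) (simp add: ghost_witt_frob[OF S n] cutoff_def trunc_quotD)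
  moreover have "dfrob n (\<lambda>k. 0) = (\<lambda>k. 0)" by (auto simp: dfrob_def)
  ultimately show ?thesis by simp
qed

lemma model_eta_ver:
  assumes S: "truncation_set S" and n: "0 < n"
  shows "eta model S (witt_ver n S a) = ver model n S (eta model (S \<div> n) a)"
proof -
  have "cutoff S (\<lambda>k. ghost k (witt_ver n S a)) = cutoff S (dver n (cutoff (S \<div> n) (\<lambda>k. ghost k a)))"
    by (rule cutoff_cong) (simp add: dver_cutoff[OF S n] ghost_witt_ver[OF S n], simp add: dver_def)
  moreover have "dver n (\<lambda>k. 0) = (\<lambda>k. 0)" by (auto simp: dver_def)
  ultimately show ?thesis by simp
qed

lemma model_projection_formula:
  assumes S: "truncation_set S" and n: "0 < n"
    and x: "x \<in> carrier (obj model S)" and y: "y \<in> carrier (obj model (S \<div> n))"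
  shows "x \<otimes>\<^bsub>obj model S\<^esub> ver model n S y = ver model n S (frob model n S x \<otimes>\<^bsub>obj model (S \<div> n)\<^esub> y)"
proof -
  note Sn = truncation_set_quot[OF S, of n]
  obtain g v h w where [simp]: "x = (g, v)" "y = (h, w)" by (metis surj_pair)
  have g: "dwork S g" and h: "dwork (S \<div> n) h" and g0: "g \<in> gvec S" using x y by (auto simp: gvec_dwork)
  have "(\<lambda>k. g k * cutoff S (dver n h) k) =
    cutoff S (dver n (\<lambda>k. cutoff (S \<div> n) (\<lambda>k. g (n * k)) k * h k))"
  proof
    fix k
    show "g k * cutoff S (dver n h) k = cutoff S (dver n (\<lambda>k. cutoff (S \<div> n) (\<lambda>k. g (n * k)) k * h k)) k"
      using trunc_quotI[OF S, of n "k div n"] by (auto simp: cutoff_def dver_def)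
  qed
  moreover have "red S (\<lambda>k. dact g (red S (dver n w)) k + dact (cutoff S (dver n h)) v k) =
    red S (dver n (red (S \<div> n) (\<lambda>k. dact (cutoff (S \<div> n) (\<lambda>k. g (n * k))) w k + dact h (red (S \<div> n) (dfrob n v)) k)))"
  proof (rule red_cong)
    fix k assume k: "k \<in> S"
    have "[dact g (red S (dver n w)) k + dact (cutoff S (dver n h)) v k =
      dver n (dact (\<lambda>k. g (n * k)) w) k + dver n (dact h (dfrob n v)) k] (mod int k)"
      unfolding dact_cutoff[OF S k]
      by (intro cong_add cong_trans[OF dact_red[OF S k] dact_dver[OF S g n k]] dact_of_dver[OF S h n k])
    also have "dver n (dact (\<lambda>k. g (n * k)) w) k + dver n (dact h (dfrob n v)) k =
      dver n (\<lambda>k. dact (\<lambda>k. g (n * k)) w k + dact h (dfrob n v) k) k"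
      by (simp add: dver_add)
    also have "[dver n (\<lambda>k. dact (\<lambda>k. g (n * k)) w k + dact h (dfrob n v) k) k =
      dver n (red (S \<div> n) (\<lambda>k. dact (cutoff (S \<div> n) (\<lambda>k. g (n * k))) w k + dact h (red (S \<div> n) (dfrob n v)) k)) k] (mod int k)"
    proof (rule dver_cong)
      assume "n dvd k"
      then have j: "k div n \<in> S \<div> n" using k by (intro trunc_quotI[OF S]) simp
      show "[dact (\<lambda>k. g (n * k)) w (k div n) + dact h (dfrob n v) (k div n) =
        red (S \<div> n) (\<lambda>k. dact (cutoff (S \<div> n) (\<lambda>k. g (n * k))) w k + dact h (red (S \<div> n) (dfrob n v)) k) (k div n)]
        (mod int (k div n))"
        by (rule cong_sym, rule cong_trans[OF cong_red[OF j]])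
          (simp only: dact_cutoff[OF Sn j], intro cong_add cong_refl dact_red[OF Sn j])
    qed
    finally show "[dact g (red S (dver n w)) k + dact (cutoff S (dver n h)) v k =
      dver n (red (S \<div> n) (\<lambda>k. dact (cutoff (S \<div> n) (\<lambda>k. g (n * k))) w k + dact h (red (S \<div> n) (dfrob n v)) k)) k] (mod int k)" .
  qed
  ultimately show ?thesis by simp
qed

lemma model_frob_diff_ver:
  assumes S: "truncation_set S" and n: "0 < n" and y: "y \<in> carrier (obj model (S \<div> n))"
  shows "frob model n S (diff model S (ver model n S y)) =
        diff model (S \<div> n) y \<oplus>\<^bsub>obj model (S \<div> n)\<^esub>
        [(n - 1)] \<cdot>\<^bsub>obj model (S \<div> n)\<^esub> (dlog_minus_one model (S \<div> n) \<otimes>\<^bsub>obj model (S \<div> n)\<^esub> y)"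
proof -
  note Sn = truncation_set_quot[OF S, of n]
  interpret cring "model_ring (S \<div> n)" using Sn by (rule cring_model_ring)
  obtain h w where [simp]: "y = (h, w)" by (metis surj_pair)
  have h: "dwork (S \<div> n) h" using y by (auto simp: gvec_dwork)
  have e: "dlog_minus_one model (S \<div> n) \<otimes>\<^bsub>model_ring (S \<div> n)\<^esub> y =
      (\<lambda>k. 0, red (S \<div> n) (dact h (red (S \<div> n) dlog_coord)))"
    by (simp add: model_dlog[OF Sn] red_dact_zero[OF Sn])
  have "[(n - 1)] \<cdot>\<^bsub>model_ring (S \<div> n)\<^esub> (dlog_minus_one model (S \<div> n) \<otimes>\<^bsub>model_ring (S \<div> n)\<^esub> y) =
      (\<lambda>k. 0, red (S \<div> n) (\<lambda>k. int (n - 1) * red (S \<div> n) (dact h (red (S \<div> n) dlog_coord)) k))"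
    unfolding e by (subst model_nat_mult[OF Sn]) (simp_all add: red_fvec[OF Sn])
  moreover have "red (S \<div> n) (dfrob n (cutoff S (dquot (cutoff S (dver n h))))) =
    red (S \<div> n) (\<lambda>k. cutoff (S \<div> n) (dquot h) k + red (S \<div> n) (\<lambda>k. int (n - 1) * red (S \<div> n) (dact h (red (S \<div> n) dlog_coord)) k) k)"
  proof (rule red_cong)
    fix k assume k: "k \<in> S \<div> n"
    have c: "cutoff S (dquot (cutoff S (dver n h))) = cutoff S (dquot (dver n h))"
      by (rule cutoff_cong) (rule dquot_cutoff[OF S])
    have "[int (n - 1) * dact h dlog_coord k =
       red (S \<div> n) (\<lambda>k. int (n - 1) * red (S \<div> n) (dact h (red (S \<div> n) dlog_coord)) k) k] (mod int k)"
      by (rule cong_sym, rule cong_trans[OF cong_red[OF k]], rule cong_scalar_left,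
          rule cong_trans[OF cong_red[OF k, of "dact h (red (S \<div> n) dlog_coord)"] dact_red[OF Sn k]])
    then have "[dquot h k + int (n - 1) * dact h dlog_coord k = cutoff (S \<div> n) (dquot h) k +
       red (S \<div> n) (\<lambda>k. int (n - 1) * red (S \<div> n) (dact h (red (S \<div> n) dlog_coord)) k) k] (mod int k)"
      using k by (intro cong_add) (simp_all add: cutoff_def)
    with dfrob_dquot_dver[OF S h n trunc_quotD[OF k]]
    show "[dfrob n (cutoff S (dquot (cutoff S (dver n h)))) k = cutoff (S \<div> n) (dquot h) k +
       red (S \<div> n) (\<lambda>k. int (n - 1) * red (S \<div> n) (dact h (red (S \<div> n) dlog_coord)) k) k] (mod int k)"
      unfolding c dfrob_cutoff[OF S trunc_quotD[OF k]] by (rule cong_trans)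
  qed
  ultimately show ?thesis by simp
qed

lemma model_frob_diff_teich:
  assumes S: "truncation_set S" and n: "0 < n"
  shows "frob model n S (diff model S (eta model S (teich S a))) =
        eta model (S \<div> n) (teich (S \<div> n) a [^]\<^bsub>witt (S \<div> n)\<^esub> (n - 1)) \<otimes>\<^bsub>obj model (S \<div> n)\<^esub>
        diff model (S \<div> n) (eta model (S \<div> n) (teich (S \<div> n) a))"
proof -
  note Sn = truncation_set_quot[OF S, of n]
  have t: "cutoff S (\<lambda>k. ghost k (teich S a)) = cutoff S (\<lambda>k. a ^ k)" if "truncation_set S" for S
    using that by (intro cutoff_cong) simp
  have p: "cutoff (S \<div> n) (\<lambda>k. ghost k (teich (S \<div> n) a [^]\<^bsub>witt (S \<div> n)\<^esub> (n - 1))) =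
      cutoff (S \<div> n) (\<lambda>k. (a ^ k) ^ (n - 1))"
    using Sn by (intro cutoff_cong) simp
  have c: "cutoff S (dquot (cutoff S g)) = cutoff S (dquot g)" if "truncation_set S" for S g
    by (rule cutoff_cong) (rule dquot_cutoff[OF that])
  have "red (S \<div> n) (dfrob n (cutoff S (dquot (\<lambda>k. a ^ k)))) =
    red (S \<div> n) (dact (cutoff (S \<div> n) (\<lambda>k. (a ^ k) ^ (n - 1))) (cutoff (S \<div> n) (dquot (\<lambda>k. a ^ k))))"
    using dfrob_dquot_power[OF n] truncation_set_pos[OF Sn]
    by (intro red_cong) (simp add: dfrob_cutoff[OF S trunc_quotD] dact_cutoff[OF Sn])
  then show ?thesis
    by (simp only: model_simps model_ring_simps fst_conv snd_conv t[OF S] t[OF Sn] p c[OF S] c[OF Sn])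
      (simp add: red_dact_zero[OF Sn])
qed

lemma model_eta_deg: "truncation_set S \<Longrightarrow> eta model S a \<in> deg model S 0"
  by (simp add: cutoff_gvec dwork_ghost)

lemma model_eta_res:
  assumes "truncation_set T" "T \<subseteq> S"
  shows "res model S T (eta model S a) = eta model T (restrict a T)"
  using assms ghost_restrict[OF assms(1)] by (auto simp: cutoff_def fun_eq_iff)

lemma model_res_id: "x \<in> carrier (obj model S) \<Longrightarrow> res model S S x = x"
  by (auto simp: cutoff_id gvec_def fvec_def cutoff_def fun_eq_iff split: if_splits)

lemma model_res_res: "U \<subseteq> T \<Longrightarrow> res model T U (res model S T x) = res model S U x"
  by (simp add: cutoff_cutoff)

theorem witt_complex_model: "witt_complex model"
proof (rule witt_complex.intro, goal_cases)
  case 6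
  then show ?case by (rule model_limit)
qed (rule model_graded model_res_hom model_res_deg model_res_id model_res_res
    model_eta_hom model_eta_deg model_eta_res model_diff_hom model_diff_deg model_diff_res
    model_frob_hom model_frob_deg model_frob_res model_ver_hom model_ver_deg model_ver_res
    model_leibniz model_diff_diff model_frob_1 model_ver_1 model_frob_frob model_ver_ver
    model_frob_ver model_frob_ver_coprime model_frob_eta model_eta_ver model_projection_formula
    model_frob_diff_ver model_frob_diff_teich; assumption)+

section \<open>Additive maps between rings\<close>

lemma
  assumes R: "ring R" and R': "ring R'" and h: "h \<in> hom (add_monoid R) (add_monoid R')"
  shows add_hom_closed: "x \<in> carrier R \<Longrightarrow> h x \<in> carrier R'"
    and add_hom_add: "x \<in> carrier R \<Longrightarrow> y \<in> carrier R \<Longrightarrow> h (x \<oplus>\<^bsub>R\<^esub> y) = h x \<oplus>\<^bsub>R'\<^esub> h y"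
    and add_hom_zero: "h \<zero>\<^bsub>R\<^esub> = \<zero>\<^bsub>R'\<^esub>"
    and add_hom_uminus: "x \<in> carrier R \<Longrightarrow> h (\<ominus>\<^bsub>R\<^esub> x) = \<ominus>\<^bsub>R'\<^esub> h x"
    and add_hom_nat_mult: "x \<in> carrier R \<Longrightarrow> h ([(n :: nat)] \<cdot>\<^bsub>R\<^esub> x) = [n] \<cdot>\<^bsub>R'\<^esub> h x"
    and add_hom_int_mult: "x \<in> carrier R \<Longrightarrow> h ([(k :: int)] \<cdot>\<^bsub>R\<^esub> x) = [k] \<cdot>\<^bsub>R'\<^esub> h x"
    and add_hom_finsum: "finite I \<Longrightarrow> t \<in> I \<rightarrow> carrier R \<Longrightarrow>
      h (\<Oplus>\<^bsub>R\<^esub>i\<in>I. t i) = (\<Oplus>\<^bsub>R'\<^esub>i\<in>I. h (t i))"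
proof -
  interpret R: ring R by fact
  interpret R': ring R' by fact
  interpret h: group_hom "add_monoid R" "add_monoid R'" h
    by (intro group_hom.intro group_hom_axioms.intro R.add.group_axioms R'.add.group_axioms h)
  show cl: "h x \<in> carrier R'" if "x \<in> carrier R" for x
    using h.hom_closed that by simp
  show add: "h (x \<oplus>\<^bsub>R\<^esub> y) = h x \<oplus>\<^bsub>R'\<^esub> h y" if "x \<in> carrier R" "y \<in> carrier R" for x y
    using h.hom_mult that by simp
  show z: "h \<zero>\<^bsub>R\<^esub> = \<zero>\<^bsub>R'\<^esub>"
    using h.hom_one by simp
  show "h (\<ominus>\<^bsub>R\<^esub> x) = \<ominus>\<^bsub>R'\<^esub> h x" if "x \<in> carrier R" for x
    using h.hom_inv that by (simp add: a_inv_def)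
  show "h ([(n :: nat)] \<cdot>\<^bsub>R\<^esub> x) = [n] \<cdot>\<^bsub>R'\<^esub> h x" if "x \<in> carrier R" for n x
    using h.hom_nat_pow that by (simp add: add_pow_def)
  show "h ([(k :: int)] \<cdot>\<^bsub>R\<^esub> x) = [k] \<cdot>\<^bsub>R'\<^esub> h x" if "x \<in> carrier R" for k x
    using h.hom_int_pow that by (simp add: add_pow_def)
  show "h (\<Oplus>\<^bsub>R\<^esub>i\<in>I. t i) = (\<Oplus>\<^bsub>R'\<^esub>i\<in>I. h (t i))" if "finite I" "t \<in> I \<rightarrow> carrier R"
    using that
  proof (induction I rule: finite_induct)
    case (insert i I)
    then show ?case using cl by (simp add: R.finsum_insert R'.finsum_insert add Pi_def)
  qed (simp add: z)
qed

lemma ring_hom_add_hom: "h \<in> ring_hom R R' \<Longrightarrow> h \<in> hom (add_monoid R) (add_monoid R')"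
  by (auto simp: ring_hom_def hom_def)

section \<open>Relations in an arbitrary Witt complex\<close>

lemma lcm_div_gcd:
  fixes m n :: nat
  assumes "0 < m" "0 < n"
  defines "m' \<equiv> m div gcd m n" and "n' \<equiv> n div gcd m n"
  shows "m = gcd m n * m'" "n = gcd m n * n'" "coprime m' n'" "lcm m n div m = n'" "lcm m n = m * n'"
    "0 < m'" "0 < n'" "0 < gcd m n"
proof -
  show 1: "m = gcd m n * m'" "n = gcd m n * n'" "coprime m' n'" "0 < gcd m n"
    using assms div_gcd_coprime[of m n] by (simp_all add: m'_def n'_def)
  show 2: "lcm m n = m * n'" using assms by (simp add: lcm_nat_def n'_def div_mult_swap)
  then show "lcm m n div m = n'" using assms by simp
  show "0 < m'" "0 < n'" using 1 assms by (metis mult_0_right neq0_conv)+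
qed

context witt_complex
begin

lemma ring_obj: "truncation_set S \<Longrightarrow> ring (obj E S)"
  by (rule anticomm_graded_ring.axioms(1)[OF graded])

lemma deg_carrier: "truncation_set S \<Longrightarrow> x \<in> deg E S q \<Longrightarrow> x \<in> carrier (obj E S)"
  using anticomm_graded_ring.degree_subgroup[OF graded, of S q] subgroup.subset by fastforce

lemma deg_add: "truncation_set S \<Longrightarrow> x \<in> deg E S q \<Longrightarrow> y \<in> deg E S q \<Longrightarrow> x \<oplus>\<^bsub>obj E S\<^esub> y \<in> deg E S q"
  using anticomm_graded_ring.degree_subgroup[OF graded, of S q] subgroup.m_closed by fastforce

lemma deg_one: "truncation_set S \<Longrightarrow> \<one>\<^bsub>obj E S\<^esub> \<in> deg E S 0"
  by (rule anticomm_graded_ring.one_degree[OF graded])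

lemma deg_zero: "truncation_set S \<Longrightarrow> \<zero>\<^bsub>obj E S\<^esub> \<in> deg E S q"
  using anticomm_graded_ring.degree_subgroup[OF graded, of S q] subgroup.one_closed by fastforce

lemma deg_int_mult:
  assumes "truncation_set S" "x \<in> deg E S q"
  shows "[(k :: int)] \<cdot>\<^bsub>obj E S\<^esub> x \<in> deg E S q"
proof -
  interpret ring "obj E S" using assms by (intro ring_obj)
  show ?thesis
    using add.subgroup_int_pow_closed[OF anticomm_graded_ring.degree_subgroup[OF graded[OF assms(1)]] assms(2)]
    by simp
qed

lemma deg_mult: "truncation_set S \<Longrightarrow> x \<in> deg E S p \<Longrightarrow> y \<in> deg E S q \<Longrightarrow> x \<otimes>\<^bsub>obj E S\<^esub> y \<in> deg E S (p + q)"
  by (rule anticomm_graded_ring.mult_degree[OF graded])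

lemma deg_0_comm:
  assumes S: "truncation_set S" and x: "x \<in> deg E S 0" and y: "y \<in> deg E S q"
  shows "x \<otimes>\<^bsub>obj E S\<^esub> y = y \<otimes>\<^bsub>obj E S\<^esub> x"
proof -
  interpret ring "obj E S" using S by (rule ring_obj)
  show ?thesis
    using anticomm_graded_ring.anticomm[OF graded[OF S] x y] deg_carrier[OF S x] deg_carrier[OF S y] by simp
qed

lemma diff_closed: "truncation_set S \<Longrightarrow> x \<in> carrier (obj E S) \<Longrightarrow> diff E S x \<in> carrier (obj E S)"
  by (rule add_hom_closed[OF ring_obj ring_obj diff_hom])

lemma ver_closed: "truncation_set S \<Longrightarrow> 0 < n \<Longrightarrow> x \<in> carrier (obj E (S \<div> n)) \<Longrightarrow> ver E n S x \<in> carrier (obj E S)"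
  by (intro add_hom_closed[OF ring_obj ring_obj ver_hom] truncation_set_quot)

lemma frob_add_hom: "truncation_set S \<Longrightarrow> 0 < n \<Longrightarrow>
    frob E n S \<in> hom (add_monoid (obj E S)) (add_monoid (obj E (S \<div> n)))"
  by (intro ring_hom_add_hom frob_hom)

lemma frob_closed: "truncation_set S \<Longrightarrow> 0 < n \<Longrightarrow> x \<in> carrier (obj E S) \<Longrightarrow> frob E n S x \<in> carrier (obj E (S \<div> n))"
  by (intro ring_hom_closed[OF frob_hom])

lemma res_add_hom: "truncation_set S \<Longrightarrow> truncation_set T \<Longrightarrow> T \<subseteq> S \<Longrightarrow>
    res E S T \<in> hom (add_monoid (obj E S)) (add_monoid (obj E T))"
  by (intro ring_hom_add_hom res_hom)

lemma frob_mult: "truncation_set S \<Longrightarrow> 0 < n \<Longrightarrow> x \<in> carrier (obj E S) \<Longrightarrow> y \<in> carrier (obj E S) \<Longrightarrow>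
    frob E n S (x \<otimes>\<^bsub>obj E S\<^esub> y) = frob E n S x \<otimes>\<^bsub>obj E (S \<div> n)\<^esub> frob E n S y"
  by (intro ring_hom_mult[OF frob_hom])

lemma frob_one: "truncation_set S \<Longrightarrow> 0 < n \<Longrightarrow> frob E n S \<one>\<^bsub>obj E S\<^esub> = \<one>\<^bsub>obj E (S \<div> n)\<^esub>"
  by (intro ring_hom_one[OF frob_hom])

lemma eta_one: "truncation_set S \<Longrightarrow> eta E S (teich S 1) = \<one>\<^bsub>obj E S\<^esub>"
  using ring_hom_one[OF eta_hom] by (simp add: witt_one_eq)

lemma ver_one_eq: "truncation_set S \<Longrightarrow> ver_one E S n = ver E n S \<one>\<^bsub>obj E (S \<div> n)\<^esub>"
  by (simp add: ver_one_def eta_one truncation_set_quot)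

lemma one_closed': "truncation_set S \<Longrightarrow> \<one>\<^bsub>obj E S\<^esub> \<in> carrier (obj E S)"
  by (intro deg_carrier[OF _ deg_one])

lemma ver_one_deg: "truncation_set S \<Longrightarrow> 0 < n \<Longrightarrow> ver_one E S n \<in> deg E S 0"
  by (simp add: ver_one_eq ver_deg deg_one truncation_set_quot)

lemma ver_one_closed: "truncation_set S \<Longrightarrow> 0 < n \<Longrightarrow> ver_one E S n \<in> carrier (obj E S)"
  by (intro deg_carrier[OF _ ver_one_deg])

lemma diff_ver_one_deg: "truncation_set S \<Longrightarrow> 0 < n \<Longrightarrow> diff E S (ver_one E S n) \<in> deg E S 1"
  using diff_deg[OF _ ver_one_deg] by simp

lemma diff_ver_one_closed: "truncation_set S \<Longrightarrow> 0 < n \<Longrightarrow> diff E S (ver_one E S n) \<in> carrier (obj E S)"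
  by (intro diff_closed ver_one_closed)

lemma ver_ver_one:
  assumes "truncation_set S" "0 < m" "0 < n"
  shows "ver E m S (ver_one E (S \<div> m) n) = ver_one E S (m * n)"
  using ver_ver[OF assms(1,3,2) one_closed'[OF truncation_set_quot[OF assms(1)]]] assms
  by (simp add: ver_one_eq truncation_set_quot trunc_quot_quot mult.commute)

text \<open>Over the empty set 0 and 1 coincide as Witt vectors, so 0 = 1 in the ring. As S \<div> n
  is empty for n outside S, this is the reason why V_n vanishes for such n.\<close>

lemma trivial_obj:
  assumes "x \<in> carrier (obj E {})"
  shows "x = \<zero>\<^bsub>obj E {}\<^esub>"
proof -
  have S: "truncation_set {}" by (simp add: truncation_set_def)
  interpret ring "obj E {}" using S by (rule ring_obj)
  interpret W: cring "witt {}" using S by (rule ring_witt)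
  have "\<one>\<^bsub>witt {}\<^esub> = \<zero>\<^bsub>witt {}\<^esub>"
    by (rule ghost_inj[OF S witt_closed(3)[OF S] witt_closed(4)[OF S]]) simp
  moreover have "eta E {} \<zero>\<^bsub>witt {}\<^esub> = \<zero>\<^bsub>obj E {}\<^esub>"
    by (rule add_hom_zero[OF W.ring_axioms ring_axioms ring_hom_add_hom[OF eta_hom[OF S]]])
  moreover have "eta E {} \<one>\<^bsub>witt {}\<^esub> = \<one>\<^bsub>obj E {}\<^esub>" using ring_hom_one[OF eta_hom[OF S]] .
  ultimately have "\<one>\<^bsub>obj E {}\<^esub> = \<zero>\<^bsub>obj E {}\<^esub>" by simp
  then show ?thesis using assms by (metis l_one l_null)
qed

lemma trunc_quot_empty: "truncation_set S \<Longrightarrow> n \<notin> S \<Longrightarrow> S \<div> n = {}"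
  unfolding trunc_quot_def using truncation_set_dvd[of S _ n] dvd_triv_left[of n] by blast

lemma ver_outside:
  assumes S: "truncation_set S" and n: "0 < n" "n \<notin> S" and x: "x \<in> carrier (obj E (S \<div> n))"
  shows "ver E n S x = \<zero>\<^bsub>obj E S\<^esub>"
proof -
  have "truncation_set {}" by (simp add: truncation_set_def)
  then show ?thesis
    using trivial_obj[of x] x add_hom_zero[OF ring_obj ring_obj ver_hom[OF S n(1)]] S
    by (simp add: trunc_quot_empty[OF S n(2)])
qed

lemma ver_one_outside: "truncation_set S \<Longrightarrow> 0 < n \<Longrightarrow> n \<notin> S \<Longrightarrow> ver_one E S n = \<zero>\<^bsub>obj E S\<^esub>"
  by (simp add: ver_one_eq ver_outside one_closed' truncation_set_quot)

lemma diff_zero: "truncation_set S \<Longrightarrow> diff E S \<zero>\<^bsub>obj E S\<^esub> = \<zero>\<^bsub>obj E S\<^esub>"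
  by (rule add_hom_zero[OF ring_obj ring_obj diff_hom])

lemma diff_ver_one_outside: "truncation_set S \<Longrightarrow> 0 < n \<Longrightarrow> n \<notin> S \<Longrightarrow> diff E S (ver_one E S n) = \<zero>\<^bsub>obj E S\<^esub>"
  by (simp add: ver_one_outside diff_zero)

lemma leibniz_0:
  assumes S: "truncation_set S" and x: "x \<in> deg E S 0" and y: "y \<in> deg E S q"
  shows "diff E S (x \<otimes>\<^bsub>obj E S\<^esub> y) = diff E S x \<otimes>\<^bsub>obj E S\<^esub> y \<oplus>\<^bsub>obj E S\<^esub> x \<otimes>\<^bsub>obj E S\<^esub> diff E S y"
proof -
  interpret ring "obj E S" using S by (rule ring_obj)
  have "x \<otimes>\<^bsub>obj E S\<^esub> diff E S y \<in> carrier (obj E S)"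
    using deg_carrier[OF S x] diff_closed[OF S deg_carrier[OF S y]] by simp
  then have "[((- 1 :: int) ^ 0)] \<cdot>\<^bsub>obj E S\<^esub> (x \<otimes>\<^bsub>obj E S\<^esub> diff E S y) = x \<otimes>\<^bsub>obj E S\<^esub> diff E S y"
    by simp
  then show ?thesis
    by (simp only: leibniz[OF S x y])
qed

lemma diff_one:
  assumes S: "truncation_set S"
  shows "diff E S \<one>\<^bsub>obj E S\<^esub> = \<zero>\<^bsub>obj E S\<^esub>"
proof -
  interpret ring "obj E S" using S by (rule ring_obj)
  have c: "diff E S \<one>\<^bsub>obj E S\<^esub> \<in> carrier (obj E S)" using S by (simp add: diff_closed)
  have "diff E S \<one>\<^bsub>obj E S\<^esub> = diff E S \<one>\<^bsub>obj E S\<^esub> \<oplus>\<^bsub>obj E S\<^esub> diff E S \<one>\<^bsub>obj E S\<^esub>"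
    using leibniz_0[OF S deg_one[OF S] deg_one[OF S]] c by simp
  then show ?thesis using c by (metis add.r_cancel_one)
qed

lemma frob_ver_one_self:
  assumes S: "truncation_set S" and n: "0 < n"
  shows "frob E n S (ver_one E S n) = [n] \<cdot>\<^bsub>obj E (S \<div> n)\<^esub> \<one>\<^bsub>obj E (S \<div> n)\<^esub>"
  using frob_ver[OF S n one_closed'[OF truncation_set_quot[OF S]]] by (simp add: ver_one_eq[OF S])

lemma mult_ver_one:
  assumes S: "truncation_set S" and n: "0 < n" and x: "x \<in> carrier (obj E S)"
  shows "x \<otimes>\<^bsub>obj E S\<^esub> ver_one E S n = ver E n S (frob E n S x)"
proof -
  interpret Q: ring "obj E (S \<div> n)" using S by (intro ring_obj truncation_set_quot)
  show ?thesis
    using projection_formula[OF S n x Q.one_closed] frob_closed[OF S n x] by (simp add: ver_one_eq[OF S])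
qed

subsection \<open>The class of \<open>-1\<close>\<close>

definition minus_one :: "nat set \<Rightarrow> 'u" where
  "minus_one S = eta E S (teich S (- 1))"

abbreviation eps :: "nat set \<Rightarrow> 'u" where
  "eps S \<equiv> dlog_minus_one E S"

lemma minus_one_deg: "truncation_set S \<Longrightarrow> minus_one S \<in> deg E S 0"
  by (simp add: minus_one_def eta_deg)

lemma minus_one_square:
  assumes S: "truncation_set S"
  shows "minus_one S \<otimes>\<^bsub>obj E S\<^esub> minus_one S = \<one>\<^bsub>obj E S\<^esub>"
proof -
  have "teich S (-1) \<otimes>\<^bsub>witt S\<^esub> teich S (-1) = \<one>\<^bsub>witt S\<^esub>"
    using S by (intro ghost_inj[OF S]) (simp_all flip: power_mult_distrib)
  then show ?thesis
    using ring_hom_mult[OF eta_hom[OF S], of "teich S (-1)" "teich S (-1)"] ring_hom_one[OF eta_hom[OF S]]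
    by (simp add: minus_one_def)
qed

text \<open>Ghost components decide: (-1)^n is -1 for odd n and -1 + 2 for even n.\<close>

lemma minus_one_eq:
  assumes S: "truncation_set S"
  shows "minus_one S = \<ominus>\<^bsub>obj E S\<^esub> \<one>\<^bsub>obj E S\<^esub> \<oplus>\<^bsub>obj E S\<^esub> ver_one E S 2"
proof -
  interpret W: cring "witt S" using S by (rule ring_witt)
  note hom = ring_hom_add_hom[OF eta_hom[OF S]]
  have c: "\<ominus>\<^bsub>witt S\<^esub> \<one>\<^bsub>witt S\<^esub> \<in> carrier (witt S)" by (rule W.a_inv_closed[OF W.one_closed])
  have v: "witt_ver 2 S (teich (S \<div> 2) 1) \<in> carrier (witt S)" by (simp add: witt_ver_closed)
  have "teich S (-1) = \<ominus>\<^bsub>witt S\<^esub> \<one>\<^bsub>witt S\<^esub> \<oplus>\<^bsub>witt S\<^esub> witt_ver 2 S (teich (S \<div> 2) 1)"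
  proof (rule ghost_inj[OF S])
    fix n assume n: "n \<in> S"
    have "even n \<Longrightarrow> ghost (n div 2) (teich (S \<div> 2) 1) = 1"
      using S n by (subst ghost_teich[OF truncation_set_quot[OF S] trunc_quotI[OF S]]) simp_all
    then show "ghost n (teich S (-1)) = ghost n (\<ominus>\<^bsub>witt S\<^esub> \<one>\<^bsub>witt S\<^esub> \<oplus>\<^bsub>witt S\<^esub> witt_ver 2 S (teich (S \<div> 2) 1))"
      using S n W.one_closed by (simp add: ghost_witt_ver minus_one_power_iff)
  qed (use S in \<open>simp_all\<close>)
  then show ?thesis
    using add_hom_add[OF W.ring_axioms ring_obj[OF S] hom c v]
      add_hom_uminus[OF W.ring_axioms ring_obj[OF S] hom W.one_closed] ring_hom_one[OF eta_hom[OF S]]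
      eta_ver[OF S, of 2 "teich (S \<div> 2) 1"]
    by (simp add: minus_one_def ver_one_def)
qed

lemma inv_minus_one:
  assumes S: "truncation_set S"
  shows "inv\<^bsub>obj E S\<^esub> minus_one S = minus_one S"
proof -
  interpret ring "obj E S" using S by (rule ring_obj)
  show ?thesis
    using minus_one_square[OF S] deg_carrier[OF S minus_one_deg[OF S]] by (intro inv_char) auto
qed

lemma eps_eq: "truncation_set S \<Longrightarrow> eps S = minus_one S \<otimes>\<^bsub>obj E S\<^esub> diff E S (minus_one S)"
  by (simp add: dlog_minus_one_def inv_minus_one flip: minus_one_def)

lemma eps_deg: "truncation_set S \<Longrightarrow> eps S \<in> deg E S 1"
  using deg_mult[OF _ minus_one_deg diff_deg[OF _ minus_one_deg]] by (simp add: eps_eq)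

lemma eps_closed: "truncation_set S \<Longrightarrow> eps S \<in> carrier (obj E S)"
  by (intro deg_carrier[OF _ eps_deg])

text \<open>Differentiate [-1]^2 = 1 and cancel the unit [-1].\<close>

lemma diff_minus_one_double:
  assumes S: "truncation_set S"
  shows "diff E S (minus_one S) \<oplus>\<^bsub>obj E S\<^esub> diff E S (minus_one S) = \<zero>\<^bsub>obj E S\<^esub>"
proof -
  interpret ring "obj E S" using S by (rule ring_obj)
  let ?u = "minus_one S" and ?d = "diff E S (minus_one S)"
  have u: "?u \<in> carrier (obj E S)" using deg_carrier[OF S minus_one_deg[OF S]] .
  have d: "?d \<in> carrier (obj E S)" using diff_closed[OF S u] .
  have "\<zero>\<^bsub>obj E S\<^esub> = diff E S (?u \<otimes>\<^bsub>obj E S\<^esub> ?u)" by (simp add: minus_one_square[OF S] diff_one[OF S])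
  also have "\<dots> = ?d \<otimes>\<^bsub>obj E S\<^esub> ?u \<oplus>\<^bsub>obj E S\<^esub> ?u \<otimes>\<^bsub>obj E S\<^esub> ?d"
    by (rule leibniz_0[OF S minus_one_deg[OF S] minus_one_deg[OF S]])
  also have "?d \<otimes>\<^bsub>obj E S\<^esub> ?u = ?u \<otimes>\<^bsub>obj E S\<^esub> ?d"
    using deg_0_comm[OF S minus_one_deg[OF S] diff_deg[OF S minus_one_deg[OF S]]] by simp
  also have "?u \<otimes>\<^bsub>obj E S\<^esub> ?d \<oplus>\<^bsub>obj E S\<^esub> ?u \<otimes>\<^bsub>obj E S\<^esub> ?d = ?u \<otimes>\<^bsub>obj E S\<^esub> (?d \<oplus>\<^bsub>obj E S\<^esub> ?d)" using u d by (simp add: r_distr)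
  finally have "?u \<otimes>\<^bsub>obj E S\<^esub> \<zero>\<^bsub>obj E S\<^esub> = ?u \<otimes>\<^bsub>obj E S\<^esub> (?u \<otimes>\<^bsub>obj E S\<^esub> (?d \<oplus>\<^bsub>obj E S\<^esub> ?d))" by simp
  also have "\<dots> = (?u \<otimes>\<^bsub>obj E S\<^esub> ?u) \<otimes>\<^bsub>obj E S\<^esub> (?d \<oplus>\<^bsub>obj E S\<^esub> ?d)" using u d by (simp add: m_assoc)
  also have "\<dots> = ?d \<oplus>\<^bsub>obj E S\<^esub> ?d" using d by (simp add: minus_one_square[OF S])
  finally show ?thesis using u by simp
qed

lemma eps_double:
  assumes S: "truncation_set S"
  shows "eps S \<oplus>\<^bsub>obj E S\<^esub> eps S = \<zero>\<^bsub>obj E S\<^esub>"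
proof -
  interpret ring "obj E S" using S by (rule ring_obj)
  have u: "minus_one S \<in> carrier (obj E S)" using deg_carrier[OF S minus_one_deg[OF S]] .
  then show ?thesis
    using diff_minus_one_double[OF S] diff_closed[OF S u] by (simp add: eps_eq[OF S] flip: r_distr)
qed

text \<open>For u = [-1], axiom (i) gives u d(du) = u^2 (du)^2 = (du)^2. Together with the other
  Leibniz term (du)^2 this is 2 (du)^2 = 0.\<close>

lemma diff_eps:
  assumes S: "truncation_set S"
  shows "diff E S (eps S) = \<zero>\<^bsub>obj E S\<^esub>"
proof -
  interpret ring "obj E S" using S by (rule ring_obj)
  let ?u = "minus_one S" and ?d = "diff E S (minus_one S)"
  have u: "?u \<in> carrier (obj E S)" using deg_carrier[OF S minus_one_deg[OF S]] .
  have d: "?d \<in> carrier (obj E S)" using diff_closed[OF S u] .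
  have "diff E S (eps S) = ?d \<otimes>\<^bsub>obj E S\<^esub> ?d \<oplus>\<^bsub>obj E S\<^esub> ?u \<otimes>\<^bsub>obj E S\<^esub> diff E S ?d"
    unfolding eps_eq[OF S] by (rule leibniz_0[OF S minus_one_deg[OF S] diff_deg[OF S minus_one_deg[OF S]]])
  also have "diff E S ?d = (?u \<otimes>\<^bsub>obj E S\<^esub> ?d) \<otimes>\<^bsub>obj E S\<^esub> ?d" using diff_diff[OF S u] by (simp add: eps_eq[OF S])
  also have "?u \<otimes>\<^bsub>obj E S\<^esub> ((?u \<otimes>\<^bsub>obj E S\<^esub> ?d) \<otimes>\<^bsub>obj E S\<^esub> ?d) = (?u \<otimes>\<^bsub>obj E S\<^esub> ?u) \<otimes>\<^bsub>obj E S\<^esub> (?d \<otimes>\<^bsub>obj E S\<^esub> ?d)" using u d by (simp add: m_assoc)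
  also have "?d \<otimes>\<^bsub>obj E S\<^esub> ?d \<oplus>\<^bsub>obj E S\<^esub> (?u \<otimes>\<^bsub>obj E S\<^esub> ?u) \<otimes>\<^bsub>obj E S\<^esub> (?d \<otimes>\<^bsub>obj E S\<^esub> ?d) = (?d \<oplus>\<^bsub>obj E S\<^esub> ?d) \<otimes>\<^bsub>obj E S\<^esub> ?d"
    using d by (simp add: minus_one_square[OF S] l_distr)
  also have "\<dots> = \<zero>\<^bsub>obj E S\<^esub>" using d by (simp add: diff_minus_one_double[OF S])
  finally show ?thesis .
qed

lemma eta_nat_pow:
  assumes S: "truncation_set S" and a: "a \<in> carrier (witt S)"
  shows "eta E S (a [^]\<^bsub>witt S\<^esub> (n :: nat)) = eta E S a [^]\<^bsub>obj E S\<^esub> n"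
proof -
  interpret W: cring "witt S" using S by (rule ring_witt)
  show ?thesis
    by (induction n) (use a ring_hom_one[OF eta_hom[OF S]] ring_hom_mult[OF eta_hom[OF S] W.nat_pow_closed[OF a] a] in simp_all)
qed

text \<open>For u = [-1] one has F_n(u) = u^n and, by axiom (v), F_n(du) = u^(n-1) du. The product
  is u^(2n-1) du = u du because u^2 = 1.\<close>

lemma frob_eps:
  assumes S: "truncation_set S" and n: "0 < n"
  shows "frob E n S (eps S) = eps (S \<div> n)"
proof -
  note Sn = truncation_set_quot[OF S, of n]
  interpret ring "obj E (S \<div> n)" using Sn by (rule ring_obj)
  interpret W: cring "witt (S \<div> n)" using Sn by (rule ring_witt)
  let ?u = "minus_one (S \<div> n)" and ?d = "diff E (S \<div> n) (minus_one (S \<div> n))"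
  have u: "?u \<in> carrier (obj E (S \<div> n))" using deg_carrier[OF Sn minus_one_deg[OF Sn]] .
  have d: "?d \<in> carrier (obj E (S \<div> n))" using diff_closed[OF Sn u] .
  have u0: "minus_one S \<in> carrier (obj E S)" using deg_carrier[OF S minus_one_deg[OF S]] .
  have "witt_frob n S (teich S (-1)) = teich (S \<div> n) (-1) [^]\<^bsub>witt (S \<div> n)\<^esub> n"
  proof (rule ghost_inj[OF Sn])
    fix k assume k: "k \<in> S \<div> n"
    then show "ghost k (witt_frob n S (teich S (-1))) = ghost k (teich (S \<div> n) (-1) [^]\<^bsub>witt (S \<div> n)\<^esub> n)"
      using S Sn n trunc_quotD[OF k] by (simp add: ghost_witt_frob mult.commute flip: power_mult)
  qed (use S n W.nat_pow_closed[of "teich (S \<div> n) (-1)" n] in \<open>simp_all add: witt_frob_closed\<close>)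
  then have fu: "frob E n S (minus_one S) = ?u [^]\<^bsub>obj E (S \<div> n)\<^esub> n"
    using frob_eta[OF S n, of "teich S (-1)"] eta_nat_pow[OF Sn, of "teich (S \<div> n) (-1)" n]
    by (simp add: minus_one_def)
  have fd: "frob E n S (diff E S (minus_one S)) = ?u [^]\<^bsub>obj E (S \<div> n)\<^esub> (n - 1) \<otimes>\<^bsub>obj E (S \<div> n)\<^esub> ?d"
    using frob_diff_teich[OF S n, of "-1"] eta_nat_pow[OF Sn, of "teich (S \<div> n) (-1)" "n - 1"]
    by (simp add: minus_one_def)
  obtain m where m: "n = Suc m" using n by (cases n) auto
  have "frob E n S (eps S) = frob E n S (minus_one S) \<otimes>\<^bsub>obj E (S \<div> n)\<^esub> frob E n S (diff E S (minus_one S))"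
    unfolding eps_eq[OF S] by (rule frob_mult[OF S n u0 diff_closed[OF S u0]])
  also have "\<dots> = (?u [^]\<^bsub>obj E (S \<div> n)\<^esub> n \<otimes>\<^bsub>obj E (S \<div> n)\<^esub> ?u [^]\<^bsub>obj E (S \<div> n)\<^esub> (n - 1)) \<otimes>\<^bsub>obj E (S \<div> n)\<^esub> ?d"
    using u d by (simp add: fu fd m_assoc)
  also have "?u [^]\<^bsub>obj E (S \<div> n)\<^esub> n \<otimes>\<^bsub>obj E (S \<div> n)\<^esub> ?u [^]\<^bsub>obj E (S \<div> n)\<^esub> (n - 1) = ?u [^]\<^bsub>obj E (S \<div> n)\<^esub> (2 * m + 1)"
  proof -
    have "n + (n - 1) = 2 * m + 1" by (simp add: m)
    then show ?thesis by (simp only: nat_pow_mult[OF u])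
  qed
  also have "\<dots> = ?u"
  proof -
    have "?u [^]\<^bsub>obj E (S \<div> n)\<^esub> (2 :: nat) = \<one>\<^bsub>obj E (S \<div> n)\<^esub>"
      using u minus_one_square[OF Sn] by (simp add: numeral_2_eq_2)
    then have "?u [^]\<^bsub>obj E (S \<div> n)\<^esub> (2 * m) = \<one>\<^bsub>obj E (S \<div> n)\<^esub>"
      using nat_pow_pow[OF u, of 2 m] by simp
    then show ?thesis using u by simp
  qed
  finally show ?thesis by (simp add: eps_eq[OF Sn])
qed

lemma eps_mult_ver_one:
  assumes S: "truncation_set S" and n: "0 < n"
  shows "eps S \<otimes>\<^bsub>obj E S\<^esub> ver_one E S n = ver E n S (eps (S \<div> n))"
  by (simp add: mult_ver_one[OF S n eps_closed[OF S]] frob_eps[OF S n])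

lemma even_mult_eps:
  assumes S: "truncation_set S" and y: "y \<in> carrier (obj E S)" and k: "even k"
  shows "[(k :: nat)] \<cdot>\<^bsub>obj E S\<^esub> (eps S \<otimes>\<^bsub>obj E S\<^esub> y) = \<zero>\<^bsub>obj E S\<^esub>"
proof -
  interpret ring "obj E S" using S by (rule ring_obj)
  obtain i where i: "k = 2 * i" using k by blast
  have "[(2 :: nat)] \<cdot>\<^bsub>obj E S\<^esub> (eps S \<otimes>\<^bsub>obj E S\<^esub> y) = (eps S \<oplus>\<^bsub>obj E S\<^esub> eps S) \<otimes>\<^bsub>obj E S\<^esub> y"
    using y eps_closed[OF S] by (simp add: numeral_2_eq_2 l_distr)
  then have "[(2 :: nat)] \<cdot>\<^bsub>obj E S\<^esub> (eps S \<otimes>\<^bsub>obj E S\<^esub> y) = \<zero>\<^bsub>obj E S\<^esub>" using y by (simp add: eps_double[OF S])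
  then show ?thesis
    using y eps_closed[OF S] by (simp add: i add.nat_pow_pow[symmetric])
qed

subsection \<open>The basic relations\<close>

lemma frob_diff_ver_one_self:
  assumes S: "truncation_set S" and n: "0 < n"
  shows "frob E n S (diff E S (ver_one E S n)) = [(n - 1)] \<cdot>\<^bsub>obj E (S \<div> n)\<^esub> eps (S \<div> n)"
proof -
  note Sn = truncation_set_quot[OF S, of n]
  interpret ring "obj E (S \<div> n)" using Sn by (rule ring_obj)
  show ?thesis
    using frob_diff_ver[OF S n one_closed] eps_closed[OF Sn] by (simp add: ver_one_eq[OF S] diff_one[OF Sn])
qed

text \<open>Write n V_n(y) as V_n(y) V_n(1) and apply d. The two Leibniz terms are V_n of F_n
  dV_n(y) and V_n of F_n dV_n(1) y. By axiom (iv) they contribute V_n(dy) and twice the element (n -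
  1) V_n(\<epsilon> y), and the latter doubles to 0.\<close>

lemma ver_diff:
  assumes S: "truncation_set S" and n: "0 < n" and y: "y \<in> deg E (S \<div> n) 0"
  shows "ver E n S (diff E (S \<div> n) y) = [n] \<cdot>\<^bsub>obj E S\<^esub> diff E S (ver E n S y)"
proof -
  note Sn = truncation_set_quot[OF S, of n]
  interpret R: ring "obj E S" using S by (rule ring_obj)
  interpret Q: ring "obj E (S \<div> n)" using Sn by (rule ring_obj)
  note hom = ver_hom[OF S n]
  let ?V = "ver E n S" and ?e = "eps (S \<div> n) \<otimes>\<^bsub>obj E (S \<div> n)\<^esub> y"
  have yc: "y \<in> carrier (obj E (S \<div> n))" using deg_carrier[OF Sn y] .
  have dy: "diff E (S \<div> n) y \<in> carrier (obj E (S \<div> n))" using diff_closed[OF Sn yc] .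
  have ec: "?e \<in> carrier (obj E (S \<div> n))" using yc eps_closed[OF Sn] by simp
  have Vy: "?V y \<in> carrier (obj E S)" "?V y \<in> deg E S 0" using ver_closed[OF S n yc] ver_deg[OF S n y] .
  have dV: "diff E S (?V y) \<in> carrier (obj E S)" using diff_closed[OF S Vy(1)] .
  have 1: "diff E S (?V y) \<otimes>\<^bsub>obj E S\<^esub> ver_one E S n = ?V (diff E (S \<div> n) y) \<oplus>\<^bsub>obj E S\<^esub> [(n - 1)] \<cdot>\<^bsub>obj E S\<^esub> ?V ?e"
    using dy ec by (simp add: mult_ver_one[OF S n dV] frob_diff_ver[OF S n yc]
        add_hom_add[OF ring_obj[OF Sn] ring_obj[OF S] hom] add_hom_nat_mult[OF ring_obj[OF Sn] ring_obj[OF S] hom])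
  have "?V y \<otimes>\<^bsub>obj E S\<^esub> diff E S (ver_one E S n) = diff E S (ver_one E S n) \<otimes>\<^bsub>obj E S\<^esub> ?V y"
    by (rule deg_0_comm[OF S Vy(2) diff_ver_one_deg[OF S n]])
  also have "\<dots> = ?V (([(n - 1)] \<cdot>\<^bsub>obj E (S \<div> n)\<^esub> eps (S \<div> n)) \<otimes>\<^bsub>obj E (S \<div> n)\<^esub> y)"
    by (simp add: projection_formula[OF S n diff_ver_one_closed[OF S n] yc] frob_diff_ver_one_self[OF S n])
  also have "\<dots> = [(n - 1)] \<cdot>\<^bsub>obj E S\<^esub> ?V ?e"
    using yc ec eps_closed[OF Sn] by (simp add: Q.add_pow_ldistr add_hom_nat_mult[OF ring_obj[OF Sn] ring_obj[OF S] hom])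
  finally have 2: "?V y \<otimes>\<^bsub>obj E S\<^esub> diff E S (ver_one E S n) = [(n - 1)] \<cdot>\<^bsub>obj E S\<^esub> ?V ?e" .
  have 3: "?V y \<otimes>\<^bsub>obj E S\<^esub> ver_one E S n = [n] \<cdot>\<^bsub>obj E S\<^esub> ?V y"
    using yc by (simp add: mult_ver_one[OF S n Vy(1)] frob_ver[OF S n yc] add_hom_nat_mult[OF ring_obj[OF Sn] ring_obj[OF S] hom])
  let ?z = "[(n - 1)] \<cdot>\<^bsub>obj E S\<^esub> ?V ?e"
  have Vec: "?V ?e \<in> carrier (obj E S)" using ver_closed[OF S n ec] .
  have "?V ?e \<oplus>\<^bsub>obj E S\<^esub> ?V ?e = ?V ([(2::nat)] \<cdot>\<^bsub>obj E (S \<div> n)\<^esub> ?e)"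
    using ec Vec by (simp add: add_hom_add[OF ring_obj[OF Sn] ring_obj[OF S] hom] numeral_2_eq_2)
  also have "\<dots> = \<zero>\<^bsub>obj E S\<^esub>"
    using yc by (simp add: even_mult_eps[OF Sn] add_hom_zero[OF ring_obj[OF Sn] ring_obj[OF S] hom])
  finally have "?z \<oplus>\<^bsub>obj E S\<^esub> ?z = \<zero>\<^bsub>obj E S\<^esub>"
    using Vec by (metis R.add.nat_pow_distrib R.add.nat_pow_one)
  moreover have "[n] \<cdot>\<^bsub>obj E S\<^esub> diff E S (?V y) = diff E S (?V y \<otimes>\<^bsub>obj E S\<^esub> ver_one E S n)"
    using Vy by (simp add: 3 add_hom_nat_mult[OF ring_obj[OF S] ring_obj[OF S] diff_hom[OF S]])
  then have "[n] \<cdot>\<^bsub>obj E S\<^esub> diff E S (?V y) = ?V (diff E (S \<div> n) y) \<oplus>\<^bsub>obj E S\<^esub> ?z \<oplus>\<^bsub>obj E S\<^esub> ?z"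
    by (simp add: leibniz_0[OF S Vy(2) ver_one_deg[OF S n]] 1 2)
  ultimately show ?thesis
    using ver_closed[OF S n dy] Vec by (simp add: R.a_assoc)
qed

text \<open>The upper bound on the order of the generators in degree 1: by \<open>ver_diff\<close>
  the multiple is V_n(d1), and d1 = 0.\<close>

lemma torsion_diff_ver_one:
  assumes S: "truncation_set S" and n: "0 < n"
  shows "[n] \<cdot>\<^bsub>obj E S\<^esub> diff E S (ver_one E S n) = \<zero>\<^bsub>obj E S\<^esub>"
proof -
  note Sn = truncation_set_quot[OF S, of n]
  show ?thesis
    using ver_diff[OF S n deg_one[OF Sn]]
    by (simp add: ver_one_eq[OF S] diff_one[OF Sn] add_hom_zero[OF ring_obj[OF Sn] ring_obj[OF S] ver_hom[OF S n]])
qed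

lemma ver_diff_ver_one:
  assumes S: "truncation_set S" and m: "0 < m" and n: "0 < n"
  shows "ver E m S (diff E (S \<div> m) (ver_one E (S \<div> m) n)) = [m] \<cdot>\<^bsub>obj E S\<^esub> diff E S (ver_one E S (m * n))"
  by (simp add: ver_diff[OF S m ver_one_deg[OF truncation_set_quot[OF S] n]] ver_ver_one[OF assms])

text \<open>Evaluate F_m d on V_m F_m(x) = x V_m(1) in two ways, by axiom (iv) and by the Leibniz
  rule. The terms with \<epsilon> agree and cancel.\<close>

lemma diff_frob:
  assumes S: "truncation_set S" and m: "0 < m" and x: "x \<in> deg E S 0"
  shows "diff E (S \<div> m) (frob E m S x) = [m] \<cdot>\<^bsub>obj E (S \<div> m)\<^esub> frob E m S (diff E S x)"
proof -
  note Sm = truncation_set_quot[OF S, of m]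
  interpret R: ring "obj E S" using S by (rule ring_obj)
  interpret Q: ring "obj E (S \<div> m)" using Sm by (rule ring_obj)
  let ?X = "frob E m S x" and ?e = "eps (S \<div> m)"
  have xc: "x \<in> carrier (obj E S)" using deg_carrier[OF S x] .
  have X: "?X \<in> carrier (obj E (S \<div> m))" "?X \<in> deg E (S \<div> m) 0"
    using frob_closed[OF S m xc] frob_deg[OF S m x] .
  have dx: "diff E S x \<in> carrier (obj E S)" using diff_closed[OF S xc] .
  have e: "?e \<in> carrier (obj E (S \<div> m))" using eps_closed[OF Sm] .
  have V: "ver E m S ?X = x \<otimes>\<^bsub>obj E S\<^esub> ver_one E S m" by (simp add: mult_ver_one[OF S m xc])
  have "diff E (S \<div> m) ?X \<oplus>\<^bsub>obj E (S \<div> m)\<^esub> [(m - 1)] \<cdot>\<^bsub>obj E (S \<div> m)\<^esub> (?e \<otimes>\<^bsub>obj E (S \<div> m)\<^esub> ?X) =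
    frob E m S (diff E S (x \<otimes>\<^bsub>obj E S\<^esub> ver_one E S m))"
    unfolding V[symmetric] by (rule frob_diff_ver[OF S m X(1), symmetric])
  also have "\<dots> = frob E m S (diff E S x \<otimes>\<^bsub>obj E S\<^esub> ver_one E S m) \<oplus>\<^bsub>obj E (S \<div> m)\<^esub>
      frob E m S (x \<otimes>\<^bsub>obj E S\<^esub> diff E S (ver_one E S m))"
    unfolding leibniz_0[OF S x ver_one_deg[OF S m]]
    by (rule add_hom_add[OF ring_obj[OF S] ring_obj[OF Sm] frob_add_hom[OF S m]])
      (simp_all add: dx xc ver_one_closed[OF S m] diff_ver_one_closed[OF S m])
  also have "frob E m S (diff E S x \<otimes>\<^bsub>obj E S\<^esub> ver_one E S m) = [m] \<cdot>\<^bsub>obj E (S \<div> m)\<^esub> frob E m S (diff E S x)"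
    using frob_closed[OF S m dx]
    by (simp add: frob_mult[OF S m dx ver_one_closed[OF S m]] frob_ver_one_self[OF S m] Q.add_pow_rdistr)
  also have "frob E m S (x \<otimes>\<^bsub>obj E S\<^esub> diff E S (ver_one E S m)) = [(m - 1)] \<cdot>\<^bsub>obj E (S \<div> m)\<^esub> (?X \<otimes>\<^bsub>obj E (S \<div> m)\<^esub> ?e)"
    using X e by (simp add: frob_mult[OF S m xc diff_ver_one_closed[OF S m]] frob_diff_ver_one_self[OF S m] Q.add_pow_rdistr)
  also have "?X \<otimes>\<^bsub>obj E (S \<div> m)\<^esub> ?e = ?e \<otimes>\<^bsub>obj E (S \<div> m)\<^esub> ?X"
    by (rule deg_0_comm[OF Sm X(2) eps_deg[OF Sm]])
  finally show ?thesis
    using X e frob_closed[OF S m dx] diff_closed[OF Sm X(1)] by simp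
qed

section \<open>Frobenius on V_n(1) and dV_n(1)\<close>

lemma frob_ver_one_coprime:
  assumes S: "truncation_set S" and m: "0 < m" and n: "0 < n" and c: "coprime m n"
  shows "frob E m S (ver_one E S n) = ver_one E (S \<div> m) n"
proof -
  note Sn = truncation_set_quot[OF S, of n] and Sm = truncation_set_quot[OF S, of m]
  show ?thesis
    using frob_ver_coprime[OF S m n c one_closed'[OF Sn]] m n
    by (simp add: ver_one_eq[OF S] ver_one_eq[OF Sm] frob_one[OF Sn] trunc_quot_quot mult.commute)
qed

text \<open>Because n kills dV_n(1), multiplication by a m is the identity on it. Moreover m F_m
  dV_n(1) = d F_m V_n(1) = dV_n(1) by \<open>diff_frob\<close>, so F_m can be divided by m at the
  cost of the inverse a.\<close>

lemma frob_diff_ver_one_coprime: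
  assumes S: "truncation_set S" and m: "0 < m" and n: "0 < n" and c: "coprime m n"
    and a: "[a * int m = 1] (mod int n)"
  shows "frob E m S (diff E S (ver_one E S n)) = [a] \<cdot>\<^bsub>obj E (S \<div> m)\<^esub> diff E (S \<div> m) (ver_one E (S \<div> m) n)"
proof -
  note Sm = truncation_set_quot[OF S, of m]
  interpret R: ring "obj E S" using S by (rule ring_obj)
  interpret Q: ring "obj E (S \<div> m)" using Sm by (rule ring_obj)
  let ?D = "diff E S (ver_one E S n)"
  have D: "?D \<in> carrier (obj E S)" using diff_ver_one_closed[OF S n] .
  obtain b where b: "a * int m = 1 + int n * b" using a by (metis cong_iff_lin cong_sym mult.commute)
  have "[(int n * b)] \<cdot>\<^bsub>obj E S\<^esub> ?D = [b] \<cdot>\<^bsub>obj E S\<^esub> ([(int n)] \<cdot>\<^bsub>obj E S\<^esub> ?D)"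
    using D by (simp add: R.add.int_pow_pow mult.commute)
  also have "[(int n)] \<cdot>\<^bsub>obj E S\<^esub> ?D = \<zero>\<^bsub>obj E S\<^esub>"
    using torsion_diff_ver_one[OF S n] by (simp add: add_pow_def int_pow_int)
  finally have "[(int m * a)] \<cdot>\<^bsub>obj E S\<^esub> ?D = ?D"
    using D b by (simp add: R.add.int_pow_mult mult.commute)
  then have "frob E m S ?D = [(int m * a)] \<cdot>\<^bsub>obj E (S \<div> m)\<^esub> frob E m S ?D"
    using add_hom_int_mult[OF ring_obj[OF S] ring_obj[OF Sm] frob_add_hom[OF S m] D, of "int m * a"] by simp
  also have "\<dots> = [a] \<cdot>\<^bsub>obj E (S \<div> m)\<^esub> ([(int m)] \<cdot>\<^bsub>obj E (S \<div> m)\<^esub> frob E m S ?D)"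
    using frob_closed[OF S m D] by (simp add: Q.add.int_pow_pow)
  also have "[(int m)] \<cdot>\<^bsub>obj E (S \<div> m)\<^esub> frob E m S ?D = diff E (S \<div> m) (ver_one E (S \<div> m) n)"
    using diff_frob[OF S m ver_one_deg[OF S n]] by (simp add: frob_ver_one_coprime[OF S m n c] add_pow_def int_pow_int)
  finally show ?thesis .
qed

lemma frob_ver_one:
  assumes S: "truncation_set S" and m: "0 < m" and n: "0 < n"
  shows "frob E m S (ver_one E S n) = [gcd m n] \<cdot>\<^bsub>obj E (S \<div> m)\<^esub> ver_one E (S \<div> m) (lcm m n div m)"
proof -
  note l = lcm_div_gcd[OF m n]
  let ?d = "gcd m n" and ?m = "m div gcd m n" and ?n = "n div gcd m n"
  note Sd = truncation_set_quot[OF S, of ?d]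
  have Q: "(S \<div> ?d) \<div> ?m = S \<div> m" using l by (simp add: trunc_quot_quot)
  have v: "ver_one E S n = ver E ?d S (ver_one E (S \<div> ?d) ?n)"
    using ver_ver_one[OF S l(8,7)] l(2) by simp
  have c: "ver_one E (S \<div> ?d) ?n \<in> carrier (obj E (S \<div> ?d))" using ver_one_closed[OF Sd l(7)] .
  have "frob E m S (ver_one E S n) = frob E ?m (S \<div> ?d) (frob E ?d S (ver_one E S n))"
    using frob_frob[OF S l(6,8) ver_one_closed[OF S n]] l(1) by (simp add: mult.commute)
  also have "frob E ?d S (ver_one E S n) = [?d] \<cdot>\<^bsub>obj E (S \<div> ?d)\<^esub> ver_one E (S \<div> ?d) ?n"
    unfolding v by (rule frob_ver[OF S l(8) c])
  also have "frob E ?m (S \<div> ?d) ([?d] \<cdot>\<^bsub>obj E (S \<div> ?d)\<^esub> ver_one E (S \<div> ?d) ?n) =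
      [?d] \<cdot>\<^bsub>obj E (S \<div> m)\<^esub> ver_one E (S \<div> m) ?n"
    using add_hom_nat_mult[OF ring_obj[OF Sd] ring_obj[OF truncation_set_quot[OF Sd]] frob_add_hom[OF Sd l(6)] c, of ?d]
      frob_ver_one_coprime[OF Sd l(6,7,3)] by (simp add: Q)
  finally show ?thesis by (simp only: l(4))
qed

text \<open>With d = gcd(m,n), split F_m = F_(m/d) F_d and V_n = V_d V_(n/d). Axiom (iv) evaluates
  F_d d V_d and leaves (d - 1) \<epsilon> V_(n/d)(1); the remaining indices m/d and n/d are coprime
  to each other.\<close>

lemma frob_diff_ver_one:
  assumes S: "truncation_set S" and m: "0 < m" and n: "0 < n"
    and a: "[a * int (m div gcd m n) = 1] (mod int (n div gcd m n))"
  shows "frob E m S (diff E S (ver_one E S n)) =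
    [a] \<cdot>\<^bsub>obj E (S \<div> m)\<^esub> diff E (S \<div> m) (ver_one E (S \<div> m) (lcm m n div m)) \<oplus>\<^bsub>obj E (S \<div> m)\<^esub>
    [(gcd m n - 1)] \<cdot>\<^bsub>obj E (S \<div> m)\<^esub> ver E (lcm m n div m) (S \<div> m) (eps ((S \<div> m) \<div> (lcm m n div m)))"
proof -
  note l = lcm_div_gcd[OF m n]
  let ?d = "gcd m n" and ?m = "m div gcd m n" and ?n = "n div gcd m n"
  note Sd = truncation_set_quot[OF S, of ?d] and Sm = truncation_set_quot[OF S, of m]
  have Q: "(S \<div> ?d) \<div> ?m = S \<div> m" using l by (simp add: trunc_quot_quot)
  interpret Q: ring "obj E (S \<div> m)" using Sm by (rule ring_obj)
  interpret D: ring "obj E (S \<div> ?d)" using Sd by (rule ring_obj)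
  let ?y = "ver_one E (S \<div> ?d) ?n"
  have v: "ver_one E S n = ver E ?d S ?y"
    using ver_ver_one[OF S l(8,7)] l(2) by simp
  have y: "?y \<in> carrier (obj E (S \<div> ?d))" using ver_one_closed[OF Sd l(7)] .
  have e: "eps (S \<div> ?d) \<in> carrier (obj E (S \<div> ?d))" using eps_closed[OF Sd] .
  have ey: "eps (S \<div> ?d) \<otimes>\<^bsub>obj E (S \<div> ?d)\<^esub> ?y \<in> carrier (obj E (S \<div> ?d))" using y e by simp
  note hom = frob_add_hom[OF Sd l(6), unfolded Q]
  have "frob E m S (diff E S (ver_one E S n)) = frob E ?m (S \<div> ?d) (frob E ?d S (diff E S (ver_one E S n)))"
    using frob_frob[OF S l(6,8) diff_ver_one_closed[OF S n]] l(1) by (simp add: mult.commute)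
  also have "frob E ?d S (diff E S (ver_one E S n)) = diff E (S \<div> ?d) ?y \<oplus>\<^bsub>obj E (S \<div> ?d)\<^esub>
      [(?d - 1)] \<cdot>\<^bsub>obj E (S \<div> ?d)\<^esub> (eps (S \<div> ?d) \<otimes>\<^bsub>obj E (S \<div> ?d)\<^esub> ?y)"
    unfolding v by (rule frob_diff_ver[OF S l(8) y])
  also have "frob E ?m (S \<div> ?d) \<dots> = frob E ?m (S \<div> ?d) (diff E (S \<div> ?d) ?y) \<oplus>\<^bsub>obj E (S \<div> m)\<^esub>
      [(?d - 1)] \<cdot>\<^bsub>obj E (S \<div> m)\<^esub> frob E ?m (S \<div> ?d) (eps (S \<div> ?d) \<otimes>\<^bsub>obj E (S \<div> ?d)\<^esub> ?y)"
    using ey diff_closed[OF Sd y]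
    by (simp add: add_hom_add[OF ring_obj[OF Sd] ring_obj[OF Sm] hom] add_hom_nat_mult[OF ring_obj[OF Sd] ring_obj[OF Sm] hom])
  also have "frob E ?m (S \<div> ?d) (diff E (S \<div> ?d) ?y) = [a] \<cdot>\<^bsub>obj E (S \<div> m)\<^esub> diff E (S \<div> m) (ver_one E (S \<div> m) ?n)"
    using frob_diff_ver_one_coprime[OF Sd l(6,7,3) a] by (simp add: Q)
  also have "frob E ?m (S \<div> ?d) (eps (S \<div> ?d) \<otimes>\<^bsub>obj E (S \<div> ?d)\<^esub> ?y) = ver E ?n (S \<div> m) (eps ((S \<div> m) \<div> ?n))"
    using frob_mult[OF Sd l(6) e y] frob_eps[OF Sd l(6)] frob_ver_one_coprime[OF Sd l(6,7,3)]
      eps_mult_ver_one[OF Sm l(7)] by (simp add: Q)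
  finally show ?thesis by (simp only: l(4))
qed

text \<open>From [-1] = -1 + V_2(1) follows d[-1] = dV_2(1). Multiplication by [-1] gives -dV_2(1) +
  V_2(F_2 dV_2(1)), where the sign is absorbed because dV_2(1) has order dividing 2, and F_2 dV_2(1)
  = \<epsilon> by axiom (iv).\<close>

lemma eps_rec:
  assumes S: "truncation_set S"
  shows "eps S = diff E S (ver_one E S 2) \<oplus>\<^bsub>obj E S\<^esub> ver E 2 S (eps (S \<div> 2))"
proof -
  note S2 = truncation_set_quot[OF S, of 2]
  interpret ring "obj E S" using S by (rule ring_obj)
  interpret Q: ring "obj E (S \<div> 2)" using S2 by (rule ring_obj)
  let ?V = "ver_one E S 2" and ?D = "diff E S (ver_one E S 2)"
  have V: "?V \<in> carrier (obj E S)" and D: "?D \<in> carrier (obj E S)"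
    using ver_one_closed[OF S, of 2] diff_ver_one_closed[OF S, of 2] by simp_all
  have "diff E S (minus_one S) = diff E S (\<ominus>\<^bsub>obj E S\<^esub> \<one>\<^bsub>obj E S\<^esub>) \<oplus>\<^bsub>obj E S\<^esub> ?D"
    unfolding minus_one_eq[OF S]
    using V by (intro add_hom_add[OF ring_obj[OF S] ring_obj[OF S] diff_hom[OF S]]) simp_all
  also have "diff E S (\<ominus>\<^bsub>obj E S\<^esub> \<one>\<^bsub>obj E S\<^esub>) = \<zero>\<^bsub>obj E S\<^esub>"
    by (simp add: add_hom_uminus[OF ring_obj[OF S] ring_obj[OF S] diff_hom[OF S]] diff_one[OF S])
  finally have du: "diff E S (minus_one S) = ?D" using D by simp
  have "[(2::nat)] \<cdot>\<^bsub>obj E S\<^esub> ?D = \<zero>\<^bsub>obj E S\<^esub>" using torsion_diff_ver_one[OF S, of 2] by simp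
  then have "?D \<oplus>\<^bsub>obj E S\<^esub> ?D = \<zero>\<^bsub>obj E S\<^esub>" using D by (simp add: numeral_2_eq_2)
  then have m: "\<ominus>\<^bsub>obj E S\<^esub> ?D = ?D" using D by (simp add: minus_equality)
  have "?V \<otimes>\<^bsub>obj E S\<^esub> ?D = ?D \<otimes>\<^bsub>obj E S\<^esub> ?V" by (rule deg_0_comm[OF S ver_one_deg[OF S] diff_ver_one_deg[OF S]]) simp_all
  also have "\<dots> = ver E 2 S (frob E 2 S ?D)" by (rule mult_ver_one[OF S _ D]) simp
  also have "frob E 2 S ?D = eps (S \<div> 2)"
    using frob_diff_ver_one_self[OF S, of 2] eps_closed[OF S2] by simp
  finally have VD: "?V \<otimes>\<^bsub>obj E S\<^esub> ?D = ver E 2 S (eps (S \<div> 2))" .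
  have "eps S = (\<ominus>\<^bsub>obj E S\<^esub> \<one>\<^bsub>obj E S\<^esub> \<oplus>\<^bsub>obj E S\<^esub> ?V) \<otimes>\<^bsub>obj E S\<^esub> ?D" by (simp add: eps_eq[OF S] du) (simp add: minus_one_eq[OF S])
  also have "\<dots> = \<ominus>\<^bsub>obj E S\<^esub> ?D \<oplus>\<^bsub>obj E S\<^esub> ?V \<otimes>\<^bsub>obj E S\<^esub> ?D" using V D by (simp add: l_distr l_minus)
  finally show ?thesis by (simp add: m VD)
qed

lemma ver_eps_rec:
  assumes S: "truncation_set S" and n: "0 < n"
  shows "ver E n S (eps (S \<div> n)) =
    [n] \<cdot>\<^bsub>obj E S\<^esub> diff E S (ver_one E S (2 * n)) \<oplus>\<^bsub>obj E S\<^esub> ver E (2 * n) S (eps (S \<div> (2 * n)))"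
proof -
  note Sn = truncation_set_quot[OF S, of n]
  have Q: "(S \<div> n) \<div> 2 = S \<div> (2 * n)" using n by (simp add: trunc_quot_quot mult.commute)
  have S2: "truncation_set (S \<div> (2 * n))" by (rule truncation_set_quot[OF S])
  have e: "eps (S \<div> (2 * n)) \<in> carrier (obj E (S \<div> (2 * n)))" by (rule eps_closed[OF S2])
  have "ver E n S (eps (S \<div> n)) = ver E n S (diff E (S \<div> n) (ver_one E (S \<div> n) 2)) \<oplus>\<^bsub>obj E S\<^esub>
      ver E n S (ver E 2 (S \<div> n) (eps (S \<div> (2 * n))))"
    using diff_ver_one_closed[OF Sn, of 2] ver_closed[OF Sn, of 2, unfolded Q, OF _ e]
    by (subst eps_rec[OF Sn]) (simp add: Q add_hom_add[OF ring_obj[OF Sn] ring_obj[OF S] ver_hom[OF S n]])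
  also have "ver E n S (diff E (S \<div> n) (ver_one E (S \<div> n) 2)) = [n] \<cdot>\<^bsub>obj E S\<^esub> diff E S (ver_one E S (2 * n))"
    using ver_diff_ver_one[OF S n, of 2] by (simp add: mult.commute)
  also have "ver E n S (ver E 2 (S \<div> n) (eps (S \<div> (2 * n)))) = ver E (2 * n) S (eps (S \<div> (2 * n)))"
    using e by (intro ver_ver[OF S _ n]) simp_all
  finally show ?thesis .
qed

text \<open>The element \<epsilon> dV_n(1) equals d(V_n(\<epsilon>)), since d\<epsilon> = 0 and
  2\<epsilon> = 0. Applying d to \<open>ver_eps_rec\<close> therefore expresses it by the same
  element for 2n. Over a finite S the indices n, 2n, 4n, ... leave S, where everything is 0.\<close>

lemma eps_diff_ver_one:
  assumes S: "truncation_set S" and fin: "finite S" and n: "0 < n"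
  shows "eps S \<otimes>\<^bsub>obj E S\<^esub> diff E S (ver_one E S n) = \<zero>\<^bsub>obj E S\<^esub>"
proof -
  interpret ring "obj E S" using S by (rule ring_obj)
  let ?D = "\<lambda>n. diff E S (ver_one E S n)" and ?e = "\<lambda>n. ver E n S (eps (S \<div> n))"
  have D: "?D n \<in> carrier (obj E S)" if "0 < n" for n using diff_ver_one_closed[OF S that] .
  have e: "eps S \<in> carrier (obj E S)" using eps_closed[OF S] .
  have en: "?e n \<in> carrier (obj E S)" if "0 < n" for n
    using ver_closed[OF S that eps_closed[OF truncation_set_quot[OF S]]] .
  have B: "diff E S (?e n) = eps S \<otimes>\<^bsub>obj E S\<^esub> ?D n" if n: "0 < n" for n
  proof -
    have "?e n = ver_one E S n \<otimes>\<^bsub>obj E S\<^esub> eps S"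
      using eps_mult_ver_one[OF S n] deg_0_comm[OF S ver_one_deg[OF S n] eps_deg[OF S]] by simp
    then have "diff E S (?e n) = ?D n \<otimes>\<^bsub>obj E S\<^esub> eps S"
      using leibniz_0[OF S ver_one_deg[OF S n] eps_deg[OF S]] D[OF n] e ver_one_closed[OF S n]
      by (simp add: diff_eps[OF S])
    also have "\<dots> = \<ominus>\<^bsub>obj E S\<^esub> (eps S \<otimes>\<^bsub>obj E S\<^esub> ?D n)"
      using anticomm_graded_ring.anticomm[OF graded[OF S] diff_ver_one_deg[OF S n] eps_deg[OF S]] e D[OF n]
      by (simp add: add.int_pow_neg)
    also have "\<dots> = eps S \<otimes>\<^bsub>obj E S\<^esub> ?D n"
      using eps_double[OF S] e D[OF n] by (intro minus_equality) (simp_all flip: l_distr)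
    finally show ?thesis .
  qed
  have rec: "diff E S (?e n) = [n] \<cdot>\<^bsub>obj E S\<^esub> (eps S \<otimes>\<^bsub>obj E S\<^esub> ?D (2 * n)) \<oplus>\<^bsub>obj E S\<^esub> diff E S (?e (2 * n))" if n: "0 < n" for n
  proof -
    have "diff E S (?D (2 * n)) = eps S \<otimes>\<^bsub>obj E S\<^esub> ?D (2 * n)"
      using diff_diff[OF S ver_one_closed[OF S, of "2 * n"]] n by simp
    then show ?thesis
      using n D[of "2 * n"] en[of "2 * n"]
      by (subst ver_eps_rec[OF S n])
        (simp add: add_hom_add[OF ring_obj[OF S] ring_obj[OF S] diff_hom[OF S]]
          add_hom_nat_mult[OF ring_obj[OF S] ring_obj[OF S] diff_hom[OF S]])
  qed
  obtain N where N: "\<And>k. k \<in> S \<Longrightarrow> k < N" using fin by (metis finite_nat_set_iff_bounded)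
  have "0 < n \<Longrightarrow> eps S \<otimes>\<^bsub>obj E S\<^esub> ?D n = \<zero>\<^bsub>obj E S\<^esub>" for n
  proof (induction "N - n" arbitrary: n rule: less_induct)
    case less
    show ?case
    proof (cases "n \<in> S")
      case False
      then show ?thesis using less.prems e by (simp add: diff_ver_one_outside[OF S])
    next
      case True
      then have "eps S \<otimes>\<^bsub>obj E S\<^esub> ?D (2 * n) = \<zero>\<^bsub>obj E S\<^esub>" using N[OF True] less.prems by (intro less.hyps) auto
      then show ?thesis using rec[OF less.prems] B[OF less.prems] B[of "2 * n"] less.prems by simp
    qed
  qed
  then show ?thesis using n .
qed

end

section \<open>Transporting the structure of a Witt complex\<close>

text \<open>
  All axioms but the limit condition are equations, so they are reflected by injective maps. This
  covers both subcomplexes and copies of a complex along an injection of the underlying types.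
\<close>

lemma witt_complex_pullback:
  fixes E :: "'a witt_data" and E' :: "'b witt_data" and i :: "nat set \<Rightarrow> 'b \<Rightarrow> 'a"
  assumes E: "witt_complex E"
    and graded': "\<And>S. truncation_set S \<Longrightarrow> anticomm_graded_ring (obj E' S) (deg E' S)"
    and i: "\<And>S. truncation_set S \<Longrightarrow> i S \<in> ring_hom (obj E' S) (obj E S)"
    and inj: "\<And>S. truncation_set S \<Longrightarrow> inj_on (i S) (carrier (obj E' S))"
    and i_deg: "\<And>S q x. truncation_set S \<Longrightarrow> x \<in> deg E' S q \<Longrightarrow> i S x \<in> deg E S q"
    and res_deg': "\<And>S T q x. truncation_set S \<Longrightarrow> truncation_set T \<Longrightarrow> T \<subseteq> S \<Longrightarrow> x \<in> deg E' S q \<Longrightarrow>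
      res E' S T x \<in> deg E' T q"
    and eta_deg': "\<And>S a. truncation_set S \<Longrightarrow> a \<in> carrier (witt S) \<Longrightarrow> eta E' S a \<in> deg E' S 0"
    and diff_deg': "\<And>S q x. truncation_set S \<Longrightarrow> x \<in> deg E' S q \<Longrightarrow> diff E' S x \<in> deg E' S (q + 1)"
    and frob_deg': "\<And>S n q x. truncation_set S \<Longrightarrow> 0 < n \<Longrightarrow> x \<in> deg E' S q \<Longrightarrow> frob E' n S x \<in> deg E' (S \<div> n) q"
    and ver_deg': "\<And>S n q x. truncation_set S \<Longrightarrow> 0 < n \<Longrightarrow> x \<in> deg E' (S \<div> n) q \<Longrightarrow> ver E' n S x \<in> deg E' S q"
    and res_closed': "\<And>S T x. truncation_set S \<Longrightarrow> truncation_set T \<Longrightarrow> T \<subseteq> S \<Longrightarrow> x \<in> carrier (obj E' S) \<Longrightarrow>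
      res E' S T x \<in> carrier (obj E' T)"
    and diff_closed': "\<And>S x. truncation_set S \<Longrightarrow> x \<in> carrier (obj E' S) \<Longrightarrow> diff E' S x \<in> carrier (obj E' S)"
    and frob_closed': "\<And>S n x. truncation_set S \<Longrightarrow> 0 < n \<Longrightarrow> x \<in> carrier (obj E' S) \<Longrightarrow> frob E' n S x \<in> carrier (obj E' (S \<div> n))"
    and ver_closed': "\<And>S n x. truncation_set S \<Longrightarrow> 0 < n \<Longrightarrow> x \<in> carrier (obj E' (S \<div> n)) \<Longrightarrow> ver E' n S x \<in> carrier (obj E' S)"
    and i_res: "\<And>S T x. truncation_set S \<Longrightarrow> truncation_set T \<Longrightarrow> T \<subseteq> S \<Longrightarrow> x \<in> carrier (obj E' S) \<Longrightarrow>
      i T (res E' S T x) = res E S T (i S x)"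
    and i_eta: "\<And>S a. truncation_set S \<Longrightarrow> a \<in> carrier (witt S) \<Longrightarrow> i S (eta E' S a) = eta E S a"
    and i_diff: "\<And>S x. truncation_set S \<Longrightarrow> x \<in> carrier (obj E' S) \<Longrightarrow> i S (diff E' S x) = diff E S (i S x)"
    and i_frob: "\<And>S n x. truncation_set S \<Longrightarrow> 0 < n \<Longrightarrow> x \<in> carrier (obj E' S) \<Longrightarrow> i (S \<div> n) (frob E' n S x) = frob E n S (i S x)"
    and i_ver: "\<And>S n x. truncation_set S \<Longrightarrow> 0 < n \<Longrightarrow> x \<in> carrier (obj E' (S \<div> n)) \<Longrightarrow> i S (ver E' n S x) = ver E n S (i (S \<div> n) x)"
    and limit': "\<And>S t q. truncation_set S \<Longrightarrow>
      (\<And>T. truncation_set T \<Longrightarrow> finite T \<Longrightarrow> T \<subseteq> S \<Longrightarrow> t T \<in> deg E' T q) \<Longrightarrow>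
      (\<And>T U. truncation_set T \<Longrightarrow> finite T \<Longrightarrow> T \<subseteq> S \<Longrightarrow> truncation_set U \<Longrightarrow> U \<subseteq> T \<Longrightarrow>
        res E' T U (t T) = t U) \<Longrightarrow>
      \<exists>!y. y \<in> deg E' S q \<and> (\<forall>T. truncation_set T \<and> finite T \<and> T \<subseteq> S \<longrightarrow> res E' S T y = t T)"
  shows "witt_complex E'"
proof -
  interpret E: witt_complex E by fact
  note Q = truncation_set_quot
  have ring: "ring (obj E' S)" if "truncation_set S" for S
    by (rule anticomm_graded_ring.axioms(1)[OF graded'[OF that]])
  have degc: "x \<in> carrier (obj E' S)" if "truncation_set S" "x \<in> deg E' S q" for S q x
    using anticomm_graded_ring.degree_subgroup[OF graded'[OF that(1)], of q] subgroup.subset that(2) by fastforce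
  have etac: "eta E' S a \<in> carrier (obj E' S)" if "truncation_set S" "a \<in> carrier (witt S)" for S a
    using degc[OF that(1) eta_deg'[OF that]] .
  have eqI: "x = y" if "truncation_set S" "i S x = i S y" "x \<in> carrier (obj E' S)" "y \<in> carrier (obj E' S)" for S x y
    using inj_onD[OF inj[OF that(1)] that(2-4)] .
  have ic: "i S x \<in> carrier (obj E S)" if "truncation_set S" "x \<in> carrier (obj E' S)" for S x
    using ring_hom_closed[OF i[OF that(1)] that(2)] .
  have im: "i S (x \<otimes>\<^bsub>obj E' S\<^esub> y) = i S x \<otimes>\<^bsub>obj E S\<^esub> i S y"
    if "truncation_set S" "x \<in> carrier (obj E' S)" "y \<in> carrier (obj E' S)" for S x y
    using ring_hom_mult[OF i[OF that(1)] that(2,3)] .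
  have ia: "i S (x \<oplus>\<^bsub>obj E' S\<^esub> y) = i S x \<oplus>\<^bsub>obj E S\<^esub> i S y"
    if "truncation_set S" "x \<in> carrier (obj E' S)" "y \<in> carrier (obj E' S)" for S x y
    using ring_hom_add[OF i[OF that(1)] that(2,3)] .
  have i1: "i S \<one>\<^bsub>obj E' S\<^esub> = \<one>\<^bsub>obj E S\<^esub>" if "truncation_set S" for S
    using ring_hom_one[OF i[OF that]] .
  have iint: "i S ([(k :: int)] \<cdot>\<^bsub>obj E' S\<^esub> x) = [k] \<cdot>\<^bsub>obj E S\<^esub> i S x"
    if "truncation_set S" "x \<in> carrier (obj E' S)" for S k x
    using add_hom_int_mult[OF ring[OF that(1)] E.ring_obj[OF that(1)] ring_hom_add_hom[OF i[OF that(1)]] that(2)] .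
  have inat: "i S ([(k :: nat)] \<cdot>\<^bsub>obj E' S\<^esub> x) = [k] \<cdot>\<^bsub>obj E S\<^esub> i S x"
    if "truncation_set S" "x \<in> carrier (obj E' S)" for S k x
    using add_hom_nat_mult[OF ring[OF that(1)] E.ring_obj[OF that(1)] ring_hom_add_hom[OF i[OF that(1)]] that(2)] .
  have mc: "x \<otimes>\<^bsub>obj E' S\<^esub> y \<in> carrier (obj E' S)" "x \<oplus>\<^bsub>obj E' S\<^esub> y \<in> carrier (obj E' S)"
    if "truncation_set S" "x \<in> carrier (obj E' S)" "y \<in> carrier (obj E' S)" for S x y
    using ring.ring_simprules(1,5)[OF ring[OF that(1)]] that by auto
  have oc: "\<one>\<^bsub>obj E' S\<^esub> \<in> carrier (obj E' S)" if "truncation_set S" for S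
    using ring.ring_simprules(6)[OF ring[OF that(1)]] .
  have kc: "[(k :: int)] \<cdot>\<^bsub>obj E' S\<^esub> x \<in> carrier (obj E' S)" "[(n :: nat)] \<cdot>\<^bsub>obj E' S\<^esub> x \<in> carrier (obj E' S)"
    if "truncation_set S" "x \<in> carrier (obj E' S)" for S k n x
  proof -
    interpret ring "obj E' S" using that by (intro ring)
    show "[(k :: int)] \<cdot>\<^bsub>obj E' S\<^esub> x \<in> carrier (obj E' S)" "[(n :: nat)] \<cdot>\<^bsub>obj E' S\<^esub> x \<in> carrier (obj E' S)"
      using that by simp_all
  qed
  \<comment> \<open>The inverse in \<open>dlog_minus_one\<close> refers to the ring at hand, so it
    is first identified: [-1] is its own inverse, because its image squares to 1 and the map is
    injective. After that the class is a product that the map preserves.\<close>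
  have dlog: "dlog_minus_one E' S \<in> carrier (obj E' S)" "i S (dlog_minus_one E' S) = dlog_minus_one E S"
    if S: "truncation_set S" for S
  proof -
    let ?u = "eta E' S (teich S (-1))"
    interpret ring "obj E' S" using S by (rule ring)
    have u: "?u \<in> carrier (obj E' S)" using S by (intro etac) simp_all
    have iu: "i S ?u = E.minus_one S" using S by (simp add: i_eta E.minus_one_def)
    have "?u \<otimes>\<^bsub>obj E' S\<^esub> ?u = \<one>\<^bsub>obj E' S\<^esub>"
      using S u by (intro eqI[OF S]) (simp_all add: im i1 iu E.minus_one_square)
    then have "inv\<^bsub>obj E' S\<^esub> ?u = ?u" using u by (intro inv_char) auto
    then have d: "dlog_minus_one E' S = ?u \<otimes>\<^bsub>obj E' S\<^esub> diff E' S ?u" by (simp add: dlog_minus_one_def)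
    show "dlog_minus_one E' S \<in> carrier (obj E' S)" "i S (dlog_minus_one E' S) = dlog_minus_one E S"
      using S u diff_closed'[OF S u] by (simp_all add: d im i_diff iu E.eps_eq)
  qed
  note cl = ic etac mc oc kc dlog res_closed' diff_closed' frob_closed' ver_closed' Q
  note comm = im ia i1 iint inat i_res i_eta i_diff i_frob i_ver
  show ?thesis
  proof (rule witt_complex.intro)
    show "anticomm_graded_ring (obj E' S) (deg E' S)" if "truncation_set S" for S using graded'[OF that] .
    show "res E' S T \<in> ring_hom (obj E' S) (obj E' T)" if "truncation_set S" "truncation_set T" "T \<subseteq> S" for S T
      by (rule ring_hom_memI; (rule eqI[OF that(2)])?)
        (use that in \<open>simp_all add: cl comm ring_hom_mult[OF E.res_hom] ring_hom_add[OF E.res_hom] ring_hom_one[OF E.res_hom]\<close>)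
    show "res E' S T x \<in> deg E' T q" if "truncation_set S" "truncation_set T" "T \<subseteq> S" "x \<in> deg E' S q" for S T x q
      using res_deg'[OF that] .
    show "res E' S S x = x" if "truncation_set S" "x \<in> carrier (obj E' S)" for S x
      by (rule eqI[OF that(1)]) (use that in \<open>simp_all add: cl comm E.res_id\<close>)
    show "res E' T U (res E' S T x) = res E' S U x"
      if "truncation_set S" "truncation_set T" "truncation_set U" "T \<subseteq> S" "U \<subseteq> T" "x \<in> carrier (obj E' S)" for S T U x
    proof -
      have "U \<subseteq> S" using that by blast
      then show ?thesis by (intro eqI[OF that(3)]) (use that in \<open>simp_all add: cl comm E.res_res\<close>)
    qed
    show "\<exists>!y. y \<in> deg E' S q \<and> (\<forall>T. truncation_set T \<and> finite T \<and> T \<subseteq> S \<longrightarrow> res E' S T y = t T)"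
      if "truncation_set S" "\<And>T. truncation_set T \<Longrightarrow> finite T \<Longrightarrow> T \<subseteq> S \<Longrightarrow> t T \<in> deg E' T q"
        "\<And>T U. truncation_set T \<Longrightarrow> finite T \<Longrightarrow> T \<subseteq> S \<Longrightarrow> truncation_set U \<Longrightarrow> U \<subseteq> T \<Longrightarrow> res E' T U (t T) = t U"
      for S t q
      using that by (rule limit')
    show "eta E' S \<in> ring_hom (witt S) (obj E' S)" if "truncation_set S" for S
    proof -
      interpret W: cring "witt S" using that by (rule ring_witt)
      show ?thesis
        by (rule ring_hom_memI; (rule eqI[OF that])?)
          (use that W.m_closed W.a_closed W.one_closed in \<open>simp_all add: cl comm ring_hom_mult[OF E.eta_hom] ring_hom_add[OF E.eta_hom] ring_hom_one[OF E.eta_hom] del: carrier_witt\<close>)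
    qed
    show "eta E' S a \<in> deg E' S 0" if "truncation_set S" "a \<in> carrier (witt S)" for S a using eta_deg'[OF that] .
    show "res E' S T (eta E' S a) = eta E' T (restrict a T)"
      if "truncation_set S" "truncation_set T" "T \<subseteq> S" "a \<in> carrier (witt S)" for S T a
      by (rule eqI[OF that(2)]) (use that in \<open>simp_all add: cl comm E.eta_res\<close>)
    show "diff E' S \<in> hom (add_monoid (obj E' S)) (add_monoid (obj E' S))" if "truncation_set S" for S
      by (rule homI; simp?; (rule eqI[OF that])?)
        (use that in \<open>simp_all add: cl comm add_hom_add[OF E.ring_obj E.ring_obj E.diff_hom]\<close>)
    show "diff E' S x \<in> deg E' S (q + 1)" if "truncation_set S" "x \<in> deg E' S q" for S x q using diff_deg'[OF that] .
    show "res E' S T (diff E' S x) = diff E' T (res E' S T x)"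
      if "truncation_set S" "truncation_set T" "T \<subseteq> S" "x \<in> carrier (obj E' S)" for S T x
      by (rule eqI[OF that(2)]) (use that in \<open>simp_all add: cl comm E.diff_res\<close>)
    show "frob E' n S \<in> ring_hom (obj E' S) (obj E' (S \<div> n))" if "truncation_set S" "0 < n" for S n
      by (rule ring_hom_memI; (rule eqI[OF Q[OF that(1), of n]])?)
        (use that in \<open>simp_all add: cl comm ring_hom_mult[OF E.frob_hom] ring_hom_add[OF E.frob_hom] ring_hom_one[OF E.frob_hom]\<close>)
    show "frob E' n S x \<in> deg E' (S \<div> n) q" if "truncation_set S" "0 < n" "x \<in> deg E' S q" for S n x q using frob_deg'[OF that] .
    show "res E' (S \<div> n) (T \<div> n) (frob E' n S x) = frob E' n T (res E' S T x)"
      if "truncation_set S" "truncation_set T" "T \<subseteq> S" "0 < n" "x \<in> carrier (obj E' S)" for S T n x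
    proof -
      have "T \<div> n \<subseteq> S \<div> n" using that by (auto simp: trunc_quot_def)
      then show ?thesis by (intro eqI[OF Q[OF that(2), of n]]) (use that in \<open>simp_all add: cl comm E.frob_res\<close>)
    qed
    show "ver E' n S \<in> hom (add_monoid (obj E' (S \<div> n))) (add_monoid (obj E' S))" if "truncation_set S" "0 < n" for S n
      by (rule homI; simp?; (rule eqI[OF that(1)])?)
        (use that in \<open>simp_all add: cl comm add_hom_add[OF E.ring_obj E.ring_obj E.ver_hom]\<close>)
    show "ver E' n S x \<in> deg E' S q" if "truncation_set S" "0 < n" "x \<in> deg E' (S \<div> n) q" for S n x q using ver_deg'[OF that] .
    show "res E' S T (ver E' n S x) = ver E' n T (res E' (S \<div> n) (T \<div> n) x)"
      if "truncation_set S" "truncation_set T" "T \<subseteq> S" "0 < n" "x \<in> carrier (obj E' (S \<div> n))" for S T n x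
    proof -
      have "T \<div> n \<subseteq> S \<div> n" using that by (auto simp: trunc_quot_def)
      then show ?thesis by (intro eqI[OF that(2)]) (use that in \<open>simp_all add: cl comm E.ver_res\<close>)
    qed
    show "diff E' S (x \<otimes>\<^bsub>obj E' S\<^esub> y) = diff E' S x \<otimes>\<^bsub>obj E' S\<^esub> y \<oplus>\<^bsub>obj E' S\<^esub>
        [((- 1 :: int) ^ q)] \<cdot>\<^bsub>obj E' S\<^esub> (x \<otimes>\<^bsub>obj E' S\<^esub> diff E' S y)"
      if "truncation_set S" "x \<in> deg E' S q" "y \<in> deg E' S q'" for S x y q q'
      by (rule eqI[OF that(1)])
        (use that degc[OF that(1,2)] degc[OF that(1,3)] in \<open>simp_all add: cl comm E.leibniz[OF that(1) i_deg[OF that(1,2)] i_deg[OF that(1,3)]]\<close>)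
    show "diff E' S (diff E' S x) = dlog_minus_one E' S \<otimes>\<^bsub>obj E' S\<^esub> diff E' S x"
      if "truncation_set S" "x \<in> carrier (obj E' S)" for S x
      by (rule eqI[OF that(1)]) (use that in \<open>simp_all add: cl comm E.diff_diff\<close>)
    show "frob E' 1 S x = x" if "truncation_set S" "x \<in> carrier (obj E' S)" for S x
    proof -
      have S1: "S \<div> 1 = S" using that(1) by (auto simp: trunc_quot_def dest: truncation_set_pos)
      show ?thesis
        using i_frob[OF that(1) _ that(2), of 1] frob_closed'[OF that(1) _ that(2), of 1] E.frob_1[OF that(1) ic[OF that]] that
        by (intro eqI[OF that(1)]) (simp_all add: S1[simplified])
    qed
    show "ver E' 1 S x = x" if "truncation_set S" "x \<in> carrier (obj E' S)" for S x
    proof -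
      have S1: "S \<div> 1 = S" using that(1) by (auto simp: trunc_quot_def dest: truncation_set_pos)
      show ?thesis
        using i_ver[OF that(1), of 1 x] ver_closed'[OF that(1), of 1 x] E.ver_1[OF that(1) ic[OF that]] that
        by (intro eqI[OF that(1)]) (simp_all add: S1[simplified])
    qed
    show "frob E' m (S \<div> n) (frob E' n S x) = frob E' (m * n) S x"
      if "truncation_set S" "0 < m" "0 < n" "x \<in> carrier (obj E' S)" for S m n x
    proof -
      have Qm: "(S \<div> n) \<div> m = S \<div> (m * n)" using that by (simp add: trunc_quot_quot mult.commute)
      show ?thesis
        using i_frob[OF Q[OF that(1)] that(2) frob_closed'[OF that(1,3,4)]]
          frob_closed'[OF Q[OF that(1)] that(2) frob_closed'[OF that(1,3,4)]] that
        by (intro eqI[OF Q[OF that(1), of "m * n"]]) (simp_all add: Qm cl comm E.frob_frob)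
    qed
    show "ver E' n S (ver E' m (S \<div> n) x) = ver E' (m * n) S x"
      if "truncation_set S" "0 < m" "0 < n" "x \<in> carrier (obj E' (S \<div> (m * n)))" for S m n x
    proof -
      have Qm: "(S \<div> n) \<div> m = S \<div> (m * n)" using that by (simp add: trunc_quot_quot mult.commute)
      note x = that(4)[folded Qm]
      show ?thesis
        using i_ver[OF Q[OF that(1)] that(2) x] ver_closed'[OF Q[OF that(1)] that(2) x] that
        by (intro eqI[OF that(1)]) (simp_all add: Qm cl comm E.ver_ver)
    qed
    show "frob E' n S (ver E' n S x) = [n] \<cdot>\<^bsub>obj E' (S \<div> n)\<^esub> x"
      if "truncation_set S" "0 < n" "x \<in> carrier (obj E' (S \<div> n))" for S n x
      by (rule eqI[OF Q[OF that(1), of n]]) (use that in \<open>simp_all add: cl comm E.frob_ver\<close>)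
    show "frob E' m S (ver E' n S x) = ver E' n (S \<div> m) (frob E' m (S \<div> n) x)"
      if "truncation_set S" "0 < m" "0 < n" "coprime m n" "x \<in> carrier (obj E' (S \<div> n))" for S m n x
    proof -
      have Qm: "(S \<div> n) \<div> m = (S \<div> m) \<div> n" using that by (simp add: trunc_quot_quot mult.commute)
      show ?thesis
        using i_frob[OF Q[OF that(1)] that(2,5)] frob_closed'[OF Q[OF that(1)] that(2,5)] that
        by (intro eqI[OF Q[OF that(1), of m]]) (simp_all add: Qm cl comm E.frob_ver_coprime)
    qed
    show "frob E' n S (eta E' S a) = eta E' (S \<div> n) (witt_frob n S a)"
      if "truncation_set S" "0 < n" "a \<in> carrier (witt S)" for S n a
      by (rule eqI[OF Q[OF that(1), of n]]) (use that in \<open>simp_all add: cl comm E.frob_eta witt_frob_closed\<close>)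
    show "eta E' S (witt_ver n S a) = ver E' n S (eta E' (S \<div> n) a)"
      if "truncation_set S" "0 < n" "a \<in> carrier (witt (S \<div> n))" for S n a
      by (rule eqI[OF that(1)]) (use that in \<open>simp_all add: cl comm E.eta_ver witt_ver_closed\<close>)
    show "x \<otimes>\<^bsub>obj E' S\<^esub> ver E' n S y = ver E' n S (frob E' n S x \<otimes>\<^bsub>obj E' (S \<div> n)\<^esub> y)"
      if "truncation_set S" "0 < n" "x \<in> carrier (obj E' S)" "y \<in> carrier (obj E' (S \<div> n))" for S n x y
      by (rule eqI[OF that(1)]) (use that in \<open>simp_all add: cl comm E.projection_formula\<close>)
    show "frob E' n S (diff E' S (ver E' n S y)) = diff E' (S \<div> n) y \<oplus>\<^bsub>obj E' (S \<div> n)\<^esub>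
        [(n - 1)] \<cdot>\<^bsub>obj E' (S \<div> n)\<^esub> (dlog_minus_one E' (S \<div> n) \<otimes>\<^bsub>obj E' (S \<div> n)\<^esub> y)"
      if "truncation_set S" "0 < n" "y \<in> carrier (obj E' (S \<div> n))" for S n y
      by (rule eqI[OF Q[OF that(1), of n]]) (use that in \<open>simp_all add: cl comm E.frob_diff_ver\<close>)
    show "frob E' n S (diff E' S (eta E' S (teich S k))) =
        eta E' (S \<div> n) (teich (S \<div> n) k [^]\<^bsub>witt (S \<div> n)\<^esub> (n - 1)) \<otimes>\<^bsub>obj E' (S \<div> n)\<^esub>
        diff E' (S \<div> n) (eta E' (S \<div> n) (teich (S \<div> n) k))"
      if "truncation_set S" "0 < n" for S n k
    proof -
      interpret W: cring "witt (S \<div> n)" using Q[OF that(1)] by (rule ring_witt)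
      have "teich (S \<div> n) k [^]\<^bsub>witt (S \<div> n)\<^esub> (n - 1) \<in> carrier (witt (S \<div> n))"
        by (rule W.nat_pow_closed) simp
      then show ?thesis
        by (intro eqI[OF Q[OF that(1), of n]]) (use that in \<open>simp_all add: cl comm E.frob_diff_teich\<close>)
    qed
  qed
qed

section \<open>The subcomplex generated by Witt vectors\<close>

lemma (in ring) finsum_subgroup:
  assumes H: "subgroup H (add_monoid R)" and t: "\<And>i. i \<in> I \<Longrightarrow> t i \<in> H"
  shows "(\<Oplus>i\<in>I. t i) \<in> H"
proof (cases "finite I")
  case True
  then show ?thesis
    using t
  proof (induction I rule: finite_induct)
    case empty
    then show ?case using subgroup.one_closed[OF H] by simp
  next
    case (insert i I)
    have sub: "H \<subseteq> carrier R" using subgroup.subset[OF H] by simp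
    then have "(\<Oplus>j\<in>insert i I. t j) = t i \<oplus> (\<Oplus>j\<in>I. t j)"
      using insert by (intro finsum_insert) auto
    then show ?case using insert subgroup.m_closed[OF H] by simp
  qed
next
  case False
  then show ?thesis using subgroup.one_closed[OF H] by (simp add: finsum_infinite)
qed

lemma add_hom_generate:
  assumes R: "ring R" and R': "ring R'" and h: "h \<in> hom (add_monoid R) (add_monoid R')"
    and H: "subgroup H (add_monoid R')" and A: "A \<subseteq> carrier R" and hA: "\<And>x. x \<in> A \<Longrightarrow> h x \<in> H"
    and x: "x \<in> generate (add_monoid R) A"
  shows "h x \<in> H"
proof -
  interpret R: ring R by fact
  interpret R': ring R' by fact
  have c: "y \<in> carrier R" if "y \<in> generate (add_monoid R) A" for y
    using R.add.generate_in_carrier[OF _ that] A by simp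
  show ?thesis using x
  proof (induction rule: generate.induct)
    case one
    then show ?case using add_hom_zero[OF R R' h] subgroup.one_closed[OF H] by simp
  next
    case (incl x)
    then show ?case by (rule hA)
  next
    case (inv x)
    then have "h (\<ominus>\<^bsub>R\<^esub> x) = \<ominus>\<^bsub>R'\<^esub> h x" using add_hom_uminus[OF R R' h] A by blast
    then show ?case using subgroup.m_inv_closed[OF H hA[OF inv]] by (simp add: a_inv_def)
  next
    case (eng x y)
    then show ?case using add_hom_add[OF R R' h c c] subgroup.m_closed[OF H] by simp
  qed
qed

lemma mult_left_add_hom: "ring R \<Longrightarrow> x \<in> carrier R \<Longrightarrow> (\<lambda>y. x \<otimes>\<^bsub>R\<^esub> y) \<in> hom (add_monoid R) (add_monoid R)"
  by (rule homI) (auto simp: ring.ring_simprules)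

lemma mult_right_add_hom: "ring R \<Longrightarrow> x \<in> carrier R \<Longrightarrow> (\<lambda>y. y \<otimes>\<^bsub>R\<^esub> x) \<in> hom (add_monoid R) (add_monoid R)"
  by (rule homI) (auto simp: ring.ring_simprules)

lemma zero_subgroup: "ring R \<Longrightarrow> subgroup {\<zero>\<^bsub>R\<^esub>} (add_monoid R)"
  using group.triv_subgroup[OF abelian_group.a_group[OF ring.is_abelian_group]] by fastforce

text \<open>The ghost components of V_m[1] are m at the multiples of m and 0 elsewhere, so the
  coefficients are provided by \<open>dwork_expansion\<close> for constant families.\<close>

lemma witt_expansion:
  assumes T: "truncation_set T" and fin: "finite T" and a: "a \<in> carrier (witt T)"
  obtains c :: "nat \<Rightarrow> int"
    where "a = (\<Oplus>\<^bsub>witt T\<^esub>m\<in>T. [c m] \<cdot>\<^bsub>witt T\<^esub> witt_ver m T (teich (T \<div> m) 1))"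
proof -
  interpret W: cring "witt T" using T by (rule ring_witt)
  let ?c = "dwork_coeff (\<lambda>x k. x) (\<lambda>n. ghost n a)"
  let ?v = "\<lambda>m. witt_ver m T (teich (T \<div> m) 1)"
  have v: "?v m \<in> carrier (witt T)" for m by (simp add: witt_ver_closed)
  have gn: "ghost k ([(n :: nat)] \<cdot>\<^bsub>witt T\<^esub> b) = int n * ghost k b" if "k \<in> T" "b \<in> carrier (witt T)" for k n b
    using that T by (induction n) (simp_all add: distrib_right)
  have gi: "ghost k ([(z :: int)] \<cdot>\<^bsub>witt T\<^esub> b) = z * ghost k b" if "k \<in> T" "b \<in> carrier (witt T)" for k z b
  proof (cases "0 \<le> z")
    case True
    then show ?thesis using gn[OF that, of "nat z"] by (simp add: add_pow_int_ge)
  next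
    case False
    have "[nat (- z)] \<cdot>\<^bsub>witt T\<^esub> b \<in> T \<rightarrow>\<^sub>E UNIV" using W.add.nat_pow_closed[OF that(2)] by simp
    then show ?thesis using False gn[OF that, of "nat (- z)"] that T by (simp add: add_pow_int_lt)
  qed
  have cv: "[?c m] \<cdot>\<^bsub>witt T\<^esub> ?v m \<in> carrier (witt T)" for m
    by (rule W.add.int_pow_closed[OF v])
  have gs: "ghost k (\<Oplus>\<^bsub>witt T\<^esub>m\<in>I. [?c m] \<cdot>\<^bsub>witt T\<^esub> ?v m) = (\<Sum>m\<in>I. ?c m * ghost k (?v m))"
    if "k \<in> T" "finite I" for k I
    using that(2)
  proof (induction I rule: finite_induct)
    case (insert m I)
    then show ?case using cv T that(1) gi[OF that(1) v] by (simp add: W.finsum_insert del: carrier_witt)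
  qed (use that T in simp)
  have "a = (\<Oplus>\<^bsub>witt T\<^esub>m\<in>T. [?c m] \<cdot>\<^bsub>witt T\<^esub> ?v m)"
  proof (rule ghost_inj[OF T])
    show "(\<Oplus>\<^bsub>witt T\<^esub>m\<in>T. [?c m] \<cdot>\<^bsub>witt T\<^esub> ?v m) \<in> T \<rightarrow>\<^sub>E UNIV"
      using W.finsum_closed[of "\<lambda>m. [?c m] \<cdot>\<^bsub>witt T\<^esub> ?v m" T] cv by simp
    fix k assume k: "k \<in> T"
    have k0: "0 < k" using T k by (rule truncation_set_pos)
    have "ghost k (\<Oplus>\<^bsub>witt T\<^esub>m\<in>T. [?c m] \<cdot>\<^bsub>witt T\<^esub> ?v m) = (\<Sum>m\<in>T. ?c m * ghost k (?v m))"
      using k fin by (rule gs)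
    also have "\<dots> = (\<Sum>m\<in>T. if m dvd k then int m * ?c m else 0)"
    proof (intro sum.cong refl)
      fix m assume m: "m \<in> T"
      have "ghost (k div m) (teich (T \<div> m) 1) = 1" if "m dvd k"
        using that k by (subst ghost_teich[OF truncation_set_quot[OF T] trunc_quotI[OF T]]) simp_all
      then show "?c m * ghost k (?v m) = (if m dvd k then int m * ?c m else 0)"
        using ghost_witt_ver[OF T truncation_set_pos[OF T m] k] by simp
    qed
    also have "\<dots> = (\<Sum>m | m dvd k. int m * ?c m)"
      using fin truncation_set_dvd[OF T k] by (intro sum.mono_neutral_cong_right) auto
    also have "\<dots> = ghost k a"
      using dwork_expansion[OF T dwork_ghost[OF T], of "\<lambda>x k. x" k a] dwork_const k by simp
    finally show "ghost k a = ghost k (\<Oplus>\<^bsub>witt T\<^esub>m\<in>T. [?c m] \<cdot>\<^bsub>witt T\<^esub> ?v m)" by simp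
  qed (use a in simp)
  then show ?thesis by (rule that)
qed

context witt_complex
begin

lemma eta_expansion:
  assumes T: "truncation_set T" and fin: "finite T" and a: "a \<in> carrier (witt T)"
  obtains c :: "nat \<Rightarrow> int" where "eta E T a = (\<Oplus>\<^bsub>obj E T\<^esub>m\<in>T. [c m] \<cdot>\<^bsub>obj E T\<^esub> ver_one E T m)"
proof -
  interpret W: cring "witt T" using T by (rule ring_witt)
  interpret R: ring "obj E T" using T by (rule ring_obj)
  note hom = ring_hom_add_hom[OF eta_hom[OF T]]
  let ?v = "\<lambda>m. witt_ver m T (teich (T \<div> m) 1)"
  have v: "?v m \<in> carrier (witt T)" for m by (simp add: witt_ver_closed)
  obtain c :: "nat \<Rightarrow> int" where c: "a = (\<Oplus>\<^bsub>witt T\<^esub>m\<in>T. [c m] \<cdot>\<^bsub>witt T\<^esub> ?v m)"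
    by (rule witt_expansion[OF T fin a])
  have "eta E T a = (\<Oplus>\<^bsub>obj E T\<^esub>m\<in>T. eta E T ([c m] \<cdot>\<^bsub>witt T\<^esub> ?v m))"
    unfolding c
    by (rule add_hom_finsum[OF W.ring_axioms R.ring_axioms hom fin]) (rule Pi_I, rule W.add.int_pow_closed[OF v])
  also have "\<dots> = (\<Oplus>\<^bsub>obj E T\<^esub>m\<in>T. [c m] \<cdot>\<^bsub>obj E T\<^esub> ver_one E T m)"
  proof (rule R.finsum_cong')
    fix m assume m: "m \<in> T"
    show "eta E T ([c m] \<cdot>\<^bsub>witt T\<^esub> ?v m) = [c m] \<cdot>\<^bsub>obj E T\<^esub> ver_one E T m"
      using add_hom_int_mult[OF W.ring_axioms R.ring_axioms hom v] eta_ver[OF T truncation_set_pos[OF T m]]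
      by (simp add: ver_one_def)
  qed (use ver_one_closed[OF T] truncation_set_pos[OF T] in auto)
  finally show ?thesis by (rule that)
qed

text \<open>The uniqueness half of the limit axiom. It reduces identities between homogeneous
  elements over an arbitrary S to finite truncation sets.\<close>

lemma eq_by_res:
  assumes S: "truncation_set S" and x: "x \<in> deg E S q" and y: "y \<in> deg E S q"
    and eq: "\<And>T. truncation_set T \<Longrightarrow> finite T \<Longrightarrow> T \<subseteq> S \<Longrightarrow> res E S T x = res E S T y"
  shows "x = y"
proof -
  have "\<exists>!z. z \<in> deg E S q \<and> (\<forall>T. truncation_set T \<and> finite T \<and> T \<subseteq> S \<longrightarrow> res E S T z = res E S T x)"
    by (rule limit[OF S]) (use S x deg_carrier[OF S x] in \<open>auto simp: res_deg res_res\<close>)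
  then show ?thesis using x y eq by (metis (no_types, lifting))
qed

text \<open>The decomposition concentrated in degree q and the one with components a and b belong to
  the same element, and the direct sum axiom identifies them.\<close>

lemma deg_unique:
  assumes S: "truncation_set S" and x: "x \<in> deg E S q" and a: "a \<in> deg E S 0" and b: "b \<in> deg E S 1"
    and xab: "x = a \<oplus>\<^bsub>obj E S\<^esub> b"
  shows "q = 0 \<Longrightarrow> x = a" "q = 1 \<Longrightarrow> x = b" "2 \<le> q \<Longrightarrow> x = \<zero>\<^bsub>obj E S\<^esub>"
proof -
  interpret R: ring "obj E S" using S by (rule ring_obj)
  have c: "x \<in> carrier (obj E S)" "a \<in> carrier (obj E S)" "b \<in> carrier (obj E S)"
    using deg_carrier[OF S] x a b by auto
  define f where "f = (\<lambda>r. if r = q then x else \<zero>\<^bsub>obj E S\<^esub>)"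
  define g where "g = (\<lambda>r :: nat. if r = 0 then a else if r = 1 then b else \<zero>\<^bsub>obj E S\<^esub>)"
  have f: "(\<forall>r. f r \<in> deg E S r) \<and> finite {r. f r \<noteq> \<zero>\<^bsub>obj E S\<^esub>} \<and> x = (\<Oplus>\<^bsub>obj E S\<^esub>r\<in>{r. f r \<noteq> \<zero>\<^bsub>obj E S\<^esub>}. f r)"
  proof -
    have sub: "{r. f r \<noteq> \<zero>\<^bsub>obj E S\<^esub>} \<subseteq> {q}" by (auto simp: f_def)
    have "(\<Oplus>\<^bsub>obj E S\<^esub>r\<in>{r. f r \<noteq> \<zero>\<^bsub>obj E S\<^esub>}. f r) = (\<Oplus>\<^bsub>obj E S\<^esub>r\<in>{q}. f r)"
      using sub c by (intro R.add.finprod_mono_neutral_cong_left) (auto simp: f_def)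
    then show ?thesis using c x deg_zero[OF S] finite_subset[OF sub] by (auto simp: f_def)
  qed
  have g: "(\<forall>r. g r \<in> deg E S r) \<and> finite {r. g r \<noteq> \<zero>\<^bsub>obj E S\<^esub>} \<and> x = (\<Oplus>\<^bsub>obj E S\<^esub>r\<in>{r. g r \<noteq> \<zero>\<^bsub>obj E S\<^esub>}. g r)"
  proof -
    have sub: "{r. g r \<noteq> \<zero>\<^bsub>obj E S\<^esub>} \<subseteq> {0, 1}" by (auto simp: g_def)
    have "(\<Oplus>\<^bsub>obj E S\<^esub>r\<in>{r. g r \<noteq> \<zero>\<^bsub>obj E S\<^esub>}. g r) = (\<Oplus>\<^bsub>obj E S\<^esub>r\<in>{0, 1}. g r)"
      using sub c by (intro R.add.finprod_mono_neutral_cong_left) (auto simp: g_def)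
    then show ?thesis using c a b deg_zero[OF S] finite_subset[OF sub] by (auto simp: g_def xab)
  qed
  have "f = g" using anticomm_graded_ring.direct_sum[OF graded[OF S] c(1)] f g by blast
  then have "f q = g q" by simp
  then show "q = 0 \<Longrightarrow> x = a" "q = 1 \<Longrightarrow> x = b" "2 \<le> q \<Longrightarrow> x = \<zero>\<^bsub>obj E S\<^esub>"
    by (simp_all add: f_def g_def split: if_splits)
qed

lemma res_ver_one:
  assumes S: "truncation_set S" and T: "truncation_set T" "T \<subseteq> S" and n: "0 < n"
  shows "res E S T (ver_one E S n) = ver_one E T n"
proof -
  have Q: "T \<div> n \<subseteq> S \<div> n" using T by (auto simp: trunc_quot_def)
  show ?thesis
    using ver_res[OF S T n one_closed'[OF truncation_set_quot[OF S]]]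
      ring_hom_one[OF res_hom[OF truncation_set_quot[OF S] truncation_set_quot[OF T(1)] Q]]
    by (simp add: ver_one_eq S T)
qed

lemma res_diff_ver_one:
  assumes S: "truncation_set S" and T: "truncation_set T" "T \<subseteq> S" and n: "0 < n"
  shows "res E S T (diff E S (ver_one E S n)) = diff E T (ver_one E T n)"
  by (simp add: diff_res[OF S T ver_one_closed[OF S n]] res_ver_one[OF assms])

text \<open>The index n runs over all positive integers and not only over T. The additional
  generators are 0, and closure under operations that multiply indices can be stated without case
  distinctions.\<close>

definition dgens :: "nat set \<Rightarrow> 'u set" where
  "dgens T = {diff E T (ver_one E T n) | n. 0 < n}"

definition dspan :: "nat set \<Rightarrow> 'u set" where
  "dspan T = generate (add_monoid (obj E T)) (dgens T)"

lemma dgens_carrier: "truncation_set T \<Longrightarrow> dgens T \<subseteq> carrier (obj E T)"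
  by (auto simp: dgens_def diff_ver_one_closed)

lemma dspan_subgroup: "truncation_set T \<Longrightarrow> subgroup (dspan T) (add_monoid (obj E T))"
  unfolding dspan_def using group.generate_is_subgroup[OF abelian_group.a_group[OF ring.is_abelian_group[OF ring_obj]]]
    dgens_carrier by fastforce

lemma dspan_gen: "0 < n \<Longrightarrow> diff E T (ver_one E T n) \<in> dspan T"
  unfolding dspan_def by (rule generate.incl) (auto simp: dgens_def)

lemma dspan_hom:
  assumes T: "truncation_set T" and R: "ring R" and h: "h \<in> hom (add_monoid (obj E T)) (add_monoid R)"
    and H: "subgroup H (add_monoid R)" and g: "\<And>n. 0 < n \<Longrightarrow> h (diff E T (ver_one E T n)) \<in> H"
    and x: "x \<in> dspan T"
  shows "h x \<in> H"
  by (rule add_hom_generate[OF ring_obj[OF T] R h H dgens_carrier[OF T] _ x[unfolded dspan_def]])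
    (auto simp: dgens_def g)

lemma dspan_deg:
  assumes T: "truncation_set T"
  shows "dspan T \<subseteq> deg E T 1"
proof -
  interpret ring "obj E T" using T by (rule ring_obj)
  have "dgens T \<subseteq> deg E T 1" using diff_ver_one_deg[OF T] by (auto simp: dgens_def)
  then show ?thesis
    unfolding dspan_def
    by (rule add.generate_subgroup_incl[OF _ anticomm_graded_ring.degree_subgroup[OF graded[OF T]]])
qed

lemma dspan_carrier: "truncation_set T \<Longrightarrow> x \<in> dspan T \<Longrightarrow> x \<in> carrier (obj E T)"
  by (rule deg_carrier[OF _ subsetD[OF dspan_deg]])

lemma dspan_int_mult:
  assumes "truncation_set T" "x \<in> dspan T"
  shows "[(k :: int)] \<cdot>\<^bsub>obj E T\<^esub> x \<in> dspan T" "[(n :: nat)] \<cdot>\<^bsub>obj E T\<^esub> x \<in> dspan T"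
proof -
  interpret ring "obj E T" using assms by (intro ring_obj)
  show k: "[(k :: int)] \<cdot>\<^bsub>obj E T\<^esub> x \<in> dspan T" for k
    using add.subgroup_int_pow_closed[OF dspan_subgroup[OF assms(1)] assms(2)] by simp
  show "[(n :: nat)] \<cdot>\<^bsub>obj E T\<^esub> x \<in> dspan T"
    using k[of "int n"] by (simp add: add_pow_def int_pow_int)
qed

lemma dspan_add: "truncation_set T \<Longrightarrow> x \<in> dspan T \<Longrightarrow> y \<in> dspan T \<Longrightarrow> x \<oplus>\<^bsub>obj E T\<^esub> y \<in> dspan T"
  using subgroup.m_closed[OF dspan_subgroup] by fastforce

text \<open>Downward induction along n, 2n, 4n, ... by \<open>ver_eps_rec\<close>; it starts where
  the index has left T and V_n is 0.\<close>

lemma ver_eps_dspan: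
  assumes T: "truncation_set T" and fin: "finite T" and n: "0 < n"
  shows "ver E n T (eps (T \<div> n)) \<in> dspan T"
proof -
  obtain N where N: "\<And>k. k \<in> T \<Longrightarrow> k < N" using fin by (metis finite_nat_set_iff_bounded)
  show ?thesis using n
  proof (induction "N - n" arbitrary: n rule: less_induct)
    case less
    show ?case
    proof (cases "n \<in> T")
      case False
      then show ?thesis
        using ver_outside[OF T less.prems _ eps_closed[OF truncation_set_quot[OF T]]]
          subgroup.one_closed[OF dspan_subgroup[OF T]] by simp
    next
      case True
      then have "ver E (2 * n) T (eps (T \<div> (2 * n))) \<in> dspan T"
        using N[OF True] less.prems by (intro less.hyps) auto
      then show ?thesis
        using less.prems by (subst ver_eps_rec[OF T less.prems]) (intro dspan_add dspan_int_mult T dspan_gen; simp)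
    qed
  qed
qed

lemma frob_diff_ver_one_dspan:
  assumes S: "truncation_set S" and m: "0 < m" and n: "0 < n" and fin: "finite (S \<div> m)"
  shows "frob E m S (diff E S (ver_one E S n)) \<in> dspan (S \<div> m)"
proof -
  note l = lcm_div_gcd[OF m n] and Sm = truncation_set_quot[OF S, of m]
  have "coprime (int (m div gcd m n)) (int (n div gcd m n))" using l(3) by simp
  then obtain a where a: "[a * int (m div gcd m n) = 1] (mod int (n div gcd m n))"
    by (metis cong_solve_coprime_int mult.commute)
  have "0 < lcm m n div m" using l by simp
  then show ?thesis
    unfolding frob_diff_ver_one[OF S m n a]
    by (intro dspan_add Sm dspan_int_mult dspan_gen ver_eps_dspan fin)
qed

lemma finite_trunc_quot: "finite T \<Longrightarrow> 0 < n \<Longrightarrow> finite (T \<div> n)"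
  by (rule finite_imageD[of "\<lambda>e. n * e"]) (auto simp: trunc_quot_def inj_on_def intro: finite_subset)

lemma frob_dspan:
  assumes T: "truncation_set T" and fin: "finite T" and n: "0 < n" and x: "x \<in> dspan T"
  shows "frob E n T x \<in> dspan (T \<div> n)"
  by (rule dspan_hom[OF T ring_obj[OF truncation_set_quot[OF T]] frob_add_hom[OF T n] dspan_subgroup[OF truncation_set_quot[OF T]] _ x])
    (intro frob_diff_ver_one_dspan T n finite_trunc_quot fin)

lemma ver_dspan:
  assumes T: "truncation_set T" and n: "0 < n" and x: "x \<in> dspan (T \<div> n)"
  shows "ver E n T x \<in> dspan T"
  by (rule dspan_hom[OF truncation_set_quot[OF T] ring_obj[OF T] ver_hom[OF T n] dspan_subgroup[OF T] _ x])
    (use n in \<open>simp add: ver_diff_ver_one[OF T n] dspan_int_mult[OF T dspan_gen]\<close>)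

lemma res_dspan:
  assumes S: "truncation_set S" and T: "truncation_set T" "T \<subseteq> S" and x: "x \<in> dspan S"
  shows "res E S T x \<in> dspan T"
  by (rule dspan_hom[OF S ring_obj[OF T(1)] res_add_hom[OF S T] dspan_subgroup[OF T(1)] _ x])
    (simp add: res_diff_ver_one[OF S T] dspan_gen)

lemma diff_dspan:
  assumes T: "truncation_set T" and fin: "finite T" and x: "x \<in> dspan T"
  shows "diff E T x = \<zero>\<^bsub>obj E T\<^esub>"
proof -
  have "diff E T x \<in> {\<zero>\<^bsub>obj E T\<^esub>}"
    by (rule dspan_hom[OF T ring_obj[OF T] diff_hom[OF T] zero_subgroup[OF ring_obj[OF T]] _ x])
      (simp add: diff_diff[OF T ver_one_closed[OF T]] eps_diff_ver_one[OF T fin])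
  then show ?thesis by simp
qed

lemma ver_one_mult_diff_ver_one:
  assumes S: "truncation_set S" and m: "0 < m" and n: "0 < n"
  shows "ver_one E S m \<otimes>\<^bsub>obj E S\<^esub> diff E S (ver_one E S n) = ver E m S (frob E m S (diff E S (ver_one E S n)))"
  using deg_0_comm[OF S ver_one_deg[OF S m] diff_ver_one_deg[OF S n]] mult_ver_one[OF S m diff_ver_one_closed[OF S n]] by simp

lemma ver_one_mult_dspan:
  assumes T: "truncation_set T" and fin: "finite T" and m: "0 < m" and x: "x \<in> dspan T"
  shows "ver_one E T m \<otimes>\<^bsub>obj E T\<^esub> x \<in> dspan T"
  by (rule dspan_hom[OF T ring_obj[OF T] mult_left_add_hom[OF ring_obj[OF T] ver_one_closed[OF T m]] dspan_subgroup[OF T] _ x])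
    (simp add: ver_one_mult_diff_ver_one[OF T m] ver_dspan[OF T m] frob_diff_ver_one_dspan[OF T m _ finite_trunc_quot[OF fin m]])

lemma eta_mult_dspan:
  assumes T: "truncation_set T" and fin: "finite T" and a: "a \<in> carrier (witt T)" and x: "x \<in> dspan T"
  shows "eta E T a \<otimes>\<^bsub>obj E T\<^esub> x \<in> dspan T"
proof -
  interpret R: ring "obj E T" using T by (rule ring_obj)
  obtain c :: "nat \<Rightarrow> int" where c: "eta E T a = (\<Oplus>\<^bsub>obj E T\<^esub>m\<in>T. [c m] \<cdot>\<^bsub>obj E T\<^esub> ver_one E T m)"
    by (rule eta_expansion[OF T fin a])
  have xc: "x \<in> carrier (obj E T)" using dspan_carrier[OF T x] .
  have v: "ver_one E T m \<in> carrier (obj E T)" if "m \<in> T" for m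
    using ver_one_closed[OF T truncation_set_pos[OF T that]] .
  have "eta E T a \<otimes>\<^bsub>obj E T\<^esub> x = (\<Oplus>\<^bsub>obj E T\<^esub>m\<in>T. ([c m] \<cdot>\<^bsub>obj E T\<^esub> ver_one E T m) \<otimes>\<^bsub>obj E T\<^esub> x)"
    unfolding c using fin xc v by (intro R.finsum_ldistr) auto
  also have "\<dots> \<in> dspan T"
  proof (rule R.finsum_subgroup[OF dspan_subgroup[OF T]])
    fix m assume m: "m \<in> T"
    have "([c m] \<cdot>\<^bsub>obj E T\<^esub> ver_one E T m) \<otimes>\<^bsub>obj E T\<^esub> x = [c m] \<cdot>\<^bsub>obj E T\<^esub> (ver_one E T m \<otimes>\<^bsub>obj E T\<^esub> x)"
      using v[OF m] xc by (rule R.add_pow_ldistr_int)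
    then show "([c m] \<cdot>\<^bsub>obj E T\<^esub> ver_one E T m) \<otimes>\<^bsub>obj E T\<^esub> x \<in> dspan T"
      using dspan_int_mult(1)[OF T ver_one_mult_dspan[OF T fin truncation_set_pos[OF T m] x]] by simp
  qed
  finally show ?thesis .
qed

text \<open>For a generator, dV_n(1) y = d(V_n(1) y) - V_n(1) dy. Both y and V_n(1) y belong to the
  span, on which d vanishes over a finite set.\<close>

lemma dspan_mult_dspan:
  assumes T: "truncation_set T" and fin: "finite T" and x: "x \<in> dspan T" and y: "y \<in> dspan T"
  shows "x \<otimes>\<^bsub>obj E T\<^esub> y = \<zero>\<^bsub>obj E T\<^esub>"
proof -
  interpret R: ring "obj E T" using T by (rule ring_obj)
  let ?D = "\<lambda>n. diff E T (ver_one E T n)"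
  have yc: "y \<in> carrier (obj E T)" "y \<in> deg E T 1"
    using dspan_carrier[OF T y] subsetD[OF dspan_deg[OF T] y] .
  have gen: "?D n \<otimes>\<^bsub>obj E T\<^esub> y \<in> {\<zero>\<^bsub>obj E T\<^esub>}" if n: "0 < n" for n
  proof -
    have "diff E T (ver_one E T n \<otimes>\<^bsub>obj E T\<^esub> y) = \<zero>\<^bsub>obj E T\<^esub>"
      using diff_dspan[OF T fin ver_one_mult_dspan[OF T fin n y]] .
    then have "?D n \<otimes>\<^bsub>obj E T\<^esub> y \<oplus>\<^bsub>obj E T\<^esub> ver_one E T n \<otimes>\<^bsub>obj E T\<^esub> diff E T y = \<zero>\<^bsub>obj E T\<^esub>"
      using leibniz_0[OF T ver_one_deg[OF T n] yc(2)] by simp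
    then show ?thesis
      using diff_dspan[OF T fin y] diff_ver_one_closed[OF T n] ver_one_closed[OF T n] yc(1) by simp
  qed
  have "x \<otimes>\<^bsub>obj E T\<^esub> y \<in> {\<zero>\<^bsub>obj E T\<^esub>}"
    by (rule dspan_hom[OF T R.ring_axioms mult_right_add_hom[OF R.ring_axioms yc(1)] zero_subgroup[OF R.ring_axioms] gen x])
  then show ?thesis by simp
qed

definition base_part :: "nat \<Rightarrow> nat set \<Rightarrow> 'u set" where
  "base_part q T = (if q = 0 then eta E T ` carrier (witt T) else if q = 1 then dspan T else {\<zero>\<^bsub>obj E T\<^esub>})"

text \<open>
  The span of the \<open>dV\<^sub>n(1)\<close> is stable under the Frobenius only over finite truncation sets, since in
  general \<open>F\<^sub>m dV\<^sub>n(1)\<close> is an infinite sum of such elements.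
\<close>

definition sub_part :: "nat set \<Rightarrow> nat \<Rightarrow> 'u set" where
  "sub_part S q = {x \<in> deg E S q. \<forall>T. truncation_set T \<and> finite T \<and> T \<subseteq> S \<longrightarrow> res E S T x \<in> base_part q T}"

text \<open>The parts in degrees 0 and 1 suffice, because the parts in higher degrees are 0 by
  \<open>sub_part_2\<close>.\<close>

definition sub_carrier :: "nat set \<Rightarrow> 'u set" where
  "sub_carrier S = {a \<oplus>\<^bsub>obj E S\<^esub> b | a b. a \<in> sub_part S 0 \<and> b \<in> sub_part S 1}"

definition subcomplex :: "'u witt_data" where
  "subcomplex = E\<lparr>obj := \<lambda>S. (obj E S)\<lparr>carrier := sub_carrier S\<rparr>, deg := sub_part\<rparr>"

lemma subcomplex_simps [simp]:
  "obj subcomplex S = (obj E S)\<lparr>carrier := sub_carrier S\<rparr>" "deg subcomplex = sub_part"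
  "res subcomplex = res E" "eta subcomplex = eta E" "diff subcomplex = diff E"
  "frob subcomplex = frob E" "ver subcomplex = ver E"
  by (simp_all add: subcomplex_def)

lemma base_part_subgroup:
  assumes T: "truncation_set T"
  shows "subgroup (base_part q T) (add_monoid (obj E T))"
proof -
  interpret W: cring "witt T" using T by (rule ring_witt)
  interpret R: ring "obj E T" using T by (rule ring_obj)
  interpret h: group_hom "add_monoid (witt T)" "add_monoid (obj E T)" "eta E T"
    by (intro group_hom.intro group_hom_axioms.intro W.add.group_axioms R.add.group_axioms ring_hom_add_hom eta_hom T)
  have "subgroup (eta E T ` carrier (witt T)) (add_monoid (obj E T))"
    using h.subgroup_img_is_subgroup[OF W.add.subgroup_self] by simp
  then show ?thesis
    using dspan_subgroup[OF T] zero_subgroup[OF R.ring_axioms] by (simp add: base_part_def)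
qed

lemma base_part_zero: "truncation_set T \<Longrightarrow> \<zero>\<^bsub>obj E T\<^esub> \<in> base_part q T"
  using subgroup.one_closed[OF base_part_subgroup] by fastforce

lemma sub_part_deg: "x \<in> sub_part S q \<Longrightarrow> x \<in> deg E S q"
  by (simp add: sub_part_def)

lemma sub_part_res: "x \<in> sub_part S q \<Longrightarrow> truncation_set T \<Longrightarrow> finite T \<Longrightarrow> T \<subseteq> S \<Longrightarrow> res E S T x \<in> base_part q T"
  by (simp add: sub_part_def)

lemma sub_part_subgroup:
  assumes S: "truncation_set S"
  shows "subgroup (sub_part S q) (add_monoid (obj E S))"
proof -
  interpret R: ring "obj E S" using S by (rule ring_obj)
  note G = anticomm_graded_ring.degree_subgroup[OF graded[OF S], of q]
  show ?thesis
  proof (rule R.add.subgroupI)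
    show "sub_part S q \<subseteq> carrier (obj E S)" using sub_part_deg deg_carrier[OF S] by blast
    have "\<zero>\<^bsub>obj E S\<^esub> \<in> sub_part S q"
      using deg_zero[OF S] add_hom_zero[OF ring_obj[OF S] ring_obj res_add_hom[OF S]] base_part_zero
      by (simp add: sub_part_def)
    then show "sub_part S q \<noteq> {}" by blast
    fix x assume x: "x \<in> sub_part S q"
    have xc: "x \<in> carrier (obj E S)" using x sub_part_deg deg_carrier[OF S] by blast
    show "\<ominus>\<^bsub>obj E S\<^esub> x \<in> sub_part S q"
      unfolding sub_part_def
    proof (intro CollectI conjI allI impI)
      show "\<ominus>\<^bsub>obj E S\<^esub> x \<in> deg E S q" using subgroup.m_inv_closed[OF G sub_part_deg[OF x]] by (simp add: a_inv_def)
      fix T assume T: "truncation_set T \<and> finite T \<and> T \<subseteq> S"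
      then have "res E S T (\<ominus>\<^bsub>obj E S\<^esub> x) = \<ominus>\<^bsub>obj E T\<^esub> res E S T x"
        using add_hom_uminus[OF ring_obj[OF S] ring_obj res_add_hom[OF S] xc] by blast
      then show "res E S T (\<ominus>\<^bsub>obj E S\<^esub> x) \<in> base_part q T"
        using subgroup.m_inv_closed[OF base_part_subgroup sub_part_res[OF x]] T by (simp add: a_inv_def)
    qed
    fix y assume y: "y \<in> sub_part S q"
    have yc: "y \<in> carrier (obj E S)" using y sub_part_deg deg_carrier[OF S] by blast
    show "x \<oplus>\<^bsub>obj E S\<^esub> y \<in> sub_part S q"
      unfolding sub_part_def
    proof (intro CollectI conjI allI impI)
      show "x \<oplus>\<^bsub>obj E S\<^esub> y \<in> deg E S q" by (rule deg_add[OF S sub_part_deg[OF x] sub_part_deg[OF y]])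
      fix T assume T: "truncation_set T \<and> finite T \<and> T \<subseteq> S"
      then have "res E S T (x \<oplus>\<^bsub>obj E S\<^esub> y) = res E S T x \<oplus>\<^bsub>obj E T\<^esub> res E S T y"
        using add_hom_add[OF ring_obj[OF S] ring_obj res_add_hom[OF S] xc yc] by blast
      then show "res E S T (x \<oplus>\<^bsub>obj E S\<^esub> y) \<in> base_part q T"
        using subgroup.m_closed[OF base_part_subgroup sub_part_res[OF x] sub_part_res[OF y]] T by simp
    qed
  qed
qed

lemma base_part_0: "base_part 0 T = eta E T ` carrier (witt T)"
  and base_part_1: "base_part (Suc 0) T = dspan T"
  and base_part_2: "2 \<le> q \<Longrightarrow> base_part q T = {\<zero>\<^bsub>obj E T\<^esub>}"
  by (auto simp: base_part_def)

lemma q_cases: "(q = 0 \<Longrightarrow> P) \<Longrightarrow> (q = Suc 0 \<Longrightarrow> P) \<Longrightarrow> (2 \<le> q \<Longrightarrow> P) \<Longrightarrow> P" for q :: nat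
  by linarith

lemma base_part_frob:
  assumes T: "truncation_set T" and fin: "finite T" and n: "0 < n" and x: "x \<in> base_part q T"
  shows "frob E n T x \<in> base_part q (T \<div> n)"
proof (rule q_cases[of q])
  assume q: "q = 0"
  then obtain a where "x = eta E T a" "a \<in> carrier (witt T)" using x by (auto simp: base_part_0)
  then show ?thesis using T n witt_frob_closed[OF T n, of a] by (auto simp: q base_part_0 frob_eta)
next
  assume q: "q = Suc 0"
  then show ?thesis using x frob_dspan[OF T fin n] by (simp add: base_part_1)
next
  assume q: "2 \<le> q"
  then show ?thesis using x add_hom_zero[OF ring_obj[OF T] ring_obj[OF truncation_set_quot[OF T]] frob_add_hom[OF T n]]
    by (simp add: base_part_2)
qed

lemma base_part_ver:
  assumes T: "truncation_set T" and n: "0 < n" and x: "x \<in> base_part q (T \<div> n)"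
  shows "ver E n T x \<in> base_part q T"
proof (rule q_cases[of q])
  assume q: "q = 0"
  then obtain a where a: "x = eta E (T \<div> n) a" "a \<in> carrier (witt (T \<div> n))" using x by (auto simp: base_part_0)
  then have "ver E n T x = eta E T (witt_ver n T a)" using T n by (simp add: eta_ver)
  then show ?thesis by (simp add: q base_part_0 witt_ver_closed)
next
  assume q: "q = Suc 0"
  then show ?thesis using x ver_dspan[OF T n] by (simp add: base_part_1)
next
  assume q: "2 \<le> q"
  then show ?thesis using x add_hom_zero[OF ring_obj[OF truncation_set_quot[OF T]] ring_obj[OF T] ver_hom[OF T n]]
    by (simp add: base_part_2)
qed

lemma base_part_res:
  assumes S: "truncation_set S" and T: "truncation_set T" "T \<subseteq> S" and x: "x \<in> base_part q S"
  shows "res E S T x \<in> base_part q T"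
proof (rule q_cases[of q])
  assume q: "q = 0"
  then obtain a where a: "x = eta E S a" "a \<in> carrier (witt S)" using x by (auto simp: base_part_0)
  then have "res E S T x = eta E T (restrict a T)" using S T by (simp add: eta_res)
  then show ?thesis by (simp add: q base_part_0)
next
  assume q: "q = Suc 0"
  then show ?thesis using x res_dspan[OF S T] by (simp add: base_part_1)
next
  assume q: "2 \<le> q"
  then show ?thesis using x add_hom_zero[OF ring_obj[OF S] ring_obj[OF T(1)] res_add_hom[OF S T]]
    by (simp add: base_part_2)
qed

lemma base_part_diff:
  assumes T: "truncation_set T" and fin: "finite T" and x: "x \<in> base_part q T"
  shows "diff E T x \<in> base_part (q + 1) T"
proof (rule q_cases[of q])
  assume q: "q = 0"
  interpret R: ring "obj E T" using T by (rule ring_obj)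
  obtain a where a: "x = eta E T a" "a \<in> carrier (witt T)" using x q by (auto simp: base_part_0)
  obtain c :: "nat \<Rightarrow> int" where c: "eta E T a = (\<Oplus>\<^bsub>obj E T\<^esub>m\<in>T. [c m] \<cdot>\<^bsub>obj E T\<^esub> ver_one E T m)"
    by (rule eta_expansion[OF T fin a(2)])
  have v: "ver_one E T m \<in> carrier (obj E T)" if "m \<in> T" for m
    using ver_one_closed[OF T truncation_set_pos[OF T that]] .
  have "diff E T x = (\<Oplus>\<^bsub>obj E T\<^esub>m\<in>T. diff E T ([c m] \<cdot>\<^bsub>obj E T\<^esub> ver_one E T m))"
    unfolding a(1) c by (rule add_hom_finsum[OF R.ring_axioms R.ring_axioms diff_hom[OF T] fin]) (use v in auto)
  also have "\<dots> \<in> dspan T"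
  proof (rule R.finsum_subgroup[OF dspan_subgroup[OF T]])
    fix m assume m: "m \<in> T"
    show "diff E T ([c m] \<cdot>\<^bsub>obj E T\<^esub> ver_one E T m) \<in> dspan T"
      using add_hom_int_mult[OF R.ring_axioms R.ring_axioms diff_hom[OF T] v[OF m], of "c m"]
        dspan_int_mult(1)[OF T dspan_gen[OF truncation_set_pos[OF T m]], of "c m"] by simp
  qed
  finally show ?thesis by (simp add: q base_part_1)
next
  assume q: "q = Suc 0"
  then show ?thesis using x diff_dspan[OF T fin] by (simp add: base_part_1 base_part_2)
next
  assume q: "2 \<le> q"
  then show ?thesis using x diff_zero[OF T] by (simp add: base_part_2)
qed

lemma base_part_mult:
  assumes T: "truncation_set T" and fin: "finite T"
  shows "x \<in> base_part 0 T \<Longrightarrow> y \<in> base_part 0 T \<Longrightarrow> x \<otimes>\<^bsub>obj E T\<^esub> y \<in> base_part 0 T"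
    "x \<in> base_part 0 T \<Longrightarrow> y \<in> base_part 1 T \<Longrightarrow> x \<otimes>\<^bsub>obj E T\<^esub> y \<in> base_part 1 T"
    "x \<in> base_part 1 T \<Longrightarrow> y \<in> base_part 1 T \<Longrightarrow> x \<otimes>\<^bsub>obj E T\<^esub> y = \<zero>\<^bsub>obj E T\<^esub>"
proof -
  interpret W: cring "witt T" using T by (rule ring_witt)
  show "x \<otimes>\<^bsub>obj E T\<^esub> y \<in> base_part 0 T" if xy: "x \<in> base_part 0 T" "y \<in> base_part 0 T"
  proof -
    obtain a b where ab: "x = eta E T a" "a \<in> carrier (witt T)" "y = eta E T b" "b \<in> carrier (witt T)"
      using xy by (auto simp: base_part_0)
    then have "x \<otimes>\<^bsub>obj E T\<^esub> y = eta E T (a \<otimes>\<^bsub>witt T\<^esub> b)" by (simp add: ring_hom_mult[OF eta_hom[OF T]])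
    then show ?thesis using W.m_closed[OF ab(2,4)] unfolding base_part_0 by blast
  qed
  show "x \<otimes>\<^bsub>obj E T\<^esub> y \<in> base_part 1 T" if "x \<in> base_part 0 T" "y \<in> base_part 1 T"
    using that eta_mult_dspan[OF T fin] by (auto simp: base_part_0 base_part_1)
  show "x \<otimes>\<^bsub>obj E T\<^esub> y = \<zero>\<^bsub>obj E T\<^esub>" if "x \<in> base_part 1 T" "y \<in> base_part 1 T"
    using that dspan_mult_dspan[OF T fin] by (simp add: base_part_1)
qed

text \<open>To test F_n(x) over a finite U inside S \<div> n, the element x has to be known over a
  finite truncation set T in S with U \<subseteq> T \<div> n. The divisors of all n u with u in U
  form such a set.\<close>

lemma divisor_closure:
  assumes S: "truncation_set S" and U: "truncation_set U" "finite U" "U \<subseteq> S \<div> n" and n: "0 < n"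
  obtains T where "truncation_set T" "finite T" "T \<subseteq> S" "U \<subseteq> T \<div> n"
proof
  let ?T = "\<Union>u\<in>U. {d. d dvd n * u}"
  have pos: "0 < n * u" if "u \<in> U" for u using truncation_set_pos[OF U(1) that] n by simp
  show "truncation_set ?T"
    unfolding truncation_set_def using pos by (auto intro: dvd_trans)
  show "finite ?T" using U(2) pos by (intro finite_UN_I) auto
  show "?T \<subseteq> S" using U(3) truncation_set_dvd[OF S] trunc_quotD by blast
  show "U \<subseteq> ?T \<div> n"
  proof
    fix u assume u: "u \<in> U"
    then have "n * u \<in> ?T" by (rule UN_I) simp
    then show "u \<in> ?T \<div> n" using truncation_set_pos[OF U(1) u] by (simp add: trunc_quot_def)
  qed
qed

lemma sub_part_frob:
  assumes S: "truncation_set S" and n: "0 < n" and x: "x \<in> sub_part S q"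
  shows "frob E n S x \<in> sub_part (S \<div> n) q"
  unfolding sub_part_def
proof (intro CollectI conjI allI impI)
  show "frob E n S x \<in> deg E (S \<div> n) q" by (rule frob_deg[OF S n sub_part_deg[OF x]])
  fix U assume U: "truncation_set U \<and> finite U \<and> U \<subseteq> S \<div> n"
  have xc: "x \<in> carrier (obj E S)" using deg_carrier[OF S sub_part_deg[OF x]] .
  obtain T where T: "truncation_set T" "finite T" "T \<subseteq> S" "U \<subseteq> T \<div> n"
    using divisor_closure[OF S _ _ _ n, of U] U by blast
  note Tn = truncation_set_quot[OF T(1), of n] and Sn = truncation_set_quot[OF S, of n]
  have sub: "T \<div> n \<subseteq> S \<div> n" using T by (auto simp: trunc_quot_def)
  have "res E (S \<div> n) U (frob E n S x) = res E (T \<div> n) U (res E (S \<div> n) (T \<div> n) (frob E n S x))"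
    using res_res[OF Sn Tn _ sub T(4) frob_closed[OF S n xc]] U by simp
  also have "\<dots> = res E (T \<div> n) U (frob E n T (res E S T x))"
    by (simp add: frob_res[OF S T(1,3) n xc])
  also have "\<dots> \<in> base_part q U"
    using U by (intro base_part_res[OF Tn _ T(4)] base_part_frob[OF T(1,2) n] sub_part_res[OF x T(1-3)]) simp
  finally show "res E (S \<div> n) U (frob E n S x) \<in> base_part q U" .
qed

lemma sub_part_ver:
  assumes S: "truncation_set S" and n: "0 < n" and x: "x \<in> sub_part (S \<div> n) q"
  shows "ver E n S x \<in> sub_part S q"
  unfolding sub_part_def
proof (intro CollectI conjI allI impI)
  show "ver E n S x \<in> deg E S q" by (rule ver_deg[OF S n sub_part_deg[OF x]])
  fix T assume T: "truncation_set T \<and> finite T \<and> T \<subseteq> S"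
  have xc: "x \<in> carrier (obj E (S \<div> n))" using deg_carrier[OF truncation_set_quot[OF S] sub_part_deg[OF x]] .
  have sub: "T \<div> n \<subseteq> S \<div> n" using T by (auto simp: trunc_quot_def)
  have "res E S T (ver E n S x) = ver E n T (res E (S \<div> n) (T \<div> n) x)"
    using T by (intro ver_res[OF S _ _ n xc]) simp_all
  also have "\<dots> \<in> base_part q T"
    using T by (intro base_part_ver n sub_part_res[OF x] truncation_set_quot finite_trunc_quot sub) simp_all
  finally show "res E S T (ver E n S x) \<in> base_part q T" .
qed

lemma sub_part_restrict:
  assumes S: "truncation_set S" and T: "truncation_set T" "T \<subseteq> S" and x: "x \<in> sub_part S q"
  shows "res E S T x \<in> sub_part T q"
  unfolding sub_part_def
proof (intro CollectI conjI allI impI)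
  show "res E S T x \<in> deg E T q" by (rule res_deg[OF S T sub_part_deg[OF x]])
  fix U assume U: "truncation_set U \<and> finite U \<and> U \<subseteq> T"
  then show "res E T U (res E S T x) \<in> base_part q U"
    using sub_part_res[OF x, of U] T res_res[OF S T(1) _ T(2), of U x] deg_carrier[OF S sub_part_deg[OF x]] by auto
qed

lemma sub_part_diff:
  assumes S: "truncation_set S" and x: "x \<in> sub_part S q"
  shows "diff E S x \<in> sub_part S (q + 1)"
  unfolding sub_part_def
proof (intro CollectI conjI allI impI)
  show "diff E S x \<in> deg E S (q + 1)" by (rule diff_deg[OF S sub_part_deg[OF x]])
  fix T assume T: "truncation_set T \<and> finite T \<and> T \<subseteq> S"
  then show "res E S T (diff E S x) \<in> base_part (q + 1) T"
    using sub_part_res[OF x, of T] base_part_diff[of T "res E S T x" q]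
      diff_res[OF S _ _ deg_carrier[OF S sub_part_deg[OF x]], of T] by simp
qed

lemma sub_part_eta:
  assumes S: "truncation_set S" and a: "a \<in> carrier (witt S)"
  shows "eta E S a \<in> sub_part S 0"
  unfolding sub_part_def using eta_deg[OF S a] eta_res[OF S _ _ a] by (auto simp: base_part_0)

lemma sub_part_2:
  assumes S: "truncation_set S" and q: "2 \<le> q"
  shows "sub_part S q = {\<zero>\<^bsub>obj E S\<^esub>}"
proof
  show "{\<zero>\<^bsub>obj E S\<^esub>} \<subseteq> sub_part S q" using subgroup.one_closed[OF sub_part_subgroup[OF S]] by simp
  show "sub_part S q \<subseteq> {\<zero>\<^bsub>obj E S\<^esub>}"
  proof
    fix x assume x: "x \<in> sub_part S q"
    have "x = \<zero>\<^bsub>obj E S\<^esub>"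
    proof (rule eq_by_res[OF S sub_part_deg[OF x] deg_zero[OF S]])
      fix T assume T: "truncation_set T" "finite T" "T \<subseteq> S"
      show "res E S T x = res E S T \<zero>\<^bsub>obj E S\<^esub>"
        using sub_part_res[OF x T] q add_hom_zero[OF ring_obj[OF S] ring_obj[OF T(1)] res_add_hom[OF S T(1,3)]]
        by (simp add: base_part_2)
    qed
    then show "x \<in> {\<zero>\<^bsub>obj E S\<^esub>}" by simp
  qed
qed

lemma res_mult: "truncation_set S \<Longrightarrow> truncation_set T \<Longrightarrow> T \<subseteq> S \<Longrightarrow> x \<in> carrier (obj E S) \<Longrightarrow> y \<in> carrier (obj E S) \<Longrightarrow>
    res E S T (x \<otimes>\<^bsub>obj E S\<^esub> y) = res E S T x \<otimes>\<^bsub>obj E T\<^esub> res E S T y"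
  by (intro ring_hom_mult[OF res_hom])

lemma sub_part_mult:
  assumes S: "truncation_set S"
  shows "x \<in> sub_part S 0 \<Longrightarrow> y \<in> sub_part S 0 \<Longrightarrow> x \<otimes>\<^bsub>obj E S\<^esub> y \<in> sub_part S 0"
    "x \<in> sub_part S 0 \<Longrightarrow> y \<in> sub_part S 1 \<Longrightarrow> x \<otimes>\<^bsub>obj E S\<^esub> y \<in> sub_part S 1"
    "x \<in> sub_part S 1 \<Longrightarrow> y \<in> sub_part S 1 \<Longrightarrow> x \<otimes>\<^bsub>obj E S\<^esub> y = \<zero>\<^bsub>obj E S\<^esub>"
proof -
  have c: "x \<in> carrier (obj E S)" if "x \<in> sub_part S q" for x q using deg_carrier[OF S sub_part_deg[OF that]] .
  show "x \<otimes>\<^bsub>obj E S\<^esub> y \<in> sub_part S 0" if "x \<in> sub_part S 0" "y \<in> sub_part S 0"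
    unfolding sub_part_def
    using deg_mult[OF S sub_part_deg[OF that(1)] sub_part_deg[OF that(2)]] c[OF that(1)] c[OF that(2)]
      sub_part_res[OF that(1)] sub_part_res[OF that(2)] by (auto simp: res_mult[OF S] base_part_mult)
  show "x \<otimes>\<^bsub>obj E S\<^esub> y \<in> sub_part S 1" if "x \<in> sub_part S 0" "y \<in> sub_part S 1"
    unfolding sub_part_def
    using deg_mult[OF S sub_part_deg[OF that(1)] sub_part_deg[OF that(2)]] c[OF that(1)] c[OF that(2)]
      sub_part_res[OF that(1)] sub_part_res[OF that(2)]
    by (auto simp: res_mult[OF S] base_part_mult simp del: One_nat_def)
  show "x \<otimes>\<^bsub>obj E S\<^esub> y = \<zero>\<^bsub>obj E S\<^esub>" if "x \<in> sub_part S 1" "y \<in> sub_part S 1"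
  proof (rule eq_by_res[OF S deg_mult[OF S sub_part_deg[OF that(1)] sub_part_deg[OF that(2)]] deg_zero[OF S]])
    fix T assume T: "truncation_set T" "finite T" "T \<subseteq> S"
    show "res E S T (x \<otimes>\<^bsub>obj E S\<^esub> y) = res E S T \<zero>\<^bsub>obj E S\<^esub>"
      using T base_part_mult(3)[OF T(1,2) sub_part_res[OF that(1) T] sub_part_res[OF that(2) T]] c[OF that(1)] c[OF that(2)]
        add_hom_zero[OF ring_obj[OF S] ring_obj[OF T(1)] res_add_hom[OF S T(1,3)]]
      by (simp add: res_mult[OF S])
  qed
qed

lemma sub_carrierE:
  assumes "x \<in> sub_carrier S"
  obtains a b where "a \<in> sub_part S 0" "b \<in> sub_part S 1" "x = a \<oplus>\<^bsub>obj E S\<^esub> b"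
  using assms unfolding sub_carrier_def by blast

lemma sub_carrierI: "a \<in> sub_part S 0 \<Longrightarrow> b \<in> sub_part S 1 \<Longrightarrow> a \<oplus>\<^bsub>obj E S\<^esub> b \<in> sub_carrier S"
  unfolding sub_carrier_def by blast

lemma sub_part_closed: "truncation_set S \<Longrightarrow> x \<in> sub_part S q \<Longrightarrow> x \<in> carrier (obj E S)"
  by (rule deg_carrier[OF _ sub_part_deg])

lemma sub_part_zero: "truncation_set S \<Longrightarrow> \<zero>\<^bsub>obj E S\<^esub> \<in> sub_part S q"
  using subgroup.one_closed[OF sub_part_subgroup] by fastforce

lemma sub_part_add: "truncation_set S \<Longrightarrow> x \<in> sub_part S q \<Longrightarrow> y \<in> sub_part S q \<Longrightarrow> x \<oplus>\<^bsub>obj E S\<^esub> y \<in> sub_part S q"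
  using subgroup.m_closed[OF sub_part_subgroup] by fastforce

lemma sub_part_uminus: "truncation_set S \<Longrightarrow> x \<in> sub_part S q \<Longrightarrow> \<ominus>\<^bsub>obj E S\<^esub> x \<in> sub_part S q"
  using subgroup.m_inv_closed[OF sub_part_subgroup] by (fastforce simp: a_inv_def)

lemma sub_carrier_closed:
  assumes S: "truncation_set S" and x: "x \<in> sub_carrier S"
  shows "x \<in> carrier (obj E S)"
proof -
  interpret R: ring "obj E S" using S by (rule ring_obj)
  show ?thesis using x by (auto elim!: sub_carrierE intro: sub_part_closed[OF S])
qed

lemma sub_part_sub_carrier:
  assumes S: "truncation_set S" and x: "x \<in> sub_part S q"
  shows "x \<in> sub_carrier S"
proof -
  interpret R: ring "obj E S" using S by (rule ring_obj)
  show ?thesis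
  proof (rule q_cases[of q])
    assume "q = 0"
    then show ?thesis using sub_carrierI[OF _ sub_part_zero[OF S], of x] x sub_part_closed[OF S x] by simp
  next
    assume "q = Suc 0"
    then show ?thesis using sub_carrierI[OF sub_part_zero[OF S], of x] x sub_part_closed[OF S x] by simp
  next
    assume "2 \<le> q"
    then show ?thesis using sub_carrierI[OF sub_part_zero[OF S] sub_part_zero[OF S]] x sub_part_2[OF S] by simp
  qed
qed

text \<open>The shift r lets one argument serve restriction, Frobenius and Verschiebung with r = 0
  and the differential with r = 1.\<close>

lemma sub_carrier_image:
  assumes S: "truncation_set S" and T: "truncation_set T"
    and h: "h \<in> hom (add_monoid (obj E S)) (add_monoid (obj E T))"
    and p: "\<And>q x. x \<in> sub_part S q \<Longrightarrow> h x \<in> sub_part T (q + r)"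
    and x: "x \<in> sub_carrier S"
  shows "h x \<in> sub_carrier T"
proof -
  interpret R: ring "obj E T" using T by (rule ring_obj)
  obtain a b where ab: "a \<in> sub_part S 0" "b \<in> sub_part S 1" "x = a \<oplus>\<^bsub>obj E S\<^esub> b" using x by (rule sub_carrierE)
  have add: "y \<oplus>\<^bsub>obj E T\<^esub> z \<in> sub_carrier T" if yz: "y \<in> sub_carrier T" "z \<in> sub_carrier T" for y z
  proof -
    obtain a b where ab: "a \<in> sub_part T 0" "b \<in> sub_part T 1" "y = a \<oplus>\<^bsub>obj E T\<^esub> b" using yz(1) by (rule sub_carrierE)
    obtain c d where cd: "c \<in> sub_part T 0" "d \<in> sub_part T 1" "z = c \<oplus>\<^bsub>obj E T\<^esub> d" using yz(2) by (rule sub_carrierE)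
    have "y \<oplus>\<^bsub>obj E T\<^esub> z = (a \<oplus>\<^bsub>obj E T\<^esub> c) \<oplus>\<^bsub>obj E T\<^esub> (b \<oplus>\<^bsub>obj E T\<^esub> d)"
      using ab cd sub_part_closed[OF T] by (simp add: R.a_ac)
    then show ?thesis using sub_carrierI[OF sub_part_add[OF T ab(1) cd(1)] sub_part_add[OF T ab(2) cd(2)]] by simp
  qed
  have "h x = h a \<oplus>\<^bsub>obj E T\<^esub> h b"
    unfolding ab(3) by (rule add_hom_add[OF ring_obj[OF S] ring_obj[OF T] h sub_part_closed[OF S ab(1)] sub_part_closed[OF S ab(2)]])
  then show ?thesis using add sub_part_sub_carrier[OF T p[OF ab(1)]] sub_part_sub_carrier[OF T p[OF ab(2)]] by simp
qed

lemma sub_carrier_ring_closed: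
  assumes S: "truncation_set S" and x: "x \<in> sub_carrier S" and y: "y \<in> sub_carrier S"
  shows "x \<oplus>\<^bsub>obj E S\<^esub> y \<in> sub_carrier S" "x \<otimes>\<^bsub>obj E S\<^esub> y \<in> sub_carrier S" "\<ominus>\<^bsub>obj E S\<^esub> x \<in> sub_carrier S"
proof -
  interpret R: ring "obj E S" using S by (rule ring_obj)
  obtain a b where ab: "a \<in> sub_part S 0" "b \<in> sub_part S 1" "x = a \<oplus>\<^bsub>obj E S\<^esub> b" using x by (rule sub_carrierE)
  obtain c d where cd: "c \<in> sub_part S 0" "d \<in> sub_part S 1" "y = c \<oplus>\<^bsub>obj E S\<^esub> d" using y by (rule sub_carrierE)
  note cl = sub_part_closed[OF S ab(1)] sub_part_closed[OF S ab(2)] sub_part_closed[OF S cd(1)] sub_part_closed[OF S cd(2)]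
  have "x \<oplus>\<^bsub>obj E S\<^esub> y = (a \<oplus>\<^bsub>obj E S\<^esub> c) \<oplus>\<^bsub>obj E S\<^esub> (b \<oplus>\<^bsub>obj E S\<^esub> d)"
    using cl by (simp add: ab cd R.a_ac)
  then show "x \<oplus>\<^bsub>obj E S\<^esub> y \<in> sub_carrier S"
    using sub_carrierI[OF sub_part_add[OF S ab(1) cd(1)] sub_part_add[OF S ab(2) cd(2)]] by simp
  have "\<ominus>\<^bsub>obj E S\<^esub> x = \<ominus>\<^bsub>obj E S\<^esub> a \<oplus>\<^bsub>obj E S\<^esub> \<ominus>\<^bsub>obj E S\<^esub> b" using cl by (simp add: ab R.minus_add)
  then show "\<ominus>\<^bsub>obj E S\<^esub> x \<in> sub_carrier S"
    using sub_carrierI[OF sub_part_uminus[OF S ab(1)] sub_part_uminus[OF S ab(2)]] by simp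
  have "b \<otimes>\<^bsub>obj E S\<^esub> c = c \<otimes>\<^bsub>obj E S\<^esub> b"
    using deg_0_comm[OF S sub_part_deg[OF cd(1)] sub_part_deg[OF ab(2)]] by simp
  then have "x \<otimes>\<^bsub>obj E S\<^esub> y = (a \<otimes>\<^bsub>obj E S\<^esub> c) \<oplus>\<^bsub>obj E S\<^esub> (a \<otimes>\<^bsub>obj E S\<^esub> d \<oplus>\<^bsub>obj E S\<^esub> c \<otimes>\<^bsub>obj E S\<^esub> b)"
    using cl sub_part_mult(3)[OF S ab(2) cd(2)] by (simp add: ab cd R.l_distr R.r_distr R.a_ac)
  then show "x \<otimes>\<^bsub>obj E S\<^esub> y \<in> sub_carrier S"
    using sub_carrierI[OF sub_part_mult(1)[OF S ab(1) cd(1)]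
        sub_part_add[OF S sub_part_mult(2)[OF S ab(1) cd(2)] sub_part_mult(2)[OF S cd(1) ab(2)]]] by simp
qed

lemma sub_one: "truncation_set S \<Longrightarrow> \<one>\<^bsub>obj E S\<^esub> \<in> sub_part S 0"
  using sub_part_eta[of S "teich S 1"] by (simp add: eta_one)

lemma ring_subcomplex:
  assumes S: "truncation_set S"
  shows "ring (obj subcomplex S)"
proof -
  interpret R: ring "obj E S" using S by (rule ring_obj)
  note cl = sub_carrier_closed[OF S] and rc = sub_carrier_ring_closed[OF S]
  show ?thesis
    unfolding subcomplex_simps
  proof (rule ringI)
    show "abelian_group ((obj E S)\<lparr>carrier := sub_carrier S\<rparr>)"
    proof (rule abelian_groupI; simp)
      fix x assume "x \<in> sub_carrier S"
      then show "\<exists>y\<in>sub_carrier S. y \<oplus>\<^bsub>obj E S\<^esub> x = \<zero>\<^bsub>obj E S\<^esub>"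
        using rc(3)[of x x] cl[of x] by (intro bexI[of _ "\<ominus>\<^bsub>obj E S\<^esub> x"]) (simp_all add: R.l_neg)
    qed (use cl rc sub_part_sub_carrier[OF S sub_part_zero[OF S]] in \<open>simp_all add: R.a_ac\<close>)
    show "Group.monoid ((obj E S)\<lparr>carrier := sub_carrier S\<rparr>)"
      by (rule monoidI) (use cl rc sub_part_sub_carrier[OF S sub_one[OF S]] in \<open>simp_all add: R.m_assoc\<close>)
  qed (use cl rc in \<open>simp_all add: R.l_distr R.r_distr\<close>)
qed

lemma graded_subcomplex:
  assumes S: "truncation_set S"
  shows "anticomm_graded_ring (obj subcomplex S) (deg subcomplex S)"
proof -
  interpret R: ring "obj E S" using S by (rule ring_obj)
  interpret K: ring "obj subcomplex S" using S by (rule ring_subcomplex)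
  have sub: "subgroup (sub_part S q) (add_monoid (obj subcomplex S))" for q
  proof (rule K.add.subgroupI)
    show "sub_part S q \<subseteq> carrier (obj subcomplex S)" using sub_part_sub_carrier[OF S] by auto
    show "sub_part S q \<noteq> {}" using sub_part_zero[OF S] by blast
    fix x assume x: "x \<in> sub_part S q"
    have "\<ominus>\<^bsub>obj E S\<^esub> x \<in> sub_part S q" using sub_part_uminus[OF S x] .
    moreover have "\<ominus>\<^bsub>obj subcomplex S\<^esub> x = \<ominus>\<^bsub>obj E S\<^esub> x"
      using sub_part_sub_carrier[OF S x] sub_part_sub_carrier[OF S sub_part_uminus[OF S x]] sub_part_closed[OF S x]
      by (intro K.minus_equality) (simp_all add: R.l_neg)
    ultimately show "\<ominus>\<^bsub>obj subcomplex S\<^esub> x \<in> sub_part S q" by simp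
    fix y assume "y \<in> sub_part S q"
    with x show "x \<oplus>\<^bsub>obj subcomplex S\<^esub> y \<in> sub_part S q" using sub_part_add[OF S] by simp
  qed
  show ?thesis
  proof (rule anticomm_graded_ring_two_step[OF K.ring_axioms])
    show "subgroup (deg subcomplex S 0) (add_monoid (obj subcomplex S))" "subgroup (deg subcomplex S 1) (add_monoid (obj subcomplex S))"
      using sub by simp_all
    show "deg subcomplex S q = {\<zero>\<^bsub>obj subcomplex S\<^esub>}" if "2 \<le> q" for q using sub_part_2[OF S that] by simp
    show "\<exists>a\<in>deg subcomplex S 0. \<exists>b\<in>deg subcomplex S 1. x = a \<oplus>\<^bsub>obj subcomplex S\<^esub> b" if "x \<in> carrier (obj subcomplex S)" for x
      using that unfolding subcomplex_simps sub_carrier_def by fastforce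
    show "deg subcomplex S 0 \<inter> deg subcomplex S 1 \<subseteq> {\<zero>\<^bsub>obj subcomplex S\<^esub>}"
    proof
      fix x assume "x \<in> deg subcomplex S 0 \<inter> deg subcomplex S 1"
      then have x: "x \<in> deg E S 0" "x \<in> deg E S 1" using sub_part_deg by auto
      have "x = x \<oplus>\<^bsub>obj E S\<^esub> \<zero>\<^bsub>obj E S\<^esub>" using deg_carrier[OF S x(1)] by simp
      from deg_unique(2)[OF S x(2,1) deg_zero[OF S] this] show "x \<in> {\<zero>\<^bsub>obj subcomplex S\<^esub>}" by simp
    qed
    show "\<one>\<^bsub>obj subcomplex S\<^esub> \<in> deg subcomplex S 0" using sub_one[OF S] by simp
    show "x \<otimes>\<^bsub>obj subcomplex S\<^esub> y \<in> deg subcomplex S 0" if "x \<in> deg subcomplex S 0" "y \<in> deg subcomplex S 0" for x y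
      using sub_part_mult(1)[OF S] that by simp
    show "x \<otimes>\<^bsub>obj subcomplex S\<^esub> y \<in> deg subcomplex S 1" if "x \<in> deg subcomplex S 0" "y \<in> deg subcomplex S 1" for x y
      using sub_part_mult(2)[OF S] that by simp
    show "x \<otimes>\<^bsub>obj subcomplex S\<^esub> y = \<zero>\<^bsub>obj subcomplex S\<^esub>" if "x \<in> deg subcomplex S 1" "y \<in> deg subcomplex S 1" for x y
      using sub_part_mult(3)[OF S] that by simp
    show "x \<otimes>\<^bsub>obj subcomplex S\<^esub> y = y \<otimes>\<^bsub>obj subcomplex S\<^esub> x" if "x \<in> deg subcomplex S 0" "y \<in> deg subcomplex S 0" for x y
      using deg_0_comm[OF S sub_part_deg sub_part_deg] that by auto
    show "x \<otimes>\<^bsub>obj subcomplex S\<^esub> y = y \<otimes>\<^bsub>obj subcomplex S\<^esub> x" if "x \<in> deg subcomplex S 0" "y \<in> deg subcomplex S 1" for x y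
      using deg_0_comm[OF S sub_part_deg sub_part_deg] that by auto
  qed
qed

text \<open>The limit is taken in the ambient complex. It belongs to the subcomplex because
  membership is a condition on restrictions to finite truncation sets, and these are the given
  elements.\<close>

lemma limit_subcomplex:
  assumes S: "truncation_set S"
    and t: "\<And>T. truncation_set T \<Longrightarrow> finite T \<Longrightarrow> T \<subseteq> S \<Longrightarrow> t T \<in> sub_part T q"
    and comp: "\<And>T U. truncation_set T \<Longrightarrow> finite T \<Longrightarrow> T \<subseteq> S \<Longrightarrow> truncation_set U \<Longrightarrow> U \<subseteq> T \<Longrightarrow> res E T U (t T) = t U"
  shows "\<exists>!y. y \<in> sub_part S q \<and> (\<forall>T. truncation_set T \<and> finite T \<and> T \<subseteq> S \<longrightarrow> res E S T y = t T)"
proof -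
  have "\<exists>!y. y \<in> deg E S q \<and> (\<forall>T. truncation_set T \<and> finite T \<and> T \<subseteq> S \<longrightarrow> res E S T y = t T)"
    by (rule limit[OF S sub_part_deg[OF t] comp])
  then obtain y where y: "y \<in> deg E S q" "\<And>T. truncation_set T \<Longrightarrow> finite T \<Longrightarrow> T \<subseteq> S \<Longrightarrow> res E S T y = t T"
    by blast
  have "t T \<in> base_part q T" if "truncation_set T" "finite T" "T \<subseteq> S" for T
    using sub_part_res[OF t[OF that] that(1,2)] comp[OF that that(1)] by simp
  then have "y \<in> sub_part S q" using y by (simp add: sub_part_def)
  then show ?thesis
  proof (intro ex1I[of _ y] conjI allI impI)
    fix z assume z: "z \<in> sub_part S q \<and> (\<forall>T. truncation_set T \<and> finite T \<and> T \<subseteq> S \<longrightarrow> res E S T z = t T)"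
    then have "z \<in> deg E S q" using sub_part_deg by blast
    then show "z = y"
    proof (rule eq_by_res[OF S _ y(1)])
      fix T assume "truncation_set T" "finite T" "T \<subseteq> S"
      then show "res E S T z = res E S T y" using z y(2) by metis
    qed
  qed (use y in simp_all)
qed

lemma witt_complex_subcomplex: "witt_complex subcomplex"
proof (rule witt_complex_pullback[where E = E and i = "\<lambda>S x. x"])
  show "witt_complex E" by (rule witt_complex_axioms)
  show "anticomm_graded_ring (obj subcomplex S) (deg subcomplex S)" if "truncation_set S" for S
    using that by (rule graded_subcomplex)
  show "(\<lambda>x. x) \<in> ring_hom (obj subcomplex S) (obj E S)" if "truncation_set S" for S
    by (rule ring_hom_memI) (use sub_carrier_closed[OF that] in simp_all)
  show "x \<in> deg E S q" if "truncation_set S" "x \<in> deg subcomplex S q" for S q x using that by (simp add: sub_part_deg)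
  show "res subcomplex S T x \<in> carrier (obj subcomplex T)"
    if "truncation_set S" "truncation_set T" "T \<subseteq> S" "x \<in> carrier (obj subcomplex S)" for S T x
    using sub_carrier_image[OF that(1,2) res_add_hom[OF that(1-3)], of 0 x] that by (simp add: sub_part_restrict)
  show "diff subcomplex S x \<in> carrier (obj subcomplex S)" if "truncation_set S" "x \<in> carrier (obj subcomplex S)" for S x
    using sub_carrier_image[OF that(1) that(1) diff_hom[OF that(1)], of 1 x] that sub_part_diff[OF that(1)] by simp
  show "frob subcomplex n S x \<in> carrier (obj subcomplex (S \<div> n))"
    if "truncation_set S" "0 < n" "x \<in> carrier (obj subcomplex S)" for S n x
    using sub_carrier_image[OF that(1) truncation_set_quot[OF that(1)] frob_add_hom[OF that(1,2)], of 0 x] that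
    by (simp add: sub_part_frob)
  show "ver subcomplex n S x \<in> carrier (obj subcomplex S)"
    if "truncation_set S" "0 < n" "x \<in> carrier (obj subcomplex (S \<div> n))" for S n x
    using sub_carrier_image[OF truncation_set_quot[OF that(1)] that(1) ver_hom[OF that(1,2)], of 0 x] that
    by (simp add: sub_part_ver)
  show "\<exists>!y. y \<in> deg subcomplex S q \<and> (\<forall>T. truncation_set T \<and> finite T \<and> T \<subseteq> S \<longrightarrow> res subcomplex S T y = t T)"
    if "truncation_set S" "\<And>T. truncation_set T \<Longrightarrow> finite T \<Longrightarrow> T \<subseteq> S \<Longrightarrow> t T \<in> deg subcomplex T q"
      "\<And>T U. truncation_set T \<Longrightarrow> finite T \<Longrightarrow> T \<subseteq> S \<Longrightarrow> truncation_set U \<Longrightarrow> U \<subseteq> T \<Longrightarrow> res subcomplex T U (t T) = t U"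
    for S t q
    unfolding subcomplex_simps by (rule limit_subcomplex) (use that in simp_all)
qed (simp_all add: sub_part_restrict sub_part_eta sub_part_diff[simplified] sub_part_frob sub_part_ver)

end

text \<open>The map from E to the subcomplex, followed by the inclusion, is an endomorphism of E and
  hence the identity by initiality. So every homogeneous element is its own image in the
  subcomplex.\<close>

lemma initial_eq_subcomplex:
  fixes E :: "'u witt_data"
  assumes E: "initial_witt_complex E" and S: "truncation_set S"
  shows "deg E S q = witt_complex.sub_part E S q"
proof -
  interpret E: witt_complex E using E by (simp add: initial_witt_complex_def)
  let ?D = "E.subcomplex"
  obtain f where f: "witt_complex_map E ?D f"
    using E E.witt_complex_subcomplex by (auto simp: initial_witt_complex_def)
  interpret f: witt_complex_map E ?D f by (rule f)
  obtain h where h: "\<And>g S x. witt_complex_map E E g \<Longrightarrow> truncation_set S \<Longrightarrow> x \<in> carrier (obj E S) \<Longrightarrow> g S x = h S x"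
    using E E.witt_complex_axioms unfolding initial_witt_complex_def by metis
  have "witt_complex_map E E f"
  proof
    fix S assume S: "truncation_set S"
    show "f S \<in> ring_hom (obj E S) (obj E S)"
      using f.map_hom[OF S] E.sub_carrier_closed[OF S] by (auto simp: ring_hom_def)
    show "f S x \<in> deg E S q" if "x \<in> deg E S q" for x q
      using f.map_deg[OF S that] by (simp add: E.sub_part_deg)
  qed (use f.map_res f.map_eta f.map_diff f.map_frob f.map_ver in simp_all)
  moreover have "witt_complex_map E E (\<lambda>S x. x)"
    by unfold_locales (auto simp: ring_hom_def)
  ultimately have id: "f S x = x" if "x \<in> carrier (obj E S)" for x
    using h[OF _ S that] by metis
  show ?thesis
  proof
    show "deg E S q \<subseteq> E.sub_part S q"
      using f.map_deg[OF S] id E.deg_carrier[OF S] by fastforce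
  qed (auto dest: E.sub_part_deg)
qed

section \<open>Independence of the generators\<close>

text \<open>Initiality of E is tested only against complexes with elements in \<open>'u\<close>, so
  the explicit complex has to be copied into this type along an injection. Operations are carried
  out on preimages.\<close>

definition transport_ring :: "('a \<Rightarrow> 'b) \<Rightarrow> 'a ring \<Rightarrow> 'b ring" where
  "transport_ring j R = \<lparr>carrier = j ` carrier R,
     monoid.mult = (\<lambda>x y. j (inv_into UNIV j x \<otimes>\<^bsub>R\<^esub> inv_into UNIV j y)), one = j \<one>\<^bsub>R\<^esub>,
     ring.zero = j \<zero>\<^bsub>R\<^esub>, ring.add = (\<lambda>x y. j (inv_into UNIV j x \<oplus>\<^bsub>R\<^esub> inv_into UNIV j y))\<rparr>"

definition transport :: "('a \<Rightarrow> 'b) \<Rightarrow> 'a witt_data \<Rightarrow> 'b witt_data" where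
  "transport j E = \<lparr>obj = (\<lambda>S. transport_ring j (obj E S)), deg = (\<lambda>S q. j ` deg E S q),
     res = (\<lambda>S T x. j (res E S T (inv_into UNIV j x))), eta = (\<lambda>S a. j (eta E S a)),
     diff = (\<lambda>S x. j (diff E S (inv_into UNIV j x))), frob = (\<lambda>n S x. j (frob E n S (inv_into UNIV j x))),
     ver = (\<lambda>n S x. j (ver E n S (inv_into UNIV j x)))\<rparr>"

lemma transport_simps [simp]:
  "obj (transport j E) S = transport_ring j (obj E S)" "deg (transport j E) S q = j ` deg E S q"
  "res (transport j E) S T x = j (res E S T (inv_into UNIV j x))" "eta (transport j E) S a = j (eta E S a)"
  "diff (transport j E) S x = j (diff E S (inv_into UNIV j x))" "frob (transport j E) n S x = j (frob E n S (inv_into UNIV j x))"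
  "ver (transport j E) n S x = j (ver E n S (inv_into UNIV j x))"
  by (simp_all add: transport_def)

lemma transport_ring_simps:
  "carrier (transport_ring j R) = j ` carrier R"
  "x \<otimes>\<^bsub>transport_ring j R\<^esub> y = j (inv_into UNIV j x \<otimes>\<^bsub>R\<^esub> inv_into UNIV j y)"
  "x \<oplus>\<^bsub>transport_ring j R\<^esub> y = j (inv_into UNIV j x \<oplus>\<^bsub>R\<^esub> inv_into UNIV j y)"
  "\<one>\<^bsub>transport_ring j R\<^esub> = j \<one>\<^bsub>R\<^esub>" "\<zero>\<^bsub>transport_ring j R\<^esub> = j \<zero>\<^bsub>R\<^esub>"
  by (simp_all add: transport_ring_def)

lemma ring_transport_ring:
  assumes j: "inj j" and R: "ring R"
  shows "ring (transport_ring j R)"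
proof -
  interpret R: ring R by fact
  note [simp] = inv_f_f[OF j]
  show ?thesis
  proof (rule ringI)
    show "abelian_group (transport_ring j R)"
    proof (rule abelian_groupI)
      fix x assume "x \<in> carrier (transport_ring j R)"
      then obtain a where a: "x = j a" "a \<in> carrier R" by (auto simp: transport_ring_simps)
      show "\<exists>y\<in>carrier (transport_ring j R). y \<oplus>\<^bsub>transport_ring j R\<^esub> x = \<zero>\<^bsub>transport_ring j R\<^esub>"
        by (rule bexI[of _ "j (\<ominus>\<^bsub>R\<^esub> a)"]) (use a in \<open>auto simp: transport_ring_simps R.l_neg\<close>)
    qed (auto simp: transport_ring_simps R.a_ac)
    show "Group.monoid (transport_ring j R)"
      by (rule monoidI) (auto simp: transport_ring_simps R.m_assoc)
  qed (auto simp: transport_ring_simps R.l_distr R.r_distr)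
qed

lemma transport_ring_hom:
  assumes "inj j"
  shows "j \<in> ring_hom R (transport_ring j R)" "inv_into UNIV j \<in> ring_hom (transport_ring j R) R"
  using inv_f_f[OF assms] by (auto simp: ring_hom_def transport_ring_simps)

lemma anticomm_graded_transport:
  assumes j: "inj j" and G: "anticomm_graded_ring R G"
  shows "anticomm_graded_ring (transport_ring j R) (\<lambda>q. j ` G q)"
proof -
  interpret R: anticomm_graded_ring R G by fact
  let ?R = "transport_ring j R"
  interpret R': ring ?R using j R.ring_axioms by (rule ring_transport_ring)
  note jf = inv_f_f[OF j]
  note hom = ring_hom_add_hom[OF transport_ring_hom(1)[OF j, of R]]
  have Gc: "x \<in> carrier R" if "x \<in> G q" for x q
    using subgroup.subset[OF R.degree_subgroup[of q]] that by auto
  interpret h: group_hom "add_monoid R" "add_monoid ?R" j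
    by (intro group_hom.intro group_hom_axioms.intro R.add.group_axioms R'.add.group_axioms hom)
  show ?thesis
  proof (intro anticomm_graded_ring.intro anticomm_graded_ring_axioms.intro R'.ring_axioms)
    show "subgroup (j ` G q) (add_monoid ?R)" for q
      by (rule h.subgroup_img_is_subgroup[OF R.degree_subgroup])
    show "\<one>\<^bsub>?R\<^esub> \<in> j ` G 0" using R.one_degree by (simp add: transport_ring_simps)
    show "x \<otimes>\<^bsub>?R\<^esub> y \<in> j ` G (p + q)" if "x \<in> j ` G p" "y \<in> j ` G q" for x y p q
      using that R.mult_degree by (auto simp: transport_ring_simps jf)
    show "x \<otimes>\<^bsub>?R\<^esub> y = [((- 1 :: int) ^ (p * q))] \<cdot>\<^bsub>?R\<^esub> (y \<otimes>\<^bsub>?R\<^esub> x)" if xy: "x \<in> j ` G p" "y \<in> j ` G q" for x y p q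
    proof -
      obtain a b where ab: "x = j a" "a \<in> G p" "y = j b" "b \<in> G q" using xy by auto
      have "x \<otimes>\<^bsub>?R\<^esub> y = j ([((- 1 :: int) ^ (p * q))] \<cdot>\<^bsub>R\<^esub> (b \<otimes>\<^bsub>R\<^esub> a))"
        using R.anticomm[OF ab(2,4)] by (simp add: ab transport_ring_simps jf)
      also have "\<dots> = [((- 1 :: int) ^ (p * q))] \<cdot>\<^bsub>?R\<^esub> j (b \<otimes>\<^bsub>R\<^esub> a)"
        using Gc ab by (intro add_hom_int_mult[OF R.ring_axioms R'.ring_axioms hom]) simp
      finally show ?thesis by (simp add: ab transport_ring_simps jf)
    qed
    show "\<exists>!c. (\<forall>q. c q \<in> j ` G q) \<and> finite {q. c q \<noteq> \<zero>\<^bsub>?R\<^esub>} \<and> x = (\<Oplus>\<^bsub>?R\<^esub>q\<in>{q. c q \<noteq> \<zero>\<^bsub>?R\<^esub>}. c q)"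
      if x: "x \<in> carrier ?R" for x
    proof -
      obtain a where a: "x = j a" "a \<in> carrier R" using x by (auto simp: transport_ring_simps)
      have iff: "((\<forall>q. c q \<in> j ` G q) \<and> finite {q. c q \<noteq> \<zero>\<^bsub>?R\<^esub>} \<and> x = (\<Oplus>\<^bsub>?R\<^esub>q\<in>{q. c q \<noteq> \<zero>\<^bsub>?R\<^esub>}. c q)) \<longleftrightarrow>
        (\<exists>e. c = j \<circ> e \<and> (\<forall>q. e q \<in> G q) \<and> finite {q. e q \<noteq> \<zero>\<^bsub>R\<^esub>} \<and> a = (\<Oplus>\<^bsub>R\<^esub>q\<in>{q. e q \<noteq> \<zero>\<^bsub>R\<^esub>}. e q))" (is "?l \<longleftrightarrow> ?r") for c
      proof -
        have key: "{q. (j \<circ> e) q \<noteq> \<zero>\<^bsub>?R\<^esub>} = {q. e q \<noteq> \<zero>\<^bsub>R\<^esub>} \<and>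
            (finite {q. e q \<noteq> \<zero>\<^bsub>R\<^esub>} \<longrightarrow> (\<Oplus>\<^bsub>?R\<^esub>q\<in>{q. e q \<noteq> \<zero>\<^bsub>R\<^esub>}. (j \<circ> e) q) = j (\<Oplus>\<^bsub>R\<^esub>q\<in>{q. e q \<noteq> \<zero>\<^bsub>R\<^esub>}. e q))"
          if e: "\<forall>q. e q \<in> G q" for e
        proof -
          have "e \<in> I \<rightarrow> carrier R" for I using Gc e by blast
          then show ?thesis
            using add_hom_finsum[OF R.ring_axioms R'.ring_axioms hom, of "{q. e q \<noteq> \<zero>\<^bsub>R\<^esub>}" e]
            by (simp add: transport_ring_simps inj_eq[OF j])
        qed
        show ?thesis
        proof
          assume l: ?l
          define e where "e = inv_into UNIV j \<circ> c"
          have "c q \<in> range j" for q using l by blast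
          then have ce: "c = j \<circ> e" by (simp add: e_def fun_eq_iff f_inv_into_f)
          have eG: "\<forall>q. e q \<in> G q"
          proof
            fix q
            obtain g where "c q = j g" "g \<in> G q" using l by blast
            then show "e q \<in> G q" by (simp add: e_def jf)
          qed
          show ?r using l key[OF eG] eG inj_eq[OF j] unfolding ce a by (intro exI[of _ e]) auto
        next
          assume ?r
          then show ?l using key by (auto simp: a)
        qed
      qed
      show ?thesis unfolding iff using R.direct_sum[OF a(2)] by (auto 0 3)
    qed
  qed
qed

lemma witt_complex_transport:
  assumes j: "inj j" and E: "witt_complex E"
  shows "witt_complex (transport j E)"
proof -
  interpret E: witt_complex E by fact
  note jf [simp] = inv_f_f[OF j]
  show ?thesis
  proof (rule witt_complex_pullback[OF E, where i = "\<lambda>S. inv_into UNIV j"])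
    show "anticomm_graded_ring (obj (transport j E) S) (deg (transport j E) S)" if "truncation_set S" for S
    proof -
      have "deg (transport j E) S = (\<lambda>q. j ` deg E S q)" by auto
      then show ?thesis using anticomm_graded_transport[OF j E.graded[OF that]] by simp
    qed
    show "inv_into UNIV j \<in> ring_hom (obj (transport j E) S) (obj E S)" for S
      using transport_ring_hom(2)[OF j] by simp
    show "inj_on (inv_into UNIV j) (carrier (obj (transport j E) S))" for S
      by (auto simp: inj_on_def transport_ring_simps)
    show "\<exists>!y. y \<in> deg (transport j E) S q \<and> (\<forall>T. truncation_set T \<and> finite T \<and> T \<subseteq> S \<longrightarrow> res (transport j E) S T y = t T)"
      if S: "truncation_set S" and t: "\<And>T. truncation_set T \<Longrightarrow> finite T \<Longrightarrow> T \<subseteq> S \<Longrightarrow> t T \<in> deg (transport j E) T q"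
        and c: "\<And>T U. truncation_set T \<Longrightarrow> finite T \<Longrightarrow> T \<subseteq> S \<Longrightarrow> truncation_set U \<Longrightarrow> U \<subseteq> T \<Longrightarrow> res (transport j E) T U (t T) = t U"
      for S t q
    proof -
      have jt: "j (inv_into UNIV j (t T)) = t T" "inv_into UNIV j (t T) \<in> deg E T q" if "truncation_set T" "finite T" "T \<subseteq> S" for T
        using t[OF that] by auto
      have "\<exists>!y. y \<in> deg E S q \<and> (\<forall>T. truncation_set T \<and> finite T \<and> T \<subseteq> S \<longrightarrow> res E S T y = inv_into UNIV j (t T))"
      proof (rule E.limit[OF S])
        show "inv_into UNIV j (t T) \<in> deg E T q" if "truncation_set T" "finite T" "T \<subseteq> S" for T using jt(2)[OF that] .
        show "res E T U (inv_into UNIV j (t T)) = inv_into UNIV j (t U)"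
          if "truncation_set T" "finite T" "T \<subseteq> S" "truncation_set U" "U \<subseteq> T" for T U
          using c[OF that] by (metis transport_simps(3) jf)
      qed
      then obtain y where y: "y \<in> deg E S q" "\<And>T. truncation_set T \<Longrightarrow> finite T \<Longrightarrow> T \<subseteq> S \<Longrightarrow> res E S T y = inv_into UNIV j (t T)"
        by blast
      show ?thesis
      proof (rule ex1I[of _ "j y"])
        show "j y \<in> deg (transport j E) S q \<and> (\<forall>T. truncation_set T \<and> finite T \<and> T \<subseteq> S \<longrightarrow> res (transport j E) S T (j y) = t T)"
          using y jt by simp
        fix z assume z: "z \<in> deg (transport j E) S q \<and> (\<forall>T. truncation_set T \<and> finite T \<and> T \<subseteq> S \<longrightarrow> res (transport j E) S T z = t T)"
        then obtain x where x: "z = j x" "x \<in> deg E S q" by auto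
        have "x = y"
        proof (rule E.eq_by_res[OF S x(2) y(1)])
          fix T assume T: "truncation_set T" "finite T" "T \<subseteq> S"
          then have "j (res E S T x) = t T" using z x by simp
          then show "res E S T x = res E S T y" using y(2)[OF T] by (metis jf)
        qed
        then show "z = j y" using x by simp
      qed
    qed
  qed (auto simp: transport_ring_simps E.res_deg E.eta_deg E.diff_deg[simplified] E.frob_deg E.ver_deg E.diff_closed E.frob_closed E.ver_closed
      ring_hom_closed[OF E.res_hom])
qed

section \<open>Linear combinations in the explicit complex and the comparison map\<close>

lemma model_uminus:
  assumes S: "truncation_set S" and x: "x \<in> gvec S \<times> fvec S"
  shows "\<ominus>\<^bsub>model_ring S\<^esub> x = (\<lambda>k. - fst x k, red S (\<lambda>k. - snd x k))"
proof -
  interpret cring "model_ring S" using S by (rule cring_model_ring)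
  show ?thesis
    using x red_fvec[OF S] by (intro minus_equality) (auto simp: gvec_uminus red_def[of S] fun_eq_iff mod_simps)
qed

lemma model_int_mult:
  assumes S: "truncation_set S" and x: "x \<in> gvec S \<times> fvec S"
  shows "[(z :: int)] \<cdot>\<^bsub>model_ring S\<^esub> x = (\<lambda>k. z * fst x k, red S (\<lambda>k. z * snd x k))"
proof (cases "0 \<le> z")
  case True
  then show ?thesis using model_nat_mult[OF assms, of "nat z"] by (simp add: add_pow_int_ge)
next
  case False
  interpret cring "model_ring S" using S by (rule cring_model_ring)
  have "[nat (- z)] \<cdot>\<^bsub>model_ring S\<^esub> x \<in> carrier (model_ring S)" using x by (intro add.nat_pow_closed) simp
  then have c: "[nat (- z)] \<cdot>\<^bsub>model_ring S\<^esub> x \<in> gvec S \<times> fvec S" by simp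
  have "[z] \<cdot>\<^bsub>model_ring S\<^esub> x = \<ominus>\<^bsub>model_ring S\<^esub> ([nat (- z)] \<cdot>\<^bsub>model_ring S\<^esub> x)"
    using False by (intro add_pow_int_lt) simp
  also note model_uminus[OF S c]
  finally show ?thesis
    using False unfolding model_nat_mult[OF assms] by (auto simp: red_def fun_eq_iff mod_simps)
qed

lemma model_finsum:
  assumes S: "truncation_set S" and I: "finite I" and t: "\<And>n. n \<in> I \<Longrightarrow> t n \<in> gvec S \<times> fvec S"
  shows "fst (\<Oplus>\<^bsub>model_ring S\<^esub>n\<in>I. [(c n :: int)] \<cdot>\<^bsub>model_ring S\<^esub> t n) k = (\<Sum>n\<in>I. c n * fst (t n) k)"
    and "[snd (\<Oplus>\<^bsub>model_ring S\<^esub>n\<in>I. [(c n :: int)] \<cdot>\<^bsub>model_ring S\<^esub> t n) k = (\<Sum>n\<in>I. c n * snd (t n) k)] (mod int k)"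
proof -
  interpret cring "model_ring S" using S by (rule cring_model_ring)
  have cl: "[c n] \<cdot>\<^bsub>model_ring S\<^esub> t n \<in> carrier (model_ring S)" if "n \<in> I" for n
    using t[OF that] by (intro add.int_pow_closed) simp
  have "fst (\<Oplus>\<^bsub>model_ring S\<^esub>n\<in>I. [c n] \<cdot>\<^bsub>model_ring S\<^esub> t n) k = (\<Sum>n\<in>I. c n * fst (t n) k) \<and>
    [snd (\<Oplus>\<^bsub>model_ring S\<^esub>n\<in>I. [c n] \<cdot>\<^bsub>model_ring S\<^esub> t n) k = (\<Sum>n\<in>I. c n * snd (t n) k)] (mod int k)"
    using I t cl
  proof (induction I rule: finite_induct)
    case (insert n I)
    let ?s = "\<Oplus>\<^bsub>model_ring S\<^esub>n\<in>I. [c n] \<cdot>\<^bsub>model_ring S\<^esub> t n"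
    have s: "(\<Oplus>\<^bsub>model_ring S\<^esub>n\<in>insert n I. [c n] \<cdot>\<^bsub>model_ring S\<^esub> t n) = [c n] \<cdot>\<^bsub>model_ring S\<^esub> t n \<oplus>\<^bsub>model_ring S\<^esub> ?s"
      by (rule finsum_insert) (use insert in auto)
    have m: "[c n] \<cdot>\<^bsub>model_ring S\<^esub> t n = (\<lambda>k. c n * fst (t n) k, red S (\<lambda>k. c n * snd (t n) k))"
      using insert.prems by (intro model_int_mult[OF S]) simp
    have tn: "t n \<in> gvec S \<times> fvec S" using insert.prems by simp
    have IH: "fst ?s k = (\<Sum>n\<in>I. c n * fst (t n) k)" "[snd ?s k = (\<Sum>n\<in>I. c n * snd (t n) k)] (mod int k)"
      using insert.IH insert.prems by auto
    have sc: "?s \<in> carrier (model_ring S)" using insert.prems by (intro finsum_closed) auto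
    have "[red S (\<lambda>k. red S (\<lambda>k. c n * snd (t n) k) k + snd ?s k) k = c n * snd (t n) k + (\<Sum>n\<in>I. c n * snd (t n) k)] (mod int k)"
    proof (cases "k \<in> S")
      case True
      then show ?thesis using IH(2) by (intro cong_trans[OF cong_red[OF True]] cong_add cong_red)
    next
      case False
      then have "snd (t n) k = 0" "snd ?s k = 0" using tn sc by (auto simp: fvec_def)
      then show ?thesis using IH(2) False by (simp add: red_def cong_sym)
    qed
    then show ?case using insert.hyps IH(1) unfolding s by (simp add: m)
  qed simp
  then show "fst (\<Oplus>\<^bsub>model_ring S\<^esub>n\<in>I. [c n] \<cdot>\<^bsub>model_ring S\<^esub> t n) k = (\<Sum>n\<in>I. c n * fst (t n) k)"
    "[snd (\<Oplus>\<^bsub>model_ring S\<^esub>n\<in>I. [c n] \<cdot>\<^bsub>model_ring S\<^esub> t n) k = (\<Sum>n\<in>I. c n * snd (t n) k)] (mod int k)" by auto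
qed

lemma model_ver_one:
  assumes T: "truncation_set T" and n: "0 < n"
  shows "ver_one model T n = (cutoff T (dver n (\<lambda>k. 1)), \<lambda>k. 0)"
proof -
  have "cutoff T (dver n (cutoff (T \<div> n) (\<lambda>k. ghost k (teich (T \<div> n) 1)))) = cutoff T (dver n (\<lambda>k. 1))"
  proof (rule cutoff_cong)
    fix k assume k: "k \<in> T"
    then show "dver n (cutoff (T \<div> n) (\<lambda>k. ghost k (teich (T \<div> n) 1))) k = dver n (\<lambda>k. 1) k"
      using trunc_quotI[OF T, of n "k div n"] truncation_set_quot[OF T, of n]
      by (auto simp: dver_def cutoff_def)
  qed
  moreover have "dver n (\<lambda>k. 0) = (\<lambda>k. 0)" by (auto simp: dver_def)
  ultimately show ?thesis by (simp add: ver_one_def)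
qed

lemma initial_to_model:
  fixes E :: "'u witt_data"
  assumes E: "big_de_Rham_Witt E" and T: "truncation_set T"
  obtains F where "F \<in> hom (add_monoid (obj E T)) (add_monoid (model_ring T))"
    "\<And>n. 0 < n \<Longrightarrow> F (ver_one E T n) = (cutoff T (dver n (\<lambda>k. 1)), \<lambda>k. 0)"
    "\<And>n. 0 < n \<Longrightarrow> F (diff E T (ver_one E T n)) = (\<lambda>k. 0, cutoff T (dquot (cutoff T (dver n (\<lambda>k. 1)))))"
proof -
  obtain \<iota> :: "(nat \<Rightarrow> int) \<Rightarrow> 'u" where \<iota>: "inj \<iota>" using E by (auto simp: big_de_Rham_Witt_def)
  \<comment> \<open>The two functions of a pair are interleaved, the first at even and the second at
    odd arguments; so the given injection of single functions also embeds pairs.\<close>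
  define j where "j = (\<lambda>x :: (nat \<Rightarrow> int) \<times> (nat \<Rightarrow> int). \<iota> (\<lambda>k. if even k then fst x (k div 2) else snd x (k div 2)))"
  have j: "inj j"
  proof (rule injI)
    fix x y assume "j x = j y"
    then have "(\<lambda>k. if even k then fst x (k div 2) else snd x (k div 2)) = (\<lambda>k. if even k then fst y (k div 2) else snd y (k div 2))"
      unfolding j_def by (rule injD[OF \<iota>])
    then have *: "(if even k then fst x (k div 2) else snd x (k div 2)) = (if even k then fst y (k div 2) else snd y (k div 2))" for k
      by (rule fun_cong)
    have "fst x k = fst y k" "snd x k = snd y k" for k using *[of "2 * k"] *[of "2 * k + 1"] by simp_all
    then show "x = y" by (simp add: prod_eq_iff fun_eq_iff)
  qed
  let ?M = "transport j model"
  interpret E: witt_complex E using E by (simp add: big_de_Rham_Witt_def initial_witt_complex_def)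
  have "witt_complex ?M" by (rule witt_complex_transport[OF j witt_complex_model])
  then obtain f where "witt_complex_map E ?M f"
    using E unfolding big_de_Rham_Witt_def initial_witt_complex_def by blast
  then interpret f: witt_complex_map E ?M f .
  note jf = inv_f_f[OF j]
  have Tn: "truncation_set (T \<div> n)" for n by (rule truncation_set_quot[OF T])
  have t: "eta E (T \<div> n) (teich (T \<div> n) 1) \<in> carrier (obj E (T \<div> n))" for n
    using E.deg_carrier[OF Tn E.eta_deg[OF Tn]] by simp
  have v: "f T (ver_one E T n) = j (ver_one model T n)" if "0 < n" for n
    using f.map_ver[OF T that t] f.map_eta[OF Tn, of "teich (T \<div> n) 1" n] by (simp add: ver_one_def jf del: model_simps)
  have d: "f T (diff E T (ver_one E T n)) = j (diff model T (ver_one model T n))" if "0 < n" for n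
    using f.map_diff[OF T E.ver_one_closed[OF T that]] v[OF that] by (simp add: jf del: model_simps)
  show ?thesis
  proof (rule that[of "\<lambda>x. inv_into UNIV j (f T x)"])
    have "(\<lambda>x. inv_into UNIV j (f T x)) \<in> ring_hom (obj E T) (model_ring T)"
      using ring_hom_trans[OF f.map_hom[OF T], of "inv_into UNIV j" "model_ring T"] transport_ring_hom(2)[OF j, of "model_ring T"]
      by (simp add: comp_def)
    then show "(\<lambda>x. inv_into UNIV j (f T x)) \<in> hom (add_monoid (obj E T)) (add_monoid (model_ring T))" by (rule ring_hom_add_hom)
  qed (simp_all only: v d jf model_ver_one[OF T] model_simps fst_conv)
qed

text \<open>In the explicit complex the coordinate of V_n(1) at k is n if n divides k and 0
  otherwise. This is a triangular system with nonzero diagonal entries k.\<close>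

lemma independent_ver_one:
  assumes E: "big_de_Rham_Witt E" and T: "truncation_set T" and fin: "finite T"
    and z: "(\<Oplus>\<^bsub>obj E T\<^esub>n\<in>T. [(c n :: int)] \<cdot>\<^bsub>obj E T\<^esub> ver_one E T n) = \<zero>\<^bsub>obj E T\<^esub>" and k: "k \<in> T"
  shows "c k = 0"
proof -
  interpret E: witt_complex E using E by (simp add: big_de_Rham_Witt_def initial_witt_complex_def)
  interpret R: ring "obj E T" using T by (rule E.ring_obj)
  interpret M: cring "model_ring T" using T by (rule cring_model_ring)
  obtain F where F: "F \<in> hom (add_monoid (obj E T)) (add_monoid (model_ring T))"
    and Fv: "\<And>n. 0 < n \<Longrightarrow> F (ver_one E T n) = (cutoff T (dver n (\<lambda>k. 1)), \<lambda>k. 0)"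
    using initial_to_model[OF E T] by metis
  have pos: "0 < n" if "n \<in> T" for n using truncation_set_pos[OF T that] .
  have v: "ver_one E T n \<in> carrier (obj E T)" if "n \<in> T" for n using E.ver_one_closed[OF T pos[OF that]] .
  have "F (\<Oplus>\<^bsub>obj E T\<^esub>n\<in>T. [c n] \<cdot>\<^bsub>obj E T\<^esub> ver_one E T n) = (\<Oplus>\<^bsub>model_ring T\<^esub>n\<in>T. F ([c n] \<cdot>\<^bsub>obj E T\<^esub> ver_one E T n))"
    by (rule add_hom_finsum[OF R.ring_axioms M.ring_axioms F fin]) (use v in auto)
  also have "\<dots> = (\<Oplus>\<^bsub>model_ring T\<^esub>n\<in>T. [c n] \<cdot>\<^bsub>model_ring T\<^esub> F (ver_one E T n))"
    using add_hom_closed[OF R.ring_axioms M.ring_axioms F v] add_hom_int_mult[OF R.ring_axioms M.ring_axioms F v]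
    by (intro M.finsum_cong') (auto simp del: model_ring_simps intro: M.add.int_pow_closed)
  finally have "(\<Oplus>\<^bsub>model_ring T\<^esub>n\<in>T. [c n] \<cdot>\<^bsub>model_ring T\<^esub> F (ver_one E T n)) = \<zero>\<^bsub>model_ring T\<^esub>"
    using z add_hom_zero[OF R.ring_axioms M.ring_axioms F] by simp
  moreover have "F (ver_one E T n) \<in> gvec T \<times> fvec T" if "n \<in> T" for n
    using add_hom_closed[OF R.ring_axioms M.ring_axioms F v[OF that]] by simp
  ultimately have sum: "(\<Sum>n\<in>T. c n * fst (F (ver_one E T n)) k) = 0" for k
    using model_finsum(1)[OF T fin, of "\<lambda>n. F (ver_one E T n)" c k] by simp
  show ?thesis using k
  proof (induction k rule: less_induct)
    case (less k)
    have "(\<Sum>n\<in>T. c n * fst (F (ver_one E T n)) k) = (\<Sum>n\<in>T. if n = k then c k * int k else 0)"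
    proof (intro sum.cong refl)
      fix n assume n: "n \<in> T"
      have "n dvd k \<Longrightarrow> n \<noteq> k \<Longrightarrow> c n = 0"
        using less.IH[of n] n pos[OF less.prems] by (metis dvd_imp_le le_neq_implies_less)
      then show "c n * fst (F (ver_one E T n)) k = (if n = k then c k * int k else 0)"
        using less.prems by (auto simp: Fv[OF pos[OF n]] cutoff_def dver_def)
    qed
    then show ?case using sum[of k] fin less.prems pos[OF less.prems] by simp
  qed
qed

text \<open>The entries at proper divisors n of k never have to be computed: by induction c(n) is a
  multiple of n, and n dV_n(1) = 0. The diagonal entry is 1 modulo k, and the entries with n not
  dividing k vanish.\<close>

lemma independent_diff_ver_one:
  assumes E: "big_de_Rham_Witt E" and T: "truncation_set T" and fin: "finite T"
    and z: "(\<Oplus>\<^bsub>obj E T\<^esub>n\<in>T. [(c n :: int)] \<cdot>\<^bsub>obj E T\<^esub> diff E T (ver_one E T n)) = \<zero>\<^bsub>obj E T\<^esub>" and k: "k \<in> T"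
  shows "int k dvd c k"
proof -
  interpret E: witt_complex E using E by (simp add: big_de_Rham_Witt_def initial_witt_complex_def)
  interpret R: ring "obj E T" using T by (rule E.ring_obj)
  interpret M: cring "model_ring T" using T by (rule cring_model_ring)
  let ?D = "\<lambda>n. diff E T (ver_one E T n)"
  obtain F where F: "F \<in> hom (add_monoid (obj E T)) (add_monoid (model_ring T))"
    and Fv: "\<And>n. 0 < n \<Longrightarrow> F (?D n) = (\<lambda>k. 0, cutoff T (dquot (cutoff T (dver n (\<lambda>k. 1)))))"
    using initial_to_model[OF E T] by metis
  have pos: "0 < n" if "n \<in> T" for n using truncation_set_pos[OF T that] .
  have v: "?D n \<in> carrier (obj E T)" if "n \<in> T" for n using E.diff_ver_one_closed[OF T pos[OF that]] .
  have Fc: "F (?D n) \<in> gvec T \<times> fvec T" if "n \<in> T" for n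
    using add_hom_closed[OF R.ring_axioms M.ring_axioms F v[OF that]] by simp
  have "F (\<Oplus>\<^bsub>obj E T\<^esub>n\<in>T. [c n] \<cdot>\<^bsub>obj E T\<^esub> ?D n) = (\<Oplus>\<^bsub>model_ring T\<^esub>n\<in>T. F ([c n] \<cdot>\<^bsub>obj E T\<^esub> ?D n))"
    by (rule add_hom_finsum[OF R.ring_axioms M.ring_axioms F fin]) (use v in auto)
  also have "\<dots> = (\<Oplus>\<^bsub>model_ring T\<^esub>n\<in>T. [c n] \<cdot>\<^bsub>model_ring T\<^esub> F (?D n))"
    using add_hom_closed[OF R.ring_axioms M.ring_axioms F v] add_hom_int_mult[OF R.ring_axioms M.ring_axioms F v]
    by (intro M.finsum_cong') (auto simp del: model_ring_simps intro: M.add.int_pow_closed)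
  finally have "(\<Oplus>\<^bsub>model_ring T\<^esub>n\<in>T. [c n] \<cdot>\<^bsub>model_ring T\<^esub> F (?D n)) = \<zero>\<^bsub>model_ring T\<^esub>"
    using z add_hom_zero[OF R.ring_axioms M.ring_axioms F] by simp
  then have sum: "[(\<Sum>n\<in>T. c n * snd (F (?D n)) k) = 0] (mod int k)" for k
    using model_finsum(2)[OF T fin, of "\<lambda>n. F (?D n)" c k] Fc by (simp add: cong_sym)
  have at: "snd (F (?D n)) k = dquot (dver n (\<lambda>k. 1)) k" if "n \<in> T" "k \<in> T" for n k
    using that by (simp add: Fv[OF pos[OF that(1)]] cutoff_def[of T "dquot _"] dquot_cutoff[OF T])
  have tors: "[int n * snd (F (?D n)) k = 0] (mod int k)" if n: "n \<in> T" and k: "k \<in> T" for n k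
  proof -
    have "\<zero>\<^bsub>model_ring T\<^esub> = [n] \<cdot>\<^bsub>model_ring T\<^esub> F (?D n)"
      using E.torsion_diff_ver_one[OF T pos[OF n]] add_hom_nat_mult[OF R.ring_axioms M.ring_axioms F v[OF n], of n]
        add_hom_zero[OF R.ring_axioms M.ring_axioms F] by simp
    then have "snd \<zero>\<^bsub>model_ring T\<^esub> = snd ([n] \<cdot>\<^bsub>model_ring T\<^esub> F (?D n))" by (rule arg_cong)
    then have "red T (\<lambda>k. int n * snd (F (?D n)) k) = (\<lambda>k. 0)"
      unfolding model_nat_mult[OF T Fc[OF n]] by simp
    then show ?thesis using cong_red[OF k, of "\<lambda>k. int n * snd (F (?D n)) k"] by (simp add: cong_sym)
  qed
  show ?thesis using k
  proof (induction k rule: less_induct)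
    case (less k)
    have "[(\<Sum>n\<in>T. c n * snd (F (?D n)) k) = (\<Sum>n\<in>T. if n = k then c k else 0)] (mod int k)"
    proof (rule cong_sum)
      fix n assume n: "n \<in> T"
      consider "n = k" | "n dvd k" "n < k" | "\<not> n dvd k"
        using pos[OF less.prems] by (metis dvd_imp_le le_neq_implies_less)
      then show "[c n * snd (F (?D n)) k = (if n = k then c k else 0)] (mod int k)"
      proof cases
        case 1
        \<comment> \<open>As k does not divide k/p, the numerator at every prime p is k itself, so
          the quotient is 1.\<close>
        have "is_dquot (dver k (\<lambda>k. 1)) k 1"
          unfolding is_dquot_def
        proof (intro allI impI)
          fix p assume p: "prime p" "p dvd k"
          have "\<not> k dvd k div p"
            using p pos[OF less.prems] prime_gt_1_nat[OF p(1)] by (metis div_less_dividend dvd_imp_le dvd_div_eq_0_iff linorder_not_less neq0_conv)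
          then show "[int k * 1 = dver k (\<lambda>k. 1) k - dver k (\<lambda>k. 1) (k div p)] (mod int (p ^ (multiplicity p k + multiplicity p k)))"
            by (simp add: dver_def)
        qed
        then have "[snd (F (?D k)) k = 1] (mod int k)"
          using dquot_cong[OF T dwork_dver[OF T dwork_const pos[OF less.prems]] less.prems] at[OF less.prems less.prems] by simp
        then show ?thesis using 1 cong_scalar_left[of _ 1 "int k" "c k"] by simp
      next
        case 2
        obtain e where "c n = int n * e" using less.IH[OF 2(2) n] by blast
        then have "c n * snd (F (?D n)) k = e * (int n * snd (F (?D n)) k)" by simp
        also have "[e * (int n * snd (F (?D n)) k) = e * 0] (mod int k)"
          by (rule cong_scalar_left[OF tors[OF n less.prems]])
        finally show ?thesis using 2(2) by simp
      next
        case 3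
        then have "[snd (F (?D n)) k = 0] (mod int k)"
          unfolding at[OF n less.prems] by (intro dquot_dver_not_dvd[OF T dwork_const pos[OF n] less.prems])
        then show ?thesis using 3 cong_scalar_left[of _ 0 "int k" "c n"] by auto
      qed
    qed
    then have "[c k = 0] (mod int k)"
      using sum[of k] fin less.prems by (simp add: cong_def)
    then show ?case by (simp add: cong_0_iff)
  qed
qed

section \<open>The product description\<close>

lemma add_int_pow_0: "[(0 :: int)] \<cdot>\<^bsub>R\<^esub> x = \<zero>\<^bsub>R\<^esub>"
  by (simp add: add_pow_def)

lemma carrier_integer_mod_group_mod: "x \<in> carrier (integer_mod_group k) \<longleftrightarrow> x mod int k = x"
proof (cases "k = 0")
  case False
  then show ?thesis
    by (metis atLeastLessThan_iff carrier_integer_mod_group mod_pos_pos_trivial of_nat_0_less_iff pos_mod_bound pos_mod_sign neq0_conv)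
qed (simp add: carrier_integer_mod_group)

context witt_complex
begin

text \<open>One statement for both degrees: \<open>d n = 0\<close> gives infinite cyclic groups, and
  \<open>d n = n\<close> gives cyclic groups of order n. Generation and independence are assumed
  over finite sets; by independence the coefficient at n is the same modulo \<open>d n\<close> over
  every finite set containing n, which allows passing to the limit.\<close>

lemma deg_product_iso:
  fixes b :: "nat set \<Rightarrow> nat \<Rightarrow> 'u" and d :: "nat \<Rightarrow> nat"
  assumes S: "truncation_set S"
    and b_deg: "\<And>T n. truncation_set T \<Longrightarrow> 0 < n \<Longrightarrow> b T n \<in> deg E T q"
    and b_res: "\<And>S T n. truncation_set S \<Longrightarrow> truncation_set T \<Longrightarrow> T \<subseteq> S \<Longrightarrow> 0 < n \<Longrightarrow> res E S T (b S n) = b T n"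
    and b_out: "\<And>T n. truncation_set T \<Longrightarrow> 0 < n \<Longrightarrow> n \<notin> T \<Longrightarrow> b T n = \<zero>\<^bsub>obj E T\<^esub>"
    and tors: "\<And>T n. truncation_set T \<Longrightarrow> 0 < n \<Longrightarrow> [d n] \<cdot>\<^bsub>obj E T\<^esub> b T n = \<zero>\<^bsub>obj E T\<^esub>"
    and gen: "\<And>T x. truncation_set T \<Longrightarrow> finite T \<Longrightarrow> x \<in> deg E T q \<Longrightarrow>
      \<exists>c :: nat \<Rightarrow> int. x = (\<Oplus>\<^bsub>obj E T\<^esub>n\<in>T. [c n] \<cdot>\<^bsub>obj E T\<^esub> b T n)"
    and ind: "\<And>T (c :: nat \<Rightarrow> int) n. truncation_set T \<Longrightarrow> finite T \<Longrightarrow>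
      (\<Oplus>\<^bsub>obj E T\<^esub>n\<in>T. [c n] \<cdot>\<^bsub>obj E T\<^esub> b T n) = \<zero>\<^bsub>obj E T\<^esub> \<Longrightarrow> n \<in> T \<Longrightarrow> int (d n) dvd c n"
  shows "\<exists>\<phi>\<in>iso (product_group S (\<lambda>n. integer_mod_group (d n))) (deg_group E S q).
    \<forall>c\<in>carrier (product_group S (\<lambda>n. integer_mod_group (d n))).
      has_limit_sum E S q S (\<lambda>n. [c n] \<cdot>\<^bsub>obj E S\<^esub> b S n) (\<phi> c)"
proof -
  let ?P = "product_group S (\<lambda>n. integer_mod_group (d n))"
  define part where "part c T = (\<Oplus>\<^bsub>obj E T\<^esub>n\<in>T. [(c n :: int)] \<cdot>\<^bsub>obj E T\<^esub> b T n)" for c T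
  have pos: "0 < n" if "truncation_set T" "n \<in> T" for T n using truncation_set_pos[OF that] .
  have bc: "b T n \<in> carrier (obj E T)" if "truncation_set T" "0 < n" for T n
    using deg_carrier[OF that(1) b_deg[OF that]] .
  have mc: "[(z :: int)] \<cdot>\<^bsub>obj E T\<^esub> b T n \<in> carrier (obj E T)" if "truncation_set T" "0 < n" for T n z
    using deg_carrier[OF that(1) deg_int_mult[OF that(1) b_deg[OF that]]] .
  have mod: "[(z mod int (d n))] \<cdot>\<^bsub>obj E T\<^esub> b T n = [z] \<cdot>\<^bsub>obj E T\<^esub> b T n" if T: "truncation_set T" and n: "0 < n" for T n z
  proof -
    interpret R: ring "obj E T" using T by (rule ring_obj)
    have "[z] \<cdot>\<^bsub>obj E T\<^esub> b T n = [(int (d n) * (z div int (d n)) + z mod int (d n))] \<cdot>\<^bsub>obj E T\<^esub> b T n" by simp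
    also have "\<dots> = [(z div int (d n))] \<cdot>\<^bsub>obj E T\<^esub> ([int (d n)] \<cdot>\<^bsub>obj E T\<^esub> b T n) \<oplus>\<^bsub>obj E T\<^esub> [(z mod int (d n))] \<cdot>\<^bsub>obj E T\<^esub> b T n"
      using bc[OF T n] by (simp only: R.add.int_pow_mult R.add.int_pow_pow)
    also have "[int (d n)] \<cdot>\<^bsub>obj E T\<^esub> b T n = \<zero>\<^bsub>obj E T\<^esub>"
      using tors[OF T n] by (simp add: add_pow_def int_pow_int)
    finally show ?thesis using mc[OF T n] by simp
  qed
  have part_res: "res E T U (part c T) = part c U"
    if T: "truncation_set T" "finite T" and U: "truncation_set U" "U \<subseteq> T" for T U c
  proof -
    interpret R: ring "obj E T" using T by (intro ring_obj)
    interpret Q: ring "obj E U" using U by (intro ring_obj)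
    note hom = res_add_hom[OF T(1) U]
    have "res E T U (part c T) = (\<Oplus>\<^bsub>obj E U\<^esub>n\<in>T. res E T U ([c n] \<cdot>\<^bsub>obj E T\<^esub> b T n))"
      unfolding part_def
      by (rule add_hom_finsum[OF R.ring_axioms Q.ring_axioms hom T(2)]) (use mc[OF T(1)] pos[OF T(1)] in blast)
    also have "\<dots> = (\<Oplus>\<^bsub>obj E U\<^esub>n\<in>T. [c n] \<cdot>\<^bsub>obj E U\<^esub> b U n)"
    proof (rule Q.finsum_cong')
      fix n assume n: "n \<in> T"
      show "res E T U ([c n] \<cdot>\<^bsub>obj E T\<^esub> b T n) = [c n] \<cdot>\<^bsub>obj E U\<^esub> b U n"
        using add_hom_int_mult[OF R.ring_axioms Q.ring_axioms hom bc[OF T(1) pos[OF T(1) n]]]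
        by (simp add: b_res[OF T(1) U pos[OF T(1) n]])
    qed (use mc[OF U(1)] pos[OF T(1)] in auto)
    also have "\<dots> = part c U"
      unfolding part_def
    proof (rule Q.add.finprod_mono_neutral_cong_right[OF T(2) U(2)])
      show "[c n] \<cdot>\<^bsub>obj E U\<^esub> b U n = \<zero>\<^bsub>obj E U\<^esub>" if "n \<in> T - U" for n
        using b_out[OF U(1) pos[OF T(1)], of n] that by (simp add: Q.add.int_pow_one)
    qed (use mc[OF U(1)] pos[OF T(1)] in auto)
    finally show ?thesis .
  qed
  have part_deg: "part c T \<in> deg E T q" if T: "truncation_set T" for T c
  proof -
    interpret R: ring "obj E T" using T by (rule ring_obj)
    show ?thesis unfolding part_def
      by (rule R.finsum_subgroup[OF anticomm_graded_ring.degree_subgroup[OF graded[OF T]]])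
        (use deg_int_mult[OF T b_deg[OF T]] pos[OF T] in blast)
  qed
  have part_add: "part (\<lambda>n. c n + e n) T = part c T \<oplus>\<^bsub>obj E T\<^esub> part e T" if T: "truncation_set T" for T c e
  proof -
    interpret R: ring "obj E T" using T by (rule ring_obj)
    have "part (\<lambda>n. c n + e n) T = (\<Oplus>\<^bsub>obj E T\<^esub>n\<in>T. [c n] \<cdot>\<^bsub>obj E T\<^esub> b T n \<oplus>\<^bsub>obj E T\<^esub> [e n] \<cdot>\<^bsub>obj E T\<^esub> b T n)"
      unfolding part_def
      by (rule R.finsum_cong') (use bc[OF T] mc[OF T] pos[OF T] in \<open>auto simp: R.add.int_pow_mult\<close>)
    also have "\<dots> = part c T \<oplus>\<^bsub>obj E T\<^esub> part e T"
      unfolding part_def by (rule R.finsum_addf) (use mc[OF T] pos[OF T] in auto)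
    finally show ?thesis .
  qed
  have part_cong: "part c T = part e T" if T: "truncation_set T" and eq: "\<And>n. n \<in> T \<Longrightarrow> c n mod int (d n) = e n mod int (d n)" for T c e
  proof -
    interpret R: ring "obj E T" using T by (rule ring_obj)
    show ?thesis unfolding part_def
    proof (rule R.finsum_cong')
      fix n assume n: "n \<in> T"
      show "[c n] \<cdot>\<^bsub>obj E T\<^esub> b T n = [e n] \<cdot>\<^bsub>obj E T\<^esub> b T n"
        using mod[OF T pos[OF T n], of "c n"] mod[OF T pos[OF T n], of "e n"] eq[OF n] by simp
    qed (use mc[OF T] pos[OF T] in auto)
  qed
  have part_inj: "c n mod int (d n) = e n mod int (d n)"
    if T: "truncation_set T" "finite T" and eq: "part c T = part e T" and n: "n \<in> T" for T c e n
  proof -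
    interpret R: ring "obj E T" using T by (intro ring_obj)
    have "part e T \<oplus>\<^bsub>obj E T\<^esub> part (\<lambda>n. c n - e n) T = part (\<lambda>n. e n + (c n - e n)) T"
      by (rule part_add[OF T(1), symmetric])
    also have "\<dots> = part e T" using eq by simp
    finally have "part (\<lambda>n. c n - e n) T = \<zero>\<^bsub>obj E T\<^esub>"
      by (simp only: R.add.l_cancel_one deg_carrier[OF T(1) part_deg[OF T(1)]])
    then show ?thesis using ind[OF T _ n, of "\<lambda>n. c n - e n"] unfolding part_def mod_eq_dvd_iff by blast
  qed
  define \<phi> where "\<phi> c = (THE y. y \<in> deg E S q \<and> (\<forall>T. truncation_set T \<and> finite T \<and> T \<subseteq> S \<longrightarrow> res E S T y = part c T))" for c
  have \<phi>: "\<phi> c \<in> deg E S q" "\<And>T. truncation_set T \<Longrightarrow> finite T \<Longrightarrow> T \<subseteq> S \<Longrightarrow> res E S T (\<phi> c) = part c T" for c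
  proof -
    have "\<exists>!y. y \<in> deg E S q \<and> (\<forall>T. truncation_set T \<and> finite T \<and> T \<subseteq> S \<longrightarrow> res E S T y = part c T)"
      using limit[OF S, of "part c" q] part_deg part_res by blast
    from theI'[OF this, folded \<phi>_def]
    show "\<phi> c \<in> deg E S q" "\<And>T. truncation_set T \<Longrightarrow> finite T \<Longrightarrow> T \<subseteq> S \<Longrightarrow> res E S T (\<phi> c) = part c T" by blast+
  qed
  have \<phi>_unique: "x = \<phi> c" if "x \<in> deg E S q" "\<And>T. truncation_set T \<Longrightarrow> finite T \<Longrightarrow> T \<subseteq> S \<Longrightarrow> res E S T x = part c T" for x c
    using that \<phi>(2) by (intro eq_by_res[OF S that(1) \<phi>(1)]) simp
  have D: "truncation_set {e. e dvd n}" "finite {e. e dvd n}" "{e. e dvd n} \<subseteq> S" "n \<in> {e. e dvd n}" if "n \<in> S" for n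
    using truncation_set_pos[OF S that] truncation_set_dvd[OF S that] by (auto simp: truncation_set_def intro: dvd_trans)
  have carrier_P: "c \<in> carrier ?P \<longleftrightarrow> c \<in> extensional S \<and> (\<forall>n\<in>S. c n mod int (d n) = c n)" for c
    by (auto simp: PiE_def Pi_def carrier_integer_mod_group_mod)
  have "\<phi> \<in> hom ?P (deg_group E S q)"
  proof (rule homI)
    fix c e assume c: "c \<in> carrier ?P" and e: "e \<in> carrier ?P"
    have "\<phi> c \<oplus>\<^bsub>obj E S\<^esub> \<phi> e = \<phi> (c \<otimes>\<^bsub>?P\<^esub> e)"
    proof (rule \<phi>_unique[OF deg_add[OF S \<phi>(1) \<phi>(1)]])
      fix T assume T: "truncation_set T" "finite T" "T \<subseteq> S"
      have "res E S T (\<phi> c \<oplus>\<^bsub>obj E S\<^esub> \<phi> e) = part c T \<oplus>\<^bsub>obj E T\<^esub> part e T"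
        using add_hom_add[OF ring_obj[OF S] ring_obj[OF T(1)] res_add_hom[OF S T(1,3)] deg_carrier[OF S \<phi>(1)] deg_carrier[OF S \<phi>(1)]]
        unfolding \<phi>(2)[OF T] .
      also have "\<dots> = part (c \<otimes>\<^bsub>?P\<^esub> e) T"
        unfolding part_add[OF T(1), symmetric]
        by (rule part_cong[OF T(1)]) (use T(3) in \<open>auto simp: mult_integer_mod_group\<close>)
      finally show "res E S T (\<phi> c \<oplus>\<^bsub>obj E S\<^esub> \<phi> e) = part (c \<otimes>\<^bsub>?P\<^esub> e) T" .
    qed
    then show "\<phi> (c \<otimes>\<^bsub>?P\<^esub> e) = \<phi> c \<otimes>\<^bsub>deg_group E S q\<^esub> \<phi> e" by (simp add: deg_group_def)
  qed (simp add: deg_group_def \<phi>)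
  moreover have "bij_betw \<phi> (carrier ?P) (carrier (deg_group E S q))"
    unfolding bij_betw_def
  proof
    show "inj_on \<phi> (carrier ?P)"
    proof (rule inj_onI)
      fix c e assume c: "c \<in> carrier ?P" and e: "e \<in> carrier ?P" and eq: "\<phi> c = \<phi> e"
      show "c = e"
      proof (rule extensionalityI[of c S e])
        show "c \<in> extensional S" "e \<in> extensional S" using c e by (simp_all add: carrier_P del: carrier_product_group)
        fix n assume n: "n \<in> S"
        have "part c {e. e dvd n} = part e {e. e dvd n}" using \<phi>(2)[OF D(1-3)[OF n]] eq by metis
        then have "c n mod int (d n) = e n mod int (d n)" by (rule part_inj[OF D(1,2)[OF n] _ D(4)[OF n]])
        then show "c n = e n" using c e n by (simp add: carrier_P del: carrier_product_group)
      qed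
    qed
    show "\<phi> ` carrier ?P = carrier (deg_group E S q)"
    proof
      show "\<phi> ` carrier ?P \<subseteq> carrier (deg_group E S q)" using \<phi>(1) by (auto simp: deg_group_def)
      show "carrier (deg_group E S q) \<subseteq> \<phi> ` carrier ?P"
      proof
        fix x assume "x \<in> carrier (deg_group E S q)"
        then have x: "x \<in> deg E S q" by (simp add: deg_group_def)
        have "\<forall>T. \<exists>c. truncation_set T \<and> finite T \<and> T \<subseteq> S \<longrightarrow> res E S T x = part c T"
          using gen res_deg[OF S _ _ x] unfolding part_def by blast
        then obtain C where C: "\<And>T. truncation_set T \<Longrightarrow> finite T \<Longrightarrow> T \<subseteq> S \<Longrightarrow> res E S T x = part (C T) T"
          by metis
        \<comment> \<open>Coefficients chosen over different finite sets agree only modulo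
          \<open>d n\<close>. Those found over the divisors of n are selected and reduced, which
          also places them in the carrier of the product group.\<close>
        define c where "c = (\<lambda>n\<in>S. C {e. e dvd n} n mod int (d n))"
        have "x = \<phi> c"
        proof (rule \<phi>_unique[OF x])
          fix T assume T: "truncation_set T" "finite T" "T \<subseteq> S"
          have "part (C T) T = part c T"
          proof (rule part_cong[OF T(1)])
            fix n assume n: "n \<in> T"
            have nS: "n \<in> S" using n T by blast
            note Dn = D[OF nS]
            have sub: "{e. e dvd n} \<subseteq> T" using truncation_set_dvd[OF T(1) n] by blast
            have "part (C T) {e. e dvd n} = res E T {e. e dvd n} (res E S T x)"
              by (simp only: C[OF T] part_res[OF T(1,2) Dn(1) sub])
            also have "\<dots> = res E S {e. e dvd n} x"
              by (rule res_res[OF S T(1) Dn(1) T(3) sub deg_carrier[OF S x]])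
            also have "\<dots> = part (C {e. e dvd n}) {e. e dvd n}" by (rule C[OF Dn(1-3)])
            finally have "C T n mod int (d n) = C {e. e dvd n} n mod int (d n)"
              by (rule part_inj[OF Dn(1,2) _ Dn(4)])
            then show "C T n mod int (d n) = c n mod int (d n)" using nS by (simp add: c_def)
          qed
          then show "res E S T x = part c T" using C[OF T] by simp
        qed
        moreover have "c \<in> carrier ?P" by (simp add: carrier_P c_def del: carrier_product_group)
        ultimately show "x \<in> \<phi> ` carrier ?P" by blast
      qed
    qed
  qed
  moreover have "has_limit_sum E S q S (\<lambda>n. [c n] \<cdot>\<^bsub>obj E S\<^esub> b S n) (\<phi> c)" for c
    unfolding has_limit_sum_def
  proof (intro conjI allI impI)
    show "\<phi> c \<in> deg E S q" by (rule \<phi>)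
    show "(\<lambda>n. [c n] \<cdot>\<^bsub>obj E S\<^esub> b S n) \<in> S \<rightarrow> deg E S q"
      using deg_int_mult[OF S b_deg[OF S]] pos[OF S] by blast
    fix T assume "truncation_set T \<and> finite T \<and> T \<subseteq> S"
    then have T: "truncation_set T" "finite T" "T \<subseteq> S" by auto
    interpret Q: ring "obj E T" using T by (intro ring_obj)
    have r: "res E S T ([c n] \<cdot>\<^bsub>obj E S\<^esub> b S n) = [c n] \<cdot>\<^bsub>obj E T\<^esub> b T n" if "n \<in> S" for n
      using add_hom_int_mult[OF ring_obj[OF S] ring_obj[OF T(1)] res_add_hom[OF S T(1,3)] bc[OF S pos[OF S that]]]
      by (simp add: b_res[OF S T(1,3) pos[OF S that]])
    let ?J = "{n \<in> S. res E S T ([c n] \<cdot>\<^bsub>obj E S\<^esub> b S n) \<noteq> \<zero>\<^bsub>obj E T\<^esub>}"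
    have J: "?J \<subseteq> T"
    proof
      fix n assume n: "n \<in> ?J"
      show "n \<in> T"
      proof (rule ccontr)
        assume "n \<notin> T"
        then have "b T n = \<zero>\<^bsub>obj E T\<^esub>" using b_out[OF T(1) pos[OF S]] n by blast
        then have "[c n] \<cdot>\<^bsub>obj E T\<^esub> b T n = \<zero>\<^bsub>obj E T\<^esub>" by (simp add: Q.add.int_pow_one)
        then show False using n r[of n] by auto
      qed
    qed
    have "part c T = (\<Oplus>\<^bsub>obj E T\<^esub>n\<in>?J. res E S T ([c n] \<cdot>\<^bsub>obj E S\<^esub> b S n))"
      unfolding part_def
    proof (rule Q.add.finprod_mono_neutral_cong_right[OF T(2) J])
      show "[c n] \<cdot>\<^bsub>obj E T\<^esub> b T n = \<zero>\<^bsub>obj E T\<^esub>" if "n \<in> T - ?J" for n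
        using that T(3) r[of n] by auto
      show "[c n] \<cdot>\<^bsub>obj E T\<^esub> b T n = res E S T ([c n] \<cdot>\<^bsub>obj E S\<^esub> b S n)" if "n \<in> ?J" for n
        using that r[of n] by simp
      show "(\<lambda>n. [c n] \<cdot>\<^bsub>obj E T\<^esub> b T n) \<in> T \<rightarrow> carrier (obj E T)" using mc[OF T(1)] pos[OF T(1)] by blast
    qed
    then show "let J = ?J in finite J \<and> res E S T (\<phi> c) = (\<Oplus>\<^bsub>obj E T\<^esub>n\<in>J. res E S T ([c n] \<cdot>\<^bsub>obj E S\<^esub> b S n))"
      using finite_subset[OF J T(2)] \<phi>(2)[OF T] by simp
  qed
  ultimately show ?thesis unfolding iso_def by blast
qed

lemma dspan_expansion:
  assumes T: "truncation_set T" and fin: "finite T" and x: "x \<in> dspan T"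
  shows "\<exists>c :: nat \<Rightarrow> int. x = (\<Oplus>\<^bsub>obj E T\<^esub>n\<in>T. [c n] \<cdot>\<^bsub>obj E T\<^esub> diff E T (ver_one E T n))"
proof -
  interpret R: ring "obj E T" using T by (rule ring_obj)
  let ?D = "\<lambda>n. diff E T (ver_one E T n)"
  let ?s = "\<lambda>c :: nat \<Rightarrow> int. \<Oplus>\<^bsub>obj E T\<^esub>n\<in>T. [c n] \<cdot>\<^bsub>obj E T\<^esub> ?D n"
  have D: "?D n \<in> carrier (obj E T)" if "n \<in> T" for n
    using diff_ver_one_closed[OF T truncation_set_pos[OF T that]] .
  have add: "?s (\<lambda>n. c n + e n) = ?s c \<oplus>\<^bsub>obj E T\<^esub> ?s e" for c e
  proof -
    have "?s (\<lambda>n. c n + e n) = (\<Oplus>\<^bsub>obj E T\<^esub>n\<in>T. [c n] \<cdot>\<^bsub>obj E T\<^esub> ?D n \<oplus>\<^bsub>obj E T\<^esub> [e n] \<cdot>\<^bsub>obj E T\<^esub> ?D n)"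
      by (rule R.finsum_cong') (use D in \<open>auto simp: R.add.int_pow_mult\<close>)
    also have "\<dots> = ?s c \<oplus>\<^bsub>obj E T\<^esub> ?s e" by (rule R.finsum_addf) (use D in auto)
    finally show ?thesis .
  qed
  have sc: "?s c \<in> carrier (obj E T)" for c using D by (intro R.finsum_closed) auto
  have zero: "?s (\<lambda>n. 0) = \<zero>\<^bsub>obj E T\<^esub>" by (simp add: add_pow_def)
  have neg: "\<ominus>\<^bsub>obj E T\<^esub> ?s c = ?s (\<lambda>n. - c n)" for c
    using add[of "\<lambda>n. - c n" c] zero sc by (intro R.minus_equality) simp_all
  have single: "\<exists>c. ?D n = ?s c" if n: "0 < n" for n
  proof (cases "n \<in> T")
    case True
    have "?s (\<lambda>m. if m = n then 1 else 0) = (\<Oplus>\<^bsub>obj E T\<^esub>m\<in>T. if n = m then ?D m else \<zero>\<^bsub>obj E T\<^esub>)"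
      by (rule R.finsum_cong') (use D in \<open>auto simp: R.add.int_pow_1 add_int_pow_0\<close>)
    also have "\<dots> = ?D n" using True fin D by (intro R.finsum_singleton) auto
    finally show ?thesis by metis
  next
    case False
    show ?thesis by (rule exI[of _ "\<lambda>n. 0"]) (simp only: zero diff_ver_one_outside[OF T n False])
  qed
  have "x \<in> generate (add_monoid (obj E T)) (dgens T)" using x by (simp add: dspan_def)
  then show ?thesis
  proof (induction rule: generate.induct)
    case one
    show ?case by (rule exI[of _ "\<lambda>n. 0"]) (simp only: zero monoid.select_convs)
  next
    case (incl x)
    then obtain n where "0 < n" "x = ?D n" by (auto simp: dgens_def)
    then show ?case using single by simp
  next
    case (inv x)
    then obtain n where n: "0 < n" "x = ?D n" by (auto simp: dgens_def)
    obtain c where "x = ?s c" using single[OF n(1)] n(2) by auto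
    then show ?case by (intro exI[of _ "\<lambda>n. - c n"]) (simp only: neg[symmetric] a_inv_def)
  next
    case (eng x y)
    then obtain c e where "x = ?s c" "y = ?s e" by blast
    then show ?case by (intro exI[of _ "\<lambda>n. c n + e n"]) (simp only: add monoid.select_convs)
  qed
qed

subsection \<open>The class of \<open>-1\<close> as an infinite sum\<close>

lemma res_eps:
  assumes S: "truncation_set S" and T: "truncation_set T" "T \<subseteq> S"
  shows "res E S T (eps S) = eps T"
proof -
  have "restrict (teich S (-1)) T = teich T (-1)" using T by (auto simp: teich_def fun_eq_iff)
  then have u: "res E S T (minus_one S) = minus_one T" using eta_res[OF S T, of "teich S (-1)"] by (simp add: minus_one_def)
  have c: "minus_one S \<in> carrier (obj E S)" using deg_carrier[OF S minus_one_deg[OF S]] .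
  show ?thesis
    using res_mult[OF S T c diff_closed[OF S c]] diff_res[OF S T c] by (simp add: eps_eq S T u)
qed

lemma limit_sum_eqI:
  assumes S: "truncation_set S" and x: "has_limit_sum E S q I t x"
  shows "limit_sum E S q I t = x"
  unfolding limit_sum_def
proof (rule the_equality, rule x)
  fix y assume y: "has_limit_sum E S q I t y"
  show "y = x"
  proof (rule eq_by_res[OF S])
    show "y \<in> deg E S q" "x \<in> deg E S q" using x y by (simp_all add: has_limit_sum_def)
    fix T assume T: "truncation_set T" "finite T" "T \<subseteq> S"
    have "res E S T z = (\<Oplus>\<^bsub>obj E T\<^esub>i\<in>{i\<in>I. res E S T (t i) \<noteq> \<zero>\<^bsub>obj E T\<^esub>}. res E S T (t i))"
      if "has_limit_sum E S q I t z" for z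
      using that T unfolding has_limit_sum_def Let_def by blast
    from this[OF y] this[OF x] show "res E S T y = res E S T x" by (rule trans[OF _ sym])
  qed
qed

lemma ver_eps_partial_sum:
  assumes T: "truncation_set T" and n: "0 < n"
  shows "ver E n T (eps (T \<div> n)) =
    (\<Oplus>\<^bsub>obj E T\<^esub>r\<in>{1..N}. [(2 ^ (r - 1) * n)] \<cdot>\<^bsub>obj E T\<^esub> diff E T (ver_one E T (2 ^ r * n))) \<oplus>\<^bsub>obj E T\<^esub>
    ver E (2 ^ N * n) T (eps (T \<div> (2 ^ N * n)))"
proof -
  interpret R: ring "obj E T" using T by (rule ring_obj)
  let ?u = "\<lambda>r. [(2 ^ (r - 1) * n)] \<cdot>\<^bsub>obj E T\<^esub> diff E T (ver_one E T (2 ^ r * n))"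
  have u: "?u r \<in> carrier (obj E T)" for r using diff_ver_one_closed[OF T, of "2 ^ r * n"] n by simp
  have v: "ver E k T (eps (T \<div> k)) \<in> carrier (obj E T)" if "0 < k" for k
    by (rule ver_closed[OF T that eps_closed[OF truncation_set_quot[OF T]]])
  show ?thesis
  proof (induction N)
    case 0
    then show ?case using v[OF n] by simp
  next
    case (Suc N)
    have "{1..Suc N} = insert (Suc N) {1..N}" by auto
    then have "(\<Oplus>\<^bsub>obj E T\<^esub>r\<in>{1..Suc N}. ?u r) = ?u (Suc N) \<oplus>\<^bsub>obj E T\<^esub> (\<Oplus>\<^bsub>obj E T\<^esub>r\<in>{1..N}. ?u r)"
      using R.finsum_insert[of "{1..N}" "Suc N" ?u] u by (simp only: finite_atLeastAtMost) simp
    moreover have "ver E (2 ^ N * n) T (eps (T \<div> (2 ^ N * n))) = ?u (Suc N) \<oplus>\<^bsub>obj E T\<^esub> ver E (2 ^ Suc N * n) T (eps (T \<div> (2 ^ Suc N * n)))"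
      using ver_eps_rec[OF T, of "2 ^ N * n"] n by (simp add: mult.assoc)
    moreover have "(\<Oplus>\<^bsub>obj E T\<^esub>r\<in>{1..N}. ?u r) \<in> carrier (obj E T)" using u by (intro R.finsum_closed) auto
    ultimately show ?case using Suc u[of "Suc N"] v[of "2 ^ Suc N * n"] n by (simp add: R.a_ac del: power_Suc)
  qed
qed

text \<open>The infinite sum in the product and Frobenius formulas is nothing but V_n(\<epsilon>).
  Over a finite T whose elements are less than N, the remainder of the N-th partial sum is V with
  index 2^N n > N, hence 0, and so are the terms with r > N.\<close>

lemma limit_sum_ver_eps:
  assumes S: "truncation_set S" and n: "0 < n"
  shows "limit_sum E S 1 {1..} (\<lambda>r :: nat. [(2 ^ (r - 1) * n)] \<cdot>\<^bsub>obj E S\<^esub> diff E S (ver_one E S (2 ^ r * n))) =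
    ver E n S (eps (S \<div> n))"
proof (rule limit_sum_eqI[OF S], unfold has_limit_sum_def, intro conjI allI impI)
  let ?t = "\<lambda>S (r :: nat). [(2 ^ (r - 1) * n)] \<cdot>\<^bsub>obj E S\<^esub> diff E S (ver_one E S (2 ^ r * n))"
  have nat_int: "[(k :: nat)] \<cdot>\<^bsub>obj E T\<^esub> x = [int k] \<cdot>\<^bsub>obj E T\<^esub> x" for k T x by (simp add: add_pow_def int_pow_int)
  have p: "0 < 2 ^ r * n" for r :: nat using n by simp
  show "ver E n S (eps (S \<div> n)) \<in> deg E S 1"
    by (rule ver_deg[OF S n eps_deg[OF truncation_set_quot[OF S]]])
  show "?t S \<in> {1..} \<rightarrow> deg E S 1"
    unfolding nat_int using deg_int_mult[OF S diff_ver_one_deg[OF S p]] by blast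
  fix T assume "truncation_set T \<and> finite T \<and> T \<subseteq> S"
  then have T: "truncation_set T" "finite T" "T \<subseteq> S" by auto
  interpret Q: ring "obj E T" using T by (intro ring_obj)
  have r: "res E S T (?t S r) = ?t T r" for r
    using add_hom_nat_mult[OF ring_obj[OF S] ring_obj[OF T(1)] res_add_hom[OF S T(1,3)] diff_ver_one_closed[OF S p]]
    by (simp add: res_diff_ver_one[OF S T(1,3) p])
  obtain N where N: "\<And>k. k \<in> T \<Longrightarrow> k < N" using T(2) by (metis finite_nat_set_iff_bounded)
  have out: "2 ^ r * n \<notin> T" if "N \<le> r" for r
  proof
    assume "2 ^ r * n \<in> T"
    then have "2 ^ r * n < N" by (rule N)
    moreover have "r < 2 ^ r * n" using n less_exp[of r] by (metis less_le_trans mult.right_neutral mult_le_mono2 Suc_leI One_nat_def)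
    ultimately show False using that by simp
  qed
  let ?J = "{r \<in> {1..}. res E S T (?t S r) \<noteq> \<zero>\<^bsub>obj E T\<^esub>}"
  have J: "?J \<subseteq> {1..N}"
  proof
    fix r assume r': "r \<in> ?J"
    have "r \<le> N"
    proof (rule ccontr)
      assume "\<not> r \<le> N"
      then have "?t T r = \<zero>\<^bsub>obj E T\<^esub>" using diff_ver_one_outside[OF T(1) p out, of r] by simp
      then show False using r' r by simp
    qed
    then show "r \<in> {1..N}" using r' by simp
  qed
  have tc: "?t T r \<in> carrier (obj E T)" for r using diff_ver_one_closed[OF T(1) p] by simp
  have "res E S T (ver E n S (eps (S \<div> n))) = ver E n T (eps (T \<div> n))"
  proof -
    have "T \<div> n \<subseteq> S \<div> n" using T by (auto simp: trunc_quot_def)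
    then show ?thesis
      using ver_res[OF S T(1,3) n eps_closed[OF truncation_set_quot[OF S]]]
        res_eps[OF truncation_set_quot[OF S] truncation_set_quot[OF T(1)]] by simp
  qed
  also have "\<dots> = (\<Oplus>\<^bsub>obj E T\<^esub>r\<in>{1..N}. ?t T r) \<oplus>\<^bsub>obj E T\<^esub> ver E (2 ^ N * n) T (eps (T \<div> (2 ^ N * n)))"
    by (rule ver_eps_partial_sum[OF T(1) n])
  also have "ver E (2 ^ N * n) T (eps (T \<div> (2 ^ N * n))) = \<zero>\<^bsub>obj E T\<^esub>"
    by (rule ver_outside[OF T(1) p out[OF order_refl] eps_closed[OF truncation_set_quot[OF T(1)]]])
  also have "(\<Oplus>\<^bsub>obj E T\<^esub>r\<in>{1..N}. ?t T r) \<oplus>\<^bsub>obj E T\<^esub> \<zero>\<^bsub>obj E T\<^esub> = (\<Oplus>\<^bsub>obj E T\<^esub>r\<in>{1..N}. ?t T r)"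
    using tc by (intro Q.r_zero Q.finsum_closed) auto
  also have "\<dots> = (\<Oplus>\<^bsub>obj E T\<^esub>r\<in>?J. res E S T (?t S r))"
    by (rule Q.add.finprod_mono_neutral_cong_right[OF _ J]) (use tc r in auto)
  finally show "let J = ?J in finite J \<and> res E S T (ver E n S (eps (S \<div> n))) = (\<Oplus>\<^bsub>obj E T\<^esub>r\<in>J. res E S T (?t S r))"
    using finite_subset[OF J] by simp
qed

text \<open>The numbers {m,n} and gcd(m,n) - 1 have the same parity, and V_k(\<epsilon>) =
  \<epsilon> V_k(1) is annihilated by 2.\<close>

lemma both_even_ver_eps:
  assumes S: "truncation_set S" and k: "0 < k" and m: "0 < m"
  shows "[both_even m n] \<cdot>\<^bsub>obj E S\<^esub> ver E k S (eps (S \<div> k)) = [(gcd m n - 1)] \<cdot>\<^bsub>obj E S\<^esub> ver E k S (eps (S \<div> k))"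
proof -
  interpret R: ring "obj E S" using S by (rule ring_obj)
  let ?x = "ver E k S (eps (S \<div> k))"
  have x: "?x = eps S \<otimes>\<^bsub>obj E S\<^esub> ver_one E S k" by (rule eps_mult_ver_one[OF S k, symmetric])
  have v: "ver_one E S k \<in> carrier (obj E S)" by (rule ver_one_closed[OF S k])
  have xc: "?x \<in> carrier (obj E S)" unfolding x using v eps_closed[OF S] by simp
  have g: "0 < gcd m n" using m by simp
  show ?thesis
  proof (cases "even (gcd m n)")
    case True
    then obtain j where "gcd m n = 2 * j" by (rule evenE)
    then obtain i where i: "gcd m n - 1 = Suc (2 * i)" using g by (intro that[of "j - 1"]) linarith
    have "[Suc (2 * i)] \<cdot>\<^bsub>obj E S\<^esub> ?x = ?x"
      using even_mult_eps[OF S v, of "2 * i"] xc by (simp add: x)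
    moreover have "both_even m n = 1" using True by (auto simp: both_even_def)
    ultimately show ?thesis using xc i by simp
  next
    case False
    then have "even (gcd m n - 1)" using g by simp
    then have "[(gcd m n - 1)] \<cdot>\<^bsub>obj E S\<^esub> ?x = \<zero>\<^bsub>obj E S\<^esub>" unfolding x by (rule even_mult_eps[OF S v])
    moreover have "both_even m n = 0" using False by (auto simp: both_even_def)
    ultimately show ?thesis by (simp add: add_pow_def)
  qed
qed

end

text \<open>For existence take m a, reduced modulo the least common multiple, where a inverts m/gcd
  modulo n/gcd. Two solutions differ by a multiple of m and of n, hence of their least common
  multiple.\<close>

lemma gcd_lift:
  assumes m: "0 < m" and n: "0 < n"
  shows "int m dvd gcd_lift m n" "[gcd_lift m n = int (gcd m n)] (mod int n)"
proof -
  note l = lcm_div_gcd[OF m n]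
  have "coprime (int (m div gcd m n)) (int (n div gcd m n))" using l(3) by simp
  then obtain a where a: "[int (m div gcd m n) * a = 1] (mod int (n div gcd m n))"
    using cong_solve_coprime_int by blast
  let ?L = "int (lcm m n)"
  have mL: "int m dvd ?L" "int n dvd ?L" by simp_all
  have "int (gcd m n) * int (n div gcd m n) dvd int (gcd m n) * (int (m div gcd m n) * a - 1)"
    using a by (intro mult_dvd_mono) (simp_all add: cong_iff_dvd_diff)
  moreover have "int (gcd m n) * int (n div gcd m n) = int n" "int (gcd m n) * int (m div gcd m n) = int m"
    using l(1,2) by (metis of_nat_mult)+
  ultimately have "int n dvd int m * a - int (gcd m n)"
    by (metis mult.assoc mult.right_neutral right_diff_distrib)
  then have ma: "[int m * a = int (gcd m n)] (mod int n)" by (simp add: cong_iff_dvd_diff)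
  let ?c = "(int m * a) mod ?L"
  have L0: "0 < ?L" using m n by (simp add: lcm_pos_nat)
  have c: "[?c = int m * a] (mod ?L)" by simp
  have "\<exists>!c. 0 \<le> c \<and> c < ?L \<and> [c = 0] (mod int m) \<and> [c = int (gcd m n)] (mod int n)"
  proof (rule ex1I[of _ ?c])
    have "[?c = 0] (mod int m)"
      using cong_trans[OF cong_dvd_modulus[OF c mL(1)], of 0] by (simp add: cong_0_iff)
    moreover have "[?c = int (gcd m n)] (mod int n)"
      using cong_trans[OF cong_dvd_modulus[OF c mL(2)] ma] .
    ultimately show "0 \<le> ?c \<and> ?c < ?L \<and> [?c = 0] (mod int m) \<and> [?c = int (gcd m n)] (mod int n)"
      using L0 by simp
    fix e assume e: "0 \<le> e \<and> e < ?L \<and> [e = 0] (mod int m) \<and> [e = int (gcd m n)] (mod int n)"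
    have "int m dvd e - ?c" using e \<open>[?c = 0] (mod int m)\<close> by (simp add: cong_0_iff)
    moreover have "[e = ?c] (mod int n)" using e \<open>[?c = int (gcd m n)] (mod int n)\<close> by (metis cong_sym cong_trans)
    then have "int n dvd e - ?c" by (simp add: cong_iff_dvd_diff)
    ultimately have "lcm (int m) (int n) dvd e - ?c" by (rule lcm_least)
    then have "[e = ?c] (mod ?L)" by (simp add: cong_iff_dvd_diff)
    then show "e = ?c" using e L0 by (simp add: cong_def)
  qed
  from theI'[OF this, folded gcd_lift_def]
  show "int m dvd gcd_lift m n" "[gcd_lift m n = int (gcd m n)] (mod int n)" by (simp_all add: cong_0_iff)
qed

text \<open>The coefficient in \<open>frob_diff_ver_one\<close> may be any inverse of m/gcd modulo
  n/gcd. That (m,n]/m is one follows on dividing the congruence (m,n] \<equiv> gcd modulo n by the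
  greatest common divisor.\<close>

lemma gcd_lift_div:
  assumes m: "0 < m" and n: "0 < n"
  shows "[gcd_lift m n div int m * int (m div gcd m n) = 1] (mod int (n div gcd m n))"
proof -
  note l = lcm_div_gcd[OF m n]
  let ?a = "gcd_lift m n div int m"
  have "int n dvd ?a * int m - int (gcd m n)"
    using gcd_lift[OF m n] by (simp add: cong_iff_dvd_diff)
  moreover have "int (gcd m n) * int (n div gcd m n) = int n" "int (gcd m n) * int (m div gcd m n) = int m"
    using l(1,2) by (metis of_nat_mult)+
  then have "?a * int m - int (gcd m n) = int (gcd m n) * (?a * int (m div gcd m n) - 1)"
    by (metis (no_types, opaque_lifting) mult.assoc mult.commute mult.right_neutral right_diff_distrib)
  ultimately have "int (gcd m n) * int (n div gcd m n) dvd int (gcd m n) * (?a * int (m div gcd m n) - 1)"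
    using \<open>int (gcd m n) * int (n div gcd m n) = int n\<close> by simp
  then show ?thesis using l(8) m by (auto simp add: cong_iff_dvd_diff)
qed

context witt_complex
begin

lemma frob_diff_ver_one_limit:
  assumes S: "truncation_set S" and m: "0 < m" and n: "0 < n"
  shows "frob E m S (diff E S (ver_one E S n)) =
    [(gcd_lift m n div int m)] \<cdot>\<^bsub>obj E (S \<div> m)\<^esub> diff E (S \<div> m) (ver_one E (S \<div> m) (lcm m n div m)) \<oplus>\<^bsub>obj E (S \<div> m)\<^esub>
    [both_even m n] \<cdot>\<^bsub>obj E (S \<div> m)\<^esub> limit_sum E (S \<div> m) 1 {1..} (\<lambda>r :: nat.
      [(2 ^ (r - 1) * (lcm m n div m))] \<cdot>\<^bsub>obj E (S \<div> m)\<^esub>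
        diff E (S \<div> m) (ver_one E (S \<div> m) (2 ^ r * (lcm m n div m))))"
proof -
  have l: "0 < lcm m n div m" using lcm_div_gcd[OF m n] by simp
  note Sm = truncation_set_quot[OF S, of m]
  show ?thesis
    unfolding limit_sum_ver_eps[OF Sm l] both_even_ver_eps[OF Sm l m]
    by (rule frob_diff_ver_one[OF S m n gcd_lift_div[OF m n]])
qed

text \<open>The product is V_m(F_m dV_n(1)). With l = [m,n]/m, applying V_m turns dV_l(1) into m
  dV_[m,n](1), so the coefficient (m,n]/m becomes (m,n], and it turns V_l(\<epsilon>) into
  V_[m,n](\<epsilon>).\<close>

lemma ver_one_mult_diff_ver_one_limit:
  assumes S: "truncation_set S" and m: "0 < m" and n: "0 < n"
  shows "ver_one E S m \<otimes>\<^bsub>obj E S\<^esub> diff E S (ver_one E S n) =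
    [gcd_lift m n] \<cdot>\<^bsub>obj E S\<^esub> diff E S (ver_one E S (lcm m n)) \<oplus>\<^bsub>obj E S\<^esub>
    [both_even m n] \<cdot>\<^bsub>obj E S\<^esub> limit_sum E S 1 {1..} (\<lambda>r :: nat.
      [(2 ^ (r - 1) * lcm m n)] \<cdot>\<^bsub>obj E S\<^esub> diff E S (ver_one E S (2 ^ r * lcm m n)))"
proof -
  interpret R: ring "obj E S" using S by (rule ring_obj)
  note l = lcm_div_gcd[OF m n]
  note Sm = truncation_set_quot[OF S, of m]
  let ?k = "lcm m n div m" and ?a = "gcd_lift m n div int m"
  have k: "0 < ?k" using l by simp
  have L: "0 < lcm m n" using m n by (simp add: lcm_pos_nat)
  have mk: "?k * m = lcm m n" using l(4,5) by (simp add: mult.commute)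
  have Q: "(S \<div> m) \<div> ?k = S \<div> lcm m n" using m k mk by (simp add: trunc_quot_quot mult.commute)
  let ?D = "diff E (S \<div> m) (ver_one E (S \<div> m) ?k)" and ?e = "ver E ?k (S \<div> m) (eps ((S \<div> m) \<div> ?k))"
  have D: "?D \<in> carrier (obj E (S \<div> m))" by (rule diff_ver_one_closed[OF Sm k])
  have e: "?e \<in> carrier (obj E (S \<div> m))" by (rule ver_closed[OF Sm k eps_closed[OF truncation_set_quot[OF Sm]]])
  note hom = ver_hom[OF S m]
  interpret M: ring "obj E (S \<div> m)" using Sm by (rule ring_obj)
  have "ver_one E S m \<otimes>\<^bsub>obj E S\<^esub> diff E S (ver_one E S n) =
    ver E m S ([?a] \<cdot>\<^bsub>obj E (S \<div> m)\<^esub> ?D \<oplus>\<^bsub>obj E (S \<div> m)\<^esub> [(gcd m n - 1)] \<cdot>\<^bsub>obj E (S \<div> m)\<^esub> ?e)"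
    using ver_one_mult_diff_ver_one[OF S m n] frob_diff_ver_one[OF S m n gcd_lift_div[OF m n]] by simp
  also have "\<dots> = [?a] \<cdot>\<^bsub>obj E S\<^esub> ver E m S ?D \<oplus>\<^bsub>obj E S\<^esub> [(gcd m n - 1)] \<cdot>\<^bsub>obj E S\<^esub> ver E m S ?e"
    using D e by (simp add: add_hom_add[OF M.ring_axioms R.ring_axioms hom] add_hom_int_mult[OF M.ring_axioms R.ring_axioms hom]
        add_hom_nat_mult[OF M.ring_axioms R.ring_axioms hom])
  also have "ver E m S ?e = ver E (lcm m n) S (eps (S \<div> lcm m n))"
    using ver_ver[OF S k m, of "eps (S \<div> lcm m n)"] eps_closed[OF truncation_set_quot[OF S]] by (simp add: mk Q)
  also have "[?a] \<cdot>\<^bsub>obj E S\<^esub> ver E m S ?D = [gcd_lift m n] \<cdot>\<^bsub>obj E S\<^esub> diff E S (ver_one E S (lcm m n))"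
  proof -
    have "ver E m S ?D = [int m] \<cdot>\<^bsub>obj E S\<^esub> diff E S (ver_one E S (lcm m n))"
      using ver_diff_ver_one[OF S m k] mk by (simp add: mult.commute add_pow_def int_pow_int)
    then have "[?a] \<cdot>\<^bsub>obj E S\<^esub> ver E m S ?D = [(int m * ?a)] \<cdot>\<^bsub>obj E S\<^esub> diff E S (ver_one E S (lcm m n))"
      using diff_ver_one_closed[OF S L] by (simp add: R.add.int_pow_pow)
    then show ?thesis using gcd_lift(1)[OF m n] by simp
  qed
  finally show ?thesis
    unfolding limit_sum_ver_eps[OF S L] both_even_ver_eps[OF S L m] .
qed

lemma ver_one_mult_ver_one:
  assumes S: "truncation_set S" and m: "0 < m" and n: "0 < n"
  shows "ver_one E S m \<otimes>\<^bsub>obj E S\<^esub> ver_one E S n = [gcd m n] \<cdot>\<^bsub>obj E S\<^esub> ver_one E S (lcm m n)"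
proof -
  note l = lcm_div_gcd[OF m n] and Sm = truncation_set_quot[OF S, of m]
  have k: "0 < lcm m n div m" using l by simp
  have mk: "m * (lcm m n div m) = lcm m n" using l(4,5) by simp
  have "ver_one E S m \<otimes>\<^bsub>obj E S\<^esub> ver_one E S n = ver E m S (frob E m S (ver_one E S n))"
    using deg_0_comm[OF S ver_one_deg[OF S m] ver_one_deg[OF S n]] mult_ver_one[OF S m ver_one_closed[OF S n]] by simp
  also have "\<dots> = [gcd m n] \<cdot>\<^bsub>obj E S\<^esub> ver E m S (ver_one E (S \<div> m) (lcm m n div m))"
    unfolding frob_ver_one[OF S m n]
    by (rule add_hom_nat_mult[OF ring_obj[OF Sm] ring_obj[OF S] ver_hom[OF S m] ver_one_closed[OF Sm k]])
  also have "ver E m S (ver_one E (S \<div> m) (lcm m n div m)) = ver_one E S (lcm m n)"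
    using ver_ver_one[OF S m k] by (simp add: mk)
  finally show ?thesis .
qed

end

lemma integer_mod_group_0: "integer_mod_group 0 = integer_group"
  by (simp add: integer_mod_group_def)

theorem theorem6p1:
  fixes E :: "'u witt_data" and S :: "nat set"
  assumes "big_de_Rham_Witt E" and "truncation_set S"
  shows
    "(\<exists>\<phi>\<in>iso (product_group S (\<lambda>n. integer_group)) (deg_group E S 0).
        \<forall>c\<in>carrier (product_group S (\<lambda>n. integer_group)).
          has_limit_sum E S 0 S (\<lambda>n. [c n] \<cdot>\<^bsub>obj E S\<^esub> ver_one E S n) (\<phi> c)) \<and>
     (\<exists>\<phi>\<in>iso (product_group S (\<lambda>n. integer_mod_group n)) (deg_group E S 1).
        \<forall>c\<in>carrier (product_group S (\<lambda>n. integer_mod_group n)).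
          has_limit_sum E S 1 S (\<lambda>n. [c n] \<cdot>\<^bsub>obj E S\<^esub> diff E S (ver_one E S n)) (\<phi> c)) \<and>
     (\<forall>q\<ge>2. deg E S q = {\<zero>\<^bsub>obj E S\<^esub>}) \<and>
     (\<forall>m n. 0 < m \<and> 0 < n \<longrightarrow>
        ver_one E S m \<otimes>\<^bsub>obj E S\<^esub> ver_one E S n =
          [gcd m n] \<cdot>\<^bsub>obj E S\<^esub> ver_one E S (lcm m n) \<and>
        ver_one E S m \<otimes>\<^bsub>obj E S\<^esub> diff E S (ver_one E S n) =
          [gcd_lift m n] \<cdot>\<^bsub>obj E S\<^esub> diff E S (ver_one E S (lcm m n)) \<oplus>\<^bsub>obj E S\<^esub>
          [both_even m n] \<cdot>\<^bsub>obj E S\<^esub>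
            limit_sum E S 1 {1..} (\<lambda>r :: nat.
              [(2 ^ (r - 1) * lcm m n)] \<cdot>\<^bsub>obj E S\<^esub> diff E S (ver_one E S (2 ^ r * lcm m n))) \<and>
        frob E m S (ver_one E S n) =
          [gcd m n] \<cdot>\<^bsub>obj E (S \<div> m)\<^esub> ver_one E (S \<div> m) (lcm m n div m) \<and>
        frob E m S (diff E S (ver_one E S n)) =
          [(gcd_lift m n div int m)] \<cdot>\<^bsub>obj E (S \<div> m)\<^esub>
            diff E (S \<div> m) (ver_one E (S \<div> m) (lcm m n div m)) \<oplus>\<^bsub>obj E (S \<div> m)\<^esub>
          [both_even m n] \<cdot>\<^bsub>obj E (S \<div> m)\<^esub>
            limit_sum E (S \<div> m) 1 {1..} (\<lambda>r :: nat.
              [(2 ^ (r - 1) * (lcm m n div m))] \<cdot>\<^bsub>obj E (S \<div> m)\<^esub>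
                diff E (S \<div> m) (ver_one E (S \<div> m) (2 ^ r * (lcm m n div m)))) \<and>
        ver E m S (ver_one E (S \<div> m) n) = ver_one E S (m * n) \<and>
        ver E m S (diff E (S \<div> m) (ver_one E (S \<div> m) n)) =
          [m] \<cdot>\<^bsub>obj E S\<^esub> diff E S (ver_one E S (m * n)))"
proof -
  note S = assms(2)
  have E: "initial_witt_complex E" using assms(1) by (simp add: big_de_Rham_Witt_def)
  interpret E: witt_complex E using E by (simp add: initial_witt_complex_def)
  \<comment> \<open>By initiality homogeneous elements belong to the subcomplex. Over a finite T its
    defining condition can be applied to T itself, where restriction is the identity.\<close>
  have base: "x \<in> E.base_part q T" if T: "truncation_set T" "finite T" and x: "x \<in> deg E T q" for T q x
    using E.sub_part_res[of x T q T] T x E.res_id[OF T(1) E.deg_carrier[OF T(1) x]]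
    by (simp add: initial_eq_subcomplex[OF E T(1)])
  have deg_0: "\<exists>\<phi>\<in>iso (product_group S (\<lambda>n. integer_group)) (deg_group E S 0).
      \<forall>c\<in>carrier (product_group S (\<lambda>n. integer_group)).
        has_limit_sum E S 0 S (\<lambda>n. [c n] \<cdot>\<^bsub>obj E S\<^esub> ver_one E S n) (\<phi> c)"
  \<comment> \<open>The modulus 0 makes \<open>integer_mod_group\<close> the group of integers, and
    divisibility by 0 is the vanishing of the coefficient.\<close>
  proof (rule E.deg_product_iso[where b = "ver_one E" and d = "\<lambda>_. 0" and q = 0, unfolded integer_mod_group_0, OF S])
    show "\<exists>c :: nat \<Rightarrow> int. x = (\<Oplus>\<^bsub>obj E T\<^esub>n\<in>T. [c n] \<cdot>\<^bsub>obj E T\<^esub> ver_one E T n)"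
      if T: "truncation_set T" "finite T" and x: "x \<in> deg E T 0" for T x
    proof -
      obtain a where "x = eta E T a" "a \<in> carrier (witt T)" using base[OF T x] by (auto simp: E.base_part_0)
      then show ?thesis using E.eta_expansion[OF T] by metis
    qed
    show "int 0 dvd c n" if "truncation_set T" "finite T" "n \<in> T"
      "(\<Oplus>\<^bsub>obj E T\<^esub>n\<in>T. [c n] \<cdot>\<^bsub>obj E T\<^esub> ver_one E T n) = \<zero>\<^bsub>obj E T\<^esub>" for T n and c :: "nat \<Rightarrow> int"
      using independent_ver_one[OF assms(1) that(1,2,4,3)] by simp
  qed (simp_all add: E.ver_one_deg E.res_ver_one E.ver_one_outside add_pow_def)
  have deg_1: "\<exists>\<phi>\<in>iso (product_group S (\<lambda>n. integer_mod_group n)) (deg_group E S 1).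
      \<forall>c\<in>carrier (product_group S (\<lambda>n. integer_mod_group n)).
        has_limit_sum E S 1 S (\<lambda>n. [c n] \<cdot>\<^bsub>obj E S\<^esub> diff E S (ver_one E S n)) (\<phi> c)"
  proof (rule E.deg_product_iso[where b = "\<lambda>T n. diff E T (ver_one E T n)" and d = "\<lambda>n. n" and q = 1, OF S])
    show "\<exists>c :: nat \<Rightarrow> int. x = (\<Oplus>\<^bsub>obj E T\<^esub>n\<in>T. [c n] \<cdot>\<^bsub>obj E T\<^esub> diff E T (ver_one E T n))"
      if T: "truncation_set T" "finite T" and x: "x \<in> deg E T 1" for T x
      using base[OF T x] by (intro E.dspan_expansion[OF T]) (simp add: E.base_part_1)
    show "int n dvd c n" if "truncation_set T" "finite T" "n \<in> T"
      "(\<Oplus>\<^bsub>obj E T\<^esub>n\<in>T. [c n] \<cdot>\<^bsub>obj E T\<^esub> diff E T (ver_one E T n)) = \<zero>\<^bsub>obj E T\<^esub>" for T n and c :: "nat \<Rightarrow> int"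
      using independent_diff_ver_one[OF assms(1) that(1,2,4,3)] .
    show "diff E T (ver_one E T n) \<in> deg E T 1" if "truncation_set T" "0 < n" for T n
      by (rule E.diff_ver_one_deg[OF that])
    show "diff E T (ver_one E T n) = \<zero>\<^bsub>obj E T\<^esub>" if "truncation_set T" "0 < n" "n \<notin> T" for T n
      by (rule E.diff_ver_one_outside[OF that])
  qed (simp_all only: E.res_diff_ver_one E.torsion_diff_ver_one)
  have deg_2: "\<forall>q\<ge>2. deg E S q = {\<zero>\<^bsub>obj E S\<^esub>}"
    using initial_eq_subcomplex[OF E S] E.sub_part_2[OF S] by simp
  show ?thesis
    by (intro conjI deg_0 deg_1 deg_2 allI impI)
      (simp_all only: S E.ver_one_mult_ver_one E.ver_one_mult_diff_ver_one_limit E.frob_ver_one E.frob_diff_ver_one_limit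
        E.ver_ver_one E.ver_diff_ver_one)
qed

end
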